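(* Fix $\tau\in(0,1)$. Let $f$ be a probability density on $\mathbb{R}$ satisfying (A1), let $h^-=h_n^-$ and $h^+=h_n^+$ be bandwidth range sequences satisfying (A2), and let $K$ be a kernel satisfying (A3), where (A1), (A2), (A3) are the conditions spelled out in the context. Let $X_1,X_2,\ldots$ be independent random variables with density $f$. Then $$\mathbb{E}\{\mu_f(\widehat{R}_{h,\tau}\triangle R_\tau)\}=\sum_{j=1}^{2r}\left[\frac{B_{1,j}\,\phi(B_{2,j}n^{1/2}h^{5/2})}{(nh)^{1/2}}+B_{3,j}h^2\{2\Phi(B_{2,j}n^{1/2}h^{5/2})-1\}\right]+o\left(\frac{1}{(nh)^{1/2}}+h^2\right)$$ as $n\to\infty$, uniformly for $h\in[h_n^-,h_n^+]$ (that is, the supremum over $h\in[h_n^-,h_n^+]$ of the absolute value of the error term divided by $(nh)^{-1/2}+h^2$ tends to $0$), where $$B_{1,j}=2f_\tau\frac{\{R(K)f_\tau-2D_{3,j}+D_2\}^{1/2}}{|f'(x_j)|},\qquad B_{2,j}=\frac{|\frac12\mu_2(K)f''(x_j)-D_1|}{\{R(K)f_\tau-2D_{3,j}+D_2\}^{1/2}},\qquad B_{3,j}=f_\tau\frac{|\frac12\mu_2(K)f''(x_j)-D_1|}{|f'(x_j)|},$$ and $$D_1=\frac12\mu_2(K)\left\{\sum_{j=1}^{2r}\frac{1}{|f'(x_j)|}\right\}^{-1}\left[\sum_{j=1}^{2r}\frac{f''(x_j)}{|f'(x_j)|}+\frac{1}{f_\tau}\sum_{j=1}^{r}\{f'(x_{2j})-f'(x_{2j-1})\}\right],$$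 $$D_2=R(K)f_\tau\left\{\sum_{j=1}^{2r}\frac{1}{|f'(x_j)|}\right\}^{-2}\sum_{j=1}^{2r}\frac{1}{f'(x_j)^2},\qquad D_{3,j}=\frac{R(K)f_\tau}{|f'(x_j)|}\left\{\sum_{k=1}^{2r}\frac{1}{|f'(x_k)|}\right\}^{-1}\quad(j=1,\ldots,2r).$$
   Context: Definitions. For a probability density $g$ on $\mathbb{R}$ and $\tau\in(0,1)$, $f_\tau(g)=\inf\{y\in(0,\infty):\int_{-\infty}^\infty g(x)\mathbb{1}_{\{g(x)\ge y\}}\,dx\le 1-\tau\}$. Write $f_\tau=f_\tau(f)$ and $R_\tau=\{x\in\mathbb{R}:f(x)\ge f_\tau\}$ (the $100(1-\tau)\%$ highest-density region of $f$). A kernel is a function $K:\mathbb{R}\to\mathbb{R}$ with $\int K(x)\,dx=1$. For a bandwidth $h>0$, the kernel density estimator is $\widehat f_h(x)=\frac{1}{nh}\sum_{i=1}^nK\left(\frac{x-X_i}{h}\right)$; $\widehat f_{h,\tau}=f_\tau(\widehat f_h)$ and $\widehat R_{h,\tau}=\{x\in\mathbb{R}:\widehat f_h(x)\ge\widehat f_{h,\tau}\}$. $A\triangle B=(A\cap B^c)\cup(A^c\cap B)$ and $\mu_f(C)=\int_Cf(x)\,dx$ for Borel $C\subseteq\mathbb{R}$. $R(K)=\int K(x)^2\,dx$, $\mu_2(K)=\int x^2K(x)\,dx$; $\Phi$ and $\phi$ are the standard normal distribution function and density. Conditions. (A1) $f$ is uniformly continuous on $\mathbb{R}$. The solutions of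 $f(x)=f_\tau$ are finitely many points $x_1<\cdots<x_{2r}$, and there exists $\delta>0$ such that $f$ is twice continuously differentiable in $\bigcup_{j=1}^r[x_{2j-1}-\delta,x_{2j}+\delta]$, with $f'(x_{2j-1})>0$ and $f'(x_{2j})<0$ for $j=1,\ldots,r$. (A2) $h^-=h_n^-$ and $h^+=h_n^+$ are nonnegative sequences with $h_n^-\le h_n^+$, $n(h_n^-)^4/\sqrt{\log(1/h_n^-)}\to\infty$ and $h_n^+\to0$ as $n\to\infty$; bandwidths $h=h_n$ satisfy $h_n^-\le h_n\le h_n^+$ for all $n$. (A3) $K$ is nonnegative, continuously differentiable, of bounded variation, with $\int xK(x)\,dx=0$ and $\mu_2(K)<\infty$. Moreover $K'$ is of bounded variation and $\int K'(x)^2\,dx<\infty$. *)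

theory Defs
  imports "HOL-Probability.Probability"
begin

definition prob_density :: "(real \<Rightarrow> real) \<Rightarrow> bool" where
  "prob_density f \<longleftrightarrow>
     f \<in> borel_measurable borel \<and> (\<forall>x. f x \<ge> 0) \<and> has_bochner_integral lborel f 1"

definition hdr_level :: "real \<Rightarrow> (real \<Rightarrow> real) \<Rightarrow> real" where
  "hdr_level \<tau> g =
     Inf {y. 0 < y \<and> (LINT x|lborel. g x * indicator {x. g x \<ge> y} x) \<le> 1 - \<tau>}"

definition hdr :: "real \<Rightarrow> (real \<Rightarrow> real) \<Rightarrow> real set" where
  "hdr \<tau> g = {x. g x \<ge> hdr_level \<tau> g}"

definition density_mass :: "(real \<Rightarrow> real) \<Rightarrow> real set \<Rightarrow> real" where
  "density_mass f C = (LINT x:C|lborel. f x)"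

definition kde :: "(real \<Rightarrow> real) \<Rightarrow> (nat \<Rightarrow> real) \<Rightarrow> nat \<Rightarrow> real \<Rightarrow> real \<Rightarrow> real" where
  "kde K X n h x = 1 / (real n * h) * (\<Sum>i=1..n. K ((x - X i) / h))"

definition roughness :: "(real \<Rightarrow> real) \<Rightarrow> real" where
  "roughness K = (LINT x|lborel. (K x)\<^sup>2)"

definition second_moment :: "(real \<Rightarrow> real) \<Rightarrow> real" where
  "second_moment K = (LINT x|lborel. x\<^sup>2 * K x)"

definition bounded_variation :: "(real \<Rightarrow> real) \<Rightarrow> bool" where
  "bounded_variation g \<longleftrightarrow>
     (\<exists>V. \<forall>(m::nat) t. (\<forall>i<m. t i \<le> t (Suc i)) \<longrightarrow> (\<Sum>i<m. \<bar>g (t (Suc i)) - g (t i)\<bar>) \<le> V)"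

(* Derivatives are taken within S, hence are one-sided at the ends of an interval. *)
definition C2_on :: "real set \<Rightarrow> (real \<Rightarrow> real) \<Rightarrow> bool" where
  "C2_on S f \<longleftrightarrow>
     (\<exists>f' f''. (\<forall>x\<in>S. (f has_real_derivative f' x) (at x within S)) \<and>
               (\<forall>x\<in>S. (f' has_real_derivative f'' x) (at x within S)) \<and>
               continuous_on S f'')"

definition density_condition ::
  "real \<Rightarrow> (real \<Rightarrow> real) \<Rightarrow> nat \<Rightarrow> (nat \<Rightarrow> real) \<Rightarrow> bool" where
  "density_condition \<tau> f r x \<longleftrightarrow>
     uniformly_continuous_on UNIV f \<and>
     strict_mono_on {1..2*r} x \<and>
     {t. f t = hdr_level \<tau> f} = x ` {1..2*r} \<and>
     (\<exists>\<delta>>0. C2_on (\<Union>j\<in>{1..r}. {x (2*j - 1) - \<delta> .. x (2*j) + \<delta>}) f) \<and>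
     (\<forall>j\<in>{1..r}. deriv f (x (2*j - 1)) > 0 \<and> deriv f (x (2*j)) < 0)"

definition bandwidth_condition :: "(nat \<Rightarrow> real) \<Rightarrow> (nat \<Rightarrow> real) \<Rightarrow> bool" where
  "bandwidth_condition hm hp \<longleftrightarrow>
     (\<forall>n. 0 \<le> hm n \<and> hm n \<le> hp n) \<and>
     filterlim (\<lambda>n. real n * hm n ^ 4 / sqrt (ln (1 / hm n))) at_top sequentially \<and>
     hp \<longlonglongrightarrow> 0"

definition is_kernel :: "(real \<Rightarrow> real) \<Rightarrow> bool" where
  "is_kernel K \<longleftrightarrow> has_bochner_integral lborel K 1"

definition kernel_condition :: "(real \<Rightarrow> real) \<Rightarrow> bool" where
  "kernel_condition K \<longleftrightarrow>
     (\<forall>x. K x \<ge> 0) \<and>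
     (\<forall>x. K differentiable at x) \<and> continuous_on UNIV (deriv K) \<and>
     bounded_variation K \<and>
     has_bochner_integral lborel (\<lambda>x. x * K x) 0 \<and>
     integrable lborel (\<lambda>x. x\<^sup>2 * K x) \<and>
     bounded_variation (deriv K) \<and>
     integrable lborel (\<lambda>x. (deriv K x)\<^sup>2)"

context
  fixes \<tau> :: real and f K :: "real \<Rightarrow> real" and r :: nat and x :: "nat \<Rightarrow> real"
begin

definition coef_D1 :: real where
  "coef_D1 =
     1/2 * second_moment K * inverse (\<Sum>j=1..2*r. 1 / \<bar>deriv f (x j)\<bar>) *
     ((\<Sum>j=1..2*r. deriv (deriv f) (x j) / \<bar>deriv f (x j)\<bar>) +
      1 / hdr_level \<tau> f * (\<Sum>j=1..r. deriv f (x (2*j)) - deriv f (x (2*j - 1))))"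

definition coef_D2 :: real where
  "coef_D2 =
     roughness K * hdr_level \<tau> f * inverse ((\<Sum>j=1..2*r. 1 / \<bar>deriv f (x j)\<bar>)\<^sup>2) *
     (\<Sum>j=1..2*r. 1 / (deriv f (x j))\<^sup>2)"

definition coef_D3 :: "nat \<Rightarrow> real" where
  "coef_D3 j =
     roughness K * hdr_level \<tau> f / \<bar>deriv f (x j)\<bar> *
     inverse (\<Sum>k=1..2*r. 1 / \<bar>deriv f (x k)\<bar>)"

definition coef_B1 :: "nat \<Rightarrow> real" where
  "coef_B1 j =
     2 * hdr_level \<tau> f * sqrt (roughness K * hdr_level \<tau> f - 2 * coef_D3 j + coef_D2) /
     \<bar>deriv f (x j)\<bar>"

definition coef_B2 :: "nat \<Rightarrow> real" where
  "coef_B2 j =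
     \<bar>1/2 * second_moment K * deriv (deriv f) (x j) - coef_D1\<bar> /
     sqrt (roughness K * hdr_level \<tau> f - 2 * coef_D3 j + coef_D2)"

definition coef_B3 :: "nat \<Rightarrow> real" where
  "coef_B3 j =
     hdr_level \<tau> f * \<bar>1/2 * second_moment K * deriv (deriv f) (x j) - coef_D1\<bar> /
     \<bar>deriv f (x j)\<bar>"

definition hdr_risk_expansion :: "nat \<Rightarrow> real \<Rightarrow> real" where
  "hdr_risk_expansion n h =
     (\<Sum>j=1..2*r.
        coef_B1 j * std_normal_density (coef_B2 j * (sqrt (real n) * h powr (5/2))) / sqrt (real n * h) +
        coef_B3 j * h\<^sup>2 *
          (2 * cdf std_normal_distribution (coef_B2 j * (sqrt (real n) * h powr (5/2))) - 1))"

end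

end

theory Submission
  imports Defs "HOL-Real_Asymp.Real_Asymp"
begin

text \<open>
  Write \<open>L\<close> for the level and \<open>\<eta>\<close> for the estimation error of the density. Since the mass above the
  level is prescribed, \<open>\<eta>\<close> displaces the level to first order by
  \<open>\<Lambda> = (1/L \<integral>\<^bsub>f \<ge> L\<^esub> \<eta> + \<Sum>\<^sub>k \<eta>(x\<^sub>k) / \<bar>f'(x\<^sub>k)\<bar>) / \<Sum>\<^sub>k 1 / \<bar>f'(x\<^sub>k)\<bar>\<close>, and the risk is, to first order,
  \<open>L \<Sum>\<^sub>j \<bar>\<eta>(x\<^sub>j) - \<Lambda>\<bar> / \<bar>f'(x\<^sub>j)\<bar>\<close>. The remainder is bounded deterministically by
  integrated squares of \<open>\<eta>\<close> and of its increments near the crossings, so second moments suffice and no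
  uniform control of the estimator or of its derivative is needed; for these it is enough
  that \<open>h \<rightarrow> 0\<close> and \<open>n h\<^sup>3 \<rightarrow> \<infinity>\<close>. Each \<open>\<eta>(x\<^sub>j) - \<Lambda>\<close> is asymptotically normal with mean
  of order \<open>h\<^sup>2\<close> and variance of order \<open>1/(n h)\<close> (a triangular array; the error of the mass above the level contributes
  only to the mean), and the expansion is the mean absolute value of that normal law.
  Uniformity in \<open>h\<close> follows by applying the result to a worst bandwidth for each \<open>n\<close>.
\<close>

section \<open>Densities and the normal law\<close>

text \<open>Away from the crossings \<open>f\<close> is only uniformly continuous, so the bias of
  the estimator has no rate there and its global integrated squared error need not be of second
  order. Hence the estimator \<open>g\<close> is compared with its mean \<open>fb\<close>: a
  deviation \<open>\<bar>g - f\<bar> \<ge> e1\<close> forces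
  \<open>\<bar>g - fb\<bar> \<ge> e1 / 2\<close>, and the integrated variance is of order
  \<open>1 / (n h)\<close> on the whole line. Near a crossing the linearised boundary is wrong only
  where \<open>g\<close> departs from its affine model, and this set is measured by Chebyshev. An
  estimator may be constant on intervals, so its mass equation may fail at its own level; it is used
  at slightly shifted levels, where the infimum fixes the sign. The bandwidth requirement comes from
  the increments: over distances of order \<open>rho = 1 / sqrt (n h) + h^2\<close> their variance
  is at most of order \<open>rho / (n h^2)\<close>, which is \<open>o(1 / (n h))\<close> because
  \<open>rho / h\<close> tends to 0 when \<open>n h^3 \<rightarrow> \<infinity>\<close>. One
  parameter \<open>t\<close> then tunes the cut-offs: height \<open>t rho\<close> and width
  \<open>rho / t\<close> make every main error at most a constant times
  \<open>t rho\<close>.\<close>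

lemma bounded_variation_imp_bounded:
  assumes "bounded_variation g"
  shows "\<exists>C>0. \<forall>x. \<bar>g x\<bar> \<le> C"
proof -
  obtain V where V: "\<And>(m::nat) t. (\<forall>i<m. t i \<le> t (Suc i)) \<Longrightarrow> (\<Sum>i<m. \<bar>g (t (Suc i)) - g (t i)\<bar>) \<le> V"
    using assms unfolding bounded_variation_def by blast
  have "\<bar>g x\<bar> \<le> \<bar>g 0\<bar> + \<bar>V\<bar> + 1" for x
  proof -
    have "\<bar>g (max 0 x) - g (min 0 x)\<bar> \<le> V"
      using V[of 1 "\<lambda>i. if i = 0 then min 0 x else max 0 x"] by simp
    then show ?thesis by (cases "x \<ge> 0") auto
  qed
  then show ?thesis by (intro exI[of _ "\<bar>g 0\<bar> + \<bar>V\<bar> + 1"]) auto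
qed

text \<open>A value of at least \<open>e\<close> far out would by uniform continuity keep
  \<open>f\<close> above \<open>e / 2\<close> on a whole interval of length \<open>d\<close>, which
  is more mass than the tail beyond \<open>N\<close> has left.\<close>

lemma uniformly_continuous_integrable_tendsto_0:
  fixes f :: "real \<Rightarrow> real"
  assumes uc: "uniformly_continuous_on UNIV f" and int: "integrable lborel f" and nn: "\<And>x. f x \<ge> 0"
  shows "(f \<longlongrightarrow> 0) at_infinity"
proof (rule tendstoI)
  fix e :: real assume e: "e > 0"
  obtain d where d: "d > 0" "\<And>x y. dist y x < d \<Longrightarrow> dist (f y) (f x) < e/2"
    using uc e unfolding uniformly_continuous_on_def by (metis UNIV_I half_gt_zero)
  have fm[measurable]: "f \<in> borel_measurable borel" using int by auto
  have "(\<lambda>n. LINT x|lborel. f x * indicator {x. \<bar>x\<bar> > real n} x) \<longlonglongrightarrow> (LINT x::real|lborel. 0)"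
  proof (rule integral_dominated_convergence[where w = f])
    show "AE x in lborel. (\<lambda>n. f x * indicator {x. \<bar>x\<bar> > real n} x) \<longlonglongrightarrow> 0"
    proof (rule AE_I2)
      fix x :: real
      have "eventually (\<lambda>n. f x * indicator {x. \<bar>x\<bar> > real n} x = 0) sequentially"
        using eventually_ge_at_top[of "nat \<lceil>\<bar>x\<bar>\<rceil>"]
      proof eventually_elim
        case (elim n)
        then have "\<bar>x\<bar> \<le> real n" by linarith
        then show ?case by simp
      qed
      then show "(\<lambda>n. f x * indicator {x. \<bar>x\<bar> > real n} x) \<longlonglongrightarrow> 0"
        by (rule tendsto_eventually)
    qed
  qed (use int nn in \<open>auto simp: indicator_def\<close>)
  then have "eventually (\<lambda>n. (LINT x|lborel. f x * indicator {x. \<bar>x\<bar> > real n} x) < e * d / 2) sequentially"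
    by (rule order_tendstoD(2)) (use e d in auto)
  then obtain N where N: "(LINT x|lborel. f x * indicator {x. \<bar>x\<bar> > real N} x) < e * d / 2"
    by (auto simp: eventually_sequentially)
  have "\<bar>f x\<bar> < e" if x: "norm x \<ge> N + d" for x
  proof (rule ccontr)
    assume "\<not> \<bar>f x\<bar> < e"
    then have fx: "f x \<ge> e" using nn[of x] by simp
    have "e/2 * d = (LINT t|lborel. e/2 * indicator {x - d/2..x + d/2} t)"
      using d by simp
    also have "\<dots> \<le> (LINT t|lborel. f t * indicator {x. \<bar>x\<bar> > real N} t)"
    proof (rule integral_mono)
      show "integrable lborel (\<lambda>t. f t * indicator {x. \<bar>x\<bar> > real N} t)"
        using int by (intro integrable_real_mult_indicator) auto
      show "integrable lborel (\<lambda>t. e/2 * indicator {x - d/2..x + d/2} t)"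
        by (intro integrable_mult_right integrable_real_indicator) (auto simp: emeasure_lborel_Icc_eq)
      fix t :: real
      have "e/2 \<le> f t" "\<bar>t\<bar> > real N" if "t \<in> {x - d/2..x + d/2}"
      proof -
        have "dist t x < d" using that d by (auto simp: dist_real_def abs_if)
        then have "dist (f t) (f x) < e/2" by (rule d)
        then show "e/2 \<le> f t" using fx unfolding dist_real_def by argo
        show "\<bar>t\<bar> > real N" using that d x by (auto simp: abs_if split: if_splits)
      qed
      then show "e/2 * indicator {x - d/2..x + d/2} t \<le> f t * indicator {x. \<bar>x\<bar> > real N} t"
        using nn[of t] by (auto simp: indicator_def)
    qed
    finally show False using N by simp
  qed
  then show "eventually (\<lambda>x. dist (f x) 0 < e) at_infinity"
    unfolding eventually_at_infinity by (auto intro!: exI[of _ "N + d"])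
qed

lemma uniformly_continuous_integrable_bounded:
  fixes f :: "real \<Rightarrow> real"
  assumes uc: "uniformly_continuous_on UNIV f" and int: "integrable lborel f" and nn: "\<And>x. f x \<ge> 0"
  shows "\<exists>C>0. \<forall>x. f x \<le> C"
proof -
  have "eventually (\<lambda>x. f x < 1) at_infinity"
    using uniformly_continuous_integrable_tendsto_0[OF assms] by (rule order_tendstoD) simp
  then obtain b where b: "\<And>x. norm x \<ge> b \<Longrightarrow> f x < 1" unfolding eventually_at_infinity by auto
  have "compact (f ` {-\<bar>b\<bar>..\<bar>b\<bar>})"
    using uc by (intro compact_continuous_image) (auto intro: uniformly_continuous_imp_continuous continuous_on_subset)
  then obtain C where C: "\<And>x. x \<in> {-\<bar>b\<bar>..\<bar>b\<bar>} \<Longrightarrow> \<bar>f x\<bar> \<le> C"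
    by (meson compact_imp_bounded bounded_real image_eqI)
  have "f x \<le> \<bar>C\<bar> + 1" for x
    using b[of x] C[of x] by (cases "x \<in> {-\<bar>b\<bar>..\<bar>b\<bar>}") (fastforce simp: abs_if split: if_splits)+
  then show ?thesis by (intro exI[of _ "\<bar>C\<bar> + 1"]) auto
qed

lemma measure_std_normal_singleton: "measure std_normal_distribution {c} = 0"
proof -
  have "AE x in lborel. x \<in> {c} \<longrightarrow> ennreal (std_normal_density x) = 0"
    using AE_lborel_singleton[of c] by eventually_elim simp
  then have "{c} \<in> null_sets std_normal_distribution"
    by (subst null_sets_density_iff) auto
  then show ?thesis by (simp add: measure_eq_0_null_sets)
qed

lemma isCont_cdf_std_normal: "isCont (cdf std_normal_distribution) t"
proof -
  interpret N: real_distribution std_normal_distribution by (rule real_dist_normal_dist)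
  show ?thesis using N.isCont_cdf measure_std_normal_singleton by blast
qed

text \<open>With \<open>c = \<bar>m\<bar>\<close> and the symmetry of the law, the integrand becomes
  \<open>\<bar>v - c\<bar> = 2 (v - c) 1{v >= c} - v + c\<close>. Its tail mean is
  \<open>std_normal_density c\<close> because the density has derivative \<open>- v\<close> times
  itself.\<close>

lemma std_normal_mean_abs:
  "(LINT v|std_normal_distribution. \<bar>v + m\<bar>) =
     2 * std_normal_density m + \<bar>m\<bar> * (2 * cdf std_normal_distribution \<bar>m\<bar> - 1)"
proof -
  let ?N = "std_normal_distribution" and ?d = std_normal_density
  interpret N: real_distribution ?N by (rule real_dist_normal_dist)
  define c where "c = \<bar>m\<bar>"
  have c0: "c \<ge> 0" by (simp add: c_def)
  have id: "integrable ?N (\<lambda>v. v)" using integrable_std_normal_distribution_moment[of 1] by simp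
  have mean: "(LINT v|?N. v) = 0" using integral_std_normal_distribution_moment_odd[of 1] by simp
  have refl: "(LINT v|?N. \<bar>v + t\<bar>) = (LINT v|?N. \<bar>v - t\<bar>)" for t
  proof -
    have "(LINT v|?N. \<bar>v + t\<bar>) = (LINT v|lborel. ?d v * \<bar>v + t\<bar>)"
      by (subst integral_density) (auto simp: mult.commute)
    also have "\<dots> = (LINT v|lborel. ?d (-v) * \<bar>-v + t\<bar>)"
      using lborel_integral_real_affine[of "-1" "\<lambda>v. ?d v * \<bar>v + t\<bar>" 0] by simp
    also have "\<dots> = (LINT v|lborel. ?d v * \<bar>v - t\<bar>)"
      by (intro Bochner_Integration.integral_cong) (auto simp: std_normal_density_def)
    also have "\<dots> = (LINT v|?N. \<bar>v - t\<bar>)"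
      by (subst integral_density) (auto simp: mult.commute)
    finally show ?thesis .
  qed
  have 1: "(LINT v|?N. \<bar>v + m\<bar>) = (LINT v|?N. \<bar>v - c\<bar>)"
    using refl[of m] by (cases "m \<ge> 0") (auto simp: c_def)
  have tail: "has_bochner_integral ?N (\<lambda>v. v * indicator {c..} v) (?d c)"
  proof -
    have "(\<integral>\<^sup>+v. ennreal (v * ?d v) * indicator {c..} v \<partial>lborel) = ennreal (0 - (- ?d c))"
    proof (rule nn_integral_FTC_atLeast)
      show "((\<lambda>x. - ?d x) \<longlongrightarrow> 0) at_top"
        unfolding std_normal_density_def by real_asymp
      show "((\<lambda>x. - ?d x) has_real_derivative x * ?d x) (at x)" for x
        unfolding std_normal_density_def
        by (rule derivative_eq_intros refl | simp)+
    qed (use c0 in auto)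
    then have "(\<integral>\<^sup>+v. ennreal (v * indicator {c..} v * ?d v) \<partial>lborel) = ennreal (?d c)"
      by (subst (asm) nn_integral_cong[where v = "\<lambda>v. ennreal (v * indicator {c..} v * ?d v)"])
         (auto simp: indicator_def)
    then have "(\<integral>\<^sup>+v. ennreal (v * indicator {c..} v) \<partial>?N) = ennreal (?d c)"
      by (subst nn_integral_density) (auto simp: ennreal_mult'[symmetric] mult_ac)
    then show ?thesis
      using c0 by (intro has_bochner_integral_nn_integral) (auto simp: indicator_def)
  qed
  have meas: "(LINT v|?N. indicator {c..} v) = 1 - cdf ?N c"
  proof -
    have "{..c} = {..<c} \<union> {c}" by auto
    then have "measure ?N {..<c} = measure ?N {..c}"
      using N.finite_measure_Union[of "{..<c}" "{c}"] measure_std_normal_singleton[of c] by simp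
    moreover have "measure ?N {c..} = 1 - measure ?N {..<c}"
      using N.prob_compl[of "{..<c}"] by (auto simp: Compl_eq_Diff_UNIV[symmetric])
    ultimately show ?thesis by (simp add: cdf_def2)
  qed
  have "(LINT v|?N. \<bar>v - c\<bar>) = (LINT v|?N. 2 * (v * indicator {c..} v) - 2 * c * indicator {c..} v - v + c)"
    by (intro Bochner_Integration.integral_cong) (auto simp: indicator_def)
  also have "\<dots> = 2 * ?d c - 2 * c * (1 - cdf ?N c) - 0 + c"
  proof -
    have "has_bochner_integral ?N (indicator {c..}) (1 - cdf ?N c)"
      using meas by (auto simp: has_bochner_integral_iff intro!: N.integrable_const_bound[where B=1])
    moreover have "has_bochner_integral ?N (\<lambda>v. v) 0" using id mean by (simp add: has_bochner_integral_iff)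
    moreover have "has_bochner_integral ?N (\<lambda>v. c) c" using N.prob_space by (simp add: has_bochner_integral_iff)
    ultimately have "has_bochner_integral ?N (\<lambda>v. 2 * (v * indicator {c..} v) - 2 * c * indicator {c..} v - v + c)
        (2 * ?d c - 2 * c * (1 - cdf ?N c) - 0 + c)"
      by (intro has_bochner_integral_add has_bochner_integral_diff has_bochner_integral_mult_right tail)
    then show ?thesis by (rule has_bochner_integral_integral_eq)
  qed
  also have "?d c = ?d m" by (auto simp: c_def std_normal_density_def)
  finally show ?thesis unfolding 1 c_def[symmetric] by (simp add: algebra_simps)
qed

text \<open>Both sides are the L1 distance between the distribution function and that of the point
  mass at \<open>-m\<close>. Fubini applies to \<open>\<bar>1{v <= t} - 1{-m <= t}\<bar>\<close>;
  for fixed \<open>t\<close> the sign of the inner difference does not depend on \<open>v\<close>,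
  so the expectation passes inside the absolute value.\<close>

lemma (in real_distribution) expectation_abs_eq_cdf:
  assumes "integrable M (\<lambda>v. v)"
  shows "integrable lborel (\<lambda>t. \<bar>cdf M t - indicator {-m..} t\<bar>)"
    and "(LINT v|M. \<bar>v + m\<bar>) = (LINT t|lborel. \<bar>cdf M t - indicator {-m..} t\<bar>)"
proof -
  have mc[measurable]: "cdf M \<in> borel_measurable borel"
    by (intro borel_measurable_mono) (auto simp: mono_def intro: cdf_nondecreasing)
  have t: "(\<integral>\<^sup>+t. ennreal \<bar>indicator {v..} t - indicator {-m..} t\<bar> \<partial>lborel) = ennreal \<bar>v + m\<bar>" for v
  proof -
    have "(\<integral>\<^sup>+t. ennreal \<bar>indicator {v..} t - indicator {-m..} t :: real\<bar> \<partial>lborel) =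
          (\<integral>\<^sup>+t. indicator {min v (-m)..<max v (-m)} t \<partial>lborel)"
      by (intro nn_integral_cong) (auto simp: indicator_def min_def max_def)
    also have "\<dots> = ennreal \<bar>v + m\<bar>" by (auto simp: min_def max_def)
    finally show ?thesis .
  qed
  have v: "(\<integral>\<^sup>+v. ennreal \<bar>indicator {v..} t - indicator {-m..} t\<bar> \<partial>M) = ennreal \<bar>cdf M t - indicator {-m..} t\<bar>" for t :: real
  proof -
    have 1: "(LINT v|M. indicator {v..} t) = cdf M t"
      unfolding cdf_def by (subst Bochner_Integration.integral_cong[where g="indicator {..t}" and N=M]) (auto simp: indicator_def)
    have i: "integrable M (\<lambda>v. indicator {v..} t :: real)"
      by (intro integrable_const_bound[where B=1]) (auto simp: indicator_def)
    have "(\<integral>\<^sup>+v. ennreal \<bar>indicator {v..} t - indicator {-m..} t\<bar> \<partial>M)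
       = ennreal (LINT v|M. \<bar>indicator {v..} t - indicator {-m..} t\<bar>)"
      using i by (intro nn_integral_eq_integral) auto
    also have "(LINT v|M. \<bar>indicator {v..} t - indicator {-m..} t :: real\<bar>) = \<bar>cdf M t - indicator {-m..} t\<bar>"
    proof (cases "-m \<le> t")
      case True
      have "(LINT v|M. \<bar>indicator {v..} t - indicator {-m..} t :: real\<bar>) = (LINT v|M. 1 - indicator {v..} t)"
        using True by (intro Bochner_Integration.integral_cong) (auto simp: indicator_def)
      also have "\<dots> = 1 - cdf M t" using i 1 prob_space by simp
      finally show ?thesis using True cdf_bounded_prob[of t] by simp
    next
      case False
      have "(LINT v|M. \<bar>indicator {v..} t - indicator {-m..} t :: real\<bar>) = (LINT v|M. indicator {v..} t)"
        using False by (intro Bochner_Integration.integral_cong) (auto simp: indicator_def)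
      then show ?thesis using False 1 cdf_nonneg[of t] by simp
    qed
    finally show ?thesis .
  qed
  interpret P: pair_sigma_finite M lborel ..
  have meas: "(\<lambda>(v, t). ennreal \<bar>indicator {v..} t - indicator {-m..} t :: real\<bar>) \<in> borel_measurable (M \<Otimes>\<^sub>M lborel)"
  proof -
    have [measurable]: "(\<lambda>v. v) \<in> M \<rightarrow>\<^sub>M borel" by (simp add: measurable_ident_sets)
    have "(\<lambda>p. ennreal \<bar>indicator {p. fst p \<le> snd p} p - indicator {-m..} (snd p) :: real\<bar>) \<in> borel_measurable (M \<Otimes>\<^sub>M lborel)"
      by measurable
    also have "(\<lambda>p. ennreal \<bar>indicator {p. fst p \<le> snd p} p - indicator {-m..} (snd p) :: real\<bar>) =
       (\<lambda>(v, t). ennreal \<bar>indicator {v..} t - indicator {-m..} t :: real\<bar>)"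
      by (auto simp: fun_eq_iff indicator_def)
    finally show ?thesis .
  qed
  have eq: "(\<integral>\<^sup>+t. ennreal \<bar>cdf M t - indicator {-m..} t\<bar> \<partial>lborel) = (\<integral>\<^sup>+v. ennreal \<bar>v + m\<bar> \<partial>M)"
    unfolding t[symmetric] v[symmetric] using P.Fubini[OF meas] by simp
  have iv: "integrable M (\<lambda>v. \<bar>v + m\<bar>)" using assms by auto
  then have "(\<integral>\<^sup>+v. ennreal \<bar>v + m\<bar> \<partial>M) = ennreal (LINT v|M. \<bar>v + m\<bar>)"
    by (intro nn_integral_eq_integral) auto
  then have "has_bochner_integral lborel (\<lambda>t. \<bar>cdf M t - indicator {-m..} t\<bar>) (LINT v|M. \<bar>v + m\<bar>)"
    using eq by (intro has_bochner_integral_nn_integral) auto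
  then show "integrable lborel (\<lambda>t. \<bar>cdf M t - indicator {-m..} t\<bar>)"
    and "(LINT v|M. \<bar>v + m\<bar>) = (LINT t|lborel. \<bar>cdf M t - indicator {-m..} t\<bar>)"
    by (auto simp: has_bochner_integral_iff)
qed

lemma (in real_distribution) cdf_tail_bounds:
  assumes "integrable M (\<lambda>v. v\<^sup>2)" "(LINT v|M. v\<^sup>2) \<le> C"
  shows "t > 0 \<Longrightarrow> 1 - cdf M t \<le> C / t\<^sup>2" and "t < 0 \<Longrightarrow> cdf M t \<le> C / t\<^sup>2"
proof -
  have A: "measure M {v. v\<^sup>2 \<ge> t\<^sup>2} \<le> C / t\<^sup>2" if "t \<noteq> 0" for t
  proof -
    have "measure M {v \<in> space M. v\<^sup>2 \<ge> t\<^sup>2} \<le> (LINT v|M. v\<^sup>2) / t\<^sup>2"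
      using that by (intro integral_Markov_inequality_measure[where A="{}"] assms) auto
    also have "\<dots> \<le> C / t\<^sup>2" using assms(2) by (intro divide_right_mono) auto
    finally show ?thesis by simp
  qed
  show "1 - cdf M t \<le> C / t\<^sup>2" if "t > 0"
  proof -
    have "1 - cdf M t = measure M {t<..}"
      using prob_compl[of "{..t}"] by (auto simp: cdf_def Compl_eq_Diff_UNIV[symmetric])
    also have "\<dots> \<le> measure M {v. v\<^sup>2 \<ge> t\<^sup>2}"
      using that by (intro finite_measure_mono) (auto simp: power2_le_iff_abs_le)
    finally show ?thesis using A[of t] that by simp
  qed
  show "cdf M t \<le> C / t\<^sup>2" if "t < 0"
  proof -
    have "cdf M t \<le> measure M {v. v\<^sup>2 \<ge> t\<^sup>2}"
      unfolding cdf_def using that by (intro finite_measure_mono) (auto simp: abs_le_square_iff[symmetric])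
    then show ?thesis using A[of t] that by simp
  qed
qed

section \<open>Convergence of mean absolute values\<close>

text \<open>The shifts \<open>m n\<close> are arbitrary, possibly unbounded, since the bias in units
  of the standard deviation is not controlled over the whole bandwidth range. In the representation
  by distribution functions the shift cancels in the bound
  \<open>\<integral> \<bar>F_n - F\<bar>\<close>, and the common second moment gives the integrable
  majorant \<open>(1 + C) / (1 + t^2)\<close>.\<close>

lemma weak_conv_expectation_abs_uniform:
  fixes N :: "nat \<Rightarrow> real measure"
  assumes "\<And>n. real_distribution (N n)" "real_distribution N'"
    and wc: "weak_conv_m N N'"
    and cont: "\<And>t. isCont (cdf N') t"
    and "\<And>n. integrable (N n) (\<lambda>v. v\<^sup>2)" "\<And>n. (LINT v|N n. v\<^sup>2) \<le> C"
    and "integrable N' (\<lambda>v. v\<^sup>2)" "(LINT v|N'. v\<^sup>2) \<le> C"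
  shows "(\<lambda>n. (LINT v|N n. \<bar>v + m n\<bar>) - (LINT v|N'. \<bar>v + m n\<bar>)) \<longlonglongrightarrow> 0"
proof -
  interpret N': real_distribution N' by fact
  have N: "real_distribution (N n)" for n by fact
  have C0: "C \<ge> 0" by (rule order_trans[OF _ assms(8)]) auto
  have mN: "cdf (N n) \<in> borel_measurable borel" for n
    using finite_borel_measure.cdf_nondecreasing[OF real_distribution.finite_borel_measure_M[OF N]]
    by (intro borel_measurable_mono) (auto simp: mono_def)
  have mN': "cdf N' \<in> borel_measurable borel"
    by (intro borel_measurable_mono) (auto simp: mono_def intro: N'.cdf_nondecreasing)
  have md: "(\<lambda>t. \<bar>cdf (N n) t - cdf N' t\<bar>) \<in> borel_measurable lborel" for n
    using mN[of n] mN' by simp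
  have bnd: "\<bar>cdf (N n) t - cdf N' t\<bar> \<le> (1 + C) * inverse (1 + t\<^sup>2)" for n t
  proof -
    interpret Nn: real_distribution "N n" by fact
    have 1: "\<bar>cdf (N n) t - cdf N' t\<bar> \<le> 1"
      using Nn.cdf_bounded_prob[of t] N'.cdf_bounded_prob[of t] Nn.cdf_nonneg[of t] N'.cdf_nonneg[of t] by auto
    have 2: "\<bar>cdf (N n) t - cdf N' t\<bar> * t\<^sup>2 \<le> C"
    proof (cases "t = 0")
      case False
      have "\<bar>cdf (N n) t - cdf N' t\<bar> \<le> C / t\<^sup>2"
      proof (cases "t > 0")
        case True
        then show ?thesis
          using Nn.cdf_tail_bounds(1)[OF assms(5,6)] N'.cdf_tail_bounds(1)[OF assms(7,8)] 
            Nn.cdf_bounded_prob[of t] N'.cdf_bounded_prob[of t] by (smt (verit))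
      next
        case f: False
        then show ?thesis
          using Nn.cdf_tail_bounds(2)[OF assms(5,6)] N'.cdf_tail_bounds(2)[OF assms(7,8)] False
            Nn.cdf_nonneg[of t] N'.cdf_nonneg[of t] by (smt (verit))
      qed
      then show ?thesis using False by (simp add: field_simps)
    qed (use C0 in auto)
    have "\<bar>cdf (N n) t - cdf N' t\<bar> * (1 + t\<^sup>2) \<le> 1 + C" using 1 2 by (simp add: algebra_simps)
    moreover have "1 + t\<^sup>2 > 0" by (simp add: add_pos_nonneg)
    ultimately show ?thesis by (simp add: field_simps)
  qed
  have int: "integrable lborel (\<lambda>t::real. (1 + C) * inverse (1 + t\<^sup>2))"
    using integrable_inverse_1_plus_square by (simp add: set_integrable_def)
  have lim: "(\<lambda>n. LINT t|lborel. \<bar>cdf (N n) t - cdf N' t\<bar>) \<longlonglongrightarrow> (LINT t::real|lborel. (0::real))"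
  proof (rule integral_dominated_convergence[OF _ _ int])
    show "AE t in lborel. (\<lambda>n. \<bar>cdf (N n) t - cdf N' t\<bar>) \<longlonglongrightarrow> 0"
    proof (rule AE_I2)
      fix t
      have "(\<lambda>n. cdf (N n) t) \<longlonglongrightarrow> cdf N' t"
        using wc cont unfolding weak_conv_m_def weak_conv_def by blast
      then show "(\<lambda>n. \<bar>cdf (N n) t - cdf N' t\<bar>) \<longlonglongrightarrow> 0"
        using LIM_zero tendsto_rabs_zero by blast
    qed
    show "AE t in lborel. norm \<bar>cdf (N n) t - cdf N' t\<bar> \<le> (1 + C) * inverse (1 + t\<^sup>2)" for n
      using bnd[of n] by (intro AE_I2) (simp only: real_norm_def abs_idempotent)
  qed (simp, rule md)
  have sq: "integrable Q (\<lambda>v. v)" if "real_distribution Q" "integrable Q (\<lambda>v. v\<^sup>2)" for Q :: "real measure"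
  proof -
    interpret real_distribution Q by fact
    show ?thesis by (rule square_integrable_imp_integrable[OF _ that(2)]) simp
  qed
  have main: "\<bar>(LINT v|N n. \<bar>v + m n\<bar>) - (LINT v|N'. \<bar>v + m n\<bar>)\<bar> \<le> (LINT t|lborel. \<bar>cdf (N n) t - cdf N' t\<bar>)" for n
  proof -
    have i: "integrable (N n) (\<lambda>v. v)" "integrable N' (\<lambda>v. v)" by (rule sq[OF N assms(5)], rule sq[OF assms(2,7)])
    note a = real_distribution.expectation_abs_eq_cdf[OF N i(1), of "m n"]
    note b = N'.expectation_abs_eq_cdf[OF i(2), of "m n"]
    have "\<bar>(LINT v|N n. \<bar>v + m n\<bar>) - (LINT v|N'. \<bar>v + m n\<bar>)\<bar> = 
       \<bar>LINT t|lborel. \<bar>cdf (N n) t - indicator {-m n..} t\<bar> - \<bar>cdf N' t - indicator {-m n..} t\<bar>\<bar>"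
      using a b by simp
    also have "\<dots> \<le> (LINT t|lborel. \<bar>\<bar>cdf (N n) t - indicator {-m n..} t\<bar> - \<bar>cdf N' t - indicator {-m n..} t\<bar>\<bar>)"
      by (rule integral_abs_bound)
    also have "\<dots> \<le> (LINT t|lborel. \<bar>cdf (N n) t - cdf N' t\<bar>)"
    proof (rule integral_mono)
      show "integrable lborel (\<lambda>t. \<bar>cdf (N n) t - cdf N' t\<bar>)"
      proof (rule Bochner_Integration.integrable_bound[OF int])
        show "AE t in lborel. norm \<bar>cdf (N n) t - cdf N' t\<bar> \<le> norm ((1 + C) * inverse (1 + t\<^sup>2))"
          by (rule AE_I2) (simp only: real_norm_def abs_idempotent order_trans[OF bnd abs_ge_self])
      qed (rule md)
      show "integrable lborel (\<lambda>t. \<bar>\<bar>cdf (N n) t - indicator {-m n..} t\<bar> - \<bar>cdf N' t - indicator {-m n..} t\<bar>\<bar>)"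
        by (intro integrable_abs Bochner_Integration.integrable_diff a(1) b(1))
    qed linarith
    finally show ?thesis .
  qed
  show ?thesis
    by (rule Lim_null_comparison[OF _ lim[simplified]]) (use main in auto)
qed


section \<open>Independent sums and a central limit theorem for triangular arrays\<close>

lemma (in prob_space) expectation_sum_square_indep:
  fixes Y :: "'i \<Rightarrow> 'a \<Rightarrow> real"
  assumes "finite I" "indep_vars (\<lambda>_. borel) Y I"
    and "\<And>i. i \<in> I \<Longrightarrow> integrable M (\<lambda>\<omega>. (Y i \<omega>)\<^sup>2)" "\<And>i. i \<in> I \<Longrightarrow> expectation (Y i) = 0"
  shows "integrable M (\<lambda>\<omega>. (\<Sum>i\<in>I. Y i \<omega>)\<^sup>2) \<and>
         expectation (\<lambda>\<omega>. (\<Sum>i\<in>I. Y i \<omega>)\<^sup>2) = (\<Sum>i\<in>I. expectation (\<lambda>\<omega>. (Y i \<omega>)\<^sup>2))"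
  using assms
proof (induction I rule: finite_induct)
  case (insert k I)
  define S where "S = (\<lambda>\<omega>. \<Sum>i\<in>I. Y i \<omega>)"
  have rv: "Y i \<in> borel_measurable M" if "i \<in> insert k I" for i
    using insert.prems(1) that unfolding indep_vars_def by blast
  have Yi: "integrable M (Y i)" if "i \<in> insert k I" for i
    using rv[OF that] insert.prems(2)[OF that] by (rule square_integrable_imp_integrable)
  have iv: "indep_var borel (Y k) borel S"
    unfolding S_def by (rule indep_vars_sum[OF insert.hyps insert.prems(1)])
  have S: "integrable M S"
    unfolding S_def by (intro Bochner_Integration.integrable_sum Yi) simp
  have S0: "expectation S = 0"
    unfolding S_def by (subst Bochner_Integration.integral_sum) (use Yi insert.prems(3) in simp_all)
  have k: "integrable M (Y k)" "expectation (Y k) = 0" using Yi insert.prems(3) by simp_all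
  have prod: "integrable M (\<lambda>\<omega>. Y k \<omega> * S \<omega>)" "expectation (\<lambda>\<omega>. Y k \<omega> * S \<omega>) = 0"
    using indep_var_integrable[OF iv k(1) S] indep_var_lebesgue_integral[OF iv k(1) S] k S0 by simp_all
  have "indep_vars (\<lambda>_. borel) Y I" by (rule indep_vars_subset[OF insert.prems(1)]) blast
  note IH = insert.IH[OF this insert.prems(2,3), folded S_def, simplified]
  have eq: "(\<Sum>i\<in>insert k I. Y i \<omega>)\<^sup>2 = (Y k \<omega>)\<^sup>2 + 2 * (Y k \<omega> * S \<omega>) + (S \<omega>)\<^sup>2" for \<omega>
    using insert.hyps by (simp add: S_def power2_sum)
  have IH': "integrable M (\<lambda>\<omega>. (S \<omega>)\<^sup>2)" "expectation (\<lambda>\<omega>. (S \<omega>)\<^sup>2) = (\<Sum>i\<in>I. expectation (\<lambda>\<omega>. (Y i \<omega>)\<^sup>2))"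
    using IH by (simp_all add: S_def)
  have kk: "integrable M (\<lambda>\<omega>. (Y k \<omega>)\<^sup>2)" using insert.prems(2) by simp
  show ?case
    unfolding eq using IH' prod kk insert.hyps by (simp add: Bochner_Integration.integral_add)
qed simp

text \<open>The uniform bound \<open>c n \<rightarrow> 0\<close> takes the place of Lindeberg's
  condition: it bounds the cubic Taylor remainder of each characteristic function by
  \<open>c n\<close> times the variance. The product of the factors is then compared with the
  \<open>n\<close>-th power of \<open>1 - t^2 / (2 n)\<close>.\<close>

theorem (in prob_space) triangular_array_clt:
  fixes Y :: "nat \<Rightarrow> nat \<Rightarrow> 'a \<Rightarrow> real"
  assumes indep: "\<And>n. indep_vars (\<lambda>_. borel) (Y n) {1..n}"
    and mean: "\<And>n i. i \<in> {1..n} \<Longrightarrow> expectation (Y n i) = 0"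
    and bound: "\<And>n i \<omega>. i \<in> {1..n} \<Longrightarrow> \<omega> \<in> space M \<Longrightarrow> \<bar>Y n i \<omega>\<bar> \<le> c n"
    and var: "\<And>n i. i \<in> {1..n} \<Longrightarrow> expectation (\<lambda>\<omega>. (Y n i \<omega>)\<^sup>2) = v n / real n"
    and c: "c \<longlonglongrightarrow> 0" and v: "v \<longlonglongrightarrow> 1"
  shows "weak_conv_m (\<lambda>n. distr M borel (\<lambda>\<omega>. \<Sum>i=1..n. Y n i \<omega>)) std_normal_distribution"
proof (rule levy_continuity)
  have rv: "Y n i \<in> borel_measurable M" if "i \<in> {1..n}" for n i
    using indep that unfolding indep_vars_def by auto
  show "real_distribution (distr M borel (\<lambda>\<omega>. \<Sum>i=1..n. Y n i \<omega>))" for n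
    using rv by (intro real_distribution_distr borel_measurable_sum) auto
  show "real_distribution std_normal_distribution" by (rule real_dist_normal_dist)
  fix t :: real
  define \<phi> where "\<phi> n i = char (distr M borel (Y n i)) t" for n i
  \<comment> \<open>\<open>n\<close> times the error of one factor: the first summand accounts for
    the variance \<open>v n / n\<close> instead of \<open>1 / n\<close>, the second for the cubic
    remainder.\<close>
  define B where "B n = t\<^sup>2 / 2 * \<bar>v n - 1\<bar> + t\<^sup>2 / 6 * \<bar>t\<bar> * c n * v n" for n
  have B0: "B \<longlonglongrightarrow> 0"
    unfolding B_def by (rule tendsto_eq_intros c v refl | simp)+
  have one: "cmod (\<phi> n i - (1 - t\<^sup>2 / 2 / n)) \<le> B n / n" if i: "i \<in> {1..n}" for n i
  proof -
    have n: "real n > 0" using i by auto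
    have bd: "integrable M (\<lambda>\<omega>. (Y n i \<omega>) ^ k)" for k
    proof (rule integrable_const_bound[where B="(c n) ^ k"])
      show "AE \<omega> in M. norm (Y n i \<omega> ^ k) \<le> c n ^ k"
        using bound[OF i] by (intro AE_I2) (simp add: power_abs power_mono)
    qed (use rv[OF i] in measurable)
    have int: "integrable M (Y n i)" "integrable M (\<lambda>\<omega>. (Y n i \<omega>)\<^sup>2)"
      using bd[of 1] bd[of 2] by auto
    have var': "variance (Y n i) = v n / n" using mean[OF i] var[OF i] by simp
    have "cmod (\<phi> n i - (1 - t\<^sup>2 * (v n / n) / 2)) \<le>
        (t\<^sup>2 / 6) * expectation (\<lambda>\<omega>. min (6 * (Y n i \<omega>)\<^sup>2) (\<bar>t\<bar> * \<bar>Y n i \<omega>\<bar> ^ 3))"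
      unfolding \<phi>_def by (rule char_approx3'[OF rv[OF i] int mean[OF i] var' refl])
    also have "expectation (\<lambda>\<omega>. min (6 * (Y n i \<omega>)\<^sup>2) (\<bar>t\<bar> * \<bar>Y n i \<omega>\<bar> ^ 3)) \<le>
        expectation (\<lambda>\<omega>. \<bar>t\<bar> * c n * (Y n i \<omega>)\<^sup>2)"
    proof (rule integral_mono)
      show "integrable M (\<lambda>\<omega>. min (6 * (Y n i \<omega>)\<^sup>2) (\<bar>t\<bar> * \<bar>Y n i \<omega>\<bar> ^ 3))"
        using int bd[of 3] by (intro integrable_min integrable_mult_right) (auto simp: power_abs[symmetric])
      fix \<omega> assume \<omega>: "\<omega> \<in> space M"
      have "\<bar>Y n i \<omega>\<bar> * (Y n i \<omega>)\<^sup>2 \<le> c n * (Y n i \<omega>)\<^sup>2"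
        by (intro mult_right_mono bound i \<omega>) auto
      then have "\<bar>t\<bar> * (\<bar>Y n i \<omega>\<bar> * (Y n i \<omega>)\<^sup>2) \<le> \<bar>t\<bar> * (c n * (Y n i \<omega>)\<^sup>2)"
        by (rule mult_left_mono) simp
      moreover have "\<bar>Y n i \<omega>\<bar> * (Y n i \<omega>)\<^sup>2 = \<bar>Y n i \<omega>\<bar> ^ 3"
        by (simp add: power3_eq_cube power2_eq_square)
      ultimately show "min (6 * (Y n i \<omega>)\<^sup>2) (\<bar>t\<bar> * \<bar>Y n i \<omega>\<bar> ^ 3) \<le> \<bar>t\<bar> * c n * (Y n i \<omega>)\<^sup>2"
        by (simp add: mult.assoc)
    qed (use int in auto)
    also have "expectation (\<lambda>\<omega>. \<bar>t\<bar> * c n * (Y n i \<omega>)\<^sup>2) = \<bar>t\<bar> * c n * (v n / n)"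
      using var[OF i] by simp
    finally have 1: "cmod (\<phi> n i - (1 - t\<^sup>2 * (v n / n) / 2)) \<le> t\<^sup>2 / 6 * (\<bar>t\<bar> * c n * (v n / n))"
      by (simp add: mult_left_mono)
    have "cmod (\<phi> n i - (1 - t\<^sup>2 / 2 / n)) \<le> cmod (\<phi> n i - (1 - t\<^sup>2 * (v n / n) / 2)) +
        cmod (of_real (1 - t\<^sup>2 * (v n / n) / 2) - of_real (1 - t\<^sup>2 / 2 / n))"
      unfolding dist_norm[symmetric] by (rule dist_triangle)
    also have "cmod (of_real (1 - t\<^sup>2 * (v n / n) / 2) - of_real (1 - t\<^sup>2 / 2 / n)) = \<bar>- (t\<^sup>2 / 2 / n) * (v n - 1)\<bar>"
      unfolding of_real_diff[symmetric] norm_of_real by (rule arg_cong[where f=abs]) (use n in \<open>simp add: field_simps\<close>)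
    also have "\<bar>- (t\<^sup>2 / 2 / n) * (v n - 1)\<bar> = t\<^sup>2 / 2 / n * \<bar>v n - 1\<bar>"
      by (simp add: abs_mult)
    finally have "cmod (\<phi> n i - (1 - t\<^sup>2 / 2 / n)) \<le> t\<^sup>2 / 6 * (\<bar>t\<bar> * c n * (v n / n)) + t\<^sup>2 / 2 / n * \<bar>v n - 1\<bar>"
      using 1 by simp
    also have "\<dots> = B n / n" using n by (simp add: B_def field_simps)
    finally show ?thesis .
  qed
  have close: "\<forall>\<^sub>F n in sequentially. cmod (char (distr M borel (\<lambda>\<omega>. \<Sum>i=1..n. Y n i \<omega>)) t - of_real ((1 + (- t\<^sup>2 / 2) / n) ^ n)) \<le> B n"
    \<comment> \<open>\<open>n \<ge> t^2\<close> keeps \<open>1 - t^2 / (2 n)\<close> in the unit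
      disc, as the comparison of products factor by factor requires.\<close>
    using eventually_ge_at_top[of "nat \<lceil>t\<^sup>2\<rceil> + 1"]
  proof eventually_elim
    case (elim n)
    then have n: "real n \<ge> t\<^sup>2" "n \<ge> 1" by linarith+
    have le1: "cmod (\<phi> n i) \<le> 1" if "i \<in> {1..n}" for i
      unfolding \<phi>_def using rv[OF that] by (intro real_distribution.cmod_char_le_1 real_distribution_distr)
    have "\<bar>1 - t\<^sup>2 / 2 / n\<bar> \<le> 1"
      using n by (auto simp: abs_le_iff field_simps)
    then have le2: "cmod (1 - t\<^sup>2 / 2 / n) \<le> 1"
      by (metis norm_of_real of_real_1 of_real_diff of_real_divide of_real_numeral of_real_of_nat_eq of_real_power)
    have "char (distr M borel (\<lambda>\<omega>. \<Sum>i=1..n. Y n i \<omega>)) t = (\<Prod>i=1..n. \<phi> n i)"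
      unfolding \<phi>_def by (rule char_distr_sum[OF indep])
    moreover have "of_real ((1 + (- t\<^sup>2 / 2) / n) ^ n) = (\<Prod>i=1..n. 1 - t\<^sup>2 / 2 / n :: complex)"
      by simp
    ultimately have "cmod (char (distr M borel (\<lambda>\<omega>. \<Sum>i=1..n. Y n i \<omega>)) t - of_real ((1 + (- t\<^sup>2 / 2) / n) ^ n))
        \<le> (\<Sum>i=1..n. cmod (\<phi> n i - (1 - t\<^sup>2 / 2 / n)))"
      using norm_prod_diff[of "{1..n}" "\<phi> n" "\<lambda>_. 1 - t\<^sup>2 / 2 / n"] le1 le2 by simp
    also have "\<dots> \<le> (\<Sum>i=1..n. B n / n)" by (intro sum_mono one)
    also have "\<dots> = B n" using n by simp
    finally show ?case .
  qed
  have lim: "(\<lambda>n. complex_of_real ((1 + (- t\<^sup>2 / 2) / n) ^ n)) \<longlonglongrightarrow> complex_of_real (exp (- t\<^sup>2 / 2))"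
    by (intro tendsto_of_real tendsto_exp_limit_sequentially)
  have "(\<lambda>n. char (distr M borel (\<lambda>\<omega>. \<Sum>i=1..n. Y n i \<omega>)) t) \<longlonglongrightarrow> complex_of_real (exp (- t\<^sup>2 / 2))"
    by (rule Lim_transform[OF lim]) (rule Lim_null_comparison[OF close B0])
  then show "(\<lambda>n. char (distr M borel (\<lambda>\<omega>. \<Sum>i=1..n. Y n i \<omega>)) t) \<longlonglongrightarrow> char std_normal_distribution t"
    by (simp add: char_std_normal_distribution)
qed

section \<open>Mass above a level\<close>

definition mass_above :: "(real \<Rightarrow> real) \<Rightarrow> real \<Rightarrow> real" where
  "mass_above g y = (LINT x|lborel. g x * indicator {x. g x \<ge> y} x)"

lemma integrable_mult_indicator_real:
  fixes g :: "'a \<Rightarrow> real"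
  assumes "integrable N g" "A \<in> sets N"
  shows "integrable N (\<lambda>x. g x * indicator A x)"
  using integrable_real_mult_indicator[OF assms(2,1)] by simp

context
  fixes g :: "real \<Rightarrow> real" and \<tau> Cg :: real
  assumes g: "integrable lborel g" "\<And>x. g x \<ge> 0" "\<And>x. g x \<le> Cg" and \<tau>: "\<tau> < 1"
begin

lemma g_borel: "g \<in> borel_measurable borel"
  using g(1) by auto

lemma mass_above_integrable: "integrable lborel (\<lambda>x. g x * indicator {x. g x \<ge> y} x)"
  using g_borel by (intro integrable_mult_indicator_real[OF g(1)]) measurable

lemma mass_above_antimono: "y \<le> y' \<Longrightarrow> mass_above g y' \<le> mass_above g y"
  unfolding mass_above_def
  by (intro integral_mono mass_above_integrable) (auto simp: indicator_def g(2))

lemma hdr_level_alt: "hdr_level \<tau> g = Inf {y. 0 < y \<and> mass_above g y \<le> 1 - \<tau>}"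
  unfolding hdr_level_def mass_above_def ..

lemma mass_above_level_set_nonempty: "{y. 0 < y \<and> mass_above g y \<le> 1 - \<tau>} \<noteq> {}"
proof -
  have "mass_above g (\<bar>Cg\<bar> + 1) = (LINT x::real|lborel. 0)"
    unfolding mass_above_def
  proof (intro Bochner_Integration.integral_cong refl)
    show "g x * indicator {x. \<bar>Cg\<bar> + 1 \<le> g x} x = 0" for x
      using g(3)[of x] by (auto simp: indicator_def)
  qed
  then have "\<bar>Cg\<bar> + 1 \<in> {y. 0 < y \<and> mass_above g y \<le> 1 - \<tau>}" using \<tau> by simp
  then show ?thesis by blast
qed

lemma mass_above_bdd_below: "bdd_below {y. 0 < y \<and> mass_above g y \<le> 1 - \<tau>}"
  by (rule bdd_belowI[of _ 0]) auto

lemma mass_above_below_level: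
  assumes "0 < y" "y < hdr_level \<tau> g"
  shows "mass_above g y > 1 - \<tau>"
  using assms cInf_lower[OF _ mass_above_bdd_below, of y] unfolding hdr_level_alt by force

text \<open>Monotonicity allows a rational witness, which turns the event that a random level lies
  below \<open>a\<close> into a countable union.\<close>

lemma hdr_level_less_iff: "hdr_level \<tau> g < a \<longleftrightarrow> (\<exists>q\<in>\<rat>. 0 < q \<and> q < a \<and> mass_above g q \<le> 1 - \<tau>)"
proof
  assume "hdr_level \<tau> g < a"
  then obtain y where y: "0 < y" "mass_above g y \<le> 1 - \<tau>" "y < a"
    unfolding hdr_level_alt
    using cInf_lessD[OF mass_above_level_set_nonempty] by blast
  then obtain q where "q \<in> \<rat>" "y < q" "q < a" using Rats_dense_in_real by blast
  then show "\<exists>q\<in>\<rat>. 0 < q \<and> q < a \<and> mass_above g q \<le> 1 - \<tau>"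
    using y mass_above_antimono[of y q] by (intro bexI[of _ q]) auto
next
  assume "\<exists>q\<in>\<rat>. 0 < q \<and> q < a \<and> mass_above g q \<le> 1 - \<tau>"
  then obtain q where q: "0 < q" "q < a" "mass_above g q \<le> 1 - \<tau>" by blast
  then have "hdr_level \<tau> g \<le> q"
    unfolding hdr_level_alt by (intro cInf_lower mass_above_bdd_below) auto
  then show "hdr_level \<tau> g < a" using q by simp
qed

lemma mass_above_above_level:
  assumes "hdr_level \<tau> g < y"
  shows "mass_above g y \<le> 1 - \<tau>"
  using assms mass_above_antimono unfolding hdr_level_less_iff by (meson less_imp_le order_trans)

text \<open>A null level set makes \<open>mass_above\<close> continuous at the level. Thresholds
  below the level give \<open>\<ge>\<close> and thresholds above it give \<open>\<le>\<close>;
  positivity holds because the total mass 1 is recovered as the threshold tends to 0.\<close>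

lemma mass_above_level_exact:
  assumes int1: "(LINT x|lborel. g x) = 1" and \<tau>0: "0 < \<tau>"
    and null: "AE x in lborel. g x \<noteq> hdr_level \<tau> g"
  shows "hdr_level \<tau> g > 0" and "mass_above g (hdr_level \<tau> g) = 1 - \<tau>"
proof -
  let ?L = "hdr_level \<tau> g"
  note g_borel [measurable]
  \<comment> \<open>The exceptional set \<open>B\<close> serves the approach from above, where the
    sets increase to \<open>{g > L}\<close> rather than to \<open>{g \<ge> L}\<close>. Zeros of
    \<open>g\<close> are exempt since they carry no mass.\<close>
  have DC: "(\<lambda>k. mass_above g (y k)) \<longlonglongrightarrow> (LINT x|lborel. g x * indicator A x)"
    if lim: "\<And>x. x \<notin> B \<Longrightarrow> g x \<noteq> 0 \<Longrightarrow> eventually (\<lambda>k. (g x \<ge> y k) = (x \<in> A)) sequentially"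
      and A: "A \<in> sets borel" and B: "AE x in lborel. x \<notin> B" for y A B
    unfolding mass_above_def
  proof (rule integral_dominated_convergence[where w=g])
    show "AE x in lborel. (\<lambda>k. g x * indicator {x. y k \<le> g x} x) \<longlonglongrightarrow> g x * indicator A x"
      using B
    proof eventually_elim
      case (elim x)
      show ?case
      proof (cases "g x = 0")
        case False
        show ?thesis
          by (rule tendsto_eventually, rule eventually_mono[OF lim[OF elim False]]) (auto simp: indicator_def)
      qed simp
    qed
    show "AE x in lborel. norm (g x * indicator {x. y k \<le> g x} x) \<le> g x" for k
      by (auto simp: indicator_def g(2))
    show "(\<lambda>x. g x * indicator A x) \<in> borel_measurable lborel" using A by measurable
    show "(\<lambda>x. g x * indicator {x. y k \<le> g x} x) \<in> borel_measurable lborel" for k by measurable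
  qed (rule g(1))
  have inv0: "(\<lambda>k. inverse (real (Suc k))) \<longlonglongrightarrow> 0" by (rule LIMSEQ_inverse_real_of_nat)
  have "(\<lambda>k. mass_above g (inverse (real (Suc k)))) \<longlonglongrightarrow> (LINT x|lborel. g x * indicator UNIV x)"
  proof (rule DC[where B="{}"])
    fix x assume "g x \<noteq> 0"
    then have "g x > 0" using g(2)[of x] by simp
    from order_tendstoD(2)[OF inv0 this]
    show "\<forall>\<^sub>F k in sequentially. (inverse (real (Suc k)) \<le> g x) = (x \<in> UNIV)"
      by eventually_elim simp
  qed auto
  then have "(\<lambda>k. mass_above g (inverse (real (Suc k)))) \<longlonglongrightarrow> 1" using int1 by simp
  from order_tendstoD(1)[OF this, of "1 - \<tau>"] \<tau>0
  obtain k where k: "mass_above g (inverse (real (Suc k))) > 1 - \<tau>"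
    by (auto simp: eventually_sequentially)
  then have "inverse (real (Suc k)) \<le> ?L"
    using mass_above_above_level by (meson not_le)
  then show L0: "?L > 0" by (meson inverse_positive_iff_positive less_le_trans of_nat_0_less_iff zero_less_Suc)
  \<comment> \<open>The step \<open>?L / 2\<close> keeps the thresholds positive, as the infimum
    ranges over positive levels.\<close>
  have "(\<lambda>k. mass_above g (?L - ?L / 2 * inverse (real (Suc k)))) \<longlonglongrightarrow> (LINT x|lborel. g x * indicator {x. g x \<ge> ?L} x)"
  proof (rule DC[where B="{}"])
    fix x
    have l: "(\<lambda>k. ?L - ?L / 2 * inverse (real (Suc k))) \<longlonglongrightarrow> ?L - ?L / 2 * 0"
      by (intro tendsto_intros inv0)
    show "\<forall>\<^sub>F k in sequentially. (?L - ?L / 2 * inverse (real (Suc k)) \<le> g x) = (x \<in> {x. ?L \<le> g x})"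
    proof (cases "g x \<ge> ?L")
      case True
      have "?L - ?L / 2 * inverse (real (Suc k)) \<le> g x" for k
      proof -
        have "?L / 2 * inverse (real (Suc k)) \<ge> 0" using L0 by simp
        then show ?thesis using True by linarith
      qed
      then show ?thesis using True by simp
    next
      case False
      then have "g x < ?L - ?L / 2 * 0" by simp
      from order_tendstoD(1)[OF l this] show ?thesis by eventually_elim (use False in auto)
    qed
  qed auto
  moreover have "mass_above g (?L - ?L / 2 * inverse (real (Suc k))) \<ge> 1 - \<tau>" for k
  proof -
    have "inverse (real (Suc k)) > 0" "inverse (real (Suc k)) \<le> 1" by (simp_all add: field_simps)
    then have "?L / 2 * inverse (real (Suc k)) > 0" "?L / 2 * inverse (real (Suc k)) \<le> ?L / 2 * 1"
      using L0 by (simp, intro mult_left_mono) auto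
    then show ?thesis using L0 by (intro less_imp_le[OF mass_above_below_level]) auto
  qed
  ultimately have ge: "mass_above g ?L \<ge> 1 - \<tau>"
    unfolding mass_above_def[of g ?L] by (intro LIMSEQ_le_const) auto
  have "(\<lambda>k. mass_above g (?L + inverse (real (Suc k)))) \<longlonglongrightarrow> (LINT x|lborel. g x * indicator {x. g x \<ge> ?L} x)"
  proof (rule DC[where B="{x. g x = ?L}"])
    fix x assume x: "x \<notin> {x. g x = ?L}"
    have l: "(\<lambda>k. ?L + inverse (real (Suc k))) \<longlonglongrightarrow> ?L + 0"
      by (intro tendsto_intros inv0)
    show "\<forall>\<^sub>F k in sequentially. (?L + inverse (real (Suc k)) \<le> g x) = (x \<in> {x. ?L \<le> g x})"
    proof (cases "g x > ?L")
      case True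
      then have "?L + 0 < g x" by simp
      from order_tendstoD(2)[OF l this] show ?thesis by eventually_elim (use True in auto)
    next
      case False
      then have "\<not> ?L + inverse (real (Suc k)) \<le> g x" for k
      proof -
        have "inverse (real (Suc k)) > 0" by simp
        then show ?thesis using False by linarith
      qed
      then show ?thesis using x False by simp
    qed
  qed (use null in auto)
  moreover have "mass_above g (?L + inverse (real (Suc k))) \<le> 1 - \<tau>" for k
    by (rule mass_above_above_level) simp
  ultimately have "mass_above g ?L \<le> 1 - \<tau>"
    unfolding mass_above_def[of g ?L] by (intro LIMSEQ_le_const2) auto
  then show "mass_above g ?L = 1 - \<tau>" using ge by simp
qed

end

section \<open>Lengths of intervals and of differences of half-lines\<close>

lemma lborel_cball_real: "r \<ge> 0 \<Longrightarrow> has_bochner_integral lborel (indicator {x::real. \<bar>x - p\<bar> \<le> r} :: real \<Rightarrow> real) (2 * r)"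
proof -
  assume r: "r \<ge> 0"
  have "{x. \<bar>x - p\<bar> \<le> r} = {p - r..p + r}" by (auto simp: abs_le_iff)
  then show ?thesis using r by (simp add: has_bochner_integral_iff)
qed

lemma lborel_annulus_real:
  assumes "R \<ge> 0" "s \<ge> 0"
  shows "has_bochner_integral lborel (indicator {x::real. R < \<bar>x - p\<bar> \<and> \<bar>x - p\<bar> \<le> s} :: real \<Rightarrow> real) (2 * max 0 (s - R))"
proof (cases "s \<le> R")
  case True
  then have "indicator {x::real. R < \<bar>x - p\<bar> \<and> \<bar>x - p\<bar> \<le> s} = (\<lambda>x. 0::real)"
    by (auto simp: fun_eq_iff indicator_def)
  then show ?thesis using True by (simp add: has_bochner_integral_iff)
next
  case False
  have "has_bochner_integral lborel (\<lambda>x::real. indicator {x. \<bar>x - p\<bar> \<le> s} x - indicator {x. \<bar>x - p\<bar> \<le> R} x :: real) (2 * s - 2 * R)"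
    using assms by (intro has_bochner_integral_diff lborel_cball_real)
  moreover have "(\<lambda>x::real. indicator {x. \<bar>x - p\<bar> \<le> s} x - indicator {x. \<bar>x - p\<bar> \<le> R} x :: real) = indicator {x. R < \<bar>x - p\<bar> \<and> \<bar>x - p\<bar> \<le> s}"
    using False by (auto simp: fun_eq_iff indicator_def)
  ultimately show ?thesis using False by simp
qed

text \<open>Adding \<open>v\<close> to a line of slope \<open>m\<close> through \<open>p\<close>
  moves its zero to \<open>z = p - v / m\<close>, so \<open>W\<close> is, up to endpoints, the sign
  of \<open>v\<close> times the indicator of the interval between \<open>z\<close> and
  \<open>p\<close>.\<close>

lemma halfline_shift_integral:
  fixes m v p :: real
  assumes m: "m \<noteq> 0"
  defines "W \<equiv> \<lambda>x::real. indicator {x. m * (x - p) + v \<ge> 0} x - indicator {x. m * (x - p) \<ge> 0} x :: real"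
  shows "has_bochner_integral lborel W (v / \<bar>m\<bar>)" and "has_bochner_integral lborel (\<lambda>x. \<bar>W x\<bar>) (\<bar>v\<bar> / \<bar>m\<bar>)"
proof -
  define z where "z = p - v / m"
  have pos: "m * (x - p) + v = m * (x - z)" for x using m by (simp add: z_def field_simps)
  have I: "has_bochner_integral lborel (indicator A :: real \<Rightarrow> real) r"
    if "A \<in> sets borel" "emeasure lborel A = ennreal r" "r \<ge> 0" for A r
    using that has_bochner_integral_real_indicator[of A lborel] by (simp add: measure_def)
  have I1: "has_bochner_integral lborel (indicator {z..<p} :: real \<Rightarrow> real) \<bar>z - p\<bar>" if "z \<le> p"
    using that by (intro I) auto
  have I2: "has_bochner_integral lborel (indicator {z<..p} :: real \<Rightarrow> real) \<bar>z - p\<bar>" if "z \<le> p"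
    using that by (intro I) auto
  have I3: "has_bochner_integral lborel (indicator {p<..z} :: real \<Rightarrow> real) \<bar>z - p\<bar>" if "p \<le> z"
    using that by (intro I) auto
  have I4: "has_bochner_integral lborel (indicator {p..<z} :: real \<Rightarrow> real) \<bar>z - p\<bar>" if "p \<le> z"
    using that by (intro I) auto
  have "has_bochner_integral lborel W (v / \<bar>m\<bar>) \<and> has_bochner_integral lborel (\<lambda>x. \<bar>W x\<bar>) (\<bar>v\<bar> / \<bar>m\<bar>)"
  proof (cases "m > 0")
    case mp: True
    show ?thesis
    proof (cases "v \<ge> 0")
      case True
      then have zp: "z \<le> p" using mp by (simp add: z_def)
      have W: "W = indicator {z..<p}"
        unfolding W_def pos using mp zp by (auto simp: fun_eq_iff indicator_def zero_le_mult_iff)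
      have "\<bar>z - p\<bar> = v / \<bar>m\<bar>" using True mp by (simp add: z_def)
      then show ?thesis using I1[OF zp] True unfolding W by simp
    next
      case False
      then have zp: "p \<le> z" using mp by (simp add: z_def divide_nonpos_pos)
      have W: "W = (\<lambda>x. - indicator {p..<z} x)"
        unfolding W_def pos using mp zp by (auto simp: fun_eq_iff indicator_def zero_le_mult_iff)
      have "\<bar>z - p\<bar> = - v / \<bar>m\<bar>" using False mp zp by (simp add: z_def)
      then show ?thesis using has_bochner_integral_minus[OF I4[OF zp]] I4[OF zp] False unfolding W by simp
    qed
  next
    case False
    then have mn: "m < 0" using m by simp
    show ?thesis
    proof (cases "v \<ge> 0")
      case True
      then have zp: "p \<le> z" using mn by (simp add: z_def divide_nonneg_neg)
      have W: "W = indicator {p<..z}"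
        unfolding W_def pos using mn zp by (auto simp: fun_eq_iff indicator_def zero_le_mult_iff)
      have "\<bar>z - p\<bar> = v / \<bar>m\<bar>" using True mn by (simp add: z_def)
      then show ?thesis using I3[OF zp] True unfolding W by simp
    next
      case False
      then have zp: "z \<le> p" using mn by (simp add: z_def divide_nonpos_neg)
      have W: "W = (\<lambda>x. - indicator {z<..p} x)"
        unfolding W_def pos using mn zp by (auto simp: fun_eq_iff indicator_def zero_le_mult_iff)
      have "\<bar>z - p\<bar> = - v / \<bar>m\<bar>" using False mn by (simp add: z_def)
      then show ?thesis using has_bochner_integral_minus[OF I2[OF zp]] I2[OF zp] False unfolding W by simp
    qed
  qed
  then show "has_bochner_integral lborel W (v / \<bar>m\<bar>)" "has_bochner_integral lborel (\<lambda>x. \<bar>W x\<bar>) (\<bar>v\<bar> / \<bar>m\<bar>)" by auto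
qed

section \<open>Deterministic linearisation of the risk\<close>

lemma integrable_bounded_support_real:
  fixes h :: "real \<Rightarrow> real"
  assumes "h \<in> borel_measurable borel" "\<And>x. \<bar>x - p\<bar> \<le> s \<Longrightarrow> \<bar>h x\<bar> \<le> B" "\<And>x. \<bar>x - p\<bar> > s \<Longrightarrow> h x = 0"
  shows "integrable lborel h"
proof (rule Bochner_Integration.integrable_bound)
  show "integrable lborel (\<lambda>x. \<bar>B\<bar> * indicator {x. \<bar>x - p\<bar> \<le> \<bar>s\<bar>} x :: real)"
    using lborel_cball_real[of "\<bar>s\<bar>" p] by (intro integrable_mult_right) (auto simp: has_bochner_integral_iff)
  show "AE x in lborel. norm (h x) \<le> norm (\<bar>B\<bar> * indicator {x. \<bar>x - p\<bar> \<le> \<bar>s\<bar>} x)"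
  proof (rule AE_I2)
    fix x
    show "norm (h x) \<le> norm (\<bar>B\<bar> * indicator {x. \<bar>x - p\<bar> \<le> \<bar>s\<bar>} x)"
      using assms(2)[of x] assms(3)[of x] by (cases "\<bar>x - p\<bar> \<le> s") (auto simp: indicator_def)
  qed
qed (use assms(1) in simp)

text \<open>\<open>P\<close> is the set of crossings and \<open>m\<close> gives the slopes there.
  The two-sided bounds with \<open>c\<close> and \<open>C1\<close> hold within distance
  \<open>d\<close> of a crossing, while \<open>c1\<close> separates \<open>f\<close> from the level
  elsewhere. Derivatives do not occur: the deterministic analysis sees \<open>f\<close> only through
  these inequalities.\<close>

locale level_crossings =
  fixes f m :: "real \<Rightarrow> real" and \<tau> L Cf C1 c c1 d :: real and P :: "real set"
  assumes \<tau>: "0 < \<tau>" "\<tau> < 1"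
    and f_int: "integrable lborel f" and f_nonneg: "\<And>x. f x \<ge> 0" and f_le: "\<And>x. f x \<le> Cf"
    and L_pos: "L > 0" and f_level: "mass_above f L = 1 - \<tau>"
    and P: "finite P" "P \<noteq> {}"
    and const_pos: "d > 0" "c > 0" "C1 > 0" "c1 > 0"
    and sep: "\<And>p q x. p \<in> P \<Longrightarrow> q \<in> P \<Longrightarrow> \<bar>x - p\<bar> \<le> d \<Longrightarrow> \<bar>x - q\<bar> \<le> d \<Longrightarrow> p = q"
    and slope: "\<And>p. p \<in> P \<Longrightarrow> c \<le> \<bar>m p\<bar>"
    and lower: "\<And>p x. p \<in> P \<Longrightarrow> \<bar>x - p\<bar> \<le> d \<Longrightarrow> c * \<bar>x - p\<bar> \<le> \<bar>f x - L\<bar>"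
    and upper: "\<And>p x. p \<in> P \<Longrightarrow> \<bar>x - p\<bar> \<le> d \<Longrightarrow> \<bar>f x - L\<bar> \<le> C1 * \<bar>x - p\<bar>"
    and side: "\<And>p x. p \<in> P \<Longrightarrow> \<bar>x - p\<bar> \<le> d \<Longrightarrow> L \<le> f x \<longleftrightarrow> 0 \<le> m p * (x - p)"
    and far: "\<And>x. (\<And>p. p \<in> P \<Longrightarrow> d < \<bar>x - p\<bar>) \<Longrightarrow> c1 \<le> \<bar>f x - L\<bar>"
begin

lemma f_borel [measurable]: "f \<in> borel_measurable borel"
  using f_int by auto

lemma slope_nz: "p \<in> P \<Longrightarrow> m p \<noteq> 0"
  using slope[of p] const_pos by auto

definition near :: "real \<Rightarrow> real \<Rightarrow> real" where
  "near p x = indicator {x. \<bar>x - p\<bar> \<le> d} x"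

text \<open>A point at distance between \<open>R\<close> and \<open>d\<close> from the crossing \<open>p\<close> lies on the wrong side of the level only if
  \<open>\<bar>g - f\<bar>\<close> is at least about \<open>c * \<bar>x - p\<bar> / 2\<close> there, so \<open>ann_dev\<close> is a Chebyshev bound for the length of the set of such points.\<close>

definition ann_dev :: "(real \<Rightarrow> real) \<Rightarrow> real \<Rightarrow> real \<Rightarrow> real" where
  "ann_dev g p R = (LINT x|lborel. indicator {x. R < \<bar>x - p\<bar> \<and> \<bar>x - p\<bar> \<le> d} x * (4 * (g x - f x)\<^sup>2 / (c\<^sup>2 * (x - p)\<^sup>2)))"

text \<open>The error of the affine model at \<open>p\<close>: \<open>g x - y\<close> equals
  \<open>m p * (x - p) + v + inc g p x\<close> with \<open>v = (g p - f p) - (y - L)\<close>. It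
  joins the increment of \<open>g - f\<close> and the Taylor remainder of \<open>f\<close>.\<close>

definition inc :: "(real \<Rightarrow> real) \<Rightarrow> real \<Rightarrow> real \<Rightarrow> real" where
  "inc g p x = (g x - f x) - (g p - f p) + (f x - L - m p * (x - p))"

definition inc_dev :: "(real \<Rightarrow> real) \<Rightarrow> real \<Rightarrow> real \<Rightarrow> real" where
  "inc_dev g p R = (LINT x|lborel. indicator {x. \<bar>x - p\<bar> \<le> R} x * (inc g p x)\<^sup>2)"

definition mass_dev :: "(real \<Rightarrow> real) \<Rightarrow> real" where
  "mass_dev g = (LINT x|lborel. (g x - f x) * indicator {x. L \<le> f x} x)"

definition slope_sum :: real where
  "slope_sum = (\<Sum>p\<in>P. 1 / \<bar>m p\<bar>)"

text \<open>First-order displacement of the level under the perturbation \<open>g - f\<close>, obtained by linearising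
  the equation that the mass of \<open>g\<close> above its level is \<open>1 - \<tau>\<close>.\<close>

definition level_lin :: "(real \<Rightarrow> real) \<Rightarrow> real" where
  "level_lin g = (mass_dev g / L + (\<Sum>p\<in>P. (g p - f p) / \<bar>m p\<bar>)) / slope_sum"

definition risk_lin :: "(real \<Rightarrow> real) \<Rightarrow> real" where
  "risk_lin g = L * (\<Sum>p\<in>P. \<bar>(g p - f p) - level_lin g\<bar> / \<bar>m p\<bar>)"

lemma slope_sum_pos: "slope_sum > 0"
  unfolding slope_sum_def by (rule sum_pos) (simp_all add: P slope_nz)

lemma near_borel [measurable]: "near p \<in> borel_measurable borel"
  unfolding near_def[abs_def] by measurable

lemma sum_near_eq: "p \<in> P \<Longrightarrow> \<bar>x - p\<bar> \<le> d \<Longrightarrow> (\<Sum>q\<in>P. near q x * h q) = h p"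
proof -
  assume p: "p \<in> P" "\<bar>x - p\<bar> \<le> d"
  have "(\<Sum>q\<in>P. near q x * h q) = (\<Sum>q\<in>{p}. near q x * h q)"
  proof (rule sum.mono_neutral_right)
    show "\<forall>q\<in>P - {p}. near q x * h q = 0"
    proof
      fix q assume q: "q \<in> P - {p}"
      then have "\<not> \<bar>x - q\<bar> \<le> d" using sep[OF p(1) _ p(2), of q] by blast
      then show "near q x * h q = 0" by (simp add: near_def)
    qed
  qed (use P p in simp_all)
  then show ?thesis using p by (simp add: near_def)
qed

lemma sum_near_far: "(\<And>p. p \<in> P \<Longrightarrow> d < \<bar>x - p\<bar>) \<Longrightarrow> (\<Sum>q\<in>P. near q x * h q) = 0"
  by (intro sum.neutral) (auto simp: near_def not_le)

end

text \<open>\<open>fb\<close> stands for the mean of the estimator \<open>g\<close>. Origin of the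
  conditions on \<open>e1\<close>: \<open>L / 2\<close> keeps shifted levels positive,
  \<open>c1 / 2\<close> turns every mismatch away from the crossings into a deviation of at least
  \<open>e1\<close>, \<open>2 * C1 * d\<close> fits a test interval of length
  \<open>a / (2 * C1)\<close> into the neighbourhood of a crossing, and the last two let
  localisation errors be absorbed by the main term.\<close>

locale level_crossings_estimate = level_crossings +
  fixes g fb :: "real \<Rightarrow> real" and Cg e1 :: real
  assumes g_int: "integrable lborel g" and g_nonneg: "\<And>x. g x \<ge> 0" and g_le: "\<And>x. g x \<le> Cg"
    and fb: "\<And>x. \<bar>fb x - f x\<bar> \<le> e1 / 2" and V_int: "integrable lborel (\<lambda>x. (g x - fb x)\<^sup>2)"
    and e1: "0 < e1" "e1 \<le> L / 2" "e1 \<le> c1 / 2" "e1 \<le> 2 * C1 * d" "3 * e1 * (4 / c) \<le> L / (4 * C1)" "3 * e1 \<le> L"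
begin

abbreviation H :: "real \<Rightarrow> real \<Rightarrow> real" where
  "H y x \<equiv> indicator {x. y \<le> g x} x - indicator {x. L \<le> f x} x"

definition V :: real where "V = (LINT x|lborel. (g x - fb x)\<^sup>2)"

text \<open>The two summands pay for \<open>f\<close> and for twice \<open>\<bar>g - f\<bar>\<close>
  at points where the deviation is at least \<open>e1\<close>, both in terms of
  \<open>(g - fb)^2\<close>.\<close>

definition Ce :: real where "Ce = 4 * Cf / e1\<^sup>2 + 8 / e1"

lemma g_borel' [measurable]: "g \<in> borel_measurable borel"
  using g_int by auto

lemma dev_le: "\<bar>g x - f x\<bar> \<le> Cg + Cf"
  using g_nonneg[of x] g_le[of x] f_nonneg[of x] f_le[of x] by linarith

lemma V_nonneg: "V \<ge> 0" unfolding V_def by simp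

lemma Cf_nonneg: "Cf \<ge> 0" using f_nonneg f_le by (meson order_trans)

lemma Ce_pos: "Ce > 0" unfolding Ce_def using e1 Cf_nonneg by (simp add: add_nonneg_pos)

lemma ann_dev_integrable:
  assumes "R > 0"
  shows "integrable lborel (\<lambda>x. indicator {x. R < \<bar>x - p\<bar> \<and> \<bar>x - p\<bar> \<le> d} x * (4 * (g x - f x)\<^sup>2 / (c\<^sup>2 * (x - p)\<^sup>2)))"
proof (rule integrable_bounded_support_real[where p=p and s=d and B="4 * (Cg + Cf)\<^sup>2 / (c\<^sup>2 * R\<^sup>2)"])
  fix x
  show "\<bar>indicator {x. R < \<bar>x - p\<bar> \<and> \<bar>x - p\<bar> \<le> d} x * (4 * (g x - f x)\<^sup>2 / (c\<^sup>2 * (x - p)\<^sup>2))\<bar> \<le> 4 * (Cg + Cf)\<^sup>2 / (c\<^sup>2 * R\<^sup>2)"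
  proof (cases "R < \<bar>x - p\<bar>")
    case True
    have "(g x - f x)\<^sup>2 \<le> (Cg + Cf)\<^sup>2" using dev_le[of x] by (simp add: abs_le_square_iff[symmetric])
    moreover have "R\<^sup>2 \<le> (x - p)\<^sup>2" using True assms by (simp add: abs_le_square_iff[symmetric])
    ultimately have "4 * (g x - f x)\<^sup>2 / (c\<^sup>2 * (x - p)\<^sup>2) \<le> 4 * (Cg + Cf)\<^sup>2 / (c\<^sup>2 * R\<^sup>2)"
      using assms const_pos by (intro frac_le mult_left_mono) auto
    moreover have "4 * (g x - f x)\<^sup>2 / (c\<^sup>2 * (x - p)\<^sup>2) \<ge> 0" by simp
    ultimately show ?thesis by (auto simp: indicator_def)
  qed (auto simp: indicator_def)
qed (auto simp: indicator_def)

lemma inc_dev_integrable: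
  assumes "p \<in> P" "R \<le> d"
  shows "integrable lborel (\<lambda>x. indicator {x. \<bar>x - p\<bar> \<le> R} x * (inc g p x)\<^sup>2)"
proof (rule integrable_bounded_support_real[where p=p and s=R and B="(2 * (Cg + Cf) + C1 * d + \<bar>m p\<bar> * d)\<^sup>2"])
  fix x assume x: "\<bar>x - p\<bar> \<le> R"
  have "\<bar>f x - L\<bar> \<le> C1 * d"
    using upper[of p x] assms x const_pos by (meson mult_left_mono less_imp_le order_trans)
  moreover have "\<bar>m p * (x - p)\<bar> \<le> \<bar>m p\<bar> * d"
    unfolding abs_mult using x assms by (intro mult_left_mono) auto
  ultimately have "\<bar>inc g p x\<bar> \<le> 2 * (Cg + Cf) + C1 * d + \<bar>m p\<bar> * d"
    unfolding inc_def using dev_le[of x] dev_le[of p] by (smt (verit))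
  then have "(inc g p x)\<^sup>2 \<le> (2 * (Cg + Cf) + C1 * d + \<bar>m p\<bar> * d)\<^sup>2"
    by (metis abs_ge_zero power2_abs power_mono)
  then show "\<bar>indicator {x. \<bar>x - p\<bar> \<le> R} x * (inc g p x)\<^sup>2\<bar> \<le> (2 * (Cg + Cf) + C1 * d + \<bar>m p\<bar> * d)\<^sup>2"
    using x by simp
qed (auto simp: inc_def)

lemma ann_dev_nonneg: "ann_dev g p R \<ge> 0"
  unfolding ann_dev_def by (intro integral_nonneg_AE AE_I2) (simp add: indicator_def)

lemma inc_dev_nonneg: "inc_dev g p R \<ge> 0"
  unfolding inc_dev_def by (intro integral_nonneg_AE AE_I2) (simp add: indicator_def)

lemma ann_dev_antimono: "0 < R \<Longrightarrow> R \<le> R' \<Longrightarrow> ann_dev g p R' \<le> ann_dev g p R"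
  unfolding ann_dev_def
  by (intro integral_mono ann_dev_integrable mult_right_mono) (auto simp: indicator_def)

lemma H_abs_le: "\<bar>H y x\<bar> \<le> 1"
  by (auto simp: indicator_def)

lemma H_mismatch: "H y x \<noteq> 0 \<Longrightarrow> \<bar>f x - L\<bar> \<le> \<bar>g x - f x\<bar> + \<bar>y - L\<bar>"
  by (cases "y \<le> g x"; cases "L \<le> f x") auto

lemma near_H_integrable: "integrable lborel (\<lambda>x. near p x * H y x)" "integrable lborel (\<lambda>x. near p x * \<bar>H y x\<bar>)"
  by (auto intro!: integrable_bounded_support_real[where p=p and s=d and B=1] simp: near_def indicator_def)

text \<open>\<open>W\<close> is the change of region predicted by the affine model of
  \<open>g - y\<close> at \<open>p\<close>. It can differ from the actual change only near the
  predicted zero, where the model error exceeds \<open>e\<close>, or beyond distance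
  \<open>R\<close>; there either \<open>g - f\<close> is large compared with the distance, or the
  distance is bounded by the shifts. Each summand covers one of these four cases.\<close>

lemma near_pointwise:
  fixes x y :: real
  assumes p: "p \<in> P" and R: "0 < R" "R \<le> d" and e: "e > 0"
  defines "v \<equiv> (g p - f p) - (y - L)"
  defines "W \<equiv> \<lambda>x. indicator {x. m p * (x - p) + v \<ge> 0} x - indicator {x. m p * (x - p) \<ge> 0} x :: real"
  shows "\<bar>near p x * H y x - W x\<bar> \<le>
     indicator {x. \<bar>x - (p - v / m p)\<bar> \<le> e / \<bar>m p\<bar>} x + indicator {x. \<bar>x - p\<bar> \<le> R} x * (inc g p x)\<^sup>2 / e\<^sup>2
     + indicator {x. R < \<bar>x - p\<bar> \<and> \<bar>x - p\<bar> \<le> d} x * (4 * (g x - f x)\<^sup>2 / (c\<^sup>2 * (x - p)\<^sup>2))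
     + indicator {x. R < \<bar>x - p\<bar> \<and> \<bar>x - p\<bar> \<le> (2 * \<bar>y - L\<bar> + \<bar>v\<bar>) / c} x" (is "_ \<le> ?T1 + ?T2 + ?T3 + ?T4")
proof -
  have T: "?T1 \<ge> 0" "?T2 \<ge> 0" "?T3 \<ge> 0" "?T4 \<ge> 0" by (simp_all add: indicator_def)
  have mp: "m p \<noteq> 0" using slope_nz[OF p] .
  have c0: "c > 0" using const_pos by simp
  \<comment> \<open>Where \<open>W\<close> is nonzero the affine term is no larger than
    \<open>v\<close>, which bounds the distance from \<open>p\<close>.\<close>
  have W4: "?T4 = 1" if "W x \<noteq> 0" "R < \<bar>x - p\<bar>"
  proof -
    have "\<bar>m p * (x - p)\<bar> \<le> \<bar>v\<bar>" using that(1)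
      by (cases "m p * (x - p) + v \<ge> 0"; cases "m p * (x - p) \<ge> 0") (auto simp: W_def)
    moreover have "c * \<bar>x - p\<bar> \<le> \<bar>m p\<bar> * \<bar>x - p\<bar>" using slope[OF p] by (intro mult_right_mono) auto
    ultimately have "c * \<bar>x - p\<bar> \<le> \<bar>v\<bar>" by (simp add: abs_mult)
    then have "c * \<bar>x - p\<bar> \<le> 2 * \<bar>y - L\<bar> + \<bar>v\<bar>" by (rule order_trans) simp
    then show ?thesis using that(2) c0 by (simp add: indicator_def field_simps)
  qed
  have Wle: "\<bar>W x\<bar> \<le> 1" by (auto simp: W_def indicator_def)
  show ?thesis
  proof (cases "\<bar>x - p\<bar> \<le> d")
    case False
    then have "near p x * H y x = 0" by (simp add: near_def)
    then have eq: "\<bar>near p x * H y x - W x\<bar> = \<bar>W x\<bar>"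
      by (simp only: diff_0 abs_minus_cancel)
    show ?thesis
    proof (cases "W x = 0")
      case True
      then show ?thesis unfolding eq using T by simp
    next
      case W1: False
      have "?T4 = 1" using W4[OF W1] False R by linarith
      then show ?thesis unfolding eq using T Wle by linarith
    qed
  next
    case nr: True
    have eq: "near p x * H y x - W x = indicator {x. y \<le> g x} x - indicator {x. m p * (x - p) + v \<ge> 0} x"
      using nr side[OF p nr] by (auto simp: near_def W_def indicator_def)
    show ?thesis
    proof (cases "\<bar>x - p\<bar> \<le> R")
      case True
      have id: "g x - y = (m p * (x - p) + v) + inc g p x" by (simp add: inc_def v_def)
      show ?thesis
      proof (cases "near p x * H y x - W x = 0")
        case False
        have 1: "\<bar>near p x * H y x - W x\<bar> \<le> 1" unfolding eq by (auto simp: indicator_def)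
        \<comment> \<open>Two numbers on different sides of 0 are no larger than their difference,
          which is \<open>inc g p x\<close> here.\<close>
        have le: "\<bar>m p * (x - p) + v\<bar> \<le> \<bar>inc g p x\<bar>"
          using False unfolding eq using id
          by (cases "y \<le> g x"; cases "m p * (x - p) + v \<ge> 0") auto
        show ?thesis
        proof (cases "\<bar>m p * (x - p) + v\<bar> \<le> e")
          case True
          have "\<bar>m p * (x - p) + v\<bar> = \<bar>m p\<bar> * \<bar>x - (p - v / m p)\<bar>"
            unfolding abs_mult[symmetric] using mp by (intro arg_cong[where f=abs]) (simp add: field_simps)
          then have "\<bar>x - (p - v / m p)\<bar> \<le> e / \<bar>m p\<bar>" using True mp by (simp add: pos_le_divide_eq mult.commute)
          then have "?T1 = 1" by simp
          then show ?thesis using 1 T by linarith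
        next
          case False
          then have "e \<le> \<bar>inc g p x\<bar>" using le by simp
          then have "e\<^sup>2 \<le> (inc g p x)\<^sup>2" using e by (simp add: abs_le_square_iff[symmetric])
          then have "?T2 \<ge> 1" using True e by simp
          then show ?thesis using 1 T by linarith
        qed
      qed (use T in simp)
    next
      case False
      have 1: "\<bar>near p x * H y x - W x\<bar> \<le> 1" unfolding eq by (auto simp: indicator_def)
      show ?thesis
      proof (cases "W x = 0")
        case W0: True
        show ?thesis
        proof (cases "H y x = 0")
          case True
          then show ?thesis using W0 T by simp
        next
          case H1: False
          have "c * \<bar>x - p\<bar> \<le> \<bar>g x - f x\<bar> + \<bar>y - L\<bar>"
            using H_mismatch[OF H1] lower[OF p nr] by linarith
          moreover have "a \<le> 2 * s \<or> a \<le> 2 * t" if "a \<le> s + t" for a s t :: real using that by linarith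
          ultimately consider "c * \<bar>x - p\<bar> \<le> 2 * \<bar>g x - f x\<bar>" | "c * \<bar>x - p\<bar> \<le> 2 * \<bar>y - L\<bar>" by blast
          then show ?thesis
          proof cases
            case a: 1
            have "(c * \<bar>x - p\<bar>)\<^sup>2 \<le> (2 * \<bar>g x - f x\<bar>)\<^sup>2" using a c0 by (intro power_mono) auto
            then have "c\<^sup>2 * (x - p)\<^sup>2 \<le> 4 * (g x - f x)\<^sup>2" by (simp add: power_mult_distrib)
            moreover have "c\<^sup>2 * (x - p)\<^sup>2 > 0" using c0 False R by auto
            ultimately have "4 * (g x - f x)\<^sup>2 / (c\<^sup>2 * (x - p)\<^sup>2) \<ge> 1" by simp
            then have "?T3 \<ge> 1" using False nr by simp
            then show ?thesis using 1 T by linarith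
          next
            case a: 2
            then have "c * \<bar>x - p\<bar> \<le> 2 * \<bar>y - L\<bar> + \<bar>v\<bar>" by (rule order_trans) simp
            then have "?T4 = 1" using False c0 by (simp add: indicator_def field_simps)
            then show ?thesis using 1 T by linarith
          qed
        qed
      next
        case W1: False
        then have "?T4 = 1" using W4 False by simp
        then show ?thesis using 1 T by linarith
      qed
    qed
  qed
qed

text \<open>The integrals of the four cases of \<open>near_pointwise\<close>, with \<open>D\<close>
  the displacement of the level.\<close>

definition near_err :: "real \<Rightarrow> real \<Rightarrow> real \<Rightarrow> real \<Rightarrow> real" where
  "near_err R e D p = 2 * e / \<bar>m p\<bar> + inc_dev g p R / e\<^sup>2 + ann_dev g p R
     + 2 * max 0 ((2 * \<bar>D\<bar> + \<bar>(g p - f p) - D\<bar>) / c - R)"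

text \<open>One pointwise bound serves both parts, since taking absolute values does not increase
  distances and \<open>near p\<close> is 0 or 1.\<close>

lemma near_integral:
  fixes y :: real
  assumes p: "p \<in> P" and R: "0 < R" "R \<le> d" and e: "e > 0"
  defines "v \<equiv> (g p - f p) - (y - L)"
  shows "\<bar>(LINT x|lborel. near p x * H y x) - v / \<bar>m p\<bar>\<bar> \<le> near_err R e (y - L) p"
    and "\<bar>(LINT x|lborel. near p x * \<bar>H y x\<bar>) - \<bar>v\<bar> / \<bar>m p\<bar>\<bar> \<le> near_err R e (y - L) p"
proof -
  define W where "W = (\<lambda>x. indicator {x. m p * (x - p) + v \<ge> 0} x - indicator {x. m p * (x - p) \<ge> 0} x :: real)"
  have W: "has_bochner_integral lborel W (v / \<bar>m p\<bar>)" "has_bochner_integral lborel (\<lambda>x. \<bar>W x\<bar>) (\<bar>v\<bar> / \<bar>m p\<bar>)"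
    unfolding W_def by (rule halfline_shift_integral[OF slope_nz[OF p]])+
  let ?T1 = "\<lambda>x. indicator {x. \<bar>x - (p - v / m p)\<bar> \<le> e / \<bar>m p\<bar>} x :: real"
  let ?T2 = "\<lambda>x. indicator {x. \<bar>x - p\<bar> \<le> R} x * (inc g p x)\<^sup>2 / e\<^sup>2"
  let ?T3 = "\<lambda>x. indicator {x. R < \<bar>x - p\<bar> \<and> \<bar>x - p\<bar> \<le> d} x * (4 * (g x - f x)\<^sup>2 / (c\<^sup>2 * (x - p)\<^sup>2))"
  let ?T4 = "\<lambda>x. indicator {x. R < \<bar>x - p\<bar> \<and> \<bar>x - p\<bar> \<le> (2 * \<bar>y - L\<bar> + \<bar>v\<bar>) / c} x :: real"
  have i1: "has_bochner_integral lborel ?T1 (2 * (e / \<bar>m p\<bar>))"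
    using e by (intro lborel_cball_real) simp
  have i2: "has_bochner_integral lborel ?T2 (inc_dev g p R / e\<^sup>2)"
    using inc_dev_integrable[OF p R(2)] by (intro has_bochner_integral_divide_zero) (simp add: inc_dev_def has_bochner_integral_iff)
  have i3: "has_bochner_integral lborel ?T3 (ann_dev g p R)"
    using ann_dev_integrable[OF R(1)] by (simp add: ann_dev_def has_bochner_integral_iff)
  have i4: "has_bochner_integral lborel ?T4 (2 * max 0 ((2 * \<bar>y - L\<bar> + \<bar>v\<bar>) / c - R))"
    using R const_pos by (intro lborel_annulus_real) auto
  have "has_bochner_integral lborel (\<lambda>x. ?T1 x + ?T2 x + ?T3 x + ?T4 x)
     (2 * (e / \<bar>m p\<bar>) + inc_dev g p R / e\<^sup>2 + ann_dev g p R + 2 * max 0 ((2 * \<bar>y - L\<bar> + \<bar>v\<bar>) / c - R))"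
    by (intro has_bochner_integral_add i1 i2 i3 i4)
  then have T: "integrable lborel (\<lambda>x. ?T1 x + ?T2 x + ?T3 x + ?T4 x)"
     "(LINT x|lborel. ?T1 x + ?T2 x + ?T3 x + ?T4 x) = near_err R e (y - L) p"
    by (simp_all add: has_bochner_integral_iff near_err_def v_def)
  have pw: "\<bar>near p x * H y x - W x\<bar> \<le> ?T1 x + ?T2 x + ?T3 x + ?T4 x" for x
    unfolding W_def v_def by (rule near_pointwise[OF p R e])
  have "\<bar>(LINT x|lborel. near p x * H y x) - v / \<bar>m p\<bar>\<bar> = \<bar>LINT x|lborel. near p x * H y x - W x\<bar>"
    using W near_H_integrable by (simp add: has_bochner_integral_iff)
  also have "\<dots> \<le> (LINT x|lborel. \<bar>near p x * H y x - W x\<bar>)" by (rule integral_abs_bound)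
  also have "\<dots> \<le> (LINT x|lborel. ?T1 x + ?T2 x + ?T3 x + ?T4 x)"
    using W near_H_integrable by (intro integral_mono T(1) pw integrable_abs Bochner_Integration.integrable_diff) (auto simp: has_bochner_integral_iff)
  finally show "\<bar>(LINT x|lborel. near p x * H y x) - v / \<bar>m p\<bar>\<bar> \<le> near_err R e (y - L) p" unfolding T(2) .
  have "\<bar>(LINT x|lborel. near p x * \<bar>H y x\<bar>) - \<bar>v\<bar> / \<bar>m p\<bar>\<bar> = \<bar>LINT x|lborel. near p x * \<bar>H y x\<bar> - \<bar>W x\<bar>\<bar>"
    using W near_H_integrable by (simp add: has_bochner_integral_iff)
  also have "\<dots> \<le> (LINT x|lborel. \<bar>near p x * \<bar>H y x\<bar> - \<bar>W x\<bar>\<bar>)" by (rule integral_abs_bound)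
  also have "\<dots> \<le> (LINT x|lborel. ?T1 x + ?T2 x + ?T3 x + ?T4 x)"
  proof (intro integral_mono T(1) integrable_abs Bochner_Integration.integrable_diff)
    fix x
    have "near p x * \<bar>H y x\<bar> = \<bar>near p x * H y x\<bar>" by (simp add: near_def abs_mult indicator_def)
    then show "\<bar>near p x * \<bar>H y x\<bar> - \<bar>W x\<bar>\<bar> \<le> ?T1 x + ?T2 x + ?T3 x + ?T4 x"
      using order_trans[OF abs_triangle_ineq3 pw[of x]] by (simp only:)
  next
    show "integrable lborel (\<lambda>x. near p x * \<bar>H y x\<bar>)" by (rule near_H_integrable)
    show "integrable lborel W" using W(1) by (simp only: has_bochner_integral_iff)
  qed
  finally show "\<bar>(LINT x|lborel. near p x * \<bar>H y x\<bar>) - \<bar>v\<bar> / \<bar>m p\<bar>\<bar> \<le> near_err R e (y - L) p" unfolding T(2) .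
qed

text \<open>As \<open>fb\<close> is within \<open>e1 / 2\<close> of \<open>f\<close>, at least half
  of a deviation of size \<open>e1\<close> or more is due to \<open>g - fb\<close>.\<close>

lemma dev_large:
  assumes "e1 \<le> \<bar>g x - f x\<bar>"
  shows "\<bar>g x - f x\<bar> \<le> 4 / e1 * (g x - fb x)\<^sup>2" "1 \<le> 4 / e1\<^sup>2 * (g x - fb x)\<^sup>2"
proof -
  let ?a = "\<bar>g x - fb x\<bar>"
  have "\<bar>g x - f x\<bar> \<le> ?a + \<bar>fb x - f x\<bar>"
    using abs_triangle_ineq[of "g x - fb x" "fb x - f x"] by simp
  moreover have "s \<le> 2 * t \<and> e1 / 2 \<le> t" if "s \<le> t + u" "u \<le> e1 / 2" "e1 \<le> s" for s t u
    using that by linarith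
  ultimately have a: "\<bar>g x - f x\<bar> \<le> 2 * ?a" "e1 / 2 \<le> ?a" using fb[of x] assms by blast+
  have "e1 / 2 * ?a \<le> ?a * ?a" using a by (intro mult_right_mono) auto
  then have "e1 / 2 * ?a \<le> (g x - fb x)\<^sup>2" by (simp add: power2_eq_square)
  then have "2 * ?a \<le> 4 / e1 * (g x - fb x)\<^sup>2" using e1 by (simp add: field_simps)
  with a(1) show "\<bar>g x - f x\<bar> \<le> 4 / e1 * (g x - fb x)\<^sup>2" by (rule order_trans)
  have "(e1 / 2)\<^sup>2 \<le> ?a\<^sup>2" using a e1 by (intro power_mono) auto
  then show "1 \<le> 4 / e1\<^sup>2 * (g x - fb x)\<^sup>2" using e1 by (simp add: field_simps power2_eq_square)
qed

text \<open>On a mismatch near a crossing both \<open>f\<close> and \<open>g\<close> are within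
  \<open>2 * \<bar>g - f\<bar> + e1\<close> of \<open>L\<close>: this is below \<open>3 * e1\<close>
  for small deviations and otherwise paid for by \<open>Ce\<close>. A mismatch away from all
  crossings is itself a large deviation.\<close>

lemma localise_pointwise:
  assumes D: "\<bar>y - L\<bar> \<le> e1"
  shows "\<bar>g x * H y x - (\<Sum>p\<in>P. near p x * (L * H y x))\<bar> \<le> (\<Sum>p\<in>P. near p x * (3 * e1 * \<bar>H y x\<bar>)) + Ce * (g x - fb x)\<^sup>2"
    and "\<bar>f x * \<bar>H y x\<bar> - (\<Sum>p\<in>P. near p x * (L * \<bar>H y x\<bar>))\<bar> \<le> (\<Sum>p\<in>P. near p x * (3 * e1 * \<bar>H y x\<bar>)) + Ce * (g x - fb x)\<^sup>2"
proof -
  let ?q = "(g x - fb x)\<^sup>2"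
  have Ceq: "Ce * ?q = Cf * (4 / e1\<^sup>2 * ?q) + 2 * (4 / e1 * ?q)"
    by (simp add: Ce_def field_simps)
  have q0: "Ce * ?q \<ge> 0" "Cf * (4 / e1\<^sup>2 * ?q) \<ge> 0" "4 / e1 * ?q \<ge> 0" using Ce_pos Cf_nonneg e1 by simp_all
  have H: "H y x = 0 \<or> \<bar>H y x\<bar> = 1" by (auto simp: indicator_def)
  have G: "\<bar>g x * H y x\<bar> = g x * \<bar>H y x\<bar>" using g_nonneg[of x] by (simp add: abs_mult)
  have "\<bar>g x * H y x - (\<Sum>p\<in>P. near p x * (L * H y x))\<bar> \<le> (\<Sum>p\<in>P. near p x * (3 * e1 * \<bar>H y x\<bar>)) + Ce * ?q \<and>
     \<bar>f x * \<bar>H y x\<bar> - (\<Sum>p\<in>P. near p x * (L * \<bar>H y x\<bar>))\<bar> \<le> (\<Sum>p\<in>P. near p x * (3 * e1 * \<bar>H y x\<bar>)) + Ce * ?q"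
  proof (cases "H y x = 0")
    case True
    then show ?thesis using q0 by simp
  next
    case False
    then have H1: "\<bar>H y x\<bar> = 1" using H by blast
    have mm: "\<bar>f x - L\<bar> \<le> \<bar>g x - f x\<bar> + e1" using H_mismatch[OF False] D by linarith
    show ?thesis
    proof (cases "\<exists>p\<in>P. \<bar>x - p\<bar> \<le> d")
      case True
      then obtain p where p: "p \<in> P" "\<bar>x - p\<bar> \<le> d" by blast
      have key: "2 * \<bar>g x - f x\<bar> + e1 \<le> 3 * e1 + Ce * ?q"
      proof (cases "e1 \<le> \<bar>g x - f x\<bar>")
        case True
        have "2 * a + e1 \<le> 3 * e1 + (s + 2 * t)" if "a \<le> t" "0 \<le> s" for a s t
          using that e1(1) by linarith
        from this[OF dev_large(1)[OF True] q0(2)] show ?thesis unfolding Ceq .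
      next
        case False
        have "2 * a + e1 \<le> 3 * e1 + s" if "\<not> e1 \<le> a" "0 \<le> s" for a s
          using that by linarith
        from this[OF False q0(1)] show ?thesis .
      qed
      have "\<bar>g x * H y x - L * H y x\<bar> = \<bar>g x - L\<bar>" unfolding left_diff_distrib[symmetric] abs_mult H1 by simp
      moreover have "\<bar>f x * \<bar>H y x\<bar> - L * \<bar>H y x\<bar>\<bar> = \<bar>f x - L\<bar>" unfolding H1 by simp
      moreover have "\<bar>g x - L\<bar> \<le> 2 * \<bar>g x - f x\<bar> + e1" using mm by (smt (verit, best))
      moreover have "\<bar>f x - L\<bar> \<le> 2 * \<bar>g x - f x\<bar> + e1" using mm by (smt (verit, best))
      ultimately show ?thesis unfolding sum_near_eq[OF p]
        using order_trans[OF _ key] H1 by (metis mult.right_neutral)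
    next
      case False
      then have fr: "\<And>p. p \<in> P \<Longrightarrow> d < \<bar>x - p\<bar>" by (meson not_le)
      have big: "e1 \<le> \<bar>g x - f x\<bar>" using far[OF fr] mm e1 by linarith
      have "g x \<le> f x + \<bar>g x - f x\<bar>" by linarith
      moreover have "f x \<le> Cf * (4 / e1\<^sup>2 * ?q)"
        using mult_mono[OF f_le dev_large(2)[OF big]] Cf_nonneg f_nonneg by simp
      moreover have "a \<le> s + 2 * t \<and> b \<le> s + 2 * t" if "a \<le> b + w" "b \<le> s" "w \<le> t" "0 \<le> t" for a b s t w :: real
        using that by linarith
      ultimately have "g x \<le> Ce * ?q \<and> f x \<le> Ce * ?q"
        using dev_large(1)[OF big] q0(3) unfolding Ceq by blast
      moreover have z: "(\<Sum>q\<in>P. near q x * h q) = 0" for h :: "real \<Rightarrow> real"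
        by (rule sum_near_far) (rule fr)
      ultimately show ?thesis unfolding z using G H1 f_nonneg[of x] by simp
    qed
  qed
  then show "\<bar>g x * H y x - (\<Sum>p\<in>P. near p x * (L * H y x))\<bar> \<le> (\<Sum>p\<in>P. near p x * (3 * e1 * \<bar>H y x\<bar>)) + Ce * ?q"
    "\<bar>f x * \<bar>H y x\<bar> - (\<Sum>p\<in>P. near p x * (L * \<bar>H y x\<bar>))\<bar> \<le> (\<Sum>p\<in>P. near p x * (3 * e1 * \<bar>H y x\<bar>)) + Ce * ?q" by auto
qed

lemma H_integrable: "integrable lborel (\<lambda>x. g x * H y x)" "integrable lborel (\<lambda>x. f x * \<bar>H y x\<bar>)"
proof -
  have "integrable lborel (\<lambda>x. g x * indicator {x. y \<le> g x} x - g x * indicator {x. L \<le> f x} x)"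
    by (intro Bochner_Integration.integrable_diff integrable_mult_indicator_real g_int) measurable
  then show "integrable lborel (\<lambda>x. g x * H y x)" by (simp add: right_diff_distrib)
  show "integrable lborel (\<lambda>x. f x * \<bar>H y x\<bar>)"
  proof (rule Bochner_Integration.integrable_bound[OF f_int])
    show "AE x in lborel. norm (f x * \<bar>H y x\<bar>) \<le> norm (f x)"
      using f_nonneg by (intro AE_I2) (auto simp: indicator_def)
  qed measurable
qed

abbreviation NH :: "real \<Rightarrow> real \<Rightarrow> real" where "NH y p \<equiv> LINT x|lborel. near p x * H y x"
abbreviation NA :: "real \<Rightarrow> real \<Rightarrow> real" where "NA y p \<equiv> LINT x|lborel. near p x * \<bar>H y x\<bar>"

text \<open>Integrating the pointwise comparison replaces the weights \<open>g\<close> and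
  \<open>f\<close> by the constant \<open>L\<close>, so that only lengths of mismatch sets near the
  crossings remain to be computed.\<close>

lemma localise:
  assumes D: "\<bar>y - L\<bar> \<le> e1"
  shows "\<bar>(LINT x|lborel. g x * H y x) - L * (\<Sum>p\<in>P. NH y p)\<bar> \<le> 3 * e1 * (\<Sum>p\<in>P. NA y p) + Ce * V"
    and "\<bar>(LINT x|lborel. f x * \<bar>H y x\<bar>) - L * (\<Sum>p\<in>P. NA y p)\<bar> \<le> 3 * e1 * (\<Sum>p\<in>P. NA y p) + Ce * V"
proof -
  have s1: "has_bochner_integral lborel (\<lambda>x. \<Sum>p\<in>P. near p x * (K * H y x)) (K * (\<Sum>p\<in>P. NH y p))" for K
  proof -
    have "has_bochner_integral lborel (\<lambda>x. \<Sum>p\<in>P. K * (near p x * H y x)) (\<Sum>p\<in>P. K * NH y p)"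
      using near_H_integrable(1) by (intro has_bochner_integral_sum has_bochner_integral_mult_right has_bochner_integral_integrable)
    then show ?thesis by (simp add: sum_distrib_left mult_ac)
  qed
  have s2: "has_bochner_integral lborel (\<lambda>x. \<Sum>p\<in>P. near p x * (K * \<bar>H y x\<bar>)) (K * (\<Sum>p\<in>P. NA y p))" for K
  proof -
    have "has_bochner_integral lborel (\<lambda>x. \<Sum>p\<in>P. K * (near p x * \<bar>H y x\<bar>)) (\<Sum>p\<in>P. K * NA y p)"
      using near_H_integrable(2) by (intro has_bochner_integral_sum has_bochner_integral_mult_right has_bochner_integral_integrable)
    then show ?thesis by (simp add: sum_distrib_left mult_ac)
  qed
  have s3: "has_bochner_integral lborel (\<lambda>x. (\<Sum>p\<in>P. near p x * (3 * e1 * \<bar>H y x\<bar>)) + Ce * (g x - fb x)\<^sup>2) (3 * e1 * (\<Sum>p\<in>P. NA y p) + Ce * V)"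
    unfolding V_def by (intro has_bochner_integral_add s2 has_bochner_integral_mult_right has_bochner_integral_integrable V_int)
  note i = has_bochner_integral_iff[THEN iffD1, THEN conjunct1] has_bochner_integral_integral_eq
  have "\<bar>(LINT x|lborel. g x * H y x) - L * (\<Sum>p\<in>P. NH y p)\<bar> = \<bar>LINT x|lborel. g x * H y x - (\<Sum>p\<in>P. near p x * (L * H y x))\<bar>"
    using i[OF s1[of L]] H_integrable(1) by (subst Bochner_Integration.integral_diff) auto
  also have "\<dots> \<le> (LINT x|lborel. \<bar>g x * H y x - (\<Sum>p\<in>P. near p x * (L * H y x))\<bar>)" by (rule integral_abs_bound)
  also have "\<dots> \<le> 3 * e1 * (\<Sum>p\<in>P. NA y p) + Ce * V"
    unfolding i(2)[OF s3, symmetric]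
    by (intro integral_mono i(1)[OF s3] localise_pointwise(1)[OF D] integrable_abs Bochner_Integration.integrable_diff H_integrable i(1)[OF s1])
  finally show "\<bar>(LINT x|lborel. g x * H y x) - L * (\<Sum>p\<in>P. NH y p)\<bar> \<le> 3 * e1 * (\<Sum>p\<in>P. NA y p) + Ce * V" .
  have "\<bar>(LINT x|lborel. f x * \<bar>H y x\<bar>) - L * (\<Sum>p\<in>P. NA y p)\<bar> = \<bar>LINT x|lborel. f x * \<bar>H y x\<bar> - (\<Sum>p\<in>P. near p x * (L * \<bar>H y x\<bar>))\<bar>"
    using i[OF s2[of L]] H_integrable(2) by (subst Bochner_Integration.integral_diff) auto
  also have "\<dots> \<le> (LINT x|lborel. \<bar>f x * \<bar>H y x\<bar> - (\<Sum>p\<in>P. near p x * (L * \<bar>H y x\<bar>))\<bar>)" by (rule integral_abs_bound)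
  also have "\<dots> \<le> 3 * e1 * (\<Sum>p\<in>P. NA y p) + Ce * V"
    unfolding i(2)[OF s3, symmetric]
    by (intro integral_mono i(1)[OF s3] localise_pointwise(2)[OF D] integrable_abs Bochner_Integration.integrable_diff H_integrable i(1)[OF s2])
  finally show "\<bar>(LINT x|lborel. f x * \<bar>H y x\<bar>) - L * (\<Sum>p\<in>P. NA y p)\<bar> \<le> 3 * e1 * (\<Sum>p\<in>P. NA y p) + Ce * V" .
qed

text \<open>Exact because \<open>f\<close> has mass \<open>1 - \<tau>\<close> above
  \<open>L\<close>: the imbalance splits into the error on the true region and the effect of
  exchanging the regions. Its sign is known at levels on either side of the level of
  \<open>g\<close>, and this drives the estimates below.\<close>

lemma mass_above_eq: "mass_above g y - (1 - \<tau>) = mass_dev g + (LINT x|lborel. g x * H y x)"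
proof -
  have i: "integrable lborel (\<lambda>x. g x * indicator {x. y \<le> g x} x)" "integrable lborel (\<lambda>x. g x * indicator {x. L \<le> f x} x)"
    "integrable lborel (\<lambda>x. f x * indicator {x. L \<le> f x} x)"
    by (intro integrable_mult_indicator_real g_int f_int; measurable)+
  have "mass_dev g = (LINT x|lborel. g x * indicator {x. L \<le> f x} x) - mass_above f L"
    unfolding mass_dev_def mass_above_def left_diff_distrib using i by simp
  moreover have "(LINT x|lborel. g x * H y x) = mass_above g y - (LINT x|lborel. g x * indicator {x. L \<le> f x} x)"
    unfolding mass_above_def right_diff_distrib using i by simp
  ultimately show ?thesis using f_level by simp
qed

end

section \<open>A priori bound for the displacement of the level\<close>

context level_crossings_estimate
begin

abbreviation ann_term :: "real \<Rightarrow> real \<Rightarrow> real \<Rightarrow> real" where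
  "ann_term p R x \<equiv> indicator {x. R < \<bar>x - p\<bar> \<and> \<bar>x - p\<bar> \<le> d} x * (4 * (g x - f x)\<^sup>2 / (c\<^sup>2 * (x - p)\<^sup>2))"

lemma ann_term_cover:
  assumes "0 < R" "\<bar>x - p\<bar> \<le> d" "c * \<bar>x - p\<bar> \<le> 2 * \<bar>g x - f x\<bar>"
  shows "1 \<le> indicator {x. \<bar>x - p\<bar> \<le> R} x + ann_term p R x"
proof (cases "\<bar>x - p\<bar> \<le> R")
  case True
  then show ?thesis by simp
next
  case False
  have c0: "c > 0" using const_pos by simp
  have "(c * \<bar>x - p\<bar>)\<^sup>2 \<le> (2 * \<bar>g x - f x\<bar>)\<^sup>2" using assms c0 by (intro power_mono) auto
  then have "c\<^sup>2 * (x - p)\<^sup>2 \<le> 4 * (g x - f x)\<^sup>2" by (simp add: power_mult_distrib)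
  moreover have "c\<^sup>2 * (x - p)\<^sup>2 > 0" using c0 False assms(1) by auto
  ultimately have "4 * (g x - f x)\<^sup>2 / (c\<^sup>2 * (x - p)\<^sup>2) \<ge> 1" by simp
  then show ?thesis using False assms by simp
qed

lemma has_integral_cover:
  assumes "0 < R"
  shows "has_bochner_integral lborel (\<lambda>x. indicator {x. \<bar>x - p\<bar> \<le> R} x + ann_term p R x) (2 * R + ann_dev g p R)"
  unfolding ann_dev_def using assms
  by (intro has_bochner_integral_add lborel_cball_real has_bochner_integral_integrable ann_dev_integrable) auto

text \<open>No control of increments of \<open>g - f\<close> is involved: a mismatch at
  \<open>x\<close> puts \<open>c * \<bar>x - p\<bar>\<close> below twice the deviation or below
  twice the level shift.\<close>

lemma crude_abs:
  assumes p: "p \<in> P" and R: "0 < R"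
  shows "NA y p \<le> (2 * R + ann_dev g p R) + 2 * (2 * \<bar>y - L\<bar> / c)"
proof -
  let ?B = "\<lambda>x. (indicator {x. \<bar>x - p\<bar> \<le> R} x + ann_term p R x) + indicator {x. \<bar>x - p\<bar> \<le> 2 * \<bar>y - L\<bar> / c} x :: real"
  have i: "has_bochner_integral lborel ?B ((2 * R + ann_dev g p R) + 2 * (2 * \<bar>y - L\<bar> / c))"
    using const_pos by (intro has_bochner_integral_add has_integral_cover R lborel_cball_real) simp
  have "NA y p \<le> (LINT x|lborel. ?B x)"
  proof (rule integral_mono)
    show "integrable lborel ?B" using i by (simp only: has_bochner_integral_iff)
    fix x
    have nn: "0 \<le> ann_term p R x" by simp
    show "near p x * \<bar>H y x\<bar> \<le> ?B x"
    proof (cases "\<bar>x - p\<bar> \<le> d \<and> H y x \<noteq> 0")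
      case True
      have 1: "near p x * \<bar>H y x\<bar> \<le> 1" using H_abs_le[of y x] by (simp add: near_def indicator_def)
      have "c * \<bar>x - p\<bar> \<le> \<bar>g x - f x\<bar> + \<bar>y - L\<bar>"
        using H_mismatch[of y x] lower[OF p, of x] True by linarith
      moreover have "a \<le> 2 * s \<or> a \<le> 2 * t" if "a \<le> s + t" for a s t :: real using that by linarith
      ultimately consider "c * \<bar>x - p\<bar> \<le> 2 * \<bar>g x - f x\<bar>" | "c * \<bar>x - p\<bar> \<le> 2 * \<bar>y - L\<bar>" by blast
      then show ?thesis
      proof cases
        case a: 1
        show ?thesis using ann_term_cover[OF R _ a] True 1 by (simp add: add_increasing2)
      next
        case a: 2
        then have "\<bar>x - p\<bar> \<le> 2 * \<bar>y - L\<bar> / c" using const_pos by (simp add: pos_le_divide_eq mult.commute)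
        then show ?thesis using 1 nn by (simp add: add_increasing)
      qed
    next
      case False
      then have z: "near p x * \<bar>H y x\<bar> = 0" by (auto simp: near_def)
      show ?thesis unfolding z using nn by (intro add_nonneg_nonneg) auto
    qed
  qed (rule near_H_integrable)
  then show ?thesis using i by (simp only: has_bochner_integral_iff)
qed

text \<open>Where \<open>\<bar>g - f\<bar>\<close> stays below \<open>\<bar>f - L\<bar>\<close>, a
  shift of the level by \<open>a\<close> in direction \<open>s\<close> never makes
  \<open>s * H\<close> positive, and makes it \<open>-1\<close> on the interval \<open>J\<close>
  next to \<open>p\<close>, in which \<open>f\<close> lies less than halfway from \<open>L\<close>
  to the new level. The remaining points are covered by the annulus bound and count twice: once for
  a wrong sign, once for a possible loss of \<open>J\<close>.\<close>

lemma crude_signed: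
  assumes p: "p \<in> P" and R: "0 < R" and s: "s = 1 \<or> s = -1" and D: "s * (y - L) = a" "0 < a" "a \<le> 2 * C1 * d"
  shows "s * NH y p \<le> 2 * (2 * R + ann_dev g p R) - a / (2 * C1)"
proof -
  have C1: "C1 > 0" and c0: "c > 0" using const_pos by auto
  \<comment> \<open>By \<open>upper\<close>, \<open>\<bar>f - L\<bar>\<close> stays below
    \<open>a / 2\<close> at distances less than \<open>l\<close>.\<close>
  define l where "l = a / (2 * C1)"
  have l: "0 < l" "l \<le> d" "C1 * l = a / 2" using D C1 by (auto simp: l_def field_simps)
  define J where "J = (if s * m p > 0 then {p<..<p + l} else {p - l<..<p})"
  have Jint: "has_bochner_integral lborel (indicator J :: real \<Rightarrow> real) l"
    using l unfolding J_def by (auto simp: has_bochner_integral_iff)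
  have J: "\<bar>x - p\<bar> \<le> d \<and> 0 < s * (f x - L) \<and> s * (f x - L) < a / 2" if "x \<in> J" for x
  proof -
    have x: "\<bar>x - p\<bar> < l" "x \<noteq> p" "0 < (s * m p) * (x - p)"
      using that l slope_nz[OF p] s unfolding J_def by (auto split: if_splits simp: zero_less_mult_iff mult_less_0_iff)
    then have d: "\<bar>x - p\<bar> \<le> d" using l by simp
    have "\<bar>f x - L\<bar> < C1 * l" using upper[OF p d] x C1 by (meson le_less_trans mult_less_cancel_left_pos)
    moreover have "0 < \<bar>f x - L\<bar>" using lower[OF p d] x c0 by (meson less_le_trans mult_pos_pos zero_less_abs_iff right_minus_eq)
    moreover have "0 < s * (f x - L)"
    proof (cases "s = 1")
      case True
      then have "L \<le> f x" using side[OF p d] x by simp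
      then show ?thesis using True \<open>0 < \<bar>f x - L\<bar>\<close> by simp
    next
      case False
      then have s1: "s = -1" using s by simp
      then have "\<not> L \<le> f x" using side[OF p d] x by (simp add: not_le)
      then show ?thesis using s1 by simp
    qed
    moreover have "\<bar>s * (f x - L)\<bar> = \<bar>f x - L\<bar>" using s by (auto simp: abs_mult)
    ultimately show ?thesis using d l by simp
  qed
  let ?B = "\<lambda>x. 2 * (indicator {x. \<bar>x - p\<bar> \<le> R} x + ann_term p R x) - indicator J x :: real"
  have i: "has_bochner_integral lborel ?B (2 * (2 * R + ann_dev g p R) - l)"
    by (intro has_bochner_integral_diff has_bochner_integral_mult_right has_integral_cover R Jint)
  have hi: "has_bochner_integral lborel (\<lambda>x. s * (near p x * H y x)) (s * NH y p)"
    by (intro has_bochner_integral_mult_right has_bochner_integral_integrable near_H_integrable)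
  have "(LINT x|lborel. s * (near p x * H y x)) \<le> (LINT x|lborel. ?B x)"
  proof (rule integral_mono)
    show "integrable lborel ?B" using i by (simp only: has_bochner_integral_iff)
    show "integrable lborel (\<lambda>x. s * (near p x * H y x))" using hi by (simp only: has_bochner_integral_iff)
    fix x
    have nn: "0 \<le> ann_term p R x" by simp
    show "s * (near p x * H y x) \<le> ?B x"
    proof (cases "\<bar>x - p\<bar> \<le> d")
      case False
      then have "x \<notin> J" using J by blast
      then show ?thesis using False nn by (simp add: near_def)
    next
      case d: True
      have eq: "near p x * H y x = H y x" using d by (simp add: near_def)
      show ?thesis
      proof (cases "\<bar>f x - L\<bar> \<le> \<bar>g x - f x\<bar>")
        case True
        have "c * \<bar>x - p\<bar> \<le> 2 * \<bar>g x - f x\<bar>"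
          by (rule order_trans[OF order_trans[OF lower[OF p d] True]]) simp
        from ann_term_cover[OF R d this]
        have "1 \<le> indicator {x. \<bar>x - p\<bar> \<le> R} x + ann_term p R x" .
        moreover have "s * H y x \<le> 1" using s by (auto simp: indicator_def)
        moreover have "indicator J x \<le> (1::real)" by (simp add: indicator_def)
        ultimately show ?thesis unfolding eq by (smt (verit))
      next
        case False
        have neg: "s * H y x \<le> - indicator J x"
        proof (cases "x \<in> J")
          case True
          have a: "\<bar>f x - L\<bar> < a / 2" "0 < s * (f x - L)" using J[OF True] s by auto
          show ?thesis
          proof (cases "s = 1")
            case s1: True
            have "L \<le> f x" using a s1 by simp
            moreover have "\<not> y \<le> g x" using a s1 False D by (simp add: abs_if split: if_splits)
            ultimately show ?thesis using s1 True by simp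
          next
            case False': False
            then have s1: "s = -1" using s by simp
            have "\<not> L \<le> f x" using a s1 by simp
            moreover have "y \<le> g x" using a s1 False D by (simp add: abs_if split: if_splits)
            ultimately show ?thesis using s1 True by simp
          qed
        next
          case nJ: False
          show ?thesis
          proof (cases "s = 1")
            case s1: True
            have "L \<le> f x" if "y \<le> g x" using that s1 False D by (simp add: abs_if split: if_splits)
            then show ?thesis using s1 nJ by (auto simp: indicator_def)
          next
            case False': False
            then have s1: "s = -1" using s by simp
            have "y \<le> g x" if "L \<le> f x" using that s1 False D by (simp add: abs_if split: if_splits)
            then show ?thesis using s1 nJ by (auto simp: indicator_def)
          qed
        qed
        have "0 \<le> indicator {x. \<bar>x - p\<bar> \<le> R} x + ann_term p R x" using nn by simp
        moreover have "u \<le> 2 * w - j" if "u \<le> - j" "0 \<le> w" for u w j :: real using that by linarith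
        ultimately show ?thesis unfolding eq using neg by blast
      qed
    qed
  qed
  then show ?thesis using i hi unfolding l_def by (simp only: has_bochner_integral_iff)
qed

text \<open>With \<open>N\<close> the sum, the factor 3 collects \<open>2 * N\<close> from
  \<open>crude_signed\<close> and one further \<open>N\<close> from the localisation error, whose
  factor \<open>3 * e1\<close> is at most \<open>L\<close>.\<close>

definition crude :: "real \<Rightarrow> real" where
  "crude R = \<bar>mass_dev g\<bar> + 3 * L * (\<Sum>p\<in>P. 2 * R + ann_dev g p R) + Ce * V"

lemma crude_nonneg: "0 < R \<Longrightarrow> 0 \<le> crude R"
  unfolding crude_def using L_pos Ce_pos V_nonneg ann_dev_nonneg
  by (intro add_nonneg_nonneg mult_nonneg_nonneg sum_nonneg) auto

text \<open>If the mass at the shifted level has not yet changed side, the loss proportional to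
  \<open>a\<close> in \<open>crude_signed\<close> must be compensated by deviations. Half of this
  loss absorbs the part of the localisation error that grows with \<open>a\<close>.\<close>

lemma crude_bound:
  assumes R: "0 < R" and s: "s = 1 \<or> s = -1" and D: "s * (y - L) = a" "0 < a" "a \<le> e1"
    and sgn: "0 \<le> s * (mass_above g y - (1 - \<tau>))"
  shows "real (card P) * L / (4 * C1) * a \<le> crude R"
proof -
  have C1: "C1 > 0" and c0: "c > 0" using const_pos by auto
  have aD: "\<bar>y - L\<bar> = a" using s D by auto
  have De: "\<bar>y - L\<bar> \<le> e1" using aD D by simp
  define N where "N = (\<Sum>p\<in>P. 2 * R + ann_dev g p R)"
  define n where "n = real (card P)"
  have N0: "N \<ge> 0" unfolding N_def using R ann_dev_nonneg by (intro sum_nonneg) (simp add: add_nonneg_nonneg)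
  have n0: "n \<ge> 0" by (simp add: n_def)
  have "(\<Sum>p\<in>P. NA y p) \<le> (\<Sum>p\<in>P. (2 * R + ann_dev g p R) + 2 * (2 * \<bar>y - L\<bar> / c))"
    by (rule sum_mono[OF crude_abs[OF _ R]])
  then have A: "(\<Sum>p\<in>P. NA y p) \<le> N + n * (2 * (2 * a / c))"
    unfolding N_def n_def by (simp add: sum.distrib aD)
  have "(\<Sum>p\<in>P. s * NH y p) \<le> (\<Sum>p\<in>P. 2 * (2 * R + ann_dev g p R) - a / (2 * C1))"
    using D e1(4) by (intro sum_mono crude_signed R s) auto
  then have S: "s * (\<Sum>p\<in>P. NH y p) \<le> 2 * N - n * (a / (2 * C1))"
    by (simp add: N_def n_def sum_distrib_left sum_subtractf sum.distrib)
  define I where "I = (LINT x|lborel. g x * H y x)"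
  have I: "\<bar>I - L * (\<Sum>p\<in>P. NH y p)\<bar> \<le> 3 * e1 * (\<Sum>p\<in>P. NA y p) + Ce * V"
    unfolding I_def by (rule localise(1)[OF De])
  have "0 \<le> s * mass_dev g + s * I"
    using sgn unfolding mass_above_eq I_def[symmetric] by (simp add: distrib_left)
  also have "s * mass_dev g \<le> \<bar>mass_dev g\<bar>" using s by auto
  also have "s * I \<le> L * (s * (\<Sum>p\<in>P. NH y p)) + (3 * e1 * (\<Sum>p\<in>P. NA y p) + Ce * V)"
    using I s by (auto simp: abs_le_iff algebra_simps)
  also have "L * (s * (\<Sum>p\<in>P. NH y p)) \<le> L * (2 * N - n * (a / (2 * C1)))"
    using S L_pos by (intro mult_left_mono) auto
  also have "3 * e1 * (\<Sum>p\<in>P. NA y p) \<le> 3 * e1 * (N + n * (2 * (2 * a / c)))"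
    using A e1 by (intro mult_left_mono) auto
  also have "3 * e1 * (N + n * (2 * (2 * a / c))) = 3 * e1 * N + 3 * e1 * (4 / c) * (n * a)"
    by (simp add: field_simps)
  also have "3 * e1 * N \<le> L * N" using e1 N0 by (intro mult_right_mono) auto
  also have "3 * e1 * (4 / c) * (n * a) \<le> L / (4 * C1) * (n * a)"
    using e1 n0 D by (intro mult_right_mono) auto
  finally have "0 \<le> \<bar>mass_dev g\<bar> + (L * (2 * N - n * (a / (2 * C1))) + (L * N + L / (4 * C1) * (n * a) + Ce * V))"
    by simp
  also have "\<dots> = crude R - n * L / (4 * C1) * a"
    unfolding crude_def N_def[symmetric] using C1 by (simp add: field_simps)
  finally show ?thesis unfolding n_def by simp
qed

abbreviation lev :: real where "lev \<equiv> hdr_level \<tau> g"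

text \<open>\<open>crude_bound\<close> is applied at a level strictly between \<open>L\<close> and
  \<open>lev\<close>, where the infimum decides the sign of the mass balance; at \<open>lev\<close>
  itself the mass may jump. The minimum with \<open>e1\<close> keeps the shift in the range of the
  crude estimates.\<close>

lemma level_crude:
  assumes R: "0 < R"
  shows "real (card P) * L / (4 * C1) * (min \<bar>lev - L\<bar> e1 / 2) \<le> crude R"
proof (cases "lev = L")
  case True
  then show ?thesis using crude_nonneg[OF R] e1 by simp
next
  case False
  define s where "s = sgn (lev - L)"
  define a where "a = min \<bar>lev - L\<bar> e1 / 2"
  have s: "s = 1 \<or> s = -1" using False by (auto simp: s_def sgn_if)
  have a: "0 < a" "a \<le> e1" "a < \<bar>lev - L\<bar>" using False e1 by (auto simp: a_def min_def)
  define y where "y = L + s * a"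
  have D: "s * (y - L) = a" using s by (auto simp: y_def)
  have y0: "0 < y" using s a e1 L_pos by (auto simp: y_def)
  have "0 \<le> s * (mass_above g y - (1 - \<tau>))"
  proof (cases "s = 1")
    case True
    then have "y < lev" using a by (auto simp: y_def s_def sgn_if split: if_splits)
    from mass_above_below_level[OF g_int g_nonneg g_le \<tau>(2) y0 this] show ?thesis using True by simp
  next
    case F: False
    then have "lev < y" using a s by (auto simp: y_def s_def sgn_if split: if_splits)
    from mass_above_above_level[OF g_int g_nonneg g_le \<tau>(2) this] show ?thesis using F s by auto
  qed
  from crude_bound[OF R s D a(1,2) this] show ?thesis unfolding a_def .
qed

lemma risk_eq: "density_mass f (sym_diff (hdr \<tau> g) {x. L \<le> f x}) = (LINT x|lborel. f x * \<bar>H lev x\<bar>)"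
  unfolding density_mass_def set_lebesgue_integral_def hdr_def
  by (intro Bochner_Integration.integral_cong) (auto simp: indicator_def)

lemma risk_le_1: "(LINT x|lborel. f x * \<bar>H y x\<bar>) \<le> (LINT x|lborel. f x)"
  using f_nonneg by (intro integral_mono H_integrable f_int) (auto simp: indicator_def)

end

section \<open>Constants of the linearisation\<close>

context level_crossings
begin

text \<open>In the estimate for the risk, \<open>main_factor\<close> multiplies quantities of smaller order than the risk and must
  not depend on the cut-off \<open>e1\<close>, whereas \<open>rest_factor e1\<close> multiplies quantities of second order.\<close>

definition nP :: real where "nP = real (card P)"
definition kap :: real where "kap = nP * L / (4 * C1)"
text \<open>\<open>2 / kap\<close> converts \<open>crude\<close> into a level shift, and
  \<open>3 / c\<close> converts a level shift into a bound for the width of the mismatch region at a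
  crossing.\<close>

definition al :: real where "al = 6 / (kap * c)"
definition be :: real where "be = 1 / c"
text \<open>Dominates the coefficients of \<open>R\<close> in the width bound of
  \<open>near_err_le\<close>, so that a window of radius \<open>radius_factor * R\<close> leaves no
  multiple of \<open>R\<close> in the excess width.\<close>

definition radius_factor :: real where "radius_factor = 6 * L * nP * al + al + be + 1"
definition cK3 :: real where "cK3 = 2 * be + 2 + 2 * (al + 3 * L * al + 4 * be)"
definition cK4 :: real where "cK4 = 2 * L * nP * cK3 + nP * al * L\<^sup>2 + be * nP * L"
definition cK5 :: real where "cK5 = 3 * be + nP * al * (1 + 6 * L * nP)"
definition cE :: "real \<Rightarrow> real" where "cE e1 = 4 * Cf / e1\<^sup>2 + 8 / e1"
definition cA5 :: "real \<Rightarrow> real" where "cA5 e1 = 2 * L * nP * (2 * al * cE e1) + nP * al * cE e1 * L + cE e1"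
definition main_factor :: real where "main_factor = 2 * cK4 + 2 * cK5 + L * slope_sum"
definition cG :: "real \<Rightarrow> real" where "cG e1 = 16 / (kap * e1) * (4 / (kap * e1) + 3 * L + cE e1)"
definition rest_factor :: "real \<Rightarrow> real" where
  "rest_factor e1 = 2 * cA5 e1 + (((LINT x|lborel. f x) + 2 + 2 * L * be * nP) * cG e1 + 2 * L * be + 1)"
text \<open>Makes \<open>6 * L * nP * fixed_radius e1\<close> equal to \<open>kap * e1 / 8\<close>,
  half of the \<open>kap * e1 / 4\<close> available in \<open>risk_linear_far\<close>.\<close>

definition fixed_radius :: "real \<Rightarrow> real" where "fixed_radius e1 = e1 / (192 * C1)"

lemma Cf_nn: "Cf \<ge> 0" using f_nonneg f_le by (meson order_trans)

lemma pos: "nP > 0" "kap > 0" "al > 0" "be > 0" "radius_factor \<ge> 1" "cK3 > 0" "cK4 > 0" "cK5 > 0" "main_factor > 0"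
proof -
  show n: "nP > 0" unfolding nP_def using P by (simp add: card_gt_0_iff)
  show k: "kap > 0" unfolding kap_def using n L_pos const_pos by simp
  show a: "al > 0" unfolding al_def using k const_pos by simp
  show b: "be > 0" unfolding be_def using const_pos by simp
  show "radius_factor \<ge> 1" unfolding radius_factor_def using n a b L_pos by (simp add: add_nonneg_nonneg)
  show k3: "cK3 > 0" unfolding cK3_def using a b L_pos by (simp add: add_pos_pos)
  show k4: "cK4 > 0" unfolding cK4_def using n a b L_pos k3 by (simp add: add_pos_pos)
  show k5: "cK5 > 0" unfolding cK5_def using n a b L_pos by (intro add_pos_pos mult_pos_pos) auto
  show "main_factor > 0" unfolding main_factor_def using k4 k5 L_pos slope_sum_pos by (simp add: add_pos_pos)
qed

lemma pos_e1:
  assumes "e1 > 0"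
  shows "cE e1 > 0" "cA5 e1 > 0" "cG e1 > 0" "rest_factor e1 > 0" "fixed_radius e1 > 0"
proof -
  show e: "cE e1 > 0" unfolding cE_def using assms Cf_nn by (intro add_nonneg_pos) auto
  show a: "cA5 e1 > 0" unfolding cA5_def using pos e L_pos by (intro add_pos_pos mult_pos_pos) auto
  show g: "cG e1 > 0" unfolding cG_def using pos e L_pos assms by (intro mult_pos_pos add_pos_pos) auto
  have "(LINT x|lborel. f x) \<ge> 0" using f_nonneg by simp
  then show "rest_factor e1 > 0" unfolding rest_factor_def using pos a g L_pos
    by (intro add_pos_nonneg mult_nonneg_nonneg add_nonneg_nonneg) auto
  show "fixed_radius e1 > 0" unfolding fixed_radius_def using assms const_pos by simp
qed

lemma slope_inv_le: "p \<in> P \<Longrightarrow> 1 / \<bar>m p\<bar> \<le> be"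
  unfolding be_def using slope[of p] const_pos by (intro divide_left_mono) (auto intro: mult_pos_pos)

end

section \<open>Error of the linearised risk\<close>

context level_crossings_estimate
begin

lemma Ce_eq: "Ce = cE e1" unfolding Ce_def cE_def ..

definition Bd :: real where "Bd = \<bar>mass_dev g\<bar>"
definition Et :: real where "Et = (\<Sum>p\<in>P. \<bar>g p - f p\<bar>)"
definition E2 :: real where "E2 = (\<Sum>p\<in>P. (g p - f p)\<^sup>2)"
definition NS :: "real \<Rightarrow> real" where "NS R = (\<Sum>p\<in>P. ann_dev g p R)"
text \<open>The height \<open>e\<close> and the radius \<open>R\<close> are free. They are later
  taken as \<open>t * rho\<close> and \<open>rho / t\<close>, for which each term has mean at most a
  constant times \<open>t * rho\<close>.\<close>

definition main_dev :: "real \<Rightarrow> real \<Rightarrow> real" where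
  "main_dev e R = e + (\<Sum>p\<in>P. inc_dev g p (radius_factor * R)) / e\<^sup>2 + NS R + (Bd\<^sup>2 + E2) / R"

lemma dev_nonneg: "Bd \<ge> 0" "Et \<ge> 0" "E2 \<ge> 0" "NS R \<ge> 0"
  unfolding Bd_def Et_def E2_def NS_def by (auto intro!: sum_nonneg ann_dev_nonneg)

lemma Et_le: "Et \<le> nP + E2"
proof -
  have "\<bar>t\<bar> \<le> 1 + t\<^sup>2" for t :: real
    using sum_squares_bound[of "\<bar>t\<bar>" 1] by simp
  then have "Et \<le> (\<Sum>p\<in>P. 1 + (g p - f p)\<^sup>2)" unfolding Et_def by (rule sum_mono)
  then show ?thesis by (simp add: E2_def nP_def sum.distrib)
qed

lemma crude_eq: "crude R = Bd + 3 * L * (2 * nP * R + NS R) + cE e1 * V"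
  unfolding crude_def Bd_def NS_def nP_def Ce_eq by (simp add: sum.distrib mult_ac)

lemma main_dev_ge:
  assumes "0 < e" "0 < R"
  shows "e \<le> main_dev e R" "p \<in> P \<Longrightarrow> inc_dev g p (radius_factor * R) / e\<^sup>2 \<le> main_dev e R - e - NS R"
    "NS R \<le> main_dev e R" "Bd\<^sup>2 / R \<le> main_dev e R" "p \<in> P \<Longrightarrow> (g p - f p)\<^sup>2 / R \<le> main_dev e R" "0 < main_dev e R"
proof -
  let ?I = "(\<Sum>p\<in>P. inc_dev g p (radius_factor * R)) / e\<^sup>2"
  have I: "?I \<ge> 0" by (intro divide_nonneg_nonneg sum_nonneg inc_dev_nonneg) auto
  have b: "Bd\<^sup>2 / R \<ge> 0" "E2 / R \<ge> 0" using assms dev_nonneg by auto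
  have eq: "main_dev e R = e + ?I + NS R + Bd\<^sup>2 / R + E2 / R" unfolding main_dev_def by (simp add: add_divide_distrib)
  show "e \<le> main_dev e R" unfolding eq using I b dev_nonneg(4)[of R] by linarith
  show "NS R \<le> main_dev e R" unfolding eq using I b assms by linarith
  show "Bd\<^sup>2 / R \<le> main_dev e R" unfolding eq using I b assms dev_nonneg(4)[of R] by linarith
  show "0 < main_dev e R" unfolding eq using I b assms dev_nonneg(4)[of R] by linarith
  {
    assume p: "p \<in> P"
    have "inc_dev g p (radius_factor * R) \<le> (\<Sum>p\<in>P. inc_dev g p (radius_factor * R))"
      by (rule member_le_sum[OF p]) (auto simp: P inc_dev_nonneg)
    then have "inc_dev g p (radius_factor * R) / e\<^sup>2 \<le> ?I" by (rule divide_right_mono) simp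
    then show "inc_dev g p (radius_factor * R) / e\<^sup>2 \<le> main_dev e R - e - NS R" unfolding eq using b by linarith
    have "(g p - f p)\<^sup>2 \<le> E2" unfolding E2_def by (rule member_le_sum[OF p]) (auto simp: P)
    then have "(g p - f p)\<^sup>2 / R \<le> E2 / R" using assms by (intro divide_right_mono) auto
    then show "(g p - f p)\<^sup>2 / R \<le> main_dev e R" unfolding eq using I b assms dev_nonneg(4)[of R] by linarith
  }
qed

text \<open>Trades a first-order deviation for its square at the price of one multiple of
  \<open>R\<close>, which the enlarged window absorbs.\<close>

lemma abs_le_square_div: "0 < R \<Longrightarrow> \<bar>t\<bar> \<le> R + t\<^sup>2 / R" for t R :: real
proof -
  assume R: "0 < R"
  have q: "0 \<le> t\<^sup>2 / R" using R by simp
  show ?thesis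
  proof (cases "\<bar>t\<bar> \<le> R")
    case True
    then show ?thesis using q by (rule add_increasing2[rotated])
  next
    case False
    then have "\<bar>t\<bar> * R \<le> \<bar>t\<bar> * \<bar>t\<bar>" by (intro mult_left_mono) auto
    then have "\<bar>t\<bar> \<le> t\<^sup>2 / R" using R by (simp add: pos_le_divide_eq power2_eq_square)
    then show ?thesis using R by linarith
  qed
qed

definition step_err :: "real \<Rightarrow> real \<Rightarrow> real" where
  "step_err e R = cK3 * main_dev e R + 2 * al * cE e1 * V"

context
  fixes e R :: real
  assumes e: "0 < e" "e \<le> e1 / 2" and R: "0 < R" "radius_factor * R \<le> d"
    and close: "\<bar>lev - L\<bar> < e1 / 2"
begin

lemma level_dev: "\<bar>lev - L\<bar> \<le> 2 / kap * crude R"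
proof -
  have "kap * (min \<bar>lev - L\<bar> e1 / 2) \<le> crude R"
    using level_crude[OF R(1)] unfolding kap_def nP_def .
  moreover have "min \<bar>lev - L\<bar> e1 = \<bar>lev - L\<bar>" using close e1 by linarith
  ultimately show ?thesis using pos(2) by (simp add: field_simps)
qed

text \<open>The level shift is bounded through \<open>crude\<close> by first-order deviations. These
  are replaced by \<open>R\<close> plus squares, and \<open>radius_factor\<close> is chosen so that
  the window swallows all multiples of \<open>R\<close>.\<close>

lemma near_err_le:
  assumes p: "p \<in> P" and D: "\<bar>D\<bar> \<le> \<bar>lev - L\<bar> + e"
  shows "near_err (radius_factor * R) e D p \<le> step_err e R"
proof -
  define T where "T = main_dev e R"
  define eta where "eta = \<bar>g p - f p\<bar>"
  define N where "N = NS R"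
  note T = main_dev_ge[OF e(1) R(1), folded T_def]
  have T0: "T > 0" by (rule T)
  have c0: "c > 0" using const_pos by simp
  have alc: "al = (2 / kap) * 3 * be" unfolding al_def be_def using pos c0 by (simp add: field_simps)
  have "2 * \<bar>D\<bar> + \<bar>(g p - f p) - D\<bar> \<le> 3 * \<bar>D\<bar> + eta" unfolding eta_def by linarith
  also have "3 * \<bar>D\<bar> + eta \<le> 3 * (2 / kap * crude R + e) + eta"
    using order_trans[OF D add_right_mono[OF level_dev]] by simp
  finally have "(2 * \<bar>D\<bar> + \<bar>(g p - f p) - D\<bar>) / c \<le> (3 * (2 / kap * crude R + e) + eta) / c"
    using c0 by (intro divide_right_mono) auto
  also have "\<dots> = al * crude R + 3 * be * e + be * eta"
    unfolding alc be_def using c0 by (simp add: field_simps)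
  also have "al * crude R = al * Bd + 6 * L * nP * al * R + 3 * L * al * N + al * (cE e1 * V)"
    unfolding crude_eq N_def by (simp add: algebra_simps)
  also have "al * Bd \<le> al * (R + T)"
    using abs_le_square_div[OF R(1), of Bd] T(4) pos dev_nonneg(1) by (intro mult_left_mono) auto
  also have "be * eta \<le> be * (R + T)"
    using abs_le_square_div[OF R(1), of "g p - f p"] T(5)[OF p] pos unfolding eta_def by (intro mult_left_mono) auto
  also have "3 * L * al * N \<le> 3 * L * al * T"
    using T(3) pos L_pos unfolding N_def by (intro mult_left_mono) auto
  also have "3 * be * e \<le> 3 * be * T" using T(1) pos by (intro mult_left_mono) auto
  finally have "(2 * \<bar>D\<bar> + \<bar>(g p - f p) - D\<bar>) / c \<le>
     al * (R + T) + 6 * L * nP * al * R + 3 * L * al * T + al * (cE e1 * V) + 3 * be * T + be * (R + T)"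
    by simp
  then have "(2 * \<bar>D\<bar> + \<bar>(g p - f p) - D\<bar>) / c - radius_factor * R \<le> (al + 3 * L * al + 4 * be) * T + al * (cE e1 * V)"
    unfolding radius_factor_def using R by (simp add: algebra_simps)
  moreover have "0 \<le> (al + 3 * L * al + 4 * be) * T + al * (cE e1 * V)"
    using pos L_pos T0 pos_e1(1)[OF e1(1)] V_nonneg by (intro add_nonneg_nonneg mult_nonneg_nonneg) auto
  ultimately have mx: "max 0 ((2 * \<bar>D\<bar> + \<bar>(g p - f p) - D\<bar>) / c - radius_factor * R) \<le> (al + 3 * L * al + 4 * be) * T + al * (cE e1 * V)"
    by simp
  have "2 * e / \<bar>m p\<bar> = 2 * (1 / \<bar>m p\<bar>) * e" by simp
  also have "\<dots> \<le> 2 * be * T"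
    using slope_inv_le[OF p] T(1) e pos by (intro mult_mono) auto
  finally have t1: "2 * e / \<bar>m p\<bar> \<le> 2 * be * T" .
  have "ann_dev g p R \<le> N" unfolding N_def NS_def by (rule member_le_sum[OF p]) (auto simp: P ann_dev_nonneg)
  moreover have "ann_dev g p (radius_factor * R) \<le> ann_dev g p R"
    using R pos(5) by (intro ann_dev_antimono) auto
  ultimately have t3: "ann_dev g p (radius_factor * R) \<le> N" by simp
  have "near_err (radius_factor * R) e D p \<le> 2 * be * T + (T - e - N) + N + 2 * ((al + 3 * L * al + 4 * be) * T + al * (cE e1 * V))"
    unfolding near_err_def using T(2)[OF p, folded N_def] by (intro add_mono t1 t3 mult_left_mono mx) auto
  also have "\<dots> \<le> step_err e R"
    unfolding step_err_def cK3_def T_def[symmetric] using T0 e by (simp add: algebra_simps)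
  finally show ?thesis .
qed

definition tot_err :: real where
  "tot_err = cK4 * main_dev e R + cK5 * (e1 * (Bd + Et + R)) + cA5 e1 * V"

text \<open>\<open>near_integral\<close> is summed over the crossings and inserted into
  \<open>localise\<close>. The factor \<open>e1\<close> of the localisation error is what makes the
  first-order quantities \<open>Bd\<close>, \<open>Et\<close> and \<open>R\<close> small compared
  with the risk.\<close>

lemma linear_err:
  assumes D: "\<bar>y - L\<bar> \<le> \<bar>lev - L\<bar> + e"
  shows "\<bar>(LINT x|lborel. g x * H y x) - L * (\<Sum>p\<in>P. ((g p - f p) - (y - L)) / \<bar>m p\<bar>)\<bar> \<le> tot_err"
    and "\<bar>(LINT x|lborel. f x * \<bar>H y x\<bar>) - L * (\<Sum>p\<in>P. \<bar>(g p - f p) - (y - L)\<bar> / \<bar>m p\<bar>)\<bar> \<le> tot_err"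
proof -
  define T where "T = main_dev e R"
  define X where "X = step_err e R"
  define v where "v p = (g p - f p) - (y - L)" for p
  define U where "U = e1 * (Bd + Et + R)"
  note T = main_dev_ge[OF e(1) R(1), folded T_def]
  have T0: "T > 0" by (rule T)
  have c0: "c > 0" using const_pos by simp
  have V0: "cE e1 * V \<ge> 0" using pos_e1[OF e1(1)] V_nonneg by simp
  have De1: "\<bar>y - L\<bar> \<le> e1" using D close e by linarith
  have R': "0 < radius_factor * R" using R pos(5) by simp
  have n1: "\<bar>NH y p - v p / \<bar>m p\<bar>\<bar> \<le> X" if "p \<in> P" for p
    using near_integral(1)[OF that R' R(2) e(1), of y] near_err_le[OF that D] unfolding v_def X_def by linarith
  have n2: "\<bar>NA y p - \<bar>v p\<bar> / \<bar>m p\<bar>\<bar> \<le> X" if "p \<in> P" for p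
    using near_integral(2)[OF that R' R(2) e(1), of y] near_err_le[OF that D] unfolding v_def X_def by linarith
  have sumX: "\<bar>(\<Sum>p\<in>P. h p) - (\<Sum>p\<in>P. k p)\<bar> \<le> nP * X" if "\<And>p. p \<in> P \<Longrightarrow> \<bar>h p - k p\<bar> \<le> X" for h k :: "real \<Rightarrow> real"
  proof -
    have "\<bar>(\<Sum>p\<in>P. h p) - (\<Sum>p\<in>P. k p)\<bar> = \<bar>\<Sum>p\<in>P. h p - k p\<bar>" by (simp add: sum_subtractf)
    also have "\<dots> \<le> (\<Sum>p\<in>P. \<bar>h p - k p\<bar>)" by (rule sum_abs)
    also have "\<dots> \<le> (\<Sum>p\<in>P. X)" using that by (rule sum_mono)
    finally show ?thesis by (simp add: nP_def)
  qed
  have a1: "\<bar>L * (\<Sum>p\<in>P. NH y p) - L * (\<Sum>p\<in>P. v p / \<bar>m p\<bar>)\<bar> \<le> L * (nP * X)"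
    unfolding right_diff_distrib[symmetric] abs_mult using sumX[of "NH y" "\<lambda>p. v p / \<bar>m p\<bar>", OF n1] L_pos by simp
  have a2: "\<bar>L * (\<Sum>p\<in>P. NA y p) - L * (\<Sum>p\<in>P. \<bar>v p\<bar> / \<bar>m p\<bar>)\<bar> \<le> L * (nP * X)"
    unfolding right_diff_distrib[symmetric] abs_mult using sumX[of "NA y" "\<lambda>p. \<bar>v p\<bar> / \<bar>m p\<bar>", OF n2] L_pos by simp
  have "(\<Sum>p\<in>P. \<bar>v p\<bar> / \<bar>m p\<bar>) \<le> (\<Sum>p\<in>P. be * (\<bar>g p - f p\<bar> + (\<bar>lev - L\<bar> + e)))"
  proof (rule sum_mono)
    fix p assume p: "p \<in> P"
    have "\<bar>v p\<bar> \<le> \<bar>g p - f p\<bar> + \<bar>y - L\<bar>" unfolding v_def by linarith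
    then have "\<bar>v p\<bar> \<le> \<bar>g p - f p\<bar> + (\<bar>lev - L\<bar> + e)" using D by linarith
    then have "(1 / \<bar>m p\<bar>) * \<bar>v p\<bar> \<le> be * (\<bar>g p - f p\<bar> + (\<bar>lev - L\<bar> + e))"
      using slope_inv_le[OF p] pos(4) by (intro mult_mono) auto
    then show "\<bar>v p\<bar> / \<bar>m p\<bar> \<le> be * (\<bar>g p - f p\<bar> + (\<bar>lev - L\<bar> + e))" by simp
  qed
  also have "\<dots> = be * (Et + nP * (\<bar>lev - L\<bar> + e))"
    by (simp add: Et_def nP_def sum_distrib_left[symmetric] sum.distrib)
  finally have sv: "(\<Sum>p\<in>P. \<bar>v p\<bar> / \<bar>m p\<bar>) \<le> be * (Et + nP * (\<bar>lev - L\<bar> + e))" .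
  have "(\<Sum>p\<in>P. NA y p) \<le> (\<Sum>p\<in>P. \<bar>v p\<bar> / \<bar>m p\<bar>) + nP * X"
    using sumX[of "NA y" "\<lambda>p. \<bar>v p\<bar> / \<bar>m p\<bar>", OF n2] by linarith
  with sv have "(\<Sum>p\<in>P. NA y p) \<le> be * (Et + nP * (\<bar>lev - L\<bar> + e)) + nP * X" by linarith
  then have "3 * e1 * (\<Sum>p\<in>P. NA y p) \<le> 3 * e1 * (be * (Et + nP * (\<bar>lev - L\<bar> + e)) + nP * X)"
    using e1 by (intro mult_left_mono) auto
  also have "\<dots> \<le> 3 * e1 * (be * (Et + nP * (2 / kap * crude R + e)) + nP * X)"
    using e1 pos level_dev by (intro mult_left_mono add_mono order_refl) auto
  also have "\<dots> = 3 * be * (e1 * Et) + nP * al * (e1 * crude R) + be * nP * (3 * e1 * e) + 3 * e1 * (nP * X)"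
    unfolding al_def be_def using pos c0 by (simp add: field_simps)
  also have "e1 * crude R = e1 * Bd + 6 * L * nP * (e1 * R) + L * (3 * e1) * NS R + e1 * (cE e1 * V)"
    unfolding crude_eq by (simp add: algebra_simps)
  \<comment> \<open>Where the other factor is already small, \<open>3 * e1\<close> is replaced by
    \<open>L\<close>; this keeps \<open>main_factor\<close> independent of
    \<open>e1\<close>.\<close>
  also have "L * (3 * e1) * NS R \<le> L * L * T"
    using L_pos e1 T(3) dev_nonneg(4)[of R] by (intro mult_mono) auto
  also have "e1 * (cE e1 * V) \<le> L * (cE e1 * V)" using e1 V0 L_pos by (intro mult_right_mono) auto
  also have "be * nP * (3 * e1 * e) \<le> be * nP * (L * T)"
    using e e1 T(1) pos L_pos by (intro mult_left_mono mult_mono) auto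
  also have "3 * e1 * (nP * X) \<le> L * (nP * X)"
    using e1 pos T0 V0 pos_e1[OF e1(1)] V_nonneg unfolding X_def step_err_def T_def[symmetric]
    by (intro mult_right_mono mult_nonneg_nonneg add_nonneg_nonneg) auto
  also have "e1 * Bd \<le> U" unfolding U_def using e1 dev_nonneg R by (intro mult_left_mono) auto
  also have "e1 * R \<le> U" unfolding U_def using e1 dev_nonneg R by (intro mult_left_mono) auto
  also have "e1 * Et \<le> U" unfolding U_def using e1 dev_nonneg R by (intro mult_left_mono) auto
  finally have NAb: "3 * e1 * (\<Sum>p\<in>P. NA y p) \<le> 3 * be * U + nP * al * (U + 6 * L * nP * U + L * L * T + L * (cE e1 * V))
      + be * nP * (L * T) + L * (nP * X)"
    using pos L_pos by (auto simp: mult_left_mono add_mono)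
  have tot: "L * (nP * X) + (3 * e1 * (\<Sum>p\<in>P. NA y p) + Ce * V) \<le> tot_err"
  proof -
    have "L * (nP * X) + (3 * e1 * (\<Sum>p\<in>P. NA y p) + Ce * V) \<le> L * (nP * X) + ((3 * be * U + nP * al * (U + 6 * L * nP * U + L * L * T + L * (cE e1 * V))
      + be * nP * (L * T) + L * (nP * X)) + cE e1 * V)" unfolding Ce_eq using NAb by linarith
    also have "\<dots> = tot_err"
      unfolding tot_err_def X_def step_err_def cK4_def cK5_def cA5_def U_def[symmetric] T_def[symmetric]
      by (simp add: algebra_simps power2_eq_square)
    finally show ?thesis .
  qed
  show "\<bar>(LINT x|lborel. g x * H y x) - L * (\<Sum>p\<in>P. ((g p - f p) - (y - L)) / \<bar>m p\<bar>)\<bar> \<le> tot_err"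
    using localise(1)[OF De1] a1 tot unfolding v_def by linarith
  show "\<bar>(LINT x|lborel. f x * \<bar>H y x\<bar>) - L * (\<Sum>p\<in>P. \<bar>(g p - f p) - (y - L)\<bar> / \<bar>m p\<bar>)\<bar> \<le> tot_err"
    using localise(2)[OF De1] a2 tot unfolding v_def by linarith
qed

text \<open>At the levels \<open>lev + e\<close> and \<open>lev - e\<close> the infimum fixes the
  sign of the mass balance, so the linear equation for the displacement holds up to
  \<open>tot_err\<close> and the slack \<open>L * slope_sum * e\<close>. Its solution is
  \<open>level_lin g\<close>, and the linearised risk depends on the displacement in a Lipschitz
  way.\<close>

lemma risk_linear_close:
  "\<bar>(LINT x|lborel. f x * \<bar>H lev x\<bar>) - risk_lin g\<bar> \<le> 2 * tot_err + L * slope_sum * e"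
proof -
  define A where "A = (\<Sum>p\<in>P. (g p - f p) / \<bar>m p\<bar>)"
  define b where "b = mass_dev g"
  define D where "D = lev - L"
  define I where "I y = (LINT x|lborel. g x * H y x)" for y
  define LS where "LS = L * slope_sum"
  have LS: "LS > 0" unfolding LS_def using L_pos slope_sum_pos by simp
  have lin: "L * (\<Sum>p\<in>P. ((g p - f p) - z) / \<bar>m p\<bar>) = L * A - LS * z" for z
    unfolding A_def LS_def slope_sum_def
    by (simp add: diff_divide_distrib sum_subtractf right_diff_distrib sum_distrib_left sum_distrib_right)
  have up: "b + L * A - LS * (D + e) \<le> tot_err"
  proof -
    have "b + I (lev + e) \<le> 0"
      using mass_above_eq[of "lev + e"] mass_above_above_level[OF g_int g_nonneg g_le \<tau>(2), of "lev + e"] e unfolding b_def I_def by simp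
    moreover have "\<bar>I (lev + e) - (L * A - LS * (D + e))\<bar> \<le> tot_err"
    proof -
      have "\<bar>(lev + e) - L\<bar> \<le> \<bar>lev - L\<bar> + e" using e by linarith
      from linear_err(1)[OF this] show ?thesis unfolding lin I_def[symmetric] D_def by (simp add: algebra_simps)
    qed
    ultimately show ?thesis by linarith
  qed
  have lo: "- tot_err \<le> b + L * A - LS * (D - e)"
  proof -
    have "lev - e > 0" using close e e1 by linarith
    then have "b + I (lev - e) \<ge> 0"
      using mass_above_eq[of "lev - e"] mass_above_below_level[OF g_int g_nonneg g_le \<tau>(2), of "lev - e"] e unfolding b_def I_def by simp
    moreover have "\<bar>I (lev - e) - (L * A - LS * (D - e))\<bar> \<le> tot_err"
    proof -
      have "\<bar>(lev - e) - L\<bar> \<le> \<bar>lev - L\<bar> + e" using e by linarith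
      from linear_err(1)[OF this] show ?thesis unfolding lin I_def[symmetric] D_def by (simp add: algebra_simps)
    qed
    ultimately show ?thesis by linarith
  qed
  define La where "La = level_lin g"
  have "LS * La = b + L * A"
    unfolding La_def level_lin_def LS_def A_def[symmetric] b_def[symmetric] using L_pos slope_sum_pos by (simp add: field_simps)
  then have "\<bar>LS * (La - D)\<bar> \<le> tot_err + LS * e"
    using up lo by (simp add: abs_le_iff algebra_simps)
  then have LaD: "LS * \<bar>D - La\<bar> \<le> tot_err + LS * e"
    using LS by (simp add: abs_mult abs_minus_commute)
  have r1: "\<bar>(LINT x|lborel. f x * \<bar>H lev x\<bar>) - L * (\<Sum>p\<in>P. \<bar>(g p - f p) - D\<bar> / \<bar>m p\<bar>)\<bar> \<le> tot_err"
    unfolding D_def using e by (intro linear_err(2)) simp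
  have "\<bar>(\<Sum>p\<in>P. \<bar>(g p - f p) - D\<bar> / \<bar>m p\<bar>) - (\<Sum>p\<in>P. \<bar>(g p - f p) - La\<bar> / \<bar>m p\<bar>)\<bar>
     \<le> (\<Sum>p\<in>P. \<bar>\<bar>(g p - f p) - D\<bar> / \<bar>m p\<bar> - \<bar>(g p - f p) - La\<bar> / \<bar>m p\<bar>\<bar>)"
    unfolding sum_subtractf[symmetric] by (rule sum_abs)
  also have "\<dots> \<le> (\<Sum>p\<in>P. 1 / \<bar>m p\<bar> * \<bar>D - La\<bar>)"
  proof (rule sum_mono)
    fix p
    have "\<bar>\<bar>(g p - f p) - D\<bar> - \<bar>(g p - f p) - La\<bar>\<bar> \<le> \<bar>D - La\<bar>" by linarith
    then have "\<bar>\<bar>(g p - f p) - D\<bar> - \<bar>(g p - f p) - La\<bar>\<bar> / \<bar>m p\<bar> \<le> \<bar>D - La\<bar> / \<bar>m p\<bar>" by (rule divide_right_mono) simp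
    then show "\<bar>\<bar>(g p - f p) - D\<bar> / \<bar>m p\<bar> - \<bar>(g p - f p) - La\<bar> / \<bar>m p\<bar>\<bar> \<le> 1 / \<bar>m p\<bar> * \<bar>D - La\<bar>"
      unfolding diff_divide_distrib[symmetric] by (simp add: abs_divide)
  qed
  also have "\<dots> = slope_sum * \<bar>D - La\<bar>" unfolding slope_sum_def sum_distrib_right ..
  finally have "L * \<bar>(\<Sum>p\<in>P. \<bar>(g p - f p) - D\<bar> / \<bar>m p\<bar>) - (\<Sum>p\<in>P. \<bar>(g p - f p) - La\<bar> / \<bar>m p\<bar>)\<bar> \<le> L * (slope_sum * \<bar>D - La\<bar>)"
    using L_pos by (intro mult_left_mono) auto
  then have r2: "\<bar>L * (\<Sum>p\<in>P. \<bar>(g p - f p) - D\<bar> / \<bar>m p\<bar>) - risk_lin g\<bar> \<le> LS * \<bar>D - La\<bar>"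
    unfolding risk_lin_def La_def[symmetric] right_diff_distrib[symmetric] abs_mult LS_def using L_pos by (simp add: mult.assoc)
  show ?thesis using r1 r2 LaD unfolding LS_def by linarith
qed

end

definition rest_dev :: real where
  "rest_dev = V + Bd\<^sup>2 + E2 + NS (fixed_radius e1)"

lemma rest_dev_nonneg: "rest_dev \<ge> 0"
  unfolding rest_dev_def using V_nonneg dev_nonneg by (simp add: add_nonneg_nonneg)

text \<open>A displacement of at least \<open>e1 / 2\<close> forces \<open>rest_dev\<close> to be at
  least \<open>1 / cG e1\<close>. Bounded quantities, here the total mass and the constant part of
  the bound for \<open>risk_lin g\<close>, are therefore at most multiples of
  \<open>rest_dev\<close>.\<close>

lemma risk_linear_far:
  assumes far_lev: "e1 / 2 \<le> \<bar>lev - L\<bar>"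
  shows "\<bar>(LINT x|lborel. f x * \<bar>H lev x\<bar>) - risk_lin g\<bar> \<le> (((LINT x|lborel. f x) + 2 + 2 * L * be * nP) * cG e1 + 2 * L * be + 1) * rest_dev"
proof -
  define W where "W = rest_dev"
  define q where "q = kap * e1"
  have q: "q > 0" unfolding q_def using pos e1 by simp
  have W: "V \<le> W" "Bd\<^sup>2 \<le> W" "E2 \<le> W" "NS (fixed_radius e1) \<le> W" "0 \<le> W"
    using V_nonneg dev_nonneg(3) dev_nonneg(4)[of "fixed_radius e1"] zero_le_power2[of Bd] unfolding W_def rest_dev_def by linarith+
  have cE0: "cE e1 > 0" using pos_e1[OF e1(1)] by simp
  have "kap * (e1 / 4) \<le> kap * (min \<bar>lev - L\<bar> e1 / 2)"
    using far_lev e1 pos(2) by (intro mult_left_mono) auto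
  also have "\<dots> \<le> crude (fixed_radius e1)"
    using level_crude[OF pos_e1(5)[OF e1(1)]] unfolding kap_def nP_def .
  also have "\<dots> = Bd + 6 * L * nP * fixed_radius e1 + 3 * L * NS (fixed_radius e1) + cE e1 * V"
    unfolding crude_eq by (simp add: algebra_simps)
  also have "6 * L * nP * fixed_radius e1 = q / 8"
    unfolding fixed_radius_def q_def kap_def using const_pos by (simp add: field_simps)
  \<comment> \<open>A square inequality weighted so that, of the \<open>q / 4\<close> on the left,
    \<open>q / 16\<close> is left after subtracting \<open>q / 16\<close> and
    \<open>q / 8\<close>.\<close>
  also have "Bd \<le> q / 16 + 4 * Bd\<^sup>2 / q"
  proof -
    have "Bd * q \<le> q * q / 16 + 4 * Bd\<^sup>2"
      using sum_squares_bound[of "q / 4" "2 * Bd"] by (simp add: power2_eq_square algebra_simps)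
    then show ?thesis using q by (simp add: field_simps power2_eq_square)
  qed
  also have "4 * Bd\<^sup>2 / q = 4 / q * Bd\<^sup>2" by simp
  also have "4 / q * Bd\<^sup>2 \<le> 4 / q * W" using W q by (intro mult_left_mono) auto
  also have "3 * L * NS (fixed_radius e1) \<le> 3 * L * W" using W L_pos by (intro mult_left_mono) auto
  also have "cE e1 * V \<le> cE e1 * W" using W cE0 by (intro mult_left_mono) auto
  finally have "kap * (e1 / 4) \<le> q / 16 + 4 / q * W + q / 8 + 3 * L * W + cE e1 * W" by simp
  moreover have "kap * (e1 / 4) = q / 4" unfolding q_def by simp
  moreover have "s / 16 \<le> x + y + z" if "u \<le> s / 16 + x + s / 8 + y + z" "u = s / 4" for s u x y z :: real
    using that by linarith
  ultimately have "q / 16 \<le> 4 / q * W + 3 * L * W + cE e1 * W" by blast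
  then have "q / 16 \<le> (4 / q + 3 * L + cE e1) * W" by (simp add: distrib_right)
  then have "16 / q * (q / 16) \<le> 16 / q * ((4 / q + 3 * L + cE e1) * W)" using q by (intro mult_left_mono) auto
  moreover have "16 / q * (q / 16) = 1" using q by simp
  ultimately have "1 \<le> 16 / q * ((4 / q + 3 * L + cE e1) * W)" by metis
  then have one: "1 \<le> cG e1 * W" unfolding cG_def q_def by (metis mult.assoc)
  define A where "A = (\<Sum>p\<in>P. \<bar>g p - f p\<bar> / \<bar>m p\<bar>)"
  have A: "A \<le> be * Et"
    unfolding A_def Et_def sum_distrib_left
    by (intro sum_mono) (use mult_right_mono[OF slope_inv_le abs_ge_zero] in simp)
  have "L * slope_sum * level_lin g = mass_dev g + L * (\<Sum>p\<in>P. (g p - f p) / \<bar>m p\<bar>)"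
    unfolding level_lin_def using L_pos slope_sum_pos by (simp add: field_simps)
  also have "\<bar>\<dots>\<bar> \<le> \<bar>mass_dev g\<bar> + \<bar>L * (\<Sum>p\<in>P. (g p - f p) / \<bar>m p\<bar>)\<bar>" by (rule abs_triangle_ineq)
  also have "\<bar>L * (\<Sum>p\<in>P. (g p - f p) / \<bar>m p\<bar>)\<bar> = L * \<bar>\<Sum>p\<in>P. (g p - f p) / \<bar>m p\<bar>\<bar>"
    using L_pos by (simp add: abs_mult)
  also have "\<dots> \<le> L * A"
    unfolding A_def using L_pos by (intro mult_left_mono order_trans[OF sum_abs]) (simp_all add: abs_divide)
  finally have "\<bar>L * slope_sum * level_lin g\<bar> \<le> Bd + L * A"
    unfolding Bd_def by simp
  then have La: "L * (slope_sum * \<bar>level_lin g\<bar>) \<le> Bd + L * A"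
    unfolding abs_mult using L_pos slope_sum_pos by (simp add: mult.assoc)
  have "risk_lin g \<le> L * (\<Sum>p\<in>P. \<bar>g p - f p\<bar> / \<bar>m p\<bar> + 1 / \<bar>m p\<bar> * \<bar>level_lin g\<bar>)"
    unfolding risk_lin_def using L_pos
    by (intro mult_left_mono sum_mono) (auto simp: add_divide_distrib[symmetric] intro!: divide_right_mono abs_triangle_ineq4)
  also have "\<dots> = L * A + L * (slope_sum * \<bar>level_lin g\<bar>)"
    unfolding A_def slope_sum_def sum_distrib_right by (simp add: sum.distrib distrib_left)
  also have "\<dots> \<le> 2 * (L * A) + Bd" using La by linarith
  also have "L * A \<le> L * (be * (nP + E2))"
    using A Et_le pos(4) L_pos by (intro mult_left_mono order_trans[OF A]) auto
  also have "Bd \<le> 1 + Bd\<^sup>2" using sum_squares_bound[of Bd 1] dev_nonneg(1) by simp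
  finally have r: "risk_lin g \<le> 2 * L * be * nP + 1 + 2 * L * be * E2 + Bd\<^sup>2" by (simp add: algebra_simps)
  have r0: "0 \<le> risk_lin g" unfolding risk_lin_def using L_pos by (intro mult_nonneg_nonneg sum_nonneg) auto
  have k0: "0 \<le> (LINT x|lborel. f x * \<bar>H lev x\<bar>)" using f_nonneg by (intro integral_nonneg_AE AE_I2) simp
  have "\<bar>(LINT x|lborel. f x * \<bar>H lev x\<bar>) - risk_lin g\<bar> \<le> (LINT x|lborel. f x) + risk_lin g"
  proof -
    have "\<bar>k - r\<bar> \<le> i + r" if "0 \<le> k" "k \<le> i" "0 \<le> r" for k r i :: real using that by linarith
    from this[OF k0 risk_le_1 r0] show ?thesis .
  qed
  also have "\<dots> \<le> ((LINT x|lborel. f x) + 2 + 2 * L * be * nP) * 1 + 2 * L * be * E2 + Bd\<^sup>2"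
    using r by simp
  also have "\<dots> \<le> ((LINT x|lborel. f x) + 2 + 2 * L * be * nP) * (cG e1 * W) + 2 * L * be * W + W"
    using one W pos L_pos f_nonneg by (intro add_mono mult_left_mono add_nonneg_nonneg mult_nonneg_nonneg) auto
  finally show ?thesis unfolding W_def by (simp add: algebra_simps)
qed

text \<open>A level close to \<open>L\<close> costs the main terms, a distant one only
  \<open>rest_dev\<close>. Adding the two bounds removes the case distinction before expectations
  are taken.\<close>

theorem risk_linearisation:
  assumes e: "0 < e" "e \<le> e1 / 2" and R: "0 < R" "radius_factor * R \<le> d"
  shows "\<bar>density_mass f (sym_diff (hdr \<tau> g) {x. L \<le> f x}) - risk_lin g\<bar>
     \<le> main_factor * (main_dev e R + e1 * (Bd + Et + R)) + rest_factor e1 * rest_dev"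
proof -
  define U where "U = e1 * (Bd + Et + R)"
  have U0: "U \<ge> 0" unfolding U_def using dev_nonneg e1 R by simp
  have T: "main_dev e R > 0" "e \<le> main_dev e R" using main_dev_ge[OF e(1) R(1)] by auto
  let ?c = "((LINT x|lborel. f x) + 2 + 2 * L * be * nP) * cG e1 + 2 * L * be + 1"
  have c0: "?c \<ge> 0"
    using pos pos_e1[OF e1(1)] L_pos f_nonneg by (intro add_nonneg_nonneg mult_nonneg_nonneg) auto
  have LS: "L * slope_sum > 0" using L_pos slope_sum_pos by simp
  have m0: "main_factor * (main_dev e R + U) \<ge> 0" using pos T U0 by simp
  show ?thesis unfolding U_def[symmetric]
  proof (cases "\<bar>lev - L\<bar> < e1 / 2")
    case True
    have "\<bar>density_mass f (sym_diff (hdr \<tau> g) {x. L \<le> f x}) - risk_lin g\<bar> \<le> 2 * tot_err e R + L * slope_sum * e"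
      unfolding risk_eq by (rule risk_linear_close[OF e R True])
    also have "L * slope_sum * e \<le> L * slope_sum * (main_dev e R + U)"
      using LS T U0 by (intro mult_left_mono) auto
    also have "tot_err e R = cK4 * main_dev e R + cK5 * U + cA5 e1 * V"
      unfolding tot_err_def[OF e R True] U_def ..
    also have "cK4 * main_dev e R \<le> cK4 * (main_dev e R + U)" using pos U0 by (intro mult_left_mono) auto
    also have "cK5 * U \<le> cK5 * (main_dev e R + U)" using pos T by (intro mult_left_mono) auto
    also have "V \<le> rest_dev" unfolding rest_dev_def using dev_nonneg by simp
    finally have "\<bar>density_mass f (sym_diff (hdr \<tau> g) {x. L \<le> f x}) - risk_lin g\<bar> \<le>
       main_factor * (main_dev e R + U) + 2 * cA5 e1 * rest_dev"
      using pos_e1(2)[OF e1(1)] by (simp add: main_factor_def algebra_simps)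
    also have "2 * cA5 e1 * rest_dev \<le> rest_factor e1 * rest_dev"
      unfolding rest_factor_def using c0 rest_dev_nonneg by (intro mult_right_mono) auto
    finally show "\<bar>density_mass f (sym_diff (hdr \<tau> g) {x. L \<le> f x}) - risk_lin g\<bar> \<le> main_factor * (main_dev e R + U) + rest_factor e1 * rest_dev"
      by simp
  next
    case False
    then have "\<bar>density_mass f (sym_diff (hdr \<tau> g) {x. L \<le> f x}) - risk_lin g\<bar> \<le> ?c * rest_dev"
      unfolding risk_eq by (intro risk_linear_far) simp
    also have "\<dots> \<le> rest_factor e1 * rest_dev"
      unfolding rest_factor_def using rest_dev_nonneg pos_e1(2)[OF e1(1)] by (intro mult_right_mono) auto
    finally show "\<bar>density_mass f (sym_diff (hdr \<tau> g) {x. L \<le> f x}) - risk_lin g\<bar> \<le> main_factor * (main_dev e R + U) + rest_factor e1 * rest_dev"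
      using m0 by simp
  qed
qed

end

section \<open>Moments of the kernel density estimator\<close>

text \<open>Tonelli, with joint integrability obtained from the bound \<open>b\<close>
  itself.\<close>

lemma (in prob_space) expectation_integral_le:
  fixes F :: "'a \<Rightarrow> real \<Rightarrow> real"
  assumes F: "(\<lambda>(\<omega>, x). F \<omega> x) \<in> borel_measurable (M \<Otimes>\<^sub>M lborel)"
    and nonneg: "\<And>\<omega> x. F \<omega> x \<ge> 0"
    and int: "\<And>x. integrable M (\<lambda>\<omega>. F \<omega> x)" and le: "\<And>x. expectation (\<lambda>\<omega>. F \<omega> x) \<le> b x"
    and b: "integrable lborel b"
  shows "integrable M (\<lambda>\<omega>. LINT x|lborel. F \<omega> x)"
    and "expectation (\<lambda>\<omega>. LINT x|lborel. F \<omega> x) \<le> (LINT x|lborel. b x)"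
proof -
  interpret P: pair_sigma_finite M lborel ..
  have b0: "b x \<ge> 0" for x using le[of x] integral_nonneg_AE[of "\<lambda>\<omega>. F \<omega> x" M] nonneg by (meson AE_I2 order_trans)
  have "(\<integral>\<^sup>+p. ennreal (norm (case p of (\<omega>, x) \<Rightarrow> F \<omega> x)) \<partial>(M \<Otimes>\<^sub>M lborel)) =
    (\<integral>\<^sup>+x. (\<integral>\<^sup>+\<omega>. ennreal (norm (case (\<omega>, x) of (\<omega>, x) \<Rightarrow> F \<omega> x)) \<partial>M) \<partial>lborel)"
    by (rule P.nn_integral_snd[symmetric]) (use F in measurable)
  also have "\<dots> = (\<integral>\<^sup>+x. ennreal (expectation (\<lambda>\<omega>. F \<omega> x)) \<partial>lborel)"
    using nonneg by (intro nn_integral_cong) (simp add: nn_integral_eq_integral int)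
  also have "\<dots> \<le> (\<integral>\<^sup>+x. ennreal (b x) \<partial>lborel)"
    by (intro nn_integral_mono ennreal_leI le)
  also have "\<dots> < \<infinity>" using b b0 by (simp add: nn_integral_eq_integral)
  finally have I: "integrable (M \<Otimes>\<^sub>M lborel) (\<lambda>(\<omega>, x). F \<omega> x)"
    using F by (intro integrableI_bounded) auto
  show "integrable M (\<lambda>\<omega>. LINT x|lborel. F \<omega> x)"
    using P.integrable_fst'[OF I] by simp
  have I2: "integrable lborel (\<lambda>x. expectation (\<lambda>\<omega>. F \<omega> x))"
    using P.integrable_snd[OF I] by simp
  have "expectation (\<lambda>\<omega>. LINT x|lborel. F \<omega> x) = (LINT x|lborel. expectation (\<lambda>\<omega>. F \<omega> x))"
    using P.Fubini_integral[OF I] by simp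
  also have "\<dots> \<le> (LINT x|lborel. b x)" by (rule integral_mono[OF I2 b le])
  finally show "expectation (\<lambda>\<omega>. LINT x|lborel. F \<omega> x) \<le> (LINT x|lborel. b x)" .
qed

section \<open>Mean and variance of the kernel density estimator\<close>

locale kde_setting = prob_space M for M :: "'a measure" +
  fixes X :: "nat \<Rightarrow> 'a \<Rightarrow> real" and f K :: "real \<Rightarrow> real" and Cf CK LK :: real
  assumes f_int1: "has_bochner_integral lborel f 1" and f_nonneg: "\<And>x. f x \<ge> 0" and f_le: "\<And>x. f x \<le> Cf"
    and f_uc: "uniformly_continuous_on UNIV f"
    and K_nonneg: "\<And>x. K x \<ge> 0" and K_int1: "has_bochner_integral lborel K 1" and K_le: "\<And>x. K x \<le> CK"
    and K_lip: "\<And>x y. \<bar>K x - K y\<bar> \<le> LK * \<bar>x - y\<bar>"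
    and K_mean: "has_bochner_integral lborel (\<lambda>x. x * K x) 0" and K_second: "integrable lborel (\<lambda>x. x\<^sup>2 * K x)"
    and X_rv [measurable]: "\<And>i. X i \<in> borel_measurable M"
    and X_indep: "indep_vars (\<lambda>_. borel) X {1..}"
    and X_distr: "\<And>i. i \<ge> 1 \<Longrightarrow> distributed M lborel (X i) (\<lambda>t. ennreal (f t))"
begin

lemma f_borel [measurable]: "f \<in> borel_measurable borel"
  using f_int1 by (auto simp: has_bochner_integral_iff)

lemma K_borel [measurable]: "K \<in> borel_measurable borel"
  using K_int1 by (auto simp: has_bochner_integral_iff)

lemma f_int: "integrable lborel f" "(LINT x|lborel. f x) = 1"
  using f_int1 by (auto simp: has_bochner_integral_iff)

lemma K_int: "integrable lborel K" "(LINT x|lborel. K x) = 1"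
  using K_int1 by (auto simp: has_bochner_integral_iff)

lemma CK_nonneg: "CK \<ge> 0" using K_nonneg[of 0] K_le[of 0] by linarith

lemma Cf_nonneg: "Cf \<ge> 0" using f_nonneg[of 0] f_le[of 0] by linarith

lemma LK_nonneg: "LK \<ge> 0" using K_lip[of 1 0] by simp

definition emp :: "nat \<Rightarrow> (real \<Rightarrow> real) \<Rightarrow> 'a \<Rightarrow> real" where
  "emp n \<psi> \<omega> = (\<Sum>i=1..n. \<psi> (X i \<omega>)) / real n"

abbreviation pint :: "(real \<Rightarrow> real) \<Rightarrow> real" where
  "pint \<psi> \<equiv> LINT z|lborel. f z * \<psi> z"

lemma expectation_X: "i \<ge> 1 \<Longrightarrow> \<psi> \<in> borel_measurable borel \<Longrightarrow> expectation (\<lambda>\<omega>. \<psi> (X i \<omega>)) = pint \<psi>"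
  using distributed_integral[OF X_distr, of i \<psi>] f_nonneg by simp

lemma pint_bounded:
  assumes [measurable]: "\<psi> \<in> borel_measurable borel" and "\<And>z. \<bar>\<psi> z\<bar> \<le> C"
  shows "integrable lborel (\<lambda>z. f z * \<psi> z)" "\<bar>pint \<psi>\<bar> \<le> C"
proof -
  show i: "integrable lborel (\<lambda>z. f z * \<psi> z)"
  proof (rule Bochner_Integration.integrable_bound)
    show "integrable lborel (\<lambda>z. C * f z)" using f_int by simp
    show "AE z in lborel. norm (f z * \<psi> z) \<le> norm (C * f z)"
    proof (rule AE_I2)
      fix z
      have "\<bar>\<psi> z\<bar> \<le> \<bar>C\<bar>" using assms(2)[of z] by linarith
      then show "norm (f z * \<psi> z) \<le> norm (C * f z)"
        using f_nonneg[of z] by (simp add: abs_mult mult.commute[of _ "f z"] mult_left_mono)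
    qed
  qed measurable
  have "\<bar>pint \<psi>\<bar> \<le> (LINT z|lborel. \<bar>f z * \<psi> z\<bar>)" by (rule integral_abs_bound)
  also have "\<dots> \<le> (LINT z|lborel. f z * C)"
  proof (rule integral_mono)
    show "integrable lborel (\<lambda>z. \<bar>f z * \<psi> z\<bar>)" using i by (rule integrable_abs)
    show "integrable lborel (\<lambda>z. f z * C)" using f_int by simp
    show "\<bar>f z * \<psi> z\<bar> \<le> f z * C" for z
      using mult_left_mono[OF assms(2) f_nonneg, of z z] f_nonneg[of z] by (simp add: abs_mult)
  qed
  finally show "\<bar>pint \<psi>\<bar> \<le> C" using f_int by simp
qed

lemma centred:
  assumes [measurable]: "\<psi> \<in> borel_measurable borel" and bd: "\<And>z. \<bar>\<psi> z\<bar> \<le> C"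
  defines "Y \<equiv> \<lambda>i \<omega>. \<psi> (X i \<omega>) - pint \<psi>"
  shows "indep_vars (\<lambda>_. borel) Y {1..n}" "\<bar>Y i \<omega>\<bar> \<le> 2 * C"
    "i \<in> {1..n} \<Longrightarrow> expectation (Y i) = 0"
    "i \<in> {1..n} \<Longrightarrow> expectation (\<lambda>\<omega>. (Y i \<omega>)\<^sup>2) = pint (\<lambda>z. (\<psi> z)\<^sup>2) - (pint \<psi>)\<^sup>2"
    "integrable M (\<lambda>\<omega>. (Y i \<omega>)\<^sup>2)"
proof -
  have "indep_vars (\<lambda>_. borel) X {1..n}" by (rule indep_vars_subset[OF X_indep]) auto
  then show "indep_vars (\<lambda>_. borel) Y {1..n}"
    unfolding Y_def by (rule indep_vars_compose2[where Y="\<lambda>_ z. \<psi> z - pint \<psi>"]) simp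
  have p: "\<bar>pint \<psi>\<bar> \<le> C" by (rule pint_bounded(2)) (use bd in auto)
  show Yb: "\<bar>Y i \<omega>\<bar> \<le> 2 * C" for i \<omega> using bd[of "X i \<omega>"] p unfolding Y_def by linarith
  have Ym[measurable]: "Y i \<in> borel_measurable M" for i unfolding Y_def by measurable
  have i1: "integrable M (\<lambda>\<omega>. \<psi> (X i \<omega>))" for i
    using bd by (intro integrable_const_bound[where B=C]) auto
  have i2: "integrable M (\<lambda>\<omega>. (\<psi> (X i \<omega>))\<^sup>2)" for i
  proof (rule integrable_const_bound[where B="C\<^sup>2"])
    have "(\<psi> (X i \<omega>))\<^sup>2 \<le> C\<^sup>2" for \<omega>
      using bd[of "X i \<omega>"] by (intro abs_le_square_iff[THEN iffD1]) linarith
    then show "AE \<omega> in M. norm ((\<psi> (X i \<omega>))\<^sup>2) \<le> C\<^sup>2" by simp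
  qed measurable
  show "integrable M (\<lambda>\<omega>. (Y i \<omega>)\<^sup>2)"
    unfolding Y_def power2_diff using i1 i2 by simp
  {
    assume i: "i \<in> {1..n}"
    have e1: "expectation (\<lambda>\<omega>. \<psi> (X i \<omega>)) = pint \<psi>" using i by (intro expectation_X) auto
    have e2: "expectation (\<lambda>\<omega>. (\<psi> (X i \<omega>))\<^sup>2) = pint (\<lambda>z. (\<psi> z)\<^sup>2)" using i by (intro expectation_X) auto
    show "expectation (Y i) = 0" unfolding Y_def using e1 i1[of i] by (simp add: prob_space)
    show "expectation (\<lambda>\<omega>. (Y i \<omega>)\<^sup>2) = pint (\<lambda>z. (\<psi> z)\<^sup>2) - (pint \<psi>)\<^sup>2"
      unfolding Y_def power2_diff using e1 e2 i1[of i] i2[of i] by (simp add: prob_space power2_eq_square algebra_simps)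
  }
qed

lemma emp_diff_eq: "n > 0 \<Longrightarrow> emp n \<psi> \<omega> - pint \<psi> = (\<Sum>i=1..n. \<psi> (X i \<omega>) - pint \<psi>) / real n"
  unfolding emp_def by (simp add: sum_subtractf field_simps)

lemma emp_variance:
  assumes n: "n > 0" and m: "\<psi> \<in> borel_measurable borel" and bd: "\<And>z. \<bar>\<psi> z\<bar> \<le> C"
  shows "integrable M (\<lambda>\<omega>. (emp n \<psi> \<omega> - pint \<psi>)\<^sup>2)"
    and "expectation (\<lambda>\<omega>. (emp n \<psi> \<omega> - pint \<psi>)\<^sup>2) \<le> pint (\<lambda>z. (\<psi> z)\<^sup>2) / real n"
proof -
  note c = centred[OF m bd]
  have s: "integrable M (\<lambda>\<omega>. (\<Sum>i\<in>{1..n}. \<psi> (X i \<omega>) - pint \<psi>)\<^sup>2)"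
    "expectation (\<lambda>\<omega>. (\<Sum>i\<in>{1..n}. \<psi> (X i \<omega>) - pint \<psi>)\<^sup>2) = (\<Sum>i\<in>{1..n}. expectation (\<lambda>\<omega>. (\<psi> (X i \<omega>) - pint \<psi>)\<^sup>2))"
    using expectation_sum_square_indep[OF _ c(1), of n] c(3,5) by auto
  show "integrable M (\<lambda>\<omega>. (emp n \<psi> \<omega> - pint \<psi>)\<^sup>2)"
    unfolding emp_diff_eq[OF n] power_divide using s(1) by simp
  have "expectation (\<lambda>\<omega>. (emp n \<psi> \<omega> - pint \<psi>)\<^sup>2) = (\<Sum>i\<in>{1..n}. expectation (\<lambda>\<omega>. (\<psi> (X i \<omega>) - pint \<psi>)\<^sup>2)) / (real n)\<^sup>2"
    unfolding emp_diff_eq[OF n] power_divide using s by simp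
  also have "\<dots> = (\<Sum>i\<in>{1..n}. pint (\<lambda>z. (\<psi> z)\<^sup>2) - (pint \<psi>)\<^sup>2) / (real n)\<^sup>2"
    using c(4)[of _ n] by (intro arg_cong2[where f="(/)"] sum.cong) auto
  also have "\<dots> = (pint (\<lambda>z. (\<psi> z)\<^sup>2) - (pint \<psi>)\<^sup>2) / real n"
    using n by (simp add: power2_eq_square)
  also have "\<dots> \<le> pint (\<lambda>z. (\<psi> z)\<^sup>2) / real n" by (intro divide_right_mono) auto
  finally show "expectation (\<lambda>\<omega>. (emp n \<psi> \<omega> - pint \<psi>)\<^sup>2) \<le> pint (\<lambda>z. (\<psi> z)\<^sup>2) / real n" .
qed

definition psi :: "real \<Rightarrow> real \<Rightarrow> real \<Rightarrow> real" where
  "psi h x z = K ((x - z) / h) / h"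

text \<open>The mean of \<open>fhat n h\<close> at \<open>x\<close>, the same for every
  \<open>n > 0\<close>.\<close>

definition fbar :: "real \<Rightarrow> real \<Rightarrow> real" where
  "fbar h x = pint (psi h x)"

abbreviation fhat :: "nat \<Rightarrow> real \<Rightarrow> 'a \<Rightarrow> real \<Rightarrow> real" where
  "fhat n h \<omega> \<equiv> kde K (\<lambda>i. X i \<omega>) n h"

lemma fhat_eq: "fhat n h \<omega> x = emp n (psi h x) \<omega>"
  unfolding kde_def emp_def psi_def by (simp add: sum_divide_distrib[symmetric] field_simps)

lemma psi_borel [measurable]: "psi h x \<in> borel_measurable borel"
  unfolding psi_def[abs_def] by measurable

context
  fixes h :: real
  assumes h: "h > 0"
begin

lemma psi_bounds: "0 \<le> psi h x z" "psi h x z \<le> CK / h" "\<bar>psi h x z\<bar> \<le> CK / h"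
  using h K_nonneg K_le by (auto simp: psi_def divide_right_mono)

lemma kernel_substitution:
  "(LINT z|lborel. psi h x z * q z) = (LINT w|lborel. K w * q (x - h * w))"
proof -
  have "(LINT z|lborel. psi h x z * q z) = \<bar>-h\<bar> *\<^sub>R (LINT w|lborel. psi h x (x + (-h) * w) * q (x + (-h) * w))"
    using h by (intro lborel_integral_real_affine) simp
  also have "\<dots> = (LINT w|lborel. h * (psi h x (x + (-h) * w) * q (x + (-h) * w)))"
    using h by simp
  also have "\<dots> = (LINT w|lborel. K w * q (x - h * w))"
    using h by (intro Bochner_Integration.integral_cong) (auto simp: psi_def)
  finally show ?thesis .
qed

lemma psi_int_z: "has_bochner_integral lborel (psi h x) 1"
proof -
  have "integrable lborel (\<lambda>z. K (x / h + (-1/h) * z))"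
    using h by (intro lborel_integrable_real_affine K_int) simp
  then have "integrable lborel (psi h x)"
    unfolding psi_def[abs_def] by (simp add: diff_divide_distrib)
  moreover have "(LINT z|lborel. psi h x z) = 1"
    using kernel_substitution[of x "\<lambda>_. 1"] K_int by simp
  ultimately show ?thesis by (simp add: has_bochner_integral_iff)
qed

lemma psi_int_x: "has_bochner_integral lborel (\<lambda>x. psi h x z) 1"
proof -
  have "has_bochner_integral lborel (\<lambda>x. K (- z / h + (1/h) * x)) (1 /\<^sub>R \<bar>1/h\<bar>)"
    using h K_int1 by (subst lborel_has_bochner_integral_real_affine_iff[symmetric]) auto
  then have "has_bochner_integral lborel (\<lambda>x. K (- z / h + (1/h) * x) / h) ((1 /\<^sub>R \<bar>1/h\<bar>) / h)"
    by (intro has_bochner_integral_divide_zero) auto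
  then show ?thesis using h by (simp add: psi_def diff_divide_distrib)
qed

lemma fbar_eq: "fbar h x = (LINT w|lborel. K w * f (x - h * w))"
  unfolding fbar_def using kernel_substitution[of x f] by (simp add: mult.commute)

lemma fbar_nonneg: "fbar h x \<ge> 0"
  unfolding fbar_def using psi_bounds f_nonneg by (intro integral_nonneg_AE AE_I2) simp

lemma psi_joint [measurable]: "(\<lambda>(x, z). psi h x z) \<in> borel_measurable (borel \<Otimes>\<^sub>M borel)"
  unfolding psi_def by measurable

lemma psi_f_product: "integrable (lborel \<Otimes>\<^sub>M lborel) (\<lambda>(z, x). f z * psi h x z)"
proof -
  have m: "(\<lambda>(z, x). f z * psi h x z) \<in> borel_measurable (lborel \<Otimes>\<^sub>M lborel)"
    unfolding psi_def by measurable
  have i: "integrable lborel (\<lambda>x. f z * psi h x z)" for z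
    using psi_int_x[of z] by (simp add: has_bochner_integral_iff)
  have e: "(LINT x|lborel. norm (f z * psi h x z)) = f z" for z
    using psi_int_x[of z] f_nonneg[of z] psi_bounds(1) by (simp add: has_bochner_integral_iff abs_mult)
  show ?thesis
    by (rule lborel_pair.Fubini_integrable[OF m]) (simp_all only: e f_int i split_conv AE_I2 eventually_True)
qed

lemma fbar_int: "has_bochner_integral lborel (fbar h) 1"
proof -
  have "integrable lborel (\<lambda>x. LINT z|lborel. f z * psi h x z)"
    using lborel_pair.integrable_snd[OF psi_f_product] by simp
  moreover have "(LINT x|lborel. LINT z|lborel. f z * psi h x z) = (LINT z|lborel. LINT x|lborel. f z * psi h x z)"
    using lborel_pair.Fubini_integral[OF psi_f_product] by simp
  moreover have "(LINT z|lborel. LINT x|lborel. f z * psi h x z) = 1"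
    using psi_int_x f_int by (simp add: has_bochner_integral_iff)
  ultimately show ?thesis unfolding fbar_def[abs_def] by (simp add: has_bochner_integral_iff)
qed

lemma psi_square: "pint (\<lambda>z. (psi h x z)\<^sup>2) \<le> CK / h * fbar h x" "fbar h x \<le> Cf"
proof -
  have i: "integrable lborel (\<lambda>z. f z * psi h x z)" "integrable lborel (\<lambda>z. f z * (psi h x z)\<^sup>2)"
    by (rule pint_bounded(1)[where C="CK / h"], simp, rule psi_bounds,
        rule pint_bounded(1)[where C="(CK / h)\<^sup>2"], simp, simp add: power_mono psi_bounds)
  have "pint (\<lambda>z. (psi h x z)\<^sup>2) \<le> (LINT z|lborel. CK / h * (f z * psi h x z))"
  proof (rule integral_mono)
    fix z
    have "psi h x z * psi h x z \<le> CK / h * psi h x z" using psi_bounds by (intro mult_right_mono) auto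
    then have "f z * (psi h x z * psi h x z) \<le> f z * (CK / h * psi h x z)" using f_nonneg by (intro mult_left_mono) auto
    then show "f z * (psi h x z)\<^sup>2 \<le> CK / h * (f z * psi h x z)" by (simp add: power2_eq_square mult_ac)
  qed (use i in auto)
  then show "pint (\<lambda>z. (psi h x z)\<^sup>2) \<le> CK / h * fbar h x" by (simp add: fbar_def)
  have "fbar h x \<le> (LINT z|lborel. Cf * psi h x z)"
    unfolding fbar_def using i psi_int_z f_le psi_bounds by (intro integral_mono mult_right_mono) (auto simp: has_bochner_integral_iff)
  then show "fbar h x \<le> Cf" using psi_int_z by (simp add: has_bochner_integral_iff)
qed

text \<open>One factor of the square is bounded by the Lipschitz constant, the other by
  \<open>psi h x z + psi h p z\<close>, whose integral is 2. The result
  \<open>\<bar>x - p\<bar> / h^2\<close>, in place of \<open>\<bar>x - p\<bar>^2 / h^4\<close>, is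
  enough for distances small compared with \<open>h\<close>.\<close>

lemma psi_incr_square: "pint (\<lambda>z. (psi h x z - psi h p z)\<^sup>2) \<le> 2 * Cf * LK * \<bar>x - p\<bar> / h\<^sup>2"
proof -
  define B where "B = LK * \<bar>x - p\<bar> / h\<^sup>2"
  have d: "\<bar>psi h x z - psi h p z\<bar> \<le> B" for z
  proof -
    have "\<bar>psi h x z - psi h p z\<bar> = \<bar>K ((x - z) / h) - K ((p - z) / h)\<bar> / h"
      using h by (simp add: psi_def diff_divide_distrib[symmetric] abs_divide)
    also have "\<dots> \<le> (LK * \<bar>(x - z) / h - (p - z) / h\<bar>) / h"
      using h K_lip by (intro divide_right_mono) auto
    also have "(x - z) / h - (p - z) / h = (x - p) / h" by (simp add: diff_divide_distrib)
    also have "(LK * \<bar>(x - p) / h\<bar>) / h = B" using h by (simp add: B_def abs_divide power2_eq_square)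
    finally show ?thesis .
  qed
  have i: "integrable lborel (\<lambda>z. f z * (psi h x z - psi h p z)\<^sup>2)"
  proof (rule pint_bounded(1)[where C="B\<^sup>2"])
    have "(psi h x z - psi h p z)\<^sup>2 \<le> B\<^sup>2" for z
      using d[of z] by (intro abs_le_square_iff[THEN iffD1]) linarith
    then show "\<bar>(psi h x z - psi h p z)\<^sup>2\<bar> \<le> B\<^sup>2" for z by simp
  qed measurable
  have "pint (\<lambda>z. (psi h x z - psi h p z)\<^sup>2) \<le> (LINT z|lborel. Cf * B * (psi h x z + psi h p z))"
  proof (rule integral_mono[OF i])
    show "integrable lborel (\<lambda>z. Cf * B * (psi h x z + psi h p z))"
      using psi_int_z by (simp add: has_bochner_integral_iff)
    fix z
    have "(psi h x z - psi h p z)\<^sup>2 = \<bar>psi h x z - psi h p z\<bar> * \<bar>psi h x z - psi h p z\<bar>" by (simp add: power2_eq_square)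
    also have "\<dots> \<le> B * (psi h x z + psi h p z)"
      using d[of z] psi_bounds(1)[of x z] psi_bounds(1)[of p z] by (intro mult_mono) auto
    finally have "f z * (psi h x z - psi h p z)\<^sup>2 \<le> Cf * (B * (psi h x z + psi h p z))"
      using f_nonneg f_le Cf_nonneg by (intro mult_mono) auto
    then show "f z * (psi h x z - psi h p z)\<^sup>2 \<le> Cf * B * (psi h x z + psi h p z)" by (simp add: mult.assoc)
  qed
  also have "\<dots> = Cf * B * 2" using psi_int_z by (simp add: has_bochner_integral_iff)
  finally show ?thesis by (simp add: B_def mult_ac)
qed

lemma fhat_variance:
  assumes n: "n > 0"
  shows "integrable M (\<lambda>\<omega>. (fhat n h \<omega> x - fbar h x)\<^sup>2)"
    and "expectation (\<lambda>\<omega>. (fhat n h \<omega> x - fbar h x)\<^sup>2) \<le> CK / (real n * h) * fbar h x"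
    and "expectation (\<lambda>\<omega>. (fhat n h \<omega> x - fbar h x)\<^sup>2) \<le> CK * Cf / (real n * h)"
proof -
  note v = emp_variance[OF n psi_borel psi_bounds(3), of x, folded fbar_def fhat_eq]
  show "integrable M (\<lambda>\<omega>. (fhat n h \<omega> x - fbar h x)\<^sup>2)" by (rule v(1))
  have "expectation (\<lambda>\<omega>. (fhat n h \<omega> x - fbar h x)\<^sup>2) \<le> pint (\<lambda>z. (psi h x z)\<^sup>2) / real n" by (rule v(2))
  also have "\<dots> \<le> (CK / h * fbar h x) / real n" using psi_square by (intro divide_right_mono) auto
  finally show 1: "expectation (\<lambda>\<omega>. (fhat n h \<omega> x - fbar h x)\<^sup>2) \<le> CK / (real n * h) * fbar h x" by (simp add: mult.commute)
  also have "\<dots> \<le> CK / (real n * h) * Cf" using psi_square(2) CK_nonneg h by (intro mult_left_mono) auto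
  finally show "expectation (\<lambda>\<omega>. (fhat n h \<omega> x - fbar h x)\<^sup>2) \<le> CK * Cf / (real n * h)" by simp
qed

lemma fhat_incr_variance:
  fixes x p :: real
  assumes n: "n > 0"
  defines "D \<equiv> \<lambda>\<omega>. (fhat n h \<omega> x - fbar h x) - (fhat n h \<omega> p - fbar h p)"
  shows "integrable M (\<lambda>\<omega>. (D \<omega>)\<^sup>2)"
    and "expectation (\<lambda>\<omega>. (D \<omega>)\<^sup>2) \<le> 2 * Cf * LK * \<bar>x - p\<bar> / (real n * h\<^sup>2)"
proof -
  let ?q = "\<lambda>z. psi h x z - psi h p z"
  have bd: "\<bar>?q z\<bar> \<le> CK / h" for z using psi_bounds[of x z] psi_bounds[of p z] by linarith
  have i: "integrable lborel (\<lambda>z. f z * psi h x z)" for x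
    by (rule pint_bounded(1)[where C="CK / h"], simp, rule psi_bounds)
  have eq: "D \<omega> = emp n ?q \<omega> - pint ?q" for \<omega>
    unfolding D_def fhat_eq fbar_def emp_def right_diff_distrib sum_subtractf diff_divide_distrib using i by simp
  have m: "?q \<in> borel_measurable borel" by simp
  note v = emp_variance[OF n m bd, folded eq]
  show "integrable M (\<lambda>\<omega>. (D \<omega>)\<^sup>2)" by (rule v(1))
  have "expectation (\<lambda>\<omega>. (D \<omega>)\<^sup>2) \<le> pint (\<lambda>z. (?q z)\<^sup>2) / real n" by (rule v(2))
  also have "\<dots> \<le> (2 * Cf * LK * \<bar>x - p\<bar> / h\<^sup>2) / real n" using psi_incr_square by (intro divide_right_mono) auto
  finally show "expectation (\<lambda>\<omega>. (D \<omega>)\<^sup>2) \<le> 2 * Cf * LK * \<bar>x - p\<bar> / (real n * h\<^sup>2)" by (simp add: mult_ac)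
qed

lemma fhat_int: "n > 0 \<Longrightarrow> has_bochner_integral lborel (fhat n h \<omega>) 1"
proof -
  assume n: "n > 0"
  have "has_bochner_integral lborel (\<lambda>x. (\<Sum>i=1..n. psi h x (X i \<omega>)) / real n) ((\<Sum>i=1..n. 1) / real n)"
    using n by (intro has_bochner_integral_divide_zero has_bochner_integral_sum psi_int_x)
  then show ?thesis using n by (simp add: fhat_eq[abs_def] emp_def)
qed

lemma fhat_bounds: "n > 0 \<Longrightarrow> 0 \<le> fhat n h \<omega> x" "n > 0 \<Longrightarrow> fhat n h \<omega> x \<le> CK / h"
proof -
  assume n: "n > 0"
  show "0 \<le> fhat n h \<omega> x" unfolding fhat_eq emp_def using psi_bounds by (intro divide_nonneg_nonneg sum_nonneg) auto
  have "(\<Sum>i=1..n. psi h x (X i \<omega>)) \<le> (\<Sum>i=1..n. CK / h)" by (intro sum_mono psi_bounds)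
  then show "fhat n h \<omega> x \<le> CK / h" unfolding fhat_eq emp_def using n by (simp add: field_simps)
qed

lemma fhat_joint [measurable]: "(\<lambda>(\<omega>, x). fhat n h \<omega> x) \<in> borel_measurable (M \<Otimes>\<^sub>M borel)"
  unfolding kde_def by measurable

lemma fhat_dev_square_int:
  assumes n: "n > 0"
  shows "integrable lborel (\<lambda>x. (fhat n h \<omega> x - fbar h x)\<^sup>2)"
proof (rule Bochner_Integration.integrable_bound)
  show "integrable lborel (\<lambda>x. (CK / h + Cf) * (fhat n h \<omega> x + fbar h x))"
    using fhat_int[OF n] fbar_int by (simp add: has_bochner_integral_iff)
  have [measurable]: "fhat n h \<omega> \<in> borel_measurable borel" "fbar h \<in> borel_measurable borel"
    using fhat_int[OF n, of \<omega>] fbar_int by (auto simp: has_bochner_integral_iff)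
  show "(\<lambda>x. (fhat n h \<omega> x - fbar h x)\<^sup>2) \<in> borel_measurable lborel" by measurable
  show "AE x in lborel. norm ((fhat n h \<omega> x - fbar h x)\<^sup>2) \<le> norm ((CK / h + Cf) * (fhat n h \<omega> x + fbar h x))"
  proof (rule AE_I2)
    fix x
    note b = fhat_bounds[OF n, of \<omega> x] fbar_nonneg[of x] psi_square(2)[of x]
    have "\<bar>fhat n h \<omega> x - fbar h x\<bar> * \<bar>fhat n h \<omega> x - fbar h x\<bar> \<le> (CK / h + Cf) * (fhat n h \<omega> x + fbar h x)"
      using b by (intro mult_mono) auto
    then show "norm ((fhat n h \<omega> x - fbar h x)\<^sup>2) \<le> norm ((CK / h + Cf) * (fhat n h \<omega> x + fbar h x))"
      by (simp add: power2_eq_square)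
  qed
qed

text \<open>Keeping \<open>fbar h x\<close> as a factor of the pointwise variance bound makes this
  bound integrable over the whole line.\<close>

lemma fhat_ise:
  assumes n: "n > 0"
  shows "integrable M (\<lambda>\<omega>. LINT x|lborel. (fhat n h \<omega> x - fbar h x)\<^sup>2)"
    and "expectation (\<lambda>\<omega>. LINT x|lborel. (fhat n h \<omega> x - fbar h x)\<^sup>2) \<le> CK / (real n * h)"
proof -
  have [measurable]: "fbar h \<in> borel_measurable borel" using fbar_int by (auto simp: has_bochner_integral_iff)
  have m: "(\<lambda>(\<omega>, x). (fhat n h \<omega> x - fbar h x)\<^sup>2) \<in> borel_measurable (M \<Otimes>\<^sub>M lborel)"
    unfolding kde_def by measurable
  have b: "integrable lborel (\<lambda>x. CK / (real n * h) * fbar h x)" using fbar_int by (simp add: has_bochner_integral_iff)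
  note e = expectation_integral_le[OF m zero_le_power2 fhat_variance(1)[OF n] fhat_variance(2)[OF n] b]
  show "integrable M (\<lambda>\<omega>. LINT x|lborel. (fhat n h \<omega> x - fbar h x)\<^sup>2)" by (rule e(1))
  show "expectation (\<lambda>\<omega>. LINT x|lborel. (fhat n h \<omega> x - fbar h x)\<^sup>2) \<le> CK / (real n * h)"
    using e(2) fbar_int by (simp add: has_bochner_integral_iff)
qed

text \<open>The mass of the estimator on \<open>A\<close> is an empirical mean of \<open>Q\<close>,
  a function with values in \<open>[0, 1]\<close>, so its variance has no factor
  \<open>1 / h\<close>.\<close>

lemma fhat_mass_variance:
  assumes n: "n > 0" and A: "A \<in> sets borel"
  defines "D \<equiv> \<lambda>\<omega>. LINT x|lborel. (fhat n h \<omega> x - fbar h x) * indicator A x"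
  shows "integrable M (\<lambda>\<omega>. (D \<omega>)\<^sup>2)" and "expectation (\<lambda>\<omega>. (D \<omega>)\<^sup>2) \<le> 1 / real n"
proof -
  define Q where "Q z = (LINT x|lborel. psi h x z * indicator A x)" for z
  have i: "integrable lborel (\<lambda>x. psi h x z * indicator A x)" for z
    using psi_int_x[of z] A by (intro integrable_mult_indicator_real) (auto simp: has_bochner_integral_iff)
  have Q0: "0 \<le> Q z" for z unfolding Q_def using psi_bounds by (intro integral_nonneg_AE AE_I2) simp
  have q: "Q z \<le> (LINT x|lborel. psi h x z)" for z
    unfolding Q_def using i psi_int_x psi_bounds by (intro integral_mono) (auto simp: has_bochner_integral_iff indicator_def)
  have Q1: "Q z \<le> 1" for z using q[of z] psi_int_x[of z] by (simp add: has_bochner_integral_iff)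
  have mQ: "Q \<in> borel_measurable borel"
  proof -
    have "(\<lambda>(z, x). psi h x z * indicator A x) \<in> borel_measurable (borel \<Otimes>\<^sub>M lborel)"
      unfolding psi_def using A by measurable
    then show ?thesis unfolding Q_def[abs_def] by (rule lborel.borel_measurable_lebesgue_integral)
  qed
  have PI: "integrable (lborel \<Otimes>\<^sub>M lborel) (\<lambda>(z, x). f z * psi h x z * indicator A x)"
  proof -
    have "snd -` A \<inter> space (lborel \<Otimes>\<^sub>M lborel) \<in> sets (lborel \<Otimes>\<^sub>M lborel :: (real \<times> real) measure)"
      by (rule measurable_sets[OF measurable_snd]) (use A in simp)
    from integrable_mult_indicator_real[OF psi_f_product this]
    show ?thesis by (simp add: case_prod_beta' indicator_def space_pair_measure)
  qed
  have fb: "(LINT x|lborel. fbar h x * indicator A x) = pint Q"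
  proof -
    have "(LINT x|lborel. LINT z|lborel. f z * psi h x z * indicator A x) = (LINT z|lborel. LINT x|lborel. f z * psi h x z * indicator A x)"
      using lborel_pair.Fubini_integral[OF PI] by simp
    moreover have "(LINT z|lborel. f z * psi h x z * indicator A x) = fbar h x * indicator A x" for x
      unfolding fbar_def by (rule integral_mult_left_zero)
    moreover have "(LINT x|lborel. f z * psi h x z * indicator A x) = f z * Q z" for z
      unfolding Q_def mult.assoc by (rule integral_mult_right_zero)
    ultimately show ?thesis by (simp only:)
  qed
  have eq: "D \<omega> = emp n Q \<omega> - pint Q" for \<omega>
  proof -
    have "integrable lborel (fhat n h \<omega>)" "integrable lborel (fbar h)"
      using fhat_int[OF n, of \<omega>] fbar_int by (simp_all only: has_bochner_integral_iff)
    then have "integrable lborel (\<lambda>x. fhat n h \<omega> x * indicator A x)" "integrable lborel (\<lambda>x. fbar h x * indicator A x)"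
      using A by (intro integrable_mult_indicator_real; simp)+
    then have "D \<omega> = (LINT x|lborel. fhat n h \<omega> x * indicator A x) - pint Q"
      unfolding D_def left_diff_distrib fb[symmetric] by simp
    also have "(LINT x|lborel. fhat n h \<omega> x * indicator A x) = (LINT x|lborel. (\<Sum>i=1..n. psi h x (X i \<omega>) * indicator A x) / real n)"
      by (simp add: fhat_eq emp_def sum_distrib_right)
    also have "\<dots> = emp n Q \<omega>" unfolding emp_def Q_def
      by (subst integral_divide_zero, subst Bochner_Integration.integral_sum) (rule i, rule refl)
    finally show ?thesis .
  qed
  have Qb: "\<bar>Q z\<bar> \<le> 1" for z using Q0[of z] Q1[of z] by simp
  note v = emp_variance[OF n mQ Qb, folded eq]
  show "integrable M (\<lambda>\<omega>. (D \<omega>)\<^sup>2)" by (rule v(1))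
  have "\<bar>pint (\<lambda>z. (Q z)\<^sup>2)\<bar> \<le> 1"
    by (rule pint_bounded(2)) (use mQ Q0 Q1 in \<open>auto simp: power_le_one\<close>)
  then have "pint (\<lambda>z. (Q z)\<^sup>2) / real n \<le> 1 / real n" by (intro divide_right_mono) auto
  with v(2) show "expectation (\<lambda>\<omega>. (D \<omega>)\<^sup>2) \<le> 1 / real n" by linarith
qed

end

end

text \<open>The abbreviations used so far are tied to one fixed \<open>g\<close>; unfolded, the
  bound can be instantiated at the random \<open>g\<close> of each outcome.\<close>

lemma (in level_crossings_estimate) risk_linearisation_explicit:
  assumes e: "0 < e" "e \<le> e1 / 2" and R: "0 < R" "radius_factor * R \<le> d"
  shows "\<bar>density_mass f (sym_diff (hdr \<tau> g) {x. L \<le> f x}) - risk_lin g\<bar>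
     \<le> main_factor * (e + (\<Sum>p\<in>P. inc_dev g p (radius_factor * R)) / e\<^sup>2 + (\<Sum>p\<in>P. ann_dev g p R)
            + ((mass_dev g)\<^sup>2 + (\<Sum>p\<in>P. (g p - f p)\<^sup>2)) / R
            + e1 * (\<bar>mass_dev g\<bar> + (\<Sum>p\<in>P. \<bar>g p - f p\<bar>) + R))
        + rest_factor e1 * ((LINT x|lborel. (g x - fb x)\<^sup>2) + (mass_dev g)\<^sup>2 + (\<Sum>p\<in>P. (g p - f p)\<^sup>2)
            + (\<Sum>p\<in>P. ann_dev g p (fixed_radius e1)))"
  using risk_linearisation[OF assms]
  unfolding main_dev_def rest_dev_def NS_def E2_def Et_def Bd_def V_def by simp

lemma annulus_inverse_square_integral:
  fixes p R :: real
  assumes R: "R > 0"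
  shows "has_bochner_integral lborel (\<lambda>x. indicator {x. R < \<bar>x - p\<bar>} x * (1 / (x - p)\<^sup>2)) (2 / R)"
proof -
  have "(\<integral>\<^sup>+x. ennreal (1 / x\<^sup>2) * indicator {R..} x \<partial>lborel) = ennreal (- 0 - (- inverse R))"
  proof (rule nn_integral_FTC_atLeast)
    show "((\<lambda>x::real. - inverse x) \<longlongrightarrow> - 0) at_top"
      by (intro tendsto_minus tendsto_inverse_0_at_top filterlim_ident)
    show "((\<lambda>x. - inverse x) has_real_derivative 1 / x\<^sup>2) (at x)" if "R \<le> x" for x
      using that R by (auto intro!: derivative_eq_intros simp: power2_eq_square field_simps)
  qed auto
  then have n: "(\<integral>\<^sup>+x. ennreal (indicator {R..} x * (1 / x\<^sup>2)) \<partial>lborel) = ennreal (1 / R)"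
    by (subst (asm) nn_integral_cong[where v="\<lambda>x. ennreal (indicator {R..} x * (1 / x\<^sup>2))"]) (auto simp: indicator_def inverse_eq_divide)
  have r: "has_bochner_integral lborel (\<lambda>x. indicator {R..} x * (1 / x\<^sup>2)) (1 / R)"
    by (rule has_bochner_integral_nn_integral[OF _ _ _ n]) (use R in auto)
  have r1: "has_bochner_integral lborel (\<lambda>x. indicator {R..} (-p + 1 * x) * (1 / (-p + 1 * x)\<^sup>2)) ((1 / R) /\<^sub>R \<bar>1\<bar>)"
    using r by (subst lborel_has_bochner_integral_real_affine_iff[symmetric]) auto
  have r2: "has_bochner_integral lborel (\<lambda>x. indicator {R..} (p + (-1) * x) * (1 / (p + (-1) * x)\<^sup>2)) ((1 / R) /\<^sub>R \<bar>-1\<bar>)"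
    using r by (subst lborel_has_bochner_integral_real_affine_iff[symmetric]) auto
  have s: "has_bochner_integral lborel (\<lambda>x. indicator {R..} (-p + 1 * x) * (1 / (-p + 1 * x)\<^sup>2) + indicator {R..} (p + (-1) * x) * (1 / (p + (-1) * x)\<^sup>2)) (2 / R)"
    using has_bochner_integral_add[OF r1 r2] by simp
  \<comment> \<open>The two closed half-lines and the open exterior differ in the points
    \<open>p + R\<close> and \<open>p - R\<close>.\<close>
  have ae: "AE x in lborel. indicator {R..} (-p + 1 * x) * (1 / (-p + 1 * x)\<^sup>2) + indicator {R..} (p + (-1) * x) * (1 / (p + (-1) * x)\<^sup>2)
      = indicator {x. R < \<bar>x - p\<bar>} x * (1 / (x - p)\<^sup>2)"
    using AE_lborel_singleton[of "p + R"] AE_lborel_singleton[of "p - R"]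
  proof eventually_elim
    case (elim x)
    have sq: "(p - x)\<^sup>2 = (x - p)\<^sup>2" by (rule power2_commute)
    consider "R < x - p" | "R < p - x" | "\<bar>x - p\<bar> < R" using elim by (smt (verit))
    then show ?case using R sq by cases (auto simp: indicator_def)
  qed
  show ?thesis
    by (rule has_bochner_integral_cong_AE[THEN iffD1, OF _ _ ae s]) measurable
qed

section \<open>Bias of the estimator\<close>

context kde_setting
begin

definition mu2 :: real where "mu2 = (LINT x|lborel. x\<^sup>2 * K x)"

lemma mu2_nonneg: "mu2 \<ge> 0" unfolding mu2_def using K_nonneg by simp

lemma K_tail_second:
  assumes e: "e > 0"
  shows "\<exists>s>0. (LINT w|lborel. w\<^sup>2 * K w * indicator {w. \<bar>w\<bar> > s} w) < e"
proof -
  have "(\<lambda>n. LINT w|lborel. w\<^sup>2 * K w * indicator {w. \<bar>w\<bar> > real n} w) \<longlonglongrightarrow> (LINT w::real|lborel. 0)"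
  proof (rule integral_dominated_convergence[where w="\<lambda>w. w\<^sup>2 * K w"])
    show "AE w in lborel. (\<lambda>n. w\<^sup>2 * K w * indicator {w. \<bar>w\<bar> > real n} w) \<longlonglongrightarrow> 0"
    proof (rule AE_I2)
      fix w :: real
      have "eventually (\<lambda>n. w\<^sup>2 * K w * indicator {w. \<bar>w\<bar> > real n} w = 0) sequentially"
        using eventually_ge_at_top[of "nat \<lceil>\<bar>w\<bar>\<rceil>"]
      proof eventually_elim
        case (elim n)
        then have "\<bar>w\<bar> \<le> real n" by linarith
        then show ?case by simp
      qed
      then show "(\<lambda>n. w\<^sup>2 * K w * indicator {w. \<bar>w\<bar> > real n} w) \<longlonglongrightarrow> 0" by (rule tendsto_eventually)
    qed
    show "AE w in lborel. norm (w\<^sup>2 * K w * indicator {w. \<bar>w\<bar> > real n} w) \<le> w\<^sup>2 * K w" for n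
      using K_nonneg by (intro AE_I2) (simp add: indicator_def)
  qed (use K_second in \<open>simp_all\<close>)
  then have "eventually (\<lambda>n. (LINT w|lborel. w\<^sup>2 * K w * indicator {w. \<bar>w\<bar> > real n} w) < e) sequentially"
    by (intro order_tendstoD(2)) (use e in auto)
  then obtain N where N: "\<And>n. n \<ge> N \<Longrightarrow> (LINT w|lborel. w\<^sup>2 * K w * indicator {w. \<bar>w\<bar> > real n} w) < e"
    by (auto simp: eventually_sequentially)
  have "(LINT w|lborel. w\<^sup>2 * K w * indicator {w. \<bar>w\<bar> > real (Suc N)} w) < e" by (rule N) simp
  moreover have "real (Suc N) > 0" by simp
  ultimately show ?thesis by blast
qed

text \<open>Uniform continuity handles \<open>\<bar>h * w\<bar> < dl\<close>. Beyond that the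
  difference is at most \<open>Cf \<le> B * (h * w)^2\<close>, which the second moment of
  \<open>K\<close> turns into a term of order \<open>h^2\<close>.\<close>

lemma fbar_uniform:
  assumes e: "e > 0"
  shows "\<exists>h0>0. \<forall>h. 0 < h \<and> h < h0 \<longrightarrow> (\<forall>x. \<bar>fbar h x - f x\<bar> \<le> e)"
proof -
  obtain dl where dl: "dl > 0" "\<And>x y. dist y x < dl \<Longrightarrow> dist (f y) (f x) < e/2"
    using f_uc e unfolding uniformly_continuous_on_def by (metis UNIV_I half_gt_zero)
  define B where "B = Cf / dl\<^sup>2"
  have B: "B \<ge> 0" unfolding B_def using Cf_nonneg by simp
  have main: "\<bar>fbar h x - f x\<bar> \<le> e / 2 + B * mu2 * h\<^sup>2" if h: "h > 0" for h x
  proof -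
    have i: "integrable lborel (\<lambda>w. K w * f (x - h * w))"
    proof (rule Bochner_Integration.integrable_bound)
      show "integrable lborel (\<lambda>w. Cf * K w)" using K_int by simp
      show "AE w in lborel. norm (K w * f (x - h * w)) \<le> norm (Cf * K w)"
        using K_nonneg f_nonneg f_le Cf_nonneg by (intro AE_I2) (simp add: abs_mult mult.commute[of _ "K _"] mult_left_mono)
    qed measurable
    have "fbar h x - f x = (LINT w|lborel. K w * f (x - h * w)) - (LINT w|lborel. K w * f x)"
      using fbar_eq[OF h] K_int by simp
    also have "\<dots> = (LINT w|lborel. K w * (f (x - h * w) - f x))"
      using i K_int by (simp add: right_diff_distrib)
    finally have eq: "fbar h x - f x = (LINT w|lborel. K w * (f (x - h * w) - f x))" .
    have j: "integrable lborel (\<lambda>w. K w * (f (x - h * w) - f x))"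
      unfolding right_diff_distrib using i K_int by simp
    have "\<bar>fbar h x - f x\<bar> \<le> (LINT w|lborel. \<bar>K w * (f (x - h * w) - f x)\<bar>)"
      unfolding eq by (rule integral_abs_bound)
    also have "\<dots> \<le> (LINT w|lborel. e / 2 * K w + B * h\<^sup>2 * (w\<^sup>2 * K w))"
    proof (rule integral_mono)
      show "integrable lborel (\<lambda>w. e / 2 * K w + B * h\<^sup>2 * (w\<^sup>2 * K w))" using K_int K_second by simp
      fix w
      have b: "\<bar>f (x - h * w) - f x\<bar> \<le> e / 2 + B * (h * w)\<^sup>2"
      proof (cases "\<bar>h * w\<bar> < dl")
        case True
        then have "dist (f (x - h * w)) (f x) < e / 2" by (intro dl(2)) (simp add: dist_real_def)
        moreover have "B * (h * w)\<^sup>2 \<ge> 0" using B by simp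
        ultimately show ?thesis unfolding dist_real_def by linarith
      next
        case False
        have "dl\<^sup>2 \<le> \<bar>h * w\<bar>\<^sup>2" using False dl(1) by (intro power_mono) auto
        then have "B * dl\<^sup>2 \<le> B * (h * w)\<^sup>2" using B by (intro mult_left_mono) auto
        moreover have "B * dl\<^sup>2 = Cf" using dl(1) by (simp add: B_def)
        moreover have "\<bar>f (x - h * w) - f x\<bar> \<le> Cf"
          using f_nonneg[of x] f_nonneg[of "x - h * w"] f_le[of x] f_le[of "x - h * w"] by linarith
        ultimately show ?thesis using e by linarith
      qed
      have "\<bar>K w * (f (x - h * w) - f x)\<bar> = K w * \<bar>f (x - h * w) - f x\<bar>" using K_nonneg by (simp add: abs_mult)
      also have "\<dots> \<le> K w * (e / 2 + B * (h * w)\<^sup>2)" using b K_nonneg by (intro mult_left_mono) auto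
      finally show "\<bar>K w * (f (x - h * w) - f x)\<bar> \<le> e / 2 * K w + B * h\<^sup>2 * (w\<^sup>2 * K w)"
        by (simp add: algebra_simps power_mult_distrib)
    qed (use j in auto)
    also have "\<dots> = e / 2 + B * mu2 * h\<^sup>2"
      using K_int K_second by (simp add: mu2_def)
    finally show ?thesis .
  qed
  define h0 where "h0 = sqrt (e / 2 / (B * mu2 + 1))"
  have q: "B * mu2 + 1 > 0" using B mu2_nonneg by (simp add: add_nonneg_pos)
  have h0: "h0 > 0" unfolding h0_def using q e by simp
  have "\<bar>fbar h x - f x\<bar> \<le> e" if h: "0 < h" "h < h0" for h x
  proof -
    have "h\<^sup>2 \<le> h0\<^sup>2" using h by (intro power_mono) auto
    also have "h0\<^sup>2 = e / 2 / (B * mu2 + 1)" unfolding h0_def using q e by (intro real_sqrt_pow2) simp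
    finally have "(B * mu2 + 1) * h\<^sup>2 \<le> e / 2" using q by (simp add: field_simps)
    moreover have "B * mu2 * h\<^sup>2 \<le> (B * mu2 + 1) * h\<^sup>2" by (intro mult_right_mono) auto
    ultimately have "B * mu2 * h\<^sup>2 \<le> e / 2" by (rule order_trans[rotated])
    then show ?thesis using main[OF h(1), of x] by linarith
  qed
  then show ?thesis using h0 by blast
qed

text \<open>The mean-zero kernel removes the first-order term. For
  \<open>\<bar>h * w\<bar> > dl\<close> the expansion gives no information, but there each part of
  the remainder is at most a multiple of \<open>(h * w)^2\<close>, and \<open>h < dl / s\<close>
  forces \<open>\<bar>w\<bar> > s\<close>, where \<open>K\<close> has little second moment
  left.\<close>

lemma fbar_bias:
  fixes f1 f2 :: "real \<Rightarrow> real" and A :: "real set"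
  assumes taylor: "\<And>e. e > 0 \<Longrightarrow> \<exists>dl>0. \<forall>x\<in>A. \<forall>t. \<bar>t\<bar> \<le> dl \<longrightarrow> \<bar>f (x + t) - f x - t * f1 x - t\<^sup>2 / 2 * f2 x\<bar> \<le> e * t\<^sup>2"
    and bd: "\<And>x. x \<in> A \<Longrightarrow> \<bar>f1 x\<bar> \<le> C2" "\<And>x. x \<in> A \<Longrightarrow> \<bar>f2 x\<bar> \<le> C2" and C2: "C2 \<ge> 0" and e: "e > 0"
  shows "\<exists>h0>0. \<forall>h. 0 < h \<and> h < h0 \<longrightarrow> (\<forall>x\<in>A. \<bar>fbar h x - f x - h\<^sup>2 / 2 * mu2 * f2 x\<bar> \<le> e * h\<^sup>2)"
proof -
  define e' where "e' = e / 2 / (mu2 + 1)"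
  have m1: "mu2 + 1 > 0" using mu2_nonneg by simp
  have e': "e' > 0" "e' * mu2 \<le> e / 2"
    unfolding e'_def using e m1 mu2_nonneg by (auto simp: field_simps)
  obtain dl where dl: "dl > 0" "\<And>x t. x \<in> A \<Longrightarrow> \<bar>t\<bar> \<le> dl \<Longrightarrow> \<bar>f (x + t) - f x - t * f1 x - t\<^sup>2 / 2 * f2 x\<bar> \<le> e' * t\<^sup>2"
    using taylor[OF e'(1)] by blast
  \<comment> \<open>For displacements beyond \<open>dl\<close> the three summands bound the
    difference of values, the linear term and the quadratic term by multiples of the squared
    displacement.\<close>
  define B where "B = Cf / dl\<^sup>2 + C2 / dl + C2"
  have B0: "B \<ge> 0" unfolding B_def using Cf_nonneg C2 dl(1) by simp
  obtain s where s: "s > 0" "(LINT w|lborel. w\<^sup>2 * K w * indicator {w. \<bar>w\<bar> > s} w) < e / 2 / (B + 1)"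
    using K_tail_second[of "e / 2 / (B + 1)"] e B0 by auto
  define h0 where "h0 = dl / s"
  have h0: "h0 > 0" using dl(1) s by (simp add: h0_def)
  have "\<bar>fbar h x - f x - h\<^sup>2 / 2 * mu2 * f2 x\<bar> \<le> e * h\<^sup>2" if h: "0 < h" "h < h0" and x: "x \<in> A" for h x
  proof -
    define r where "r w = f (x - h * w) - f x + h * w * f1 x - (h * w)\<^sup>2 / 2 * f2 x" for w
    have i: "integrable lborel (\<lambda>w. K w * f (x - h * w))"
    proof (rule Bochner_Integration.integrable_bound)
      show "integrable lborel (\<lambda>w. Cf * K w)" using K_int by simp
      show "AE w in lborel. norm (K w * f (x - h * w)) \<le> norm (Cf * K w)"
        using K_nonneg f_nonneg f_le Cf_nonneg by (intro AE_I2) (simp add: abs_mult mult.commute[of _ "K _"] mult_left_mono)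
    qed measurable
    have Kr: "K w * r w = K w * f (x - h * w) - f x * K w + h * f1 x * (w * K w) - h\<^sup>2 / 2 * f2 x * (w\<^sup>2 * K w)" for w
      unfolding r_def by (simp add: algebra_simps power_mult_distrib)
    have hb: "has_bochner_integral lborel (\<lambda>w. K w * r w) (fbar h x - f x * 1 + h * f1 x * 0 - h\<^sup>2 / 2 * f2 x * mu2)"
      unfolding Kr mu2_def fbar_eq[OF h(1)]
      by (intro has_bochner_integral_add has_bochner_integral_diff has_bochner_integral_mult_right K_int1 K_mean
          has_bochner_integral_integrable[OF i] has_bochner_integral_integrable[OF K_second])
    have "\<bar>fbar h x - f x - h\<^sup>2 / 2 * mu2 * f2 x\<bar> = \<bar>LINT w|lborel. K w * r w\<bar>"
      unfolding has_bochner_integral_integral_eq[OF hb] by (simp add: mult_ac)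
    also have "\<dots> \<le> (LINT w|lborel. \<bar>K w * r w\<bar>)" by (rule integral_abs_bound)
    also have "\<dots> \<le> (LINT w|lborel. h\<^sup>2 * (e' * (w\<^sup>2 * K w) + B * (w\<^sup>2 * K w * indicator {w. \<bar>w\<bar> > s} w)))"
    proof (rule integral_mono)
      show "integrable lborel (\<lambda>w. \<bar>K w * r w\<bar>)" using hb by (simp add: has_bochner_integral_iff)
      show "integrable lborel (\<lambda>w. h\<^sup>2 * (e' * (w\<^sup>2 * K w) + B * (w\<^sup>2 * K w * indicator {w. \<bar>w\<bar> > s} w)))"
        using K_second by (intro integrable_mult_right Bochner_Integration.integrable_add integrable_mult_indicator_real) auto
      fix w
      have rb: "\<bar>r w\<bar> \<le> (h * w)\<^sup>2 * (e' + B * indicator {w. \<bar>w\<bar> > s} w)"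
      proof (cases "\<bar>h * w\<bar> \<le> dl")
        case True
        have "\<bar>r w\<bar> \<le> e' * (h * w)\<^sup>2"
          using dl(2)[OF x, of "- (h * w)"] True by (simp add: r_def)
        moreover have "0 \<le> (h * w)\<^sup>2 * (B * indicator {w. \<bar>w\<bar> > s} w)" using B0 by simp
        ultimately show ?thesis by (simp add: distrib_left mult.commute)
      next
        case False
        define t where "t = \<bar>h * w\<bar>"
        have t: "dl < t" using False by (simp add: t_def)
        have "s < \<bar>w\<bar>"
        proof (rule ccontr)
          assume "\<not> s < \<bar>w\<bar>"
          then have "h * \<bar>w\<bar> \<le> h0 * s" using h s by (intro mult_mono) auto
          then show False using t s h by (simp add: t_def h0_def abs_mult)
        qed
        then have ind: "indicator {w. \<bar>w\<bar> > s} w = (1::real)" by simp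
        have t0: "t > 0" using t dl(1) by simp
        have d2: "dl\<^sup>2 \<le> t\<^sup>2" "dl * t \<le> t\<^sup>2" using t dl(1) t0 by (auto simp: power2_eq_square intro!: mult_mono mult_right_mono)
        have f0: "\<bar>f (x - h * w) - f x\<bar> \<le> Cf"
          using f_nonneg[of x] f_nonneg[of "x - h * w"] f_le[of x] f_le[of "x - h * w"] by linarith
        have "Cf / dl\<^sup>2 * dl\<^sup>2 \<le> Cf / dl\<^sup>2 * t\<^sup>2" using d2 Cf_nonneg by (intro mult_left_mono) auto
        then have a1: "Cf \<le> Cf / dl\<^sup>2 * t\<^sup>2" using dl(1) by simp
        have "C2 / dl * (dl * t) \<le> C2 / dl * t\<^sup>2" using d2 C2 dl(1) by (intro mult_left_mono) auto
        then have a2: "C2 * t \<le> C2 / dl * t\<^sup>2" using dl(1) by simp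
        have a3: "\<bar>h * w * f1 x\<bar> \<le> C2 * t" unfolding abs_mult[of _ "f1 x"] t_def using bd(1)[OF x] by (simp add: mult.commute mult_right_mono)
        have "\<bar>(h * w)\<^sup>2 / 2 * f2 x\<bar> = t\<^sup>2 / 2 * \<bar>f2 x\<bar>" by (simp add: abs_mult t_def power_mult_distrib)
        also have "\<dots> \<le> t\<^sup>2 / 2 * C2" using bd(2)[OF x] by (intro mult_left_mono) auto
        also have "\<dots> \<le> C2 * t\<^sup>2" using C2 by (simp add: field_simps)
        finally have a4: "\<bar>(h * w)\<^sup>2 / 2 * f2 x\<bar> \<le> C2 * t\<^sup>2" .
        have "\<bar>r w\<bar> \<le> \<bar>f (x - h * w) - f x\<bar> + \<bar>h * w * f1 x\<bar> + \<bar>(h * w)\<^sup>2 / 2 * f2 x\<bar>" unfolding r_def by linarith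
        also have "\<dots> \<le> Cf / dl\<^sup>2 * t\<^sup>2 + C2 / dl * t\<^sup>2 + C2 * t\<^sup>2"
          using f0 a1 order_trans[OF a3 a2] a4 by (intro add_mono) auto
        also have "\<dots> = t\<^sup>2 * B" unfolding B_def by (simp add: algebra_simps)
        also have "\<dots> \<le> t\<^sup>2 * (e' + B)" using e' by (intro mult_left_mono) auto
        finally show ?thesis unfolding ind t_def by simp
      qed
      have "\<bar>K w * r w\<bar> = K w * \<bar>r w\<bar>" using K_nonneg by (simp add: abs_mult)
      also have "\<dots> \<le> K w * ((h * w)\<^sup>2 * (e' + B * indicator {w. \<bar>w\<bar> > s} w))" using rb K_nonneg by (intro mult_left_mono) auto
      also have "\<dots> = h\<^sup>2 * (e' * (w\<^sup>2 * K w) + B * (w\<^sup>2 * K w * indicator {w. \<bar>w\<bar> > s} w))"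
        by (simp add: algebra_simps power_mult_distrib)
      finally show "\<bar>K w * r w\<bar> \<le> h\<^sup>2 * (e' * (w\<^sup>2 * K w) + B * (w\<^sup>2 * K w * indicator {w. \<bar>w\<bar> > s} w))" .
    qed
    also have "\<dots> = h\<^sup>2 * (e' * mu2 + B * (LINT w|lborel. w\<^sup>2 * K w * indicator {w. \<bar>w\<bar> > s} w))"
    proof -
      have "integrable lborel (\<lambda>w. w\<^sup>2 * K w * indicator {w. \<bar>w\<bar> > s} w)"
        using K_second by (intro integrable_mult_indicator_real) auto
      then show ?thesis using K_second by (simp add: mu2_def)
    qed
    also have "\<dots> \<le> h\<^sup>2 * (e / 2 + e / 2)"
    proof (intro mult_left_mono add_mono e')
      have "B * (LINT w|lborel. w\<^sup>2 * K w * indicator {w. \<bar>w\<bar> > s} w) \<le> B * (e / 2 / (B + 1))"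
        using s B0 by (intro mult_left_mono) auto
      also have "\<dots> \<le> e / 2" using B0 e by (simp add: field_simps)
      finally show "B * (LINT w|lborel. w\<^sup>2 * K w * indicator {w. \<bar>w\<bar> > s} w) \<le> e / 2" .
    qed simp
    finally show ?thesis by (simp add: mult.commute)
  qed
  then show ?thesis using h0 by blast
qed

end

section \<open>Linearisation of the risk in mean\<close>

context prob_space
begin

text \<open>Integrability is part of the notion because the expectation of a non-integrable function
  is 0 by convention, so that an upper bound alone would carry no information.\<close>

definition mean_le :: "('a \<Rightarrow> real) \<Rightarrow> real \<Rightarrow> bool" where
  "mean_le Y a \<longleftrightarrow> integrable M Y \<and> expectation Y \<le> a"

lemma mean_le_add: "mean_le Y a \<Longrightarrow> mean_le Z b \<Longrightarrow> mean_le (\<lambda>\<omega>. Y \<omega> + Z \<omega>) (a + b)"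
  by (simp add: mean_le_def)

lemma mean_le_cmult: "0 \<le> k \<Longrightarrow> mean_le Y a \<Longrightarrow> mean_le (\<lambda>\<omega>. k * Y \<omega>) (k * a)"
  by (simp add: mean_le_def mult_left_mono)

lemma mean_le_divide: "0 \<le> k \<Longrightarrow> mean_le Y a \<Longrightarrow> mean_le (\<lambda>\<omega>. Y \<omega> / k) (a / k)"
  by (simp add: mean_le_def divide_right_mono)

lemma mean_le_sum: "(\<And>i. i \<in> I \<Longrightarrow> mean_le (Y i) (a i)) \<Longrightarrow> mean_le (\<lambda>\<omega>. \<Sum>i\<in>I. Y i \<omega>) (\<Sum>i\<in>I. a i)"
  by (simp add: mean_le_def Bochner_Integration.integral_sum sum_mono)

lemma mean_le_const: "mean_le (\<lambda>_. k) k"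
  by (simp add: mean_le_def prob_space)

lemma mean_le_weaken: "mean_le Y a \<Longrightarrow> a \<le> b \<Longrightarrow> mean_le Y b"
  by (simp add: mean_le_def)

lemma mean_le_dominated:
  assumes "mean_le Y a" "Z \<in> borel_measurable M" "\<And>\<omega>. 0 \<le> Z \<omega>" "\<And>\<omega>. Z \<omega> \<le> Y \<omega>"
  shows "mean_le Z a"
proof -
  have i: "integrable M Y" using assms by (simp add: mean_le_def)
  have z: "integrable M Z"
  proof (rule Bochner_Integration.integrable_bound[OF i assms(2)])
    show "AE \<omega> in M. norm (Z \<omega>) \<le> norm (Y \<omega>)"
    proof (rule AE_I2)
      fix \<omega> show "norm (Z \<omega>) \<le> norm (Y \<omega>)" using assms(3)[of \<omega>] assms(4)[of \<omega>] by simp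
    qed
  qed
  have "expectation Z \<le> expectation Y" by (rule integral_mono[OF z i assms(4)])
  then show ?thesis using assms(1) z by (simp add: mean_le_def)
qed

lemma mean_le_square_shift:
  assumes m: "Y \<in> borel_measurable M" and Y: "mean_le (\<lambda>\<omega>. (Y \<omega>)\<^sup>2) a"
  shows "mean_le (\<lambda>\<omega>. (Y \<omega> + b)\<^sup>2) (2 * a + 2 * b\<^sup>2)"
proof (rule mean_le_dominated)
  show "mean_le (\<lambda>\<omega>. 2 * (Y \<omega>)\<^sup>2 + 2 * b\<^sup>2) (2 * a + 2 * b\<^sup>2)"
    by (intro mean_le_add mean_le_cmult mean_le_const Y) simp
  show "(Y \<omega> + b)\<^sup>2 \<le> 2 * (Y \<omega>)\<^sup>2 + 2 * b\<^sup>2" for \<omega>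
    using sum_squares_bound[of "Y \<omega>" b] by (simp add: power2_sum)
qed (use m in auto)

text \<open>A second moment of order \<open>r^2\<close> becomes a first absolute moment of order
  \<open>r\<close> through \<open>\<bar>Y\<bar> \<le> r + Y^2 / r\<close>.\<close>

lemma mean_le_abs:
  assumes m: "Y \<in> borel_measurable M" and Y: "mean_le (\<lambda>\<omega>. (Y \<omega>)\<^sup>2) (a * r\<^sup>2)" and r: "r > 0"
  shows "mean_le (\<lambda>\<omega>. \<bar>Y \<omega>\<bar>) ((1 + a) * r)"
proof (rule mean_le_dominated)
  have "mean_le (\<lambda>\<omega>. r + (Y \<omega>)\<^sup>2 / r) (r + a * r\<^sup>2 / r)"
    using r by (intro mean_le_add mean_le_divide mean_le_const Y) simp
  then show "mean_le (\<lambda>\<omega>. r + (Y \<omega>)\<^sup>2 / r) ((1 + a) * r)"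
    using r by (simp add: power2_eq_square algebra_simps)
  show "\<bar>Y \<omega>\<bar> \<le> r + (Y \<omega>)\<^sup>2 / r" for \<omega>
  proof (cases "\<bar>Y \<omega>\<bar> \<le> r")
    case True
    moreover have "0 \<le> (Y \<omega>)\<^sup>2 / r" using r by simp
    ultimately show ?thesis by linarith
  next
    case False
    then have "\<bar>Y \<omega>\<bar> * r \<le> \<bar>Y \<omega>\<bar> * \<bar>Y \<omega>\<bar>" by (intro mult_left_mono) auto
    then have "\<bar>Y \<omega>\<bar> \<le> (Y \<omega>)\<^sup>2 / r" using r by (simp add: pos_le_divide_eq power2_eq_square)
    then show ?thesis using r by linarith
  qed
qed (use m in auto)

end

text \<open>\<open>f2\<close> stands for the second derivative of \<open>f\<close> near the
  crossings and \<open>Jm\<close> for its integral over the superlevel set; the two assumed bias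
  expansions link them to \<open>f\<close>.\<close>

locale hdr_sampling =
  kde?: kde_setting M X f K Cf CK LK + lc?: level_crossings f m \<tau> L Cf C1 c c1 d P
  for M :: "'a measure" and X f K Cf CK LK m \<tau> L C1 c c1 d P +
  fixes f2 :: "real \<Rightarrow> real" and C2 C3 Jm :: real
  assumes quad: "\<And>p x. p \<in> P \<Longrightarrow> \<bar>x - p\<bar> \<le> d \<Longrightarrow> \<bar>f x - L - m p * (x - p)\<bar> \<le> C3 * (x - p)\<^sup>2"
    and f2_bd: "\<And>p x. p \<in> P \<Longrightarrow> \<bar>x - p\<bar> \<le> d \<Longrightarrow> \<bar>f2 x\<bar> \<le> C2"
    and f2_cont: "\<And>p. p \<in> P \<Longrightarrow> isCont f2 p"
    and bias_near: "\<And>e. e > 0 \<Longrightarrow> \<exists>h0>0. \<forall>h. 0 < h \<and> h < h0 \<longrightarrow>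
        (\<forall>p\<in>P. \<forall>x. \<bar>x - p\<bar> \<le> d \<longrightarrow> \<bar>fbar h x - f x - h\<^sup>2 / 2 * mu2 * f2 x\<bar> \<le> e * h\<^sup>2)"
    and bias_mass: "\<And>e. e > 0 \<Longrightarrow> \<exists>h0>0. \<forall>h. 0 < h \<and> h < h0 \<longrightarrow>
        \<bar>(LINT x|lborel. (fbar h x - f x) * indicator {x. L \<le> f x} x) - h\<^sup>2 / 2 * mu2 * Jm\<bar> \<le> e * h\<^sup>2"
begin

lemma fhat_rv [measurable]: "(\<lambda>\<omega>. fhat n h \<omega> x) \<in> borel_measurable M"
  unfolding kde_def by measurable

lemma fbar_borel: "h > 0 \<Longrightarrow> fbar h \<in> borel_measurable borel"
  using fbar_int[of h] by (auto simp: has_bochner_integral_iff)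

lemma mass_dev_split:
  assumes h: "h > 0" and n: "n > 0"
  shows "mass_dev (fhat n h \<omega>) = (LINT x|lborel. (fhat n h \<omega> x - fbar h x) * indicator {x. L \<le> f x} x)
      + (LINT x|lborel. (fbar h x - f x) * indicator {x. L \<le> f x} x)"
proof -
  have A: "{x. L \<le> f x} \<in> sets lborel" by measurable
  have i: "integrable lborel (fhat n h \<omega>)" "integrable lborel (fbar h)" "integrable lborel f"
    using fhat_int[OF h n, of \<omega>] fbar_int[OF h] kde.f_int by (simp_all only: has_bochner_integral_iff)
  have j: "integrable lborel (\<lambda>x. fhat n h \<omega> x * indicator {x. L \<le> f x} x)" "integrable lborel (\<lambda>x. fbar h x * indicator {x. L \<le> f x} x)"
    "integrable lborel (\<lambda>x. f x * indicator {x. L \<le> f x} x)"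
    by (intro integrable_mult_indicator_real i A)+
  show ?thesis unfolding mass_dev_def left_diff_distrib using j by simp
qed

lemma mass_dev_rv:
  assumes h: "h > 0" and n: "n > 0"
  shows "(\<lambda>\<omega>. mass_dev (fhat n h \<omega>)) \<in> borel_measurable M"
proof -
  have "(\<lambda>(\<omega>, x). (fhat n h \<omega> x - f x) * indicator {x. L \<le> f x} x) \<in> borel_measurable (M \<Otimes>\<^sub>M lborel)"
    unfolding kde_def by measurable
  then show ?thesis unfolding mass_dev_def[abs_def] by (rule lborel.borel_measurable_lebesgue_integral)
qed

text \<open>The events that the level is below \<open>a\<close> are countable unions over rational
  thresholds, each determined by one parametrised integral.\<close>

lemma hdr_level_rv:
  assumes h: "h > 0" and n: "n > 0"
  shows "(\<lambda>\<omega>. hdr_level \<tau> (fhat n h \<omega>)) \<in> borel_measurable M"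
proof (rule borel_measurableI_less)
  fix a :: real
  have ma: "(\<lambda>\<omega>. mass_above (fhat n h \<omega>) q) \<in> borel_measurable M" for q
  proof -
    have "(\<lambda>(\<omega>, x). fhat n h \<omega> x * (if q \<le> fhat n h \<omega> x then 1 else 0)) \<in> borel_measurable (M \<Otimes>\<^sub>M lborel)"
      unfolding kde_def by measurable
    from lborel.borel_measurable_lebesgue_integral[OF this]
    have "(\<lambda>\<omega>. LINT x|lborel. fhat n h \<omega> x * (if q \<le> fhat n h \<omega> x then 1 else 0)) \<in> borel_measurable M"
      by (simp only: split_conv)
    moreover have "mass_above (fhat n h \<omega>) q = (LINT x|lborel. fhat n h \<omega> x * (if q \<le> fhat n h \<omega> x then 1 else 0))" for \<omega>
      unfolding mass_above_def by (intro Bochner_Integration.integral_cong) (auto simp: indicator_def)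
    ultimately show ?thesis by (simp only:)
  qed
  have fi: "integrable lborel (fhat n h \<omega>)" for \<omega>
    using fhat_int[OF h n, of \<omega>] by (simp only: has_bochner_integral_iff)
  have "{\<omega> \<in> space M. hdr_level \<tau> (fhat n h \<omega>) < a} =
     {\<omega> \<in> space M. \<exists>q\<in>\<rat> \<inter> {0<..<a}. mass_above (fhat n h \<omega>) q \<le> 1 - \<tau>}"
    using hdr_level_less_iff[OF fi fhat_bounds[OF h n] lc.\<tau>(2)] by auto
  also have "\<dots> \<in> sets M"
  proof (rule sets.sets_Collect_countable_Ex')
    show "countable (\<rat> \<inter> {0<..<a})" by (rule countable_Int1[OF countable_rat])
    show "{\<omega> \<in> space M. mass_above (fhat n h \<omega>) q \<le> 1 - \<tau>} \<in> sets M" for q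
      using ma[of q] by measurable
  qed
  finally show "{\<omega> \<in> space M. hdr_level \<tau> (fhat n h \<omega>) < a} \<in> sets M" .
qed

definition risk :: "nat \<Rightarrow> real \<Rightarrow> 'a \<Rightarrow> real" where
  "risk n h \<omega> = density_mass f (sym_diff (hdr \<tau> (fhat n h \<omega>)) {x. L \<le> f x})"

lemma risk_rv:
  assumes h: "h > 0" and n: "n > 0"
  shows "risk n h \<in> borel_measurable M"
proof -
  define l where "l \<omega> = hdr_level \<tau> (fhat n h \<omega>)" for \<omega>
  have [measurable]: "l \<in> borel_measurable M" unfolding l_def[abs_def] by (rule hdr_level_rv[OF h n])
  have [measurable]: "(\<lambda>(\<omega>, x). fhat n h \<omega> x) \<in> borel_measurable (M \<Otimes>\<^sub>M lborel)"
    unfolding kde_def by measurable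
  have "(\<lambda>(\<omega>, x). \<bar>(if l \<omega> \<le> fhat n h \<omega> x then 1 else 0) - (if L \<le> f x then 1 else 0)\<bar> * f x) \<in> borel_measurable (M \<Otimes>\<^sub>M lborel)"
    by measurable
  from lborel.borel_measurable_lebesgue_integral[OF this]
  have "(\<lambda>\<omega>. LINT x|lborel. \<bar>(if l \<omega> \<le> fhat n h \<omega> x then 1 else 0) - (if L \<le> f x then 1 else 0)\<bar> * f x) \<in> borel_measurable M"
    by (simp only: split_conv)
  moreover have "risk n h \<omega> = (LINT x|lborel. \<bar>(if l \<omega> \<le> fhat n h \<omega> x then 1 else 0) - (if L \<le> f x then 1 else 0)\<bar> * f x)" for \<omega>
    unfolding risk_def density_mass_def set_lebesgue_integral_def hdr_def l_def
    by (intro Bochner_Integration.integral_cong) (auto simp: indicator_def)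
  ultimately show ?thesis by (simp only: fun_eq_iff cong: measurable_cong)
qed

lemma risk_lin_rv:
  assumes h: "h > 0" and n: "n > 0"
  shows "(\<lambda>\<omega>. risk_lin (fhat n h \<omega>)) \<in> borel_measurable M"
  unfolding risk_lin_def level_lin_def using mass_dev_rv[OF assms] by measurable

end

section \<open>The error scale and its moment bounds\<close>

locale hdr_bandwidth = hdr_sampling +
  fixes h :: "nat \<Rightarrow> real"
  assumes h_pos: "\<And>n. h n > 0" and h_lim: "h \<longlonglongrightarrow> 0" and nh3: "filterlim (\<lambda>n. real n * h n ^ 3) at_top sequentially"
begin

text \<open>Order of the standard deviation plus order of the bias, the scale of the remainder to be
  shown negligible.\<close>

definition rho :: "nat \<Rightarrow> real" where "rho n = 1 / sqrt (real n * h n) + (h n)\<^sup>2"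

lemma rho_facts:
  assumes n: "n > 0"
  shows "rho n > 0" "1 / (real n * h n) \<le> (rho n)\<^sup>2" "(h n)\<^sup>2 \<le> rho n" "(h n) ^ 4 \<le> (rho n)\<^sup>2" "1 / sqrt (real n * h n) \<le> rho n"
proof -
  have q: "real n * h n > 0" using n h_pos by simp
  have a: "1 / sqrt (real n * h n) > 0" using q by simp
  have b: "(h n)\<^sup>2 > 0" using h_pos[of n] by simp
  show "rho n > 0" unfolding rho_def using a b by linarith
  show h2: "(h n)\<^sup>2 \<le> rho n" unfolding rho_def using a by linarith
  show s: "1 / sqrt (real n * h n) \<le> rho n" unfolding rho_def using b by linarith
  have "(1 / sqrt (real n * h n))\<^sup>2 \<le> (rho n)\<^sup>2" using s a by (intro power_mono) auto
  then show "1 / (real n * h n) \<le> (rho n)\<^sup>2" using q by (simp add: power_divide)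
  have "((h n)\<^sup>2)\<^sup>2 \<le> (rho n)\<^sup>2" using h2 by (intro power_mono) auto
  then show "(h n) ^ 4 \<le> (rho n)\<^sup>2" by simp
qed

lemma ev_h_less: "h0 > 0 \<Longrightarrow> eventually (\<lambda>n. h n < h0) sequentially"
  using h_lim by (rule order_tendstoD(2))

lemma ev_n: "eventually (\<lambda>n::nat. n > 0) sequentially"
  by (rule eventually_gt_at_top)

text \<open>The quotient equals \<open>1 / sqrt (n h^3) + h\<close>; this is where
  \<open>n h^3 \<rightarrow> \<infinity>\<close> enters.\<close>

lemma rho_over_h: "(\<lambda>n. rho n / h n) \<longlonglongrightarrow> 0"
proof -
  have "(\<lambda>n. inverse (sqrt (real n * h n ^ 3)) + h n) \<longlonglongrightarrow> 0 + 0"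
    by (intro tendsto_add h_lim tendsto_inverse_0_at_top filterlim_compose[OF sqrt_at_top nh3])
  moreover have "eventually (\<lambda>n. inverse (sqrt (real n * h n ^ 3)) + h n = rho n / h n) sequentially"
    using ev_n
  proof eventually_elim
    case (elim n)
    have "sqrt (real n * h n ^ 3) = sqrt (real n * h n) * h n"
      using h_pos[of n] by (simp add: power3_eq_cube real_sqrt_mult)
    then show ?case using h_pos[of n] elim by (simp add: rho_def field_simps power2_eq_square)
  qed
  ultimately show ?thesis by (simp add: tendsto_cong)
qed

lemma rho_lim: "rho \<longlonglongrightarrow> 0"
proof -
  have "(\<lambda>n. rho n / h n * h n) \<longlonglongrightarrow> 0 * 0" by (intro tendsto_mult rho_over_h h_lim)
  moreover have "rho n / h n * h n = rho n" for n using h_pos[of n] by simp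
  ultimately show ?thesis by simp
qed

lemma ev_rho_less: "a > 0 \<Longrightarrow> eventually (\<lambda>n. rho n < a) sequentially"
  using rho_lim by (rule order_tendstoD(2))

definition CE :: real where "CE = 2 * (CK * Cf) + 2 * (C2 * mu2 + 1)\<^sup>2"
definition CB :: real where "CB = 2 + 2 * (\<bar>Jm\<bar> * mu2 + 1)\<^sup>2"

lemma C2_nonneg: "C2 \<ge> 0"
proof -
  obtain p where "p \<in> P" using P by blast
  then have "\<bar>f2 p\<bar> \<le> C2" using f2_bd[of p p] const_pos by simp
  then show ?thesis by linarith
qed

lemma CE_nonneg: "CE \<ge> 0" unfolding CE_def using CK_nonneg kde.Cf_nonneg by simp

lemma CB_nonneg: "CB \<ge> 0" unfolding CB_def by simp

definition dev_ok :: "nat \<Rightarrow> bool" where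
  "dev_ok n \<longleftrightarrow> n > 0 \<and> (\<forall>p\<in>P. \<forall>x. \<bar>x - p\<bar> \<le> d \<longrightarrow> mean_le (\<lambda>\<omega>. (fhat n (h n) \<omega> x - f x)\<^sup>2) (CE * (rho n)\<^sup>2))
     \<and> mean_le (\<lambda>\<omega>. (mass_dev (fhat n (h n) \<omega>))\<^sup>2) (CB * (rho n)\<^sup>2)"

text \<open>Squared bias of order \<open>h^4\<close> and variance of order \<open>1 / (n h)\<close>
  are both dominated by \<open>rho^2\<close>; for the mass the variance \<open>1 / n\<close> is
  below \<open>1 / (n h)\<close> once \<open>h < 1\<close>.\<close>

lemma ev_dev_ok: "eventually dev_ok sequentially"
proof -
  obtain h0 where h0: "h0 > 0" "\<And>h p x. 0 < h \<Longrightarrow> h < h0 \<Longrightarrow> p \<in> P \<Longrightarrow> \<bar>x - p\<bar> \<le> d \<Longrightarrow> \<bar>fbar h x - f x - h\<^sup>2 / 2 * mu2 * f2 x\<bar> \<le> 1 * h\<^sup>2"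
    using bias_near[of 1] by auto
  obtain h1 where h1: "h1 > 0" "\<And>h. 0 < h \<Longrightarrow> h < h1 \<Longrightarrow> \<bar>(LINT x|lborel. (fbar h x - f x) * indicator {x. L \<le> f x} x) - h\<^sup>2 / 2 * mu2 * Jm\<bar> \<le> 1 * h\<^sup>2"
    using bias_mass[of 1] by auto
  show ?thesis using ev_n ev_h_less[OF h0(1)] ev_h_less[OF h1(1)] ev_h_less[OF zero_less_one]
  proof eventually_elim
    case (elim n)
    note hp = h_pos[of n] and n = elim(1)
    note r = rho_facts[OF n]
    have "mean_le (\<lambda>\<omega>. (fhat n (h n) \<omega> x - f x)\<^sup>2) (CE * (rho n)\<^sup>2)" if p: "p \<in> P" "\<bar>x - p\<bar> \<le> d" for p x
    proof -
      have "\<bar>h n ^ 2 / 2 * mu2 * f2 x\<bar> \<le> h n ^ 2 / 2 * mu2 * C2"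
        using f2_bd[OF p] mu2_nonneg by (simp add: abs_mult mult_left_mono)
      also have "\<dots> \<le> h n ^ 2 * mu2 * C2" using mu2_nonneg C2_nonneg by (intro mult_right_mono) auto
      finally have "\<bar>fbar (h n) x - f x\<bar> \<le> h n ^ 2 * mu2 * C2 + 1 * h n ^ 2"
        using h0(2)[OF hp elim(2) p] by linarith
      then have "\<bar>fbar (h n) x - f x\<bar> \<le> (C2 * mu2 + 1) * h n ^ 2" by (simp add: algebra_simps)
      then have "(fbar (h n) x - f x)\<^sup>2 \<le> ((C2 * mu2 + 1) * h n ^ 2)\<^sup>2"
        by (intro abs_le_square_iff[THEN iffD1]) linarith
      also have "\<dots> = (C2 * mu2 + 1)\<^sup>2 * h n ^ 4" by (simp add: power_mult_distrib)
      also have "\<dots> \<le> (C2 * mu2 + 1)\<^sup>2 * (rho n)\<^sup>2" using r(4) by (intro mult_left_mono) auto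
      finally have b: "(fbar (h n) x - f x)\<^sup>2 \<le> (C2 * mu2 + 1)\<^sup>2 * (rho n)\<^sup>2" .
      have v: "mean_le (\<lambda>\<omega>. (fhat n (h n) \<omega> x - fbar (h n) x)\<^sup>2) (CK * Cf * (1 / (real n * h n)))"
        using fhat_variance(1,3)[OF hp n] by (simp add: mean_le_def)
      have "mean_le (\<lambda>\<omega>. ((fhat n (h n) \<omega> x - fbar (h n) x) + (fbar (h n) x - f x))\<^sup>2)
         (2 * (CK * Cf * (1 / (real n * h n))) + 2 * (fbar (h n) x - f x)\<^sup>2)"
        by (rule mean_le_square_shift[OF _ v]) measurable
      moreover have "2 * (CK * Cf * (1 / (real n * h n))) + 2 * (fbar (h n) x - f x)\<^sup>2 \<le> 2 * (CK * Cf * (rho n)\<^sup>2) + 2 * ((C2 * mu2 + 1)\<^sup>2 * (rho n)\<^sup>2)"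
        using r(2) b CK_nonneg kde.Cf_nonneg by (intro add_mono mult_left_mono) auto
      moreover have "2 * (CK * Cf * (rho n)\<^sup>2) + 2 * ((C2 * mu2 + 1)\<^sup>2 * (rho n)\<^sup>2) = CE * (rho n)\<^sup>2"
        by (simp add: CE_def algebra_simps)
      ultimately show ?thesis using mean_le_weaken by force
    qed
    moreover have "mean_le (\<lambda>\<omega>. (mass_dev (fhat n (h n) \<omega>))\<^sup>2) (CB * (rho n)\<^sup>2)"
    proof -
      let ?b = "LINT x|lborel. (fbar (h n) x - f x) * indicator {x. L \<le> f x} x"
      let ?Y = "\<lambda>\<omega>. LINT x|lborel. (fhat n (h n) \<omega> x - fbar (h n) x) * indicator {x. L \<le> f x} x"
      have "\<bar>h n ^ 2 / 2 * mu2 * Jm\<bar> \<le> h n ^ 2 * mu2 * \<bar>Jm\<bar>"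
        using mu2_nonneg by (simp add: abs_mult field_simps)
      then have "\<bar>?b\<bar> \<le> h n ^ 2 * mu2 * \<bar>Jm\<bar> + 1 * h n ^ 2" using h1(2)[OF hp elim(3)] by linarith
      then have "\<bar>?b\<bar> \<le> (\<bar>Jm\<bar> * mu2 + 1) * h n ^ 2" by (simp add: algebra_simps)
      then have "?b\<^sup>2 \<le> ((\<bar>Jm\<bar> * mu2 + 1) * h n ^ 2)\<^sup>2"
        by (intro abs_le_square_iff[THEN iffD1]) linarith
      also have "\<dots> = (\<bar>Jm\<bar> * mu2 + 1)\<^sup>2 * h n ^ 4" by (simp add: power_mult_distrib)
      also have "\<dots> \<le> (\<bar>Jm\<bar> * mu2 + 1)\<^sup>2 * (rho n)\<^sup>2" using r(4) by (intro mult_left_mono) auto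
      finally have b: "?b\<^sup>2 \<le> (\<bar>Jm\<bar> * mu2 + 1)\<^sup>2 * (rho n)\<^sup>2" .
      have A: "{x. L \<le> f x} \<in> sets borel" by measurable
      have v: "mean_le (\<lambda>\<omega>. (?Y \<omega>)\<^sup>2) (1 / real n)"
        using fhat_mass_variance[OF hp n A] by (simp add: mean_le_def)
      have mY: "?Y \<in> borel_measurable M"
      proof -
        have [measurable]: "fbar (h n) \<in> borel_measurable borel" by (rule fbar_borel[OF hp])
        have "(\<lambda>(\<omega>, x). (fhat n (h n) \<omega> x - fbar (h n) x) * indicator {x. L \<le> f x} x) \<in> borel_measurable (M \<Otimes>\<^sub>M lborel)"
          unfolding kde_def by measurable
        then show ?thesis by (rule lborel.borel_measurable_lebesgue_integral)
      qed
      have "1 / real n \<le> 1 / (real n * h n)"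
        using elim(4) hp n by (intro divide_left_mono) (auto simp: mult_le_cancel_left1)
      then have n1: "1 / real n \<le> (rho n)\<^sup>2" using r(2) by linarith
      have "mean_le (\<lambda>\<omega>. (?Y \<omega> + ?b)\<^sup>2) (2 * (1 / real n) + 2 * ?b\<^sup>2)"
        by (rule mean_le_square_shift[OF mY v])
      moreover have "2 * (1 / real n) + 2 * ?b\<^sup>2 \<le> CB * (rho n)\<^sup>2"
        unfolding CB_def using n1 b by (simp add: algebra_simps)
      ultimately show ?thesis unfolding mass_dev_split[OF hp n] by (rule mean_le_weaken)
    qed
    ultimately show ?case unfolding dev_ok_def using n by blast
  qed
qed

text \<open>The weight \<open>1 / (x - p)^2\<close> integrates to \<open>2 / R\<close> outside
  radius \<open>R\<close>, so a mean squared error of order \<open>rho^2\<close> costs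
  \<open>rho^2 / R\<close>, which is small compared with \<open>rho\<close> when \<open>R\<close> is
  large compared with \<open>rho\<close>.\<close>

lemma ann_moment:
  assumes ok: "dev_ok n" and p: "p \<in> P" and R: "R > 0"
  shows "mean_le (\<lambda>\<omega>. ann_dev (fhat n (h n) \<omega>) p R) (8 * CE * (rho n)\<^sup>2 / (c\<^sup>2 * R))"
proof -
  let ?F = "\<lambda>\<omega> x. indicator {x. R < \<bar>x - p\<bar> \<and> \<bar>x - p\<bar> \<le> d} x * (4 * (fhat n (h n) \<omega> x - f x)\<^sup>2 / (c\<^sup>2 * (x - p)\<^sup>2))"
  let ?b = "\<lambda>x. 4 * CE * (rho n)\<^sup>2 / c\<^sup>2 * (indicator {x. R < \<bar>x - p\<bar>} x * (1 / (x - p)\<^sup>2))"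
  have b: "has_bochner_integral lborel ?b (4 * CE * (rho n)\<^sup>2 / c\<^sup>2 * (2 / R))"
    by (intro has_bochner_integral_mult_right annulus_inverse_square_integral R)
  have m: "(\<lambda>(\<omega>, x). ?F \<omega> x) \<in> borel_measurable (M \<Otimes>\<^sub>M lborel)"
    unfolding kde_def by measurable
  have e: "mean_le (\<lambda>\<omega>. ?F \<omega> x) (?b x)" for x
  proof (cases "R < \<bar>x - p\<bar> \<and> \<bar>x - p\<bar> \<le> d")
    case True
    have "mean_le (\<lambda>\<omega>. (fhat n (h n) \<omega> x - f x)\<^sup>2) (CE * (rho n)\<^sup>2)"
      using ok p True unfolding dev_ok_def by blast
    from mean_le_cmult[OF _ this, of "4 / (c\<^sup>2 * (x - p)\<^sup>2)"]
    show ?thesis using True by (simp add: mult_ac)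
  next
    case False
    then have z: "?F \<omega> x = 0" for \<omega> by (simp add: indicator_def)
    have "0 \<le> ?b x" using CE_nonneg by simp
    then show ?thesis unfolding z using mean_le_weaken[OF mean_le_const] by blast
  qed
  have i: "\<And>x. integrable M (\<lambda>\<omega>. ?F \<omega> x)" "\<And>x. expectation (\<lambda>\<omega>. ?F \<omega> x) \<le> ?b x"
    using e unfolding mean_le_def by blast+
  have nn: "0 \<le> ?F \<omega> x" for \<omega> x by simp
  have bi: "integrable lborel ?b" using b by (simp only: has_bochner_integral_iff)
  note E = expectation_integral_le[where F = ?F and b = ?b, OF m nn i bi]
  show ?thesis
    unfolding mean_le_def ann_dev_def using E has_bochner_integral_integral_eq[OF b] by simp
qed

text \<open>Three effects, each \<open>o(rho)\<close> in the window: the difference of biases by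
  continuity of \<open>f2\<close>, the Taylor remainder of order \<open>rho^2\<close>, and the
  random increment, whose variance is \<open>1 / (n h)\<close> times a multiple of
  \<open>rho / h\<close>.\<close>

lemma inc_second_moment:
  assumes k: "k \<ge> 1" and e: "e > 0"
  shows "eventually (\<lambda>n. \<forall>p\<in>P. \<forall>x. \<bar>x - p\<bar> \<le> k * rho n \<longrightarrow> mean_le (\<lambda>\<omega>. (inc (fhat n (h n) \<omega>) p x)\<^sup>2) (e * (rho n)\<^sup>2)) sequentially"
proof -
  \<comment> \<open>The deterministic part will be at most \<open>2 * e1 * rho\<close>, with square
    \<open>e / 4 * rho^2\<close>. Together with a variance of \<open>e / 4 * rho^2\<close>, both
    doubled by \<open>mean_le_square_shift\<close>, this gives \<open>e * rho^2\<close>.\<close>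
  define e1 where "e1 = sqrt (e / 16)"
  have e1: "e1 > 0" "e1\<^sup>2 = e / 16" unfolding e1_def using e by auto
  obtain h0 where h0: "h0 > 0" "\<And>h p x. 0 < h \<Longrightarrow> h < h0 \<Longrightarrow> p \<in> P \<Longrightarrow> \<bar>x - p\<bar> \<le> d \<Longrightarrow> \<bar>fbar h x - f x - h\<^sup>2 / 2 * mu2 * f2 x\<bar> \<le> e1 / 4 * h\<^sup>2"
    using bias_near[of "e1 / 4"] e1 by auto
  have "\<exists>dl>0. \<forall>p\<in>P. \<forall>x. \<bar>x - p\<bar> < dl \<longrightarrow> \<bar>f2 x - f2 p\<bar> < e1 / (mu2 + 1)"
  proof -
    have "\<exists>dl>0. \<forall>x. \<bar>x - p\<bar> < dl \<longrightarrow> \<bar>f2 x - f2 p\<bar> < e1 / (mu2 + 1)" if pP: "p \<in> P" for p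
    proof -
      have pos: "e1 / (mu2 + 1) > 0" using e1 mu2_nonneg by simp
      obtain dl where "dl > 0" "\<forall>x. dist x p < dl \<longrightarrow> dist (f2 x) (f2 p) < e1 / (mu2 + 1)"
        using f2_cont[OF pP] pos unfolding continuous_at_eps_delta by blast
      then show ?thesis by (auto simp: dist_real_def)
    qed
    then obtain D where D: "\<And>p. p \<in> P \<Longrightarrow> D p > 0 \<and> (\<forall>x. \<bar>x - p\<bar> < D p \<longrightarrow> \<bar>f2 x - f2 p\<bar> < e1 / (mu2 + 1))"
      by metis
    have "Min (D ` P) > 0" using P D by (subst Min_gr_iff) auto
    moreover have "Min (D ` P) \<le> D p" if "p \<in> P" for p using P that by simp
    ultimately show ?thesis using D by (intro exI[of _ "Min (D ` P)"]) (meson less_le_trans)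
  qed
  then obtain dl where dl: "dl > 0" "\<And>p x. p \<in> P \<Longrightarrow> \<bar>x - p\<bar> < dl \<Longrightarrow> \<bar>f2 x - f2 p\<bar> < e1 / (mu2 + 1)" by blast
  have "(\<lambda>n. 2 * Cf * LK * k * (rho n / h n)) \<longlonglongrightarrow> 2 * Cf * LK * k * 0" by (intro tendsto_mult tendsto_const rho_over_h)
  then have ev1: "eventually (\<lambda>n. 2 * Cf * LK * k * (rho n / h n) < e / 4) sequentially"
    by (rule order_tendstoD(2)) (use e in auto)
  have "(\<lambda>n. C3 * k\<^sup>2 * rho n) \<longlonglongrightarrow> C3 * k\<^sup>2 * 0" by (intro tendsto_mult tendsto_const rho_lim)
  then have ev2: "eventually (\<lambda>n. C3 * k\<^sup>2 * rho n < e1) sequentially"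
    by (rule order_tendstoD(2)) (use e1 in auto)
  have "k > 0" using k by simp
  then have ev3: "eventually (\<lambda>n. rho n < min d dl / k) sequentially"
    using const_pos dl by (intro ev_rho_less) auto
  show ?thesis using ev_n ev_h_less[OF h0(1)] ev1 ev2 ev3
  proof eventually_elim
    case (elim n)
    note n = elim(1) and hp = h_pos[of n]
    note r = rho_facts[OF n]
    show ?case
    proof (intro ballI allI impI)
      fix p x assume p: "p \<in> P" and x: "\<bar>x - p\<bar> \<le> k * rho n"
      have kr: "k * rho n < min d dl" using elim(5) \<open>k > 0\<close> by (simp add: field_simps)
      have xd: "\<bar>x - p\<bar> \<le> d" "\<bar>x - p\<bar> < dl" using x kr by auto
      define b where "b = (fbar (h n) x - f x) - (fbar (h n) p - f p) + (f x - L - m p * (x - p))"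
      have b1: "\<bar>(fbar (h n) x - f x) - (fbar (h n) p - f p)\<bar> \<le> e1 * h n ^ 2"
      proof -
        have a1: "\<bar>fbar (h n) x - f x - h n ^ 2 / 2 * mu2 * f2 x\<bar> \<le> e1 / 4 * h n ^ 2"
          by (rule h0(2)[OF hp elim(2) p xd(1)])
        have a2: "\<bar>fbar (h n) p - f p - h n ^ 2 / 2 * mu2 * f2 p\<bar> \<le> e1 / 4 * h n ^ 2"
          by (rule h0(2)[OF hp elim(2) p]) (use const_pos in simp)
        have "\<bar>h n ^ 2 / 2 * mu2 * f2 x - h n ^ 2 / 2 * mu2 * f2 p\<bar> = h n ^ 2 / 2 * (mu2 * \<bar>f2 x - f2 p\<bar>)"
        proof -
          have "h n ^ 2 / 2 * mu2 * f2 x - h n ^ 2 / 2 * mu2 * f2 p = h n ^ 2 / 2 * (mu2 * (f2 x - f2 p))" by (simp add: algebra_simps)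
          from arg_cong[where f=abs, OF this] show ?thesis unfolding abs_mult using mu2_nonneg by simp
        qed
        also have "\<dots> \<le> h n ^ 2 / 2 * (mu2 * (e1 / (mu2 + 1)))"
          using dl(2)[OF p xd(2)] mu2_nonneg by (intro mult_left_mono) auto
        also have "\<dots> \<le> h n ^ 2 / 2 * e1"
          using mu2_nonneg e1 by (intro mult_left_mono) (auto simp: field_simps)
        finally have a3: "\<bar>h n ^ 2 / 2 * mu2 * f2 x - h n ^ 2 / 2 * mu2 * f2 p\<bar> \<le> h n ^ 2 / 2 * e1" .
        have "\<bar>u - v\<bar> \<le> e1 * q" if "\<bar>u - s\<bar> \<le> e1 / 4 * q" "\<bar>v - t\<bar> \<le> e1 / 4 * q" "\<bar>s - t\<bar> \<le> q / 2 * e1" for u v s t q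
        proof -
          have "e1 * q = e1 / 4 * q + e1 / 4 * q + q / 2 * e1" by simp
          moreover have "\<bar>u - v\<bar> \<le> \<bar>u - s\<bar> + \<bar>v - t\<bar> + \<bar>s - t\<bar>" by linarith
          ultimately show ?thesis using that by linarith
        qed
        from this[OF a1 a2 a3] show ?thesis .
      qed
      have b2: "\<bar>f x - L - m p * (x - p)\<bar> \<le> e1 * rho n"
      proof -
        have C3: "C3 * (x - p)\<^sup>2 \<le> \<bar>C3\<bar> * (x - p)\<^sup>2" by (intro mult_right_mono) auto
        have sq: "(x - p)\<^sup>2 \<le> (k * rho n)\<^sup>2" using x by (intro abs_le_square_iff[THEN iffD1]) linarith
        have "C3 * (x - p)\<^sup>2 \<le> e1 * rho n"
        proof (cases "C3 \<ge> 0")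
          case True
          have "C3 * (x - p)\<^sup>2 \<le> C3 * (k * rho n)\<^sup>2" using sq True by (intro mult_left_mono) auto
          also have "\<dots> = C3 * k\<^sup>2 * rho n * rho n" by (simp add: power2_eq_square)
          also have "\<dots> \<le> e1 * rho n" using elim(4) r(1) by (intro mult_right_mono) auto
          finally show ?thesis .
        next
          case False
          then have "C3 * (x - p)\<^sup>2 \<le> 0" by (intro mult_nonpos_nonneg) auto
          moreover have "0 \<le> e1 * rho n" using e1 r(1) by simp
          ultimately show ?thesis by linarith
        qed
        then show ?thesis using quad[OF p xd(1)] by linarith
      qed
      have "e1 * h n ^ 2 \<le> e1 * rho n" using e1 r(3) by (intro mult_left_mono) auto
      then have "\<bar>b\<bar> \<le> 2 * (e1 * rho n)" unfolding b_def using b1 b2 by linarith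
      then have "b\<^sup>2 \<le> (2 * (e1 * rho n))\<^sup>2" by (intro abs_le_square_iff[THEN iffD1]) linarith
      also have "\<dots> = e / 4 * (rho n)\<^sup>2" using e1(2) by (simp add: power_mult_distrib)
      finally have bs: "b\<^sup>2 \<le> e / 4 * (rho n)\<^sup>2" .
      let ?D = "\<lambda>\<omega>. (fhat n (h n) \<omega> x - fbar (h n) x) - (fhat n (h n) \<omega> p - fbar (h n) p)"
      have "2 * Cf * LK * \<bar>x - p\<bar> / (real n * h n ^ 2) \<le> 2 * Cf * LK * (k * rho n) / (real n * h n ^ 2)"
        using x kde.Cf_nonneg LK_nonneg hp n by (intro divide_right_mono mult_left_mono) auto
      also have "\<dots> = 2 * Cf * LK * k * (rho n / h n) * (1 / (real n * h n))"
        by (simp add: power2_eq_square mult_ac)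
      also have "\<dots> \<le> e / 4 * (rho n)\<^sup>2"
        using elim(3) r(2) hp n e by (intro mult_mono) auto
      finally have vb: "2 * Cf * LK * \<bar>x - p\<bar> / (real n * h n ^ 2) \<le> e / 4 * (rho n)\<^sup>2" .
      have v: "mean_le (\<lambda>\<omega>. (?D \<omega>)\<^sup>2) (e / 4 * (rho n)\<^sup>2)"
        using fhat_incr_variance[OF hp n, of x p] vb unfolding mean_le_def by linarith
      have "mean_le (\<lambda>\<omega>. (?D \<omega> + b)\<^sup>2) (2 * (e / 4 * (rho n)\<^sup>2) + 2 * b\<^sup>2)"
        by (rule mean_le_square_shift[OF _ v]) measurable
      moreover have "?D \<omega> + b = inc (fhat n (h n) \<omega>) p x" for \<omega> unfolding b_def inc_def by simp
      moreover have "2 * (e / 4 * (rho n)\<^sup>2) + 2 * b\<^sup>2 \<le> e * (rho n)\<^sup>2" using bs by linarith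
      ultimately show "mean_le (\<lambda>\<omega>. (inc (fhat n (h n) \<omega>) p x)\<^sup>2) (e * (rho n)\<^sup>2)"
        using mean_le_weaken by simp
    qed
  qed
qed

lemma inc_moment:
  assumes n: "n > 0" and p: "p \<in> P" and R: "R > 0" and b: "b \<ge> 0"
    and le: "\<And>x. \<bar>x - p\<bar> \<le> R \<Longrightarrow> mean_le (\<lambda>\<omega>. (inc (fhat n (h n) \<omega>) p x)\<^sup>2) b"
  shows "mean_le (\<lambda>\<omega>. inc_dev (fhat n (h n) \<omega>) p R) (2 * R * b)"
proof -
  let ?F = "\<lambda>\<omega> x. indicator {x. \<bar>x - p\<bar> \<le> R} x * (inc (fhat n (h n) \<omega>) p x)\<^sup>2"
  let ?b = "\<lambda>x. b * indicator {x. \<bar>x - p\<bar> \<le> R} x :: real"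
  have b: "has_bochner_integral lborel ?b (b * (2 * R))"
    using R by (intro has_bochner_integral_mult_right lborel_cball_real) simp
  have m: "(\<lambda>(\<omega>, x). ?F \<omega> x) \<in> borel_measurable (M \<Otimes>\<^sub>M lborel)"
    unfolding inc_def kde_def by measurable
  have e: "mean_le (\<lambda>\<omega>. ?F \<omega> x) (?b x)" for x
    using le[of x] mean_le_const[of 0] by (cases "\<bar>x - p\<bar> \<le> R") (simp_all add: indicator_def)
  have i: "\<And>x. integrable M (\<lambda>\<omega>. ?F \<omega> x)" "\<And>x. expectation (\<lambda>\<omega>. ?F \<omega> x) \<le> ?b x"
    using e unfolding mean_le_def by blast+
  have nn: "0 \<le> ?F \<omega> x" for \<omega> x by simp
  have bi: "integrable lborel ?b" using b by (simp only: has_bochner_integral_iff)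
  note E = expectation_integral_le[where F = ?F and b = ?b, OF m nn i bi]
  show ?thesis
    unfolding mean_le_def inc_dev_def
  proof
    show "expectation (\<lambda>\<omega>. LINT x|lborel. ?F \<omega> x) \<le> 2 * R * b"
      using E(2) unfolding has_bochner_integral_integral_eq[OF b] by (rule order_trans) simp
  qed (rule E(1))
qed

end

section \<open>Choice of the tuning parameters\<close>

context hdr_bandwidth
begin

lemma estimate_locale:
  assumes n: "n > 0" and e1: "0 < e1" "e1 \<le> L / 2" "e1 \<le> c1 / 2" "e1 \<le> 2 * C1 * d" "3 * e1 * (4 / c) \<le> L / (4 * C1)" "3 * e1 \<le> L"
    and b: "\<And>x. \<bar>fbar (h n) x - f x\<bar> \<le> e1 / 2"
  shows "level_crossings_estimate f m \<tau> L Cf C1 c c1 d P (fhat n (h n) \<omega>) (fbar (h n)) (CK / h n) e1"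
proof (intro level_crossings_estimate.intro level_crossings_estimate_axioms.intro lc.level_crossings_axioms)
  show "integrable lborel (fhat n (h n) \<omega>)"
    using fhat_int[OF h_pos n, of \<omega>] by (simp only: has_bochner_integral_iff)
  show "integrable lborel (\<lambda>x. (fhat n (h n) \<omega> x - fbar (h n) x)\<^sup>2)" by (rule fhat_dev_square_int[OF h_pos n])
  show "0 \<le> fhat n (h n) \<omega> x" "fhat n (h n) \<omega> x \<le> CK / h n" for x by (rule fhat_bounds[OF h_pos n])+
qed (fact e1 b)+

lemma f_at_crossing: "p \<in> P \<Longrightarrow> f p = L"
  using upper[of p p] const_pos by simp

text \<open>With \<open>r = rho n\<close>, \<open>e = t * r\<close>, \<open>R = r / t\<close>,
  \<open>e1 = t^2\<close> and increments of second moment \<open>t^4 * r^2\<close>, every main term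
  has mean at most a constant times \<open>t * r\<close>. The constant \<open>C\<close> is fixed
  before \<open>t\<close>, so \<open>t\<close> can be sent to 0 afterwards;
  \<open>rest_factor e1\<close> does depend on \<open>t\<close>, but it multiplies terms of order
  \<open>r^2\<close>.\<close>

lemma risk_close_param:
  "\<exists>C>0. \<exists>t0>0. \<forall>t. 0 < t \<and> t \<le> t0 \<longrightarrow> eventually (\<lambda>n. n > 0 \<and>
      mean_le (\<lambda>\<omega>. \<bar>risk n (h n) \<omega> - risk_lin (fhat n (h n) \<omega>)\<bar>) (C * t * rho n)) sequentially"
proof -
  define Q where "Q = 3 + 2 * nP * radius_factor + 8 * nP * CE / c\<^sup>2 + (CB + nP * CE) + (1 + CB + nP * (1 + CE))"
  define C where "C = main_factor * Q + 1"
  \<comment> \<open>The conditions on \<open>e1\<close> are imposed on \<open>t\<close> instead, as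
    \<open>e1 = t^2 \<le> t\<close>.\<close>
  define t0 where "t0 = min 1 (min (L / 3) (min (c1 / 2) (min (2 * C1 * d) (L * c / (48 * C1)))))"
  note cp = const_pos
  have t0: "t0 > 0" unfolding t0_def using L_pos cp by simp
  have Q0: "Q \<ge> 0" unfolding Q_def using pos CE_nonneg CB_nonneg by (intro add_nonneg_nonneg mult_nonneg_nonneg divide_nonneg_nonneg) auto
  have C0: "C > 0" unfolding C_def using pos Q0 by (simp add: add_nonneg_pos)
  have "eventually (\<lambda>n. n > 0 \<and> mean_le (\<lambda>\<omega>. \<bar>risk n (h n) \<omega> - risk_lin (fhat n (h n) \<omega>)\<bar>) (C * t * rho n)) sequentially"
    if t: "0 < t" "t \<le> t0" for t
  proof -
    have t1: "t \<le> 1" "t \<le> L / 3" "t \<le> c1 / 2" "t \<le> 2 * C1 * d" "t \<le> L * c / (48 * C1)"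
      using t unfolding t0_def by auto
    define e1 where "e1 = t\<^sup>2"
    have e1t: "e1 \<le> t" unfolding e1_def power2_eq_square using t t1(1) mult_left_le by simp
    have e1p: "0 < e1" unfolding e1_def using t by simp
    have e1c: "e1 \<le> L / 2" "e1 \<le> c1 / 2" "e1 \<le> 2 * C1 * d" "3 * e1 \<le> L"
      using e1t t1 L_pos by auto
    have e1c': "3 * e1 * (4 / c) \<le> L / (4 * C1)"
    proof -
      have "e1 \<le> L * c / (48 * C1)" using e1t t1 by simp
      then have "e1 * (12 / c) \<le> L * c / (48 * C1) * (12 / c)" using cp by (intro mult_right_mono) auto
      then show ?thesis using cp by simp
    qed
    define k where "k = radius_factor / t"
    have k1: "k \<ge> 1" unfolding k_def using pos(5) t t1(1) by (simp add: field_simps)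
    define R2 where "R2 = fixed_radius e1"
    have R2: "R2 > 0" unfolding R2_def using pos_e1[OF e1p] by simp
    define RF where "RF = rest_factor e1"
    have RF: "RF > 0" unfolding RF_def using pos_e1[OF e1p] by simp
    define G where "G = CK + CB + nP * CE + nP * (8 * CE / (c\<^sup>2 * R2))"
    have G0: "G \<ge> 0" unfolding G_def using pos CE_nonneg CB_nonneg CK_nonneg R2
      by (intro add_nonneg_nonneg mult_nonneg_nonneg divide_nonneg_nonneg) auto
    obtain h0 where h0: "h0 > 0" "\<And>h x. 0 < h \<Longrightarrow> h < h0 \<Longrightarrow> \<bar>fbar h x - f x\<bar> \<le> e1 / 2"
      using fbar_uniform[of "e1 / 2"] e1p by auto
    have t4: "t ^ 4 > 0" using t by simp
    \<comment> \<open>As thresholds for \<open>rho n\<close> these give, in turn,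
      \<open>e \<le> e1 / 2\<close>, windows inside the neighbourhoods of radius \<open>d\<close>,
      and rest terms of at most \<open>t * r\<close>.\<close>
    have a1: "t / 2 > 0" "d / k > 0" "t / (RF * G + 1) > 0"
      using t cp k1 RF G0 by (auto intro!: divide_pos_pos add_nonneg_pos mult_nonneg_nonneg)
    show ?thesis
      using ev_dev_ok inc_second_moment[OF k1 t4] ev_h_less[OF h0(1)] ev_rho_less[OF a1(1)] ev_rho_less[OF a1(2)] ev_rho_less[OF a1(3)]
    proof eventually_elim
      case (elim n)
      note ok = elim(1)
      have n: "n > 0" using ok by (simp add: dev_ok_def)
      note hp = h_pos[of n]
      define r where "r = rho n"
      have r: "r > 0" "1 / (real n * h n) \<le> r\<^sup>2" unfolding r_def using rho_facts[OF n] by auto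
      define g where "g = fhat n (h n)"
      define e where "e = t * r"
      define R where "R = r / t"
      have e: "0 < e" "e \<le> e1 / 2" using r t elim(4) unfolding e_def e1_def r_def power2_eq_square by auto
      have R: "0 < R" "radius_factor * R = k * r" unfolding R_def k_def using r t by auto
      have Rd: "radius_factor * R \<le> d" unfolding R(2) using elim(5) k1 unfolding r_def by (simp add: field_simps)
      have est: "level_crossings_estimate f m \<tau> L Cf C1 c c1 d P (g \<omega>) (fbar (h n)) (CK / h n) e1" for \<omega>
        unfolding g_def by (rule estimate_locale[OF n e1p e1c(1-3) e1c' e1c(4) h0(2)[OF hp elim(3)]])
      note det = level_crossings_estimate.risk_linearisation_explicit[OF est e R(1) Rd]
      have grv: "(\<lambda>\<omega>. g \<omega> x) \<in> borel_measurable M" for x unfolding g_def by (rule fhat_rv)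
      have mrv: "(\<lambda>\<omega>. mass_dev (g \<omega>)) \<in> borel_measurable M" unfolding g_def by (rule mass_dev_rv[OF hp n])
      have m1: "mean_le (\<lambda>\<omega>. (g \<omega> p - f p)\<^sup>2) (CE * r\<^sup>2)" if "p \<in> P" for p
        using ok that cp unfolding dev_ok_def g_def r_def by simp
      have m2: "mean_le (\<lambda>\<omega>. (mass_dev (g \<omega>))\<^sup>2) (CB * r\<^sup>2)"
        using ok unfolding dev_ok_def g_def r_def by simp
      have m3: "mean_le (\<lambda>\<omega>. LINT x|lborel. (g \<omega> x - fbar (h n) x)\<^sup>2) (CK * r\<^sup>2)"
      proof -
        have "mean_le (\<lambda>\<omega>. LINT x|lborel. (g \<omega> x - fbar (h n) x)\<^sup>2) (CK * (1 / (real n * h n)))"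
          using fhat_ise[OF hp n] unfolding mean_le_def g_def by simp
        then show ?thesis using mult_left_mono[OF r(2) CK_nonneg] by (rule mean_le_weaken)
      qed
      have m4: "mean_le (\<lambda>\<omega>. ann_dev (g \<omega>) p s) (8 * CE * r\<^sup>2 / (c\<^sup>2 * s))" if "p \<in> P" "s > 0" for p s
        unfolding g_def r_def by (rule ann_moment[OF ok that])
      have m5: "mean_le (\<lambda>\<omega>. inc_dev (g \<omega>) p (radius_factor * R)) (2 * (k * r) * (t ^ 4 * r\<^sup>2))" if "p \<in> P" for p
        unfolding g_def R(2)
      proof (rule inc_moment[OF n that])
        show "k * r > 0" using k1 r by simp
        show "0 \<le> t ^ 4 * r\<^sup>2" by simp
        show "\<bar>x - p\<bar> \<le> k * r \<Longrightarrow> mean_le (\<lambda>\<omega>. (inc (fhat n (h n) \<omega>) p x)\<^sup>2) (t ^ 4 * r\<^sup>2)" for x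
          using elim(2) that unfolding r_def by blast
      qed
      have m6: "mean_le (\<lambda>\<omega>. \<bar>mass_dev (g \<omega>)\<bar>) ((1 + CB) * r)" by (rule mean_le_abs[OF mrv m2 r(1)])
      have m7: "mean_le (\<lambda>\<omega>. \<bar>g \<omega> p - f p\<bar>) ((1 + CE) * r)" if "p \<in> P" for p
        by (rule mean_le_abs[OF _ m1[OF that] r(1)]) (use grv in measurable)
      let ?bound = "\<lambda>\<omega>. main_factor * (e + (\<Sum>p\<in>P. inc_dev (g \<omega>) p (radius_factor * R)) / e\<^sup>2 + (\<Sum>p\<in>P. ann_dev (g \<omega>) p R)
            + ((mass_dev (g \<omega>))\<^sup>2 + (\<Sum>p\<in>P. (g \<omega> p - f p)\<^sup>2)) / R
            + e1 * (\<bar>mass_dev (g \<omega>)\<bar> + (\<Sum>p\<in>P. \<bar>g \<omega> p - f p\<bar>) + R))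
        + RF * ((LINT x|lborel. (g \<omega> x - fbar (h n) x)\<^sup>2) + (mass_dev (g \<omega>))\<^sup>2 + (\<Sum>p\<in>P. (g \<omega> p - f p)\<^sup>2)
            + (\<Sum>p\<in>P. ann_dev (g \<omega>) p R2))"
      let ?value = "main_factor * (e + (\<Sum>p\<in>P. 2 * (k * r) * (t ^ 4 * r\<^sup>2)) / e\<^sup>2 + (\<Sum>p\<in>P. 8 * CE * r\<^sup>2 / (c\<^sup>2 * R))
            + (CB * r\<^sup>2 + (\<Sum>p\<in>P. CE * r\<^sup>2)) / R
            + e1 * ((1 + CB) * r + (\<Sum>p\<in>P. (1 + CE) * r) + R))
        + RF * (CK * r\<^sup>2 + CB * r\<^sup>2 + (\<Sum>p\<in>P. CE * r\<^sup>2) + (\<Sum>p\<in>P. 8 * CE * r\<^sup>2 / (c\<^sup>2 * R2)))"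
      have mb: "mean_le ?bound ?value"
        using pos(9) RF e1p R(1) R2
        by (intro mean_le_add mean_le_cmult mean_le_divide mean_le_sum mean_le_const m1 m2 m3 m4 m5 m6 m7) auto
      \<comment> \<open>\<open>t^4\<close> divided by the \<open>t^2\<close> of \<open>e^2\<close>,
        times \<open>k = radius_factor / t\<close>, leaves one factor \<open>t\<close>.\<close>
      have v1: "(\<Sum>p\<in>P. 2 * (k * r) * (t ^ 4 * r\<^sup>2)) / e\<^sup>2 = 2 * nP * radius_factor * t * r"
        unfolding e_def k_def nP_def using t r by (simp add: field_simps power2_eq_square power4_eq_xxxx)
      have v2: "(\<Sum>p\<in>P. 8 * CE * r\<^sup>2 / (c\<^sup>2 * R)) = 8 * nP * CE / c\<^sup>2 * t * r"
        unfolding R_def nP_def using t r cp by (simp add: field_simps power2_eq_square)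
      have v3: "(CB * r\<^sup>2 + (\<Sum>p\<in>P. CE * r\<^sup>2)) / R = (CB + nP * CE) * t * r"
        unfolding R_def nP_def using t r by (simp add: field_simps power2_eq_square)
      have v4: "e1 * ((1 + CB) * r + (\<Sum>p\<in>P. (1 + CE) * r) + R) \<le> (1 + CB + nP * (1 + CE)) * t * r + t * r"
      proof -
        have "e1 * ((1 + CB) * r + (\<Sum>p\<in>P. (1 + CE) * r)) \<le> t * ((1 + CB) * r + (\<Sum>p\<in>P. (1 + CE) * r))"
          using e1t r CB_nonneg CE_nonneg by (intro mult_right_mono add_nonneg_nonneg sum_nonneg) auto
        moreover have "e1 * R = t * r" unfolding e1_def R_def using t by (simp add: power2_eq_square)
        ultimately show ?thesis unfolding nP_def by (simp add: algebra_simps)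
      qed
      have v5: "RF * (CK * r\<^sup>2 + CB * r\<^sup>2 + (\<Sum>p\<in>P. CE * r\<^sup>2) + (\<Sum>p\<in>P. 8 * CE * r\<^sup>2 / (c\<^sup>2 * R2))) \<le> t * r"
      proof -
        have q: "RF * G + 1 > 0" using RF G0 by (simp add: add_nonneg_pos)
        have "r * (RF * G + 1) < t" using elim(6) unfolding pos_less_divide_eq[OF q] r_def .
        then have "(RF * G + 1) * r \<le> t" by (simp add: mult.commute)
        then have "RF * G * r \<le> t" using r by (simp add: distrib_right)
        then have "RF * G * r * r \<le> t * r" using r by (intro mult_right_mono) auto
        moreover have "RF * (CK * r\<^sup>2 + CB * r\<^sup>2 + (\<Sum>p\<in>P. CE * r\<^sup>2) + (\<Sum>p\<in>P. 8 * CE * r\<^sup>2 / (c\<^sup>2 * R2))) = RF * G * r * r"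
          unfolding G_def nP_def by (simp add: algebra_simps power2_eq_square)
        ultimately show ?thesis by (simp only:)
      qed
      have "?value \<le> main_factor * (t * r + 2 * nP * radius_factor * t * r + 8 * nP * CE / c\<^sup>2 * t * r + (CB + nP * CE) * t * r
          + ((1 + CB + nP * (1 + CE)) * t * r + t * r)) + t * r"
        unfolding v1 v2 v3 unfolding e_def
        by (rule add_mono[OF mult_left_mono[OF add_left_mono[OF v4]] v5]) (use pos(9) in simp)
      also have "\<dots> \<le> main_factor * (Q * (t * r)) + t * r"
        unfolding Q_def using pos(9) t r by (intro add_mono mult_left_mono) (auto simp: algebra_simps)
      also have "\<dots> = C * t * r" unfolding C_def by (simp add: algebra_simps)
      finally have val: "?value \<le> C * t * r" .
      have "mean_le (\<lambda>\<omega>. \<bar>risk n (h n) \<omega> - risk_lin (g \<omega>)\<bar>) (C * t * r)"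
      proof (rule mean_le_dominated[OF mean_le_weaken[OF mb val]])
        show "(\<lambda>\<omega>. \<bar>risk n (h n) \<omega> - risk_lin (g \<omega>)\<bar>) \<in> borel_measurable M"
          unfolding g_def using risk_rv[OF hp n] risk_lin_rv[OF hp n] by measurable
        show "\<bar>risk n (h n) \<omega> - risk_lin (g \<omega>)\<bar> \<le> ?bound \<omega>" for \<omega>
          using det[of \<omega>] unfolding risk_def g_def RF_def R2_def .
      qed simp
      then show ?case using n unfolding g_def r_def by simp
    qed
  qed
  then show ?thesis using C0 t0 by blast
qed

lemma risk_nonneg_le: "0 \<le> risk n hh \<omega>" "risk n hh \<omega> \<le> 1"
proof -
  let ?S = "sym_diff (hdr \<tau> (fhat n hh \<omega>)) {x. L \<le> f x}"
  have eq: "risk n hh \<omega> = (LINT x|lborel. indicator ?S x * f x)"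
    unfolding risk_def density_mass_def set_lebesgue_integral_def by simp
  show "0 \<le> risk n hh \<omega>" unfolding eq using kde.f_nonneg by (intro integral_nonneg_AE AE_I2) simp
  show "risk n hh \<omega> \<le> 1"
  proof (cases "integrable lborel (\<lambda>x. indicator ?S x * f x)")
    case True
    have "risk n hh \<omega> \<le> (LINT x|lborel. f x)"
      unfolding eq using kde.f_nonneg kde.f_int by (intro integral_mono True) (auto simp: indicator_def)
    then show ?thesis using kde.f_int by simp
  next
    case False
    \<comment> \<open>A non-integrable integrand has integral 0 by convention.\<close>
    then show ?thesis unfolding eq by (simp add: not_integrable_integral_eq)
  qed
qed

lemma risk_lin_approx:
  "(\<lambda>n. (expectation (risk n (h n)) - expectation (\<lambda>\<omega>. risk_lin (fhat n (h n) \<omega>))) / rho n) \<longlonglongrightarrow> 0"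
proof (rule tendstoI)
  fix eps :: real assume eps: "eps > 0"
  obtain C t0 where C: "C > 0" "t0 > 0" "\<And>t. 0 < t \<Longrightarrow> t \<le> t0 \<Longrightarrow> eventually (\<lambda>n. n > 0 \<and>
      mean_le (\<lambda>\<omega>. \<bar>risk n (h n) \<omega> - risk_lin (fhat n (h n) \<omega>)\<bar>) (C * t * rho n)) sequentially"
    using risk_close_param by blast
  define t where "t = min t0 (eps / (2 * C))"
  have t: "0 < t" "t \<le> t0" "C * t < eps"
  proof -
    show "0 < t" "t \<le> t0" unfolding t_def using C eps by auto
    have "C * t \<le> C * (eps / (2 * C))" unfolding t_def using C by (intro mult_left_mono) auto
    also have "\<dots> < eps" using C eps by simp
    finally show "C * t < eps" .
  qed
  show "eventually (\<lambda>n. dist ((expectation (risk n (h n)) - expectation (\<lambda>\<omega>. risk_lin (fhat n (h n) \<omega>))) / rho n) 0 < eps) sequentially"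
    using C(3)[OF t(1,2)]
  proof eventually_elim
    case (elim n)
    then have n: "n > 0" and ml: "integrable M (\<lambda>\<omega>. \<bar>risk n (h n) \<omega> - risk_lin (fhat n (h n) \<omega>)\<bar>)"
      "expectation (\<lambda>\<omega>. \<bar>risk n (h n) \<omega> - risk_lin (fhat n (h n) \<omega>)\<bar>) \<le> C * t * rho n"
      unfolding mean_le_def by auto
    note hp = h_pos[of n]
    have i1: "integrable M (risk n (h n))"
      using risk_rv[OF hp n] risk_nonneg_le by (intro integrable_const_bound[where B=1]) auto
    have m: "(\<lambda>\<omega>. risk n (h n) \<omega> - risk_lin (fhat n (h n) \<omega>)) \<in> borel_measurable M"
      using risk_rv[OF hp n] risk_lin_rv[OF hp n] by measurable
    have i2: "integrable M (\<lambda>\<omega>. risk n (h n) \<omega> - risk_lin (fhat n (h n) \<omega>))"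
      using ml(1) m by (simp add: integrable_abs_iff)
    \<comment> \<open>Integrability of the linearised risk is inherited from the bounded risk and
      the integrable difference.\<close>
    have i3: "integrable M (\<lambda>\<omega>. risk_lin (fhat n (h n) \<omega>))"
      using Bochner_Integration.integrable_diff[OF i1 i2] by simp
    have "\<bar>expectation (risk n (h n)) - expectation (\<lambda>\<omega>. risk_lin (fhat n (h n) \<omega>))\<bar>
        = \<bar>expectation (\<lambda>\<omega>. risk n (h n) \<omega> - risk_lin (fhat n (h n) \<omega>))\<bar>"
      using i1 i3 by simp
    also have "\<dots> \<le> expectation (\<lambda>\<omega>. \<bar>risk n (h n) \<omega> - risk_lin (fhat n (h n) \<omega>)\<bar>)" by (rule integral_abs_bound)
    also have "\<dots> \<le> C * t * rho n" by (rule ml(2))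
    also have "\<dots> < eps * rho n" using t(3) rho_facts(1)[OF n] by (intro mult_strict_right_mono)
    finally show ?case using rho_facts(1)[OF n] by (simp add: dist_real_def abs_divide divide_less_eq)
  qed
qed

end

section \<open>The limiting risk along a bandwidth sequence\<close>

context hdr_bandwidth
begin

definition RK :: real where "RK = (LINT w|lborel. (K w)\<^sup>2)"

lemma K_square_int: "integrable lborel (\<lambda>w. (K w)\<^sup>2)"
proof (rule Bochner_Integration.integrable_bound)
  show "integrable lborel (\<lambda>w. CK * K w)" using K_int by simp
  show "AE w in lborel. norm ((K w)\<^sup>2) \<le> norm (CK * K w)"
    using K_nonneg K_le CK_nonneg by (intro AE_I2) (simp add: power2_eq_square mult_right_mono)
qed measurable

lemma RK_pos: "RK > 0"
proof -
  have nn: "RK \<ge> 0" unfolding RK_def by simp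
  have "RK \<noteq> 0"
  proof
    assume "RK = 0"
    then have "AE w in lborel. (K w)\<^sup>2 = 0"
      unfolding RK_def using integral_nonneg_eq_0_iff_AE[OF K_square_int] by simp
    then have "AE w in lborel. K w = 0" by simp
    then have "(LINT w|lborel. K w) = 0" by (subst integral_cong_AE[where g="\<lambda>_. 0"]) auto
    then show False using K_int by simp
  qed
  then show ?thesis using nn by simp
qed

lemma K_uniformly_continuous: "uniformly_continuous_on UNIV K"
  unfolding uniformly_continuous_on_def
proof (intro allI impI)
  fix e :: real assume e: "e > 0"
  show "\<exists>dl>0. \<forall>x\<in>UNIV. \<forall>x'\<in>UNIV. dist x' x < dl \<longrightarrow> dist (K x') (K x) < e"
  proof (intro exI[of _ "e / (LK + 1)"] conjI ballI impI)
    show "0 < e / (LK + 1)" using e LK_nonneg by simp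
    fix x x' :: real assume "dist x' x < e / (LK + 1)"
    then have "\<bar>x' - x\<bar> * (LK + 1) < e" using LK_nonneg by (simp add: dist_real_def field_simps)
    moreover have "\<bar>K x' - K x\<bar> \<le> LK * \<bar>x' - x\<bar>" by (rule K_lip)
    moreover have "\<bar>x' - x\<bar> * (LK + 1) = LK * \<bar>x' - x\<bar> + \<bar>x' - x\<bar>" by (simp add: algebra_simps)
    ultimately show "dist (K x') (K x) < e" unfolding dist_real_def by linarith
  qed
qed

lemma K_at_infinity: "(K \<longlongrightarrow> 0) at_infinity"
  by (rule uniformly_continuous_integrable_tendsto_0[OF K_uniformly_continuous K_int(1) K_nonneg])

lemma inverse_h_at_top: "filterlim (\<lambda>n. inverse (h n)) at_top sequentially"
  using h_lim h_pos by (intro filterlim_inverse_at_top) auto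

text \<open>After substitution the second kernel is evaluated at \<open>(l - k) / h n + w\<close>,
  which escapes to infinity unless \<open>k = l\<close>. Hence estimation errors at different
  crossings are asymptotically uncorrelated.\<close>

lemma cross_moment:
  assumes k: "k \<in> P" and l: "l \<in> P"
  shows "(\<lambda>n. h n * pint (\<lambda>z. psi (h n) k z * psi (h n) l z)) \<longlonglongrightarrow> (if k = l then L * RK else 0)"
proof -
  have eq: "h n * pint (\<lambda>z. psi (h n) k z * psi (h n) l z) = (LINT w|lborel. K w * (K ((l - k) / h n + w) * f (k - h n * w)))" for n
  proof -
    have "pint (\<lambda>z. psi (h n) k z * psi (h n) l z) = (LINT z|lborel. psi (h n) k z * (psi (h n) l z * f z))"
      by (simp add: mult_ac)
    also have "\<dots> = (LINT w|lborel. K w * (psi (h n) l (k - h n * w) * f (k - h n * w)))"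
      by (rule kernel_substitution[OF h_pos])
    finally have "h n * pint (\<lambda>z. psi (h n) k z * psi (h n) l z) = (LINT w|lborel. h n * (K w * (psi (h n) l (k - h n * w) * f (k - h n * w))))"
      by simp
    also have "\<dots> = (LINT w|lborel. K w * (K ((l - k) / h n + w) * f (k - h n * w)))"
    proof (intro Bochner_Integration.integral_cong refl)
      fix w
      have "(l - (k - h n * w)) / h n = (l - k) / h n + w" using h_pos[of n] by (simp add: field_simps)
      then show "h n * (K w * (psi (h n) l (k - h n * w) * f (k - h n * w))) = K w * (K ((l - k) / h n + w) * f (k - h n * w))"
        using h_pos[of n] by (simp add: psi_def)
    qed
    finally show ?thesis .
  qed
  have lim_f: "(\<lambda>n. f (k - h n * w)) \<longlonglongrightarrow> f k" for w
  proof -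
    have "isCont f k" using uniformly_continuous_imp_continuous[OF f_uc] by (simp add: continuous_on_eq_continuous_at)
    moreover have "(\<lambda>n. k - h n * w) \<longlonglongrightarrow> k - 0 * w" by (intro tendsto_intros h_lim)
    ultimately show ?thesis using isCont_tendsto_compose by fastforce
  qed
  have "(\<lambda>n. LINT w|lborel. K w * (K ((l - k) / h n + w) * f (k - h n * w))) \<longlonglongrightarrow>
      (LINT w|lborel. K w * ((if k = l then K w else 0) * f k))"
  proof (rule integral_dominated_convergence[where w="\<lambda>w. CK * Cf * K w"])
    show "AE w in lborel. (\<lambda>n. K w * (K ((l - k) / h n + w) * f (k - h n * w))) \<longlonglongrightarrow> K w * ((if k = l then K w else 0) * f k)"
    proof (rule AE_I2)
      fix w
      have "(\<lambda>n. K ((l - k) / h n + w)) \<longlonglongrightarrow> (if k = l then K w else 0)"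
      proof (cases "k = l")
        case False
        have "filterlim (\<lambda>n. \<bar>l - k\<bar> * inverse (h n)) at_top sequentially"
          using False by (intro filterlim_tendsto_pos_mult_at_top[OF tendsto_const _ inverse_h_at_top]) auto
        then have "filterlim (\<lambda>n. norm ((l - k) / h n)) at_top sequentially"
          using h_pos by (simp add: norm_divide divide_inverse abs_mult abs_of_pos)
        then have "filterlim (\<lambda>n. (l - k) / h n) at_infinity sequentially"
          by (simp add: filterlim_norm_at_top_imp_at_infinity)
        then have "filterlim (\<lambda>n. w + (l - k) / h n) at_infinity sequentially"
          by (intro tendsto_add_filterlim_at_infinity[OF tendsto_const])
        from filterlim_compose[OF K_at_infinity this]
        show ?thesis using False by (simp add: add.commute)
      qed simp
      then show "(\<lambda>n. K w * (K ((l - k) / h n + w) * f (k - h n * w))) \<longlonglongrightarrow> K w * ((if k = l then K w else 0) * f k)"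
        by (intro tendsto_mult tendsto_const lim_f)
    qed
    show "AE w in lborel. norm (K w * (K ((l - k) / h n + w) * f (k - h n * w))) \<le> CK * Cf * K w" for n
    proof (rule AE_I2)
      fix w
      have "K ((l - k) / h n + w) * f (k - h n * w) \<le> CK * Cf"
        using K_nonneg K_le kde.f_nonneg kde.f_le CK_nonneg by (intro mult_mono) auto
      then have "K w * (K ((l - k) / h n + w) * f (k - h n * w)) \<le> K w * (CK * Cf)" using K_nonneg by (intro mult_left_mono) auto
      then show "norm (K w * (K ((l - k) / h n + w) * f (k - h n * w))) \<le> CK * Cf * K w"
        using K_nonneg kde.f_nonneg by (simp add: abs_mult mult_ac)
    qed
  qed (use K_int in \<open>simp_all\<close>)
  moreover have "(LINT w|lborel. K w * ((if k = l then K w else 0) * f k)) = (if k = l then L * RK else 0)"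
    using f_at_crossing[OF k] by (simp add: RK_def power2_eq_square mult.commute mult.left_commute)
  ultimately show ?thesis unfolding eq by simp
qed

text \<open>Weight of the estimation error at \<open>k\<close> in the error at \<open>p\<close>
  minus the linearised level displacement.\<close>

definition lin_coef :: "real \<Rightarrow> real \<Rightarrow> real" where
  "lin_coef p k = (if k = p then 1 else 0) - 1 / \<bar>m k\<bar> / slope_sum"

definition lin_var :: "real \<Rightarrow> real" where
  "lin_var p = L * RK * (\<Sum>k\<in>P. (lin_coef p k)\<^sup>2)"

definition lin_noise :: "nat \<Rightarrow> real \<Rightarrow> 'a \<Rightarrow> real" where
  "lin_noise n p \<omega> = (\<Sum>k\<in>P. lin_coef p k * (fhat n (h n) \<omega> k - fbar (h n) k))"

definition lin_bias :: "real \<Rightarrow> real" where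
  "lin_bias p = mu2 / 2 * (f2 p - ((\<Sum>k\<in>P. f2 k / \<bar>m k\<bar>) + Jm / L) / slope_sum)"

text \<open>A single crossing would have coefficient \<open>1 - 1 = 0\<close>, its error being
  cancelled by the level. A second crossing always contributes.\<close>

lemma lin_var_pos:
  assumes p: "p \<in> P" and c2: "card P \<ge> 2"
  shows "lin_var p > 0"
proof -
  have "P - {p} \<noteq> {}"
  proof
    assume "P - {p} = {}"
    then have "P \<subseteq> {p}" by blast
    then have "card P \<le> card {p}" by (intro card_mono) auto
    then show False using c2 by simp
  qed
  then obtain k where k: "k \<in> P" "k \<noteq> p" by blast
  have "lin_coef p k \<noteq> 0" using k slope_nz[OF k(1)] slope_sum_pos by (simp add: lin_coef_def)
  then have "0 < (lin_coef p k)\<^sup>2" by simp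
  also have "\<dots> \<le> (\<Sum>k\<in>P. (lin_coef p k)\<^sup>2)" by (rule member_le_sum[OF k(1)]) (auto simp: P)
  finally show ?thesis unfolding lin_var_def using L_pos RK_pos by simp
qed

text \<open>\<open>b\<close> is left arbitrary because the bias in units of
  \<open>1 / sqrt (n h)\<close> may be unbounded; convergence of the mean absolute values is uniform
  in such shifts.\<close>

lemma lin_noise_clt:
  assumes p: "p \<in> P" and c2: "card P \<ge> 2"
  shows "(\<lambda>n. (expectation (\<lambda>\<omega>. \<bar>lin_noise n p \<omega> + b n\<bar>)
        - sqrt (lin_var p) / sqrt (real n * h n) * (LINT v|std_normal_distribution. \<bar>v + b n * sqrt (real n * h n) / sqrt (lin_var p)\<bar>)) / rho n) \<longlonglongrightarrow> 0"
proof -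
  define sg where "sg = sqrt (lin_var p)"
  have sg: "sg > 0" "sg\<^sup>2 = lin_var p" unfolding sg_def using lin_var_pos[OF p c2] by auto
  define Psi where "Psi n z = (\<Sum>k\<in>P. lin_coef p k * psi (h n) k z)" for n z
  define A where "A = (\<Sum>k\<in>P. \<bar>lin_coef p k\<bar>)"
  have PsiM[measurable]: "Psi n \<in> borel_measurable borel" for n unfolding Psi_def[abs_def] by measurable
  have PsiB: "\<bar>Psi n z\<bar> \<le> A * (CK / h n)" for n z
  proof -
    have "\<bar>Psi n z\<bar> \<le> (\<Sum>k\<in>P. \<bar>lin_coef p k * psi (h n) k z\<bar>)" unfolding Psi_def by (rule sum_abs)
    also have "\<dots> \<le> (\<Sum>k\<in>P. \<bar>lin_coef p k\<bar> * (CK / h n))"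
      unfolding abs_mult by (intro sum_mono mult_left_mono psi_bounds(3)[OF h_pos]) auto
    finally show ?thesis unfolding A_def sum_distrib_right .
  qed
  have ik: "integrable lborel (\<lambda>z. f z * psi (h n) k z)" for n k
    by (rule pint_bounded(1)[where C="CK / h n"]) (simp, rule psi_bounds(3)[OF h_pos])
  have pintPsi: "pint (Psi n) = (\<Sum>k\<in>P. lin_coef p k * fbar (h n) k)" for n
  proof -
    have "pint (Psi n) = (LINT z|lborel. (\<Sum>k\<in>P. lin_coef p k * (f z * psi (h n) k z)))"
      unfolding Psi_def sum_distrib_left by (simp only: mult.left_commute)
    also have "\<dots> = (\<Sum>k\<in>P. lin_coef p k * fbar (h n) k)"
      unfolding fbar_def by (subst Bochner_Integration.integral_sum) (use ik in auto)
    finally show ?thesis .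
  qed
  have noise: "lin_noise n p \<omega> = emp n (Psi n) \<omega> - pint (Psi n)" for n \<omega>
  proof -
    have "emp n (Psi n) \<omega> = (\<Sum>k\<in>P. lin_coef p k * emp n (psi (h n) k) \<omega>)"
      unfolding emp_def Psi_def by (subst sum.swap) (simp add: sum_divide_distrib sum_distrib_left)
    then show ?thesis unfolding pintPsi lin_noise_def fhat_eq by (simp add: right_diff_distrib sum_subtractf)
  qed
  define q where "q n = sqrt (real n * h n)" for n
  have q: "q n > 0" "(q n)\<^sup>2 = real n * h n" if "n > 0" for n
    unfolding q_def using that h_pos[of n] by auto
  \<comment> \<open>Scaled so that the variance of the sum tends to 1; each summand is then at most
    of order \<open>1 / sqrt (n h)\<close>.\<close>
  define Y where "Y n i \<omega> = q n / (sg * real n) * (Psi n (X i \<omega>) - pint (Psi n))" for n i \<omega>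
  define cb where "cb n = 2 * A * CK / sg * (1 / q n)" for n
  define v where "v n = h n / sg\<^sup>2 * (pint (\<lambda>z. (Psi n z)\<^sup>2) - (pint (Psi n))\<^sup>2)" for n
  define V where "V n \<omega> = (\<Sum>i=1..n. Y n i \<omega>)" for n \<omega>
  note cen = centred[OF PsiM PsiB]
  have Yindep: "indep_vars (\<lambda>_. borel) (Y n) {1..n}" for n
    unfolding Y_def[abs_def] by (rule indep_vars_compose2[OF cen(1), where Y="\<lambda>_ z. q n / (sg * real n) * z"]) simp
  have Ymean: "expectation (Y n i) = 0" if "i \<in> {1..n}" for n i
    unfolding Y_def[abs_def] using cen(3)[OF that] by simp
  have Ybound: "\<bar>Y n i \<omega>\<bar> \<le> cb n" if "i \<in> {1..n}" for n i \<omega>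
  proof -
    have n: "n > 0" using that by auto
    have "\<bar>Y n i \<omega>\<bar> = q n / (sg * real n) * \<bar>Psi n (X i \<omega>) - pint (Psi n)\<bar>"
      unfolding Y_def abs_mult using q(1)[OF n] sg n by simp
    also have "\<dots> \<le> q n / (sg * real n) * (2 * (A * (CK / h n)))"
      using cen(2) q(1)[OF n] sg n by (intro mult_left_mono) auto
    also have "\<dots> = 2 * A * CK / sg * (q n / (real n * h n))" by (simp add: mult_ac)
    also have "q n / (real n * h n) = 1 / q n" using q[OF n] by (metis power2_eq_square divide_self_if nonzero_divide_mult_cancel_right less_irrefl)
    finally show ?thesis unfolding cb_def .
  qed
  have Yvar: "expectation (\<lambda>\<omega>. (Y n i \<omega>)\<^sup>2) = v n / real n" if i: "i \<in> {1..n}" for n i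
  proof -
    have n: "n > 0" using i by auto
    have "expectation (\<lambda>\<omega>. (Y n i \<omega>)\<^sup>2) = (q n / (sg * real n))\<^sup>2 * (pint (\<lambda>z. (Psi n z)\<^sup>2) - (pint (Psi n))\<^sup>2)"
      unfolding Y_def power_mult_distrib using cen(4)[OF i] by simp
    also have "(q n / (sg * real n))\<^sup>2 = h n / sg\<^sup>2 / real n"
      unfolding power_divide power_mult_distrib q(2)[OF n] using n by (simp add: power2_eq_square)
    finally show ?thesis unfolding v_def by simp
  qed
  have one_q: "(\<lambda>n. 1 / q n) \<longlonglongrightarrow> 0"
  proof (rule real_tendsto_sandwich[OF _ _ tendsto_const rho_lim])
    show "eventually (\<lambda>n. 0 \<le> 1 / q n) sequentially" unfolding q_def using h_pos by (simp add: less_imp_le)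
    show "eventually (\<lambda>n. 1 / q n \<le> rho n) sequentially"
      using ev_n by eventually_elim (simp only: q_def rho_facts(5))
  qed
  have cb0: "cb \<longlonglongrightarrow> 0"
    unfolding cb_def[abs_def] using tendsto_mult[OF tendsto_const[of "2 * A * CK / sg"] one_q] by (simp only: mult_zero_right)
  have v1: "v \<longlonglongrightarrow> 1"
  proof -
    have ikl: "integrable lborel (\<lambda>z. f z * (psi (h n) k z * psi (h n) l z))" for n k l
    proof (rule pint_bounded(1)[where C="(CK / h n) * (CK / h n)"])
      show "\<bar>psi (h n) k z * psi (h n) l z\<bar> \<le> CK / h n * (CK / h n)" for z
        unfolding abs_mult using psi_bounds[OF h_pos] CK_nonneg h_pos[of n] by (intro mult_mono) auto
    qed measurable
    have sq: "h n * pint (\<lambda>z. (Psi n z)\<^sup>2) = (\<Sum>k\<in>P. \<Sum>l\<in>P. lin_coef p k * lin_coef p l * (h n * pint (\<lambda>z. psi (h n) k z * psi (h n) l z)))" for n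
    proof -
      have e: "f z * (Psi n z)\<^sup>2 = (\<Sum>k\<in>P. \<Sum>l\<in>P. lin_coef p k * lin_coef p l * (f z * (psi (h n) k z * psi (h n) l z)))" for z
      proof -
        have "(Psi n z)\<^sup>2 = (\<Sum>k\<in>P. \<Sum>l\<in>P. lin_coef p k * psi (h n) k z * (lin_coef p l * psi (h n) l z))"
          unfolding Psi_def power2_eq_square by (rule sum_product)
        then show ?thesis by (simp only: sum_distrib_left) (intro sum.cong refl, simp only: mult_ac)
      qed
      have "pint (\<lambda>z. (Psi n z)\<^sup>2) = (\<Sum>k\<in>P. \<Sum>l\<in>P. lin_coef p k * lin_coef p l * pint (\<lambda>z. psi (h n) k z * psi (h n) l z))"
        unfolding e using ikl by (subst Bochner_Integration.integral_sum, simp)+ (simp add: Bochner_Integration.integral_sum)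
      then show ?thesis by (simp add: sum_distrib_left mult_ac)
    qed
    have "(\<lambda>n. h n * pint (\<lambda>z. (Psi n z)\<^sup>2)) \<longlonglongrightarrow> (\<Sum>k\<in>P. \<Sum>l\<in>P. lin_coef p k * lin_coef p l * (if k = l then L * RK else 0))"
      unfolding sq by (intro tendsto_sum tendsto_mult tendsto_const cross_moment)
    also have "(\<Sum>k\<in>P. \<Sum>l\<in>P. lin_coef p k * lin_coef p l * (if k = l then L * RK else 0)) = lin_var p"
    proof -
      have "(\<Sum>l\<in>P. lin_coef p k * lin_coef p l * (if k = l then L * RK else 0)) = L * RK * (lin_coef p k)\<^sup>2" if "k \<in> P" for k
        using that P(1) by (simp add: if_distrib sum.delta power2_eq_square mult_ac cong: if_cong)
      then show ?thesis unfolding lin_var_def sum_distrib_left by (intro sum.cong) auto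
    qed
    finally have l1: "(\<lambda>n. h n * pint (\<lambda>z. (Psi n z)\<^sup>2)) \<longlonglongrightarrow> lin_var p" .
    have pb: "\<bar>pint (Psi n)\<bar> \<le> A * Cf" for n
    proof -
      have "\<bar>pint (Psi n)\<bar> \<le> (\<Sum>k\<in>P. \<bar>lin_coef p k * fbar (h n) k\<bar>)" unfolding pintPsi by (rule sum_abs)
      also have "\<dots> \<le> (\<Sum>k\<in>P. \<bar>lin_coef p k\<bar> * Cf)"
        unfolding abs_mult using fbar_nonneg[OF h_pos] psi_square(2)[OF h_pos] by (intro sum_mono mult_left_mono) auto
      finally show ?thesis unfolding A_def sum_distrib_right .
    qed
    \<comment> \<open>The mean \<open>pint (Psi n)\<close> is bounded, so after multiplication by
      \<open>h n\<close> only the second moment survives in the limit.\<close>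
    have l2: "(\<lambda>n. h n * (pint (Psi n))\<^sup>2) \<longlonglongrightarrow> 0"
    proof (rule Lim_null_comparison)
      have "(\<lambda>n. h n * (A * Cf)\<^sup>2) \<longlonglongrightarrow> 0 * (A * Cf)\<^sup>2" by (intro tendsto_mult tendsto_const h_lim)
      then show "(\<lambda>n. h n * (A * Cf)\<^sup>2) \<longlonglongrightarrow> 0" by simp
      have "(pint (Psi n))\<^sup>2 \<le> (A * Cf)\<^sup>2" for n
        using pb[of n] by (intro abs_le_square_iff[THEN iffD1]) linarith
      then show "eventually (\<lambda>n. norm (h n * (pint (Psi n))\<^sup>2) \<le> h n * (A * Cf)\<^sup>2) sequentially"
        using h_pos by (intro always_eventually allI) (simp add: abs_mult less_imp_le mult_left_mono)
    qed
    have "(\<lambda>n. (h n * pint (\<lambda>z. (Psi n z)\<^sup>2) - h n * (pint (Psi n))\<^sup>2) / sg\<^sup>2) \<longlonglongrightarrow> (lin_var p - 0) / sg\<^sup>2"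
      using sg by (intro tendsto_intros l1 l2) auto
    moreover have "(h n * pint (\<lambda>z. (Psi n z)\<^sup>2) - h n * (pint (Psi n))\<^sup>2) / sg\<^sup>2 = v n" for n
      unfolding v_def by (simp add: right_diff_distrib diff_divide_distrib)
    ultimately show ?thesis using sg lin_var_pos[OF p c2] by simp
  qed
  have Vrv[measurable]: "V n \<in> borel_measurable M" for n
    unfolding V_def[abs_def] Y_def by measurable
  have wc: "weak_conv_m (\<lambda>n. distr M borel (V n)) std_normal_distribution"
    unfolding V_def[abs_def] by (rule triangular_array_clt[OF Yindep Ymean Ybound Yvar cb0 v1])
  have Vsq: "integrable M (\<lambda>\<omega>. (V n \<omega>)\<^sup>2)" "expectation (\<lambda>\<omega>. (V n \<omega>)\<^sup>2) \<le> \<bar>v n\<bar>" for n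
  proof -
    have Yi: "integrable M (\<lambda>\<omega>. (Y n i \<omega>)\<^sup>2)" for i
      unfolding Y_def power_mult_distrib using cen(5) by simp
    have s: "integrable M (\<lambda>\<omega>. (V n \<omega>)\<^sup>2)" "expectation (\<lambda>\<omega>. (V n \<omega>)\<^sup>2) = (\<Sum>i\<in>{1..n}. expectation (\<lambda>\<omega>. (Y n i \<omega>)\<^sup>2))"
      unfolding V_def using expectation_sum_square_indep[OF _ Yindep Yi Ymean] by auto
    show "integrable M (\<lambda>\<omega>. (V n \<omega>)\<^sup>2)" by (rule s(1))
    have "(\<Sum>i\<in>{1..n}. expectation (\<lambda>\<omega>. (Y n i \<omega>)\<^sup>2)) = (\<Sum>i\<in>{1..n}. v n / real n)"
      by (intro sum.cong refl Yvar)
    also have "\<dots> \<le> \<bar>v n\<bar>" by (cases "n = 0") auto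
    finally show "expectation (\<lambda>\<omega>. (V n \<omega>)\<^sup>2) \<le> \<bar>v n\<bar>" unfolding s(2) .
  qed
  obtain Bv where Bv: "\<And>n. \<bar>v n\<bar> \<le> Bv"
    using convergent_imp_Bseq[OF convergentI[OF v1]] unfolding Bseq_def by auto
  define C where "C = max Bv 1"
  define mm where "mm n = b n * q n / sg" for n
  have conv: "(\<lambda>n. (LINT x|distr M borel (V n). \<bar>x + mm n\<bar>) - (LINT x|std_normal_distribution. \<bar>x + mm n\<bar>)) \<longlonglongrightarrow> 0"
  proof (rule weak_conv_expectation_abs_uniform[OF _ real_dist_normal_dist wc isCont_cdf_std_normal, where C=C])
    show "real_distribution (distr M borel (V n))" for n by (intro real_distribution_distr Vrv)
    show "integrable (distr M borel (V n)) (\<lambda>v. v\<^sup>2)" for n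
      using Vsq(1) by (subst integrable_distr_eq) auto
    show "(LINT v|distr M borel (V n). v\<^sup>2) \<le> C" for n
      using Vsq(2)[of n] Bv[of n] by (subst integral_distr) (auto simp: C_def)
    show "integrable std_normal_distribution (\<lambda>v. v\<^sup>2)" by (rule integrable_std_normal_distribution_moment)
    show "(LINT v|std_normal_distribution. v\<^sup>2) \<le> C"
      using std_normal_distribution_even_moments(1)[of 1] by (simp add: C_def)
  qed
  have step: "(expectation (\<lambda>\<omega>. \<bar>lin_noise n p \<omega> + b n\<bar>) - sg / q n * (LINT x|std_normal_distribution. \<bar>x + mm n\<bar>)) / rho n
      = sg / (q n * rho n) * ((LINT x|distr M borel (V n). \<bar>x + mm n\<bar>) - (LINT x|std_normal_distribution. \<bar>x + mm n\<bar>))" if n: "n > 0" for n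
  proof -
    have "lin_noise n p \<omega> + b n = sg / q n * (V n \<omega> + mm n)" for \<omega>
    proof -
      have "V n \<omega> = q n / sg * lin_noise n p \<omega>"
        unfolding V_def Y_def noise emp_diff_eq[OF n] sum_distrib_left[symmetric] by simp
      then show ?thesis unfolding mm_def using sg q(1)[OF n] by (simp add: field_simps)
    qed
    then have "\<bar>lin_noise n p \<omega> + b n\<bar> = sg / q n * \<bar>V n \<omega> + mm n\<bar>" for \<omega>
      using sg q(1)[OF n] by (simp add: abs_mult)
    then have "expectation (\<lambda>\<omega>. \<bar>lin_noise n p \<omega> + b n\<bar>) = sg / q n * (LINT x|distr M borel (V n). \<bar>x + mm n\<bar>)"
      by (simp add: integral_distr)
    then show ?thesis by (simp add: right_diff_distrib diff_divide_distrib)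
  qed
  have "(\<lambda>n. (expectation (\<lambda>\<omega>. \<bar>lin_noise n p \<omega> + b n\<bar>) - sg / q n * (LINT x|std_normal_distribution. \<bar>x + mm n\<bar>)) / rho n) \<longlonglongrightarrow> 0"
  proof (rule Lim_null_comparison)
    show "(\<lambda>n. sg * \<bar>(LINT x|distr M borel (V n). \<bar>x + mm n\<bar>) - (LINT x|std_normal_distribution. \<bar>x + mm n\<bar>)\<bar>) \<longlonglongrightarrow> 0"
      using tendsto_mult[OF tendsto_const tendsto_rabs_zero[OF conv], of sg] by simp
    show "eventually (\<lambda>n. norm ((expectation (\<lambda>\<omega>. \<bar>lin_noise n p \<omega> + b n\<bar>) - sg / q n * (LINT x|std_normal_distribution. \<bar>x + mm n\<bar>)) / rho n)
       \<le> sg * \<bar>(LINT x|distr M borel (V n). \<bar>x + mm n\<bar>) - (LINT x|std_normal_distribution. \<bar>x + mm n\<bar>)\<bar>) sequentially"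
      using ev_n
    proof eventually_elim
      case (elim n)
      have r: "rho n > 0" "1 / q n \<le> rho n" using rho_facts[OF elim] by (auto simp: q_def)
      have "1 \<le> q n * rho n" using r(2) q(1)[OF elim] by (simp add: field_simps)
      then have "sg / (q n * rho n) \<le> sg" using sg by (simp add: divide_le_eq)
      moreover have "0 \<le> sg / (q n * rho n)" using sg r q(1)[OF elim] by simp
      moreover have "\<bar>a * x\<bar> \<le> s * \<bar>x\<bar>" if "a \<le> s" "0 \<le> a" for a s x :: real
        using that by (simp add: abs_mult mult_right_mono)
      ultimately show ?case unfolding step[OF elim] real_norm_def by blast
    qed
  qed
  then show ?thesis unfolding mm_def q_def sg_def .
qed

lemma expectation_abs_close:
  assumes "integrable M Y" "integrable M Z" "\<And>\<omega>. \<bar>Y \<omega> - Z \<omega>\<bar> \<le> T \<omega>" "mean_le T a"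
  shows "\<bar>expectation (\<lambda>\<omega>. \<bar>Y \<omega>\<bar>) - expectation (\<lambda>\<omega>. \<bar>Z \<omega>\<bar>)\<bar> \<le> a"
proof -
  have iT: "integrable M T" "expectation T \<le> a" using assms(4) unfolding mean_le_def by auto
  have "\<bar>expectation (\<lambda>\<omega>. \<bar>Y \<omega>\<bar>) - expectation (\<lambda>\<omega>. \<bar>Z \<omega>\<bar>)\<bar> = \<bar>expectation (\<lambda>\<omega>. \<bar>Y \<omega>\<bar> - \<bar>Z \<omega>\<bar>)\<bar>"
    using assms by simp
  also have "\<dots> \<le> expectation (\<lambda>\<omega>. \<bar>\<bar>Y \<omega>\<bar> - \<bar>Z \<omega>\<bar>\<bar>)" by (rule integral_abs_bound)
  also have "\<dots> \<le> expectation T"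
  proof (rule integral_mono)
    show "integrable M (\<lambda>\<omega>. \<bar>\<bar>Y \<omega>\<bar> - \<bar>Z \<omega>\<bar>\<bar>)" using assms(1,2) by simp
    show "\<bar>\<bar>Y \<omega>\<bar> - \<bar>Z \<omega>\<bar>\<bar> \<le> T \<omega>" for \<omega> using order_trans[OF abs_triangle_ineq3 assms(3)] .
  qed (rule iT(1))
  also have "\<dots> \<le> a" by (rule iT(2))
  finally show ?thesis .
qed

lemma square_dev_imp_integrable:
  "Y \<in> borel_measurable M \<Longrightarrow> integrable M (\<lambda>\<omega>. (Y \<omega> - b)\<^sup>2) \<Longrightarrow> integrable M (Y :: 'a \<Rightarrow> real)"
proof -
  assume m: "Y \<in> borel_measurable M" and i: "integrable M (\<lambda>\<omega>. (Y \<omega> - b)\<^sup>2)"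
  have "integrable M (\<lambda>\<omega>. Y \<omega> - b)" by (rule square_integrable_imp_integrable[OF _ i]) (use m in simp)
  then have "integrable M (\<lambda>\<omega>. (Y \<omega> - b) + b)" by (intro Bochner_Integration.integrable_add) auto
  then show ?thesis by simp
qed

text \<open>Since \<open>1 / n = h * (1 / (n h)) \<le> h * rho^2\<close>, the random part of the
  mass error is smaller than the scale by a factor \<open>sqrt h\<close>.\<close>

lemma mass_noise:
  assumes n: "n > 0" and h1: "h n < 1"
  shows "mean_le (\<lambda>\<omega>. \<bar>LINT x|lborel. (fhat n (h n) \<omega> x - fbar (h n) x) * indicator {x. L \<le> f x} x\<bar>) (2 * sqrt (h n) * rho n)"
    and "(\<lambda>\<omega>. LINT x|lborel. (fhat n (h n) \<omega> x - fbar (h n) x) * indicator {x. L \<le> f x} x) \<in> borel_measurable M"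
proof -
  note hp = h_pos[of n] and r = rho_facts[OF n]
  have A: "{x. L \<le> f x} \<in> sets borel" by measurable
  let ?Y = "\<lambda>\<omega>. LINT x|lborel. (fhat n (h n) \<omega> x - fbar (h n) x) * indicator {x. L \<le> f x} x"
  show mY: "?Y \<in> borel_measurable M"
  proof -
    have [measurable]: "fbar (h n) \<in> borel_measurable borel" by (rule fbar_borel[OF hp])
    have "(\<lambda>(\<omega>, x). (fhat n (h n) \<omega> x - fbar (h n) x) * indicator {x. L \<le> f x} x) \<in> borel_measurable (M \<Otimes>\<^sub>M lborel)"
      unfolding kde_def by measurable
    then show ?thesis by (rule lborel.borel_measurable_lebesgue_integral)
  qed
  have "1 / real n = h n * (1 / (real n * h n))" using hp by simp
  also have "\<dots> \<le> h n * (rho n)\<^sup>2" using r(2) hp by (intro mult_left_mono) auto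
  also have "\<dots> = 1 * (sqrt (h n) * rho n)\<^sup>2" using hp by (simp add: power_mult_distrib)
  finally have le: "1 / real n \<le> 1 * (sqrt (h n) * rho n)\<^sup>2" .
  have "mean_le (\<lambda>\<omega>. (?Y \<omega>)\<^sup>2) (1 / real n)"
    using fhat_mass_variance[OF hp n A] by (simp add: mean_le_def)
  then have "mean_le (\<lambda>\<omega>. (?Y \<omega>)\<^sup>2) (1 * (sqrt (h n) * rho n)\<^sup>2)" using le by (rule mean_le_weaken)
  from mean_le_abs[OF mY this] show "mean_le (\<lambda>\<omega>. \<bar>?Y \<omega>\<bar>) (2 * sqrt (h n) * rho n)"
    using hp r(1) by (simp add: mult.assoc)
qed

definition det_bias :: "nat \<Rightarrow> real \<Rightarrow> real" where
  "det_bias n p = (fbar (h n) p - f p) - ((LINT x|lborel. (fbar (h n) x - f x) * indicator {x. L \<le> f x} x) / L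
      + (\<Sum>k\<in>P. (fbar (h n) k - f k) / \<bar>m k\<bar>)) / slope_sum"

text \<open>The three parts need different treatment: the noise at the crossings by the central
  limit theorem, the deterministic bias by Taylor expansion, the random mass error by
  \<open>mass_noise\<close>.\<close>

lemma linear_decomposition:
  assumes n: "n > 0" and p: "p \<in> P"
  shows "(fhat n (h n) \<omega> p - f p) - level_lin (fhat n (h n) \<omega>) = lin_noise n p \<omega> + det_bias n p
     - (LINT x|lborel. (fhat n (h n) \<omega> x - fbar (h n) x) * indicator {x. L \<le> f x} x) / (L * slope_sum)"
proof -
  define u where "u k = fhat n (h n) \<omega> k - fbar (h n) k" for k
  define b where "b k = fbar (h n) k - f k" for k
  define B where "B = (LINT x|lborel. (fhat n (h n) \<omega> x - fbar (h n) x) * indicator {x. L \<le> f x} x)"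
  define B' where "B' = (LINT x|lborel. (fbar (h n) x - f x) * indicator {x. L \<le> f x} x)"
  have md: "mass_dev (fhat n (h n) \<omega>) = B + B'" unfolding B_def B'_def by (rule mass_dev_split[OF h_pos n])
  have g: "fhat n (h n) \<omega> k - f k = u k + b k" for k by (simp add: u_def b_def)
  have "lin_noise n p \<omega> = (\<Sum>k\<in>P. (if k = p then u k else 0) - u k / \<bar>m k\<bar> / slope_sum)"
    unfolding lin_noise_def lin_coef_def u_def[symmetric] by (intro sum.cong) (auto simp: left_diff_distrib)
  also have "\<dots> = u p - (\<Sum>k\<in>P. u k / \<bar>m k\<bar>) / slope_sum"
    using p P(1) by (simp add: sum_subtractf sum_divide_distrib sum.delta)
  finally have ln: "lin_noise n p \<omega> = u p - (\<Sum>k\<in>P. u k / \<bar>m k\<bar>) / slope_sum" .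
  show ?thesis
    unfolding level_lin_def md g ln det_bias_def
    unfolding B_def[symmetric] B'_def[symmetric] unfolding b_def[symmetric]
    by (simp add: add_divide_distrib sum.distrib)
qed

lemma det_bias_asymp:
  assumes p: "p \<in> P"
  shows "(\<lambda>n. (det_bias n p - (h n)\<^sup>2 * lin_bias p) / (h n)\<^sup>2) \<longlonglongrightarrow> 0"
proof -
  have pt: "(\<lambda>n. (fbar (h n) k - f k) / (h n)\<^sup>2) \<longlonglongrightarrow> mu2 / 2 * f2 k" if k: "k \<in> P" for k
  proof (rule LIM_zero_cancel, rule tendstoI)
    fix e :: real assume e: "e > 0"
    obtain h0 where h0: "h0 > 0" "\<And>h. 0 < h \<Longrightarrow> h < h0 \<Longrightarrow> \<bar>fbar h k - f k - h\<^sup>2 / 2 * mu2 * f2 k\<bar> \<le> e / 2 * h\<^sup>2"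
    proof -
      obtain h0 where h0: "h0 > 0" "\<And>h p x. 0 < h \<Longrightarrow> h < h0 \<Longrightarrow> p \<in> P \<Longrightarrow> \<bar>x - p\<bar> \<le> d \<Longrightarrow> \<bar>fbar h x - f x - h\<^sup>2 / 2 * mu2 * f2 x\<bar> \<le> e / 2 * h\<^sup>2"
        using bias_near[of "e / 2"] e by auto
      have "\<bar>k - k\<bar> \<le> d" using const_pos by simp
      from that[OF h0(1)] h0(2)[OF _ _ k this] show thesis by blast
    qed
    show "eventually (\<lambda>n. dist ((fbar (h n) k - f k) / (h n)\<^sup>2 - mu2 / 2 * f2 k) 0 < e) sequentially"
      using ev_h_less[OF h0(1)]
    proof eventually_elim
      case (elim n)
      have q: "(h n)\<^sup>2 > 0" using h_pos[of n] by simp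
      have "(fbar (h n) k - f k) / (h n)\<^sup>2 - mu2 / 2 * f2 k = (fbar (h n) k - f k - (h n)\<^sup>2 / 2 * mu2 * f2 k) / (h n)\<^sup>2"
        using q by (simp add: field_simps)
      then have "\<bar>(fbar (h n) k - f k) / (h n)\<^sup>2 - mu2 / 2 * f2 k\<bar> \<le> e / 2"
        using h0(2)[OF h_pos elim] q by (simp add: abs_divide divide_le_eq)
      then show ?case using e unfolding dist_real_def by linarith
    qed
  qed
  let ?J = "\<lambda>n. LINT x|lborel. (fbar (h n) x - f x) * indicator {x. L \<le> f x} x"
  have ms: "(\<lambda>n. ?J n / (h n)\<^sup>2) \<longlonglongrightarrow> mu2 / 2 * Jm"
  proof (rule LIM_zero_cancel, rule tendstoI)
    fix e :: real assume e: "e > 0"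
    obtain h0 where h0: "h0 > 0" "\<And>h. 0 < h \<Longrightarrow> h < h0 \<Longrightarrow> \<bar>(LINT x|lborel. (fbar h x - f x) * indicator {x. L \<le> f x} x) - h\<^sup>2 / 2 * mu2 * Jm\<bar> \<le> e / 2 * h\<^sup>2"
      using bias_mass[of "e / 2"] e by auto
    show "eventually (\<lambda>n. dist (?J n / (h n)\<^sup>2 - mu2 / 2 * Jm) 0 < e) sequentially"
      using ev_h_less[OF h0(1)]
    proof eventually_elim
      case (elim n)
      have q: "(h n)\<^sup>2 > 0" using h_pos[of n] by simp
      have "?J n / (h n)\<^sup>2 - mu2 / 2 * Jm = (?J n - (h n)\<^sup>2 / 2 * mu2 * Jm) / (h n)\<^sup>2"
        using q by (simp add: field_simps)
      then have "\<bar>?J n / (h n)\<^sup>2 - mu2 / 2 * Jm\<bar> \<le> e / 2"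
        using h0(2)[OF h_pos elim] q by (simp add: abs_divide divide_le_eq)
      then show ?case using e unfolding dist_real_def by linarith
    qed
  qed
  have eq: "(det_bias n p - (h n)\<^sup>2 * lin_bias p) / (h n)\<^sup>2 =
     (fbar (h n) p - f p) / (h n)\<^sup>2 - (?J n / (h n)\<^sup>2 / L + (\<Sum>k\<in>P. (fbar (h n) k - f k) / (h n)\<^sup>2 / \<bar>m k\<bar>)) / slope_sum - lin_bias p" for n
  proof -
    have q: "(h n)\<^sup>2 \<noteq> 0" using h_pos[of n] by simp
    have s: "(\<Sum>k\<in>P. (fbar (h n) k - f k) / (h n)\<^sup>2 / \<bar>m k\<bar>) = (\<Sum>k\<in>P. (fbar (h n) k - f k) / \<bar>m k\<bar>) / (h n)\<^sup>2"
      unfolding sum_divide_distrib by (intro sum.cong) (auto simp: divide_simps)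
    have "(a - (j / L + s) / slope_sum - q * l) / q = a / q - (j / q / L + s / q) / slope_sum - l" if "q \<noteq> 0" for a j s q l
      using that L_pos slope_sum_pos by (simp add: field_simps)
    from this[OF q] show ?thesis unfolding det_bias_def s .
  qed
  have "(\<lambda>n. (fbar (h n) p - f p) / (h n)\<^sup>2 - (?J n / (h n)\<^sup>2 / L + (\<Sum>k\<in>P. (fbar (h n) k - f k) / (h n)\<^sup>2 / \<bar>m k\<bar>)) / slope_sum - lin_bias p)
     \<longlonglongrightarrow> mu2 / 2 * f2 p - (mu2 / 2 * Jm / L + (\<Sum>k\<in>P. mu2 / 2 * f2 k / \<bar>m k\<bar>)) / slope_sum - lin_bias p"
    using L_pos slope_sum_pos slope_nz by (intro tendsto_diff tendsto_divide tendsto_add tendsto_sum tendsto_const pt ms p) auto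
  moreover have "mu2 / 2 * f2 p - (mu2 / 2 * Jm / L + (\<Sum>k\<in>P. mu2 / 2 * f2 k / \<bar>m k\<bar>)) / slope_sum - lin_bias p = 0"
  proof -
    have "(\<Sum>k\<in>P. mu2 / 2 * f2 k / \<bar>m k\<bar>) = mu2 / 2 * (\<Sum>k\<in>P. f2 k / \<bar>m k\<bar>)" by (simp add: sum_distrib_left)
    then show ?thesis unfolding lin_bias_def by (simp only:) (simp add: algebra_simps add_divide_distrib)
  qed
  ultimately show ?thesis unfolding eq by simp
qed

text \<open>This is \<open>sg / q\<close> times the mean of \<open>\<bar>Z + u\<bar>\<close> for a
  standard normal \<open>Z\<close>, where \<open>sg = sqrt (lin_var p)\<close>,
  \<open>q = sqrt (n h)\<close> and \<open>u\<close> is the absolute bias in units of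
  \<open>sg / q\<close>; the sign of the bias is lost by symmetry.\<close>

definition point_risk :: "nat \<Rightarrow> real \<Rightarrow> real" where
  "point_risk n p = 2 * (sqrt (lin_var p) / sqrt (real n * h n)) * std_normal_density (\<bar>lin_bias p\<bar> / sqrt (lin_var p) * (sqrt (real n * h n) * (h n)\<^sup>2))
     + \<bar>lin_bias p\<bar> * (h n)\<^sup>2 * (2 * cdf std_normal_distribution (\<bar>lin_bias p\<bar> / sqrt (lin_var p) * (sqrt (real n * h n) * (h n)\<^sup>2)) - 1)"

lemma point_risk_asymp:
  assumes p: "p \<in> P" and c2: "card P \<ge> 2"
  shows "(\<lambda>n. (expectation (\<lambda>\<omega>. \<bar>(fhat n (h n) \<omega> p - f p) - level_lin (fhat n (h n) \<omega>)\<bar>) - point_risk n p) / rho n) \<longlonglongrightarrow> 0"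
proof -
  define b where "b n = (h n)\<^sup>2 * lin_bias p" for n
  define sg where "sg = sqrt (lin_var p)"
  have sg: "sg > 0" unfolding sg_def using lin_var_pos[OF p c2] by simp
  define Z where "Z n \<omega> = (fhat n (h n) \<omega> p - f p) - level_lin (fhat n (h n) \<omega>)" for n \<omega>
  define Bn where "Bn n \<omega> = (LINT x|lborel. (fhat n (h n) \<omega> x - fbar (h n) x) * indicator {x. L \<le> f x} x)" for n \<omega>
  define LS where "LS = L * slope_sum"
  have LS: "LS > 0" unfolding LS_def using L_pos slope_sum_pos by simp
  \<comment> \<open>Error relative to \<open>rho n\<close>: the \<open>o(h^2)\<close> remainder of
    the bias and the factor \<open>sqrt h\<close> of the random mass error.\<close>
  define err where "err n = \<bar>(det_bias n p - (h n)\<^sup>2 * lin_bias p) / (h n)\<^sup>2\<bar> + 2 * sqrt (h n) / LS" for n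
  have err0: "err \<longlonglongrightarrow> 0"
  proof -
    have "(\<lambda>n. 2 * sqrt (h n) / LS) \<longlonglongrightarrow> 2 * sqrt 0 / LS" by (intro tendsto_intros h_lim) (use LS in auto)
    from tendsto_add[OF tendsto_rabs_zero[OF det_bias_asymp[OF p]] this] show ?thesis unfolding err_def[abs_def] by simp
  qed
  have A: "(\<lambda>n. (expectation (\<lambda>\<omega>. \<bar>Z n \<omega>\<bar>) - expectation (\<lambda>\<omega>. \<bar>lin_noise n p \<omega> + b n\<bar>)) / rho n) \<longlonglongrightarrow> 0"
  proof (rule Lim_null_comparison[OF _ err0])
    show "eventually (\<lambda>n. norm ((expectation (\<lambda>\<omega>. \<bar>Z n \<omega>\<bar>) - expectation (\<lambda>\<omega>. \<bar>lin_noise n p \<omega> + b n\<bar>)) / rho n) \<le> err n) sequentially"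
      using ev_n ev_h_less[OF zero_less_one]
    proof eventually_elim
      case (elim n)
      note n = elim(1) and hp = h_pos[of n]
      note r = rho_facts[OF n]
      have grv: "(\<lambda>\<omega>. fhat n (h n) \<omega> k) \<in> borel_measurable M" for k by (rule fhat_rv)
      have gi: "integrable M (\<lambda>\<omega>. fhat n (h n) \<omega> k)" for k
        by (rule square_dev_imp_integrable[OF grv fhat_variance(1)[OF hp n]])
      have ni: "integrable M (\<lambda>\<omega>. lin_noise n p \<omega>)"
        unfolding lin_noise_def using gi by (intro Bochner_Integration.integrable_sum integrable_mult_right Bochner_Integration.integrable_diff) auto
      have Bm: "mean_le (\<lambda>\<omega>. \<bar>Bn n \<omega>\<bar>) (2 * sqrt (h n) * rho n)" "Bn n \<in> borel_measurable M"
        using mass_noise[OF elim] unfolding Bn_def[abs_def] by auto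
      have Bi: "integrable M (Bn n)"
        using Bm integrable_abs_iff[OF Bm(2)] unfolding mean_le_def by blast
      have Zeq: "Z n \<omega> = lin_noise n p \<omega> + det_bias n p - Bn n \<omega> / LS" for \<omega>
        unfolding Z_def Bn_def LS_def by (rule linear_decomposition[OF n p])
      have Zi: "integrable M (Z n)"
        unfolding Zeq[abs_def] using ni Bi by (intro Bochner_Integration.integrable_diff Bochner_Integration.integrable_add integrable_divide_zero) auto
      have ni': "integrable M (\<lambda>\<omega>. lin_noise n p \<omega> + b n)" using ni by simp
      have "\<bar>expectation (\<lambda>\<omega>. \<bar>Z n \<omega>\<bar>) - expectation (\<lambda>\<omega>. \<bar>lin_noise n p \<omega> + b n\<bar>)\<bar> \<le> \<bar>det_bias n p - b n\<bar> + 2 * sqrt (h n) * rho n / LS"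
      proof (rule expectation_abs_close[OF Zi ni'])
        show "mean_le (\<lambda>\<omega>. \<bar>det_bias n p - b n\<bar> + \<bar>Bn n \<omega>\<bar> / LS) (\<bar>det_bias n p - b n\<bar> + 2 * sqrt (h n) * rho n / LS)"
          using LS by (intro mean_le_add mean_le_const mean_le_divide Bm) auto
        show "\<bar>Z n \<omega> - (lin_noise n p \<omega> + b n)\<bar> \<le> \<bar>det_bias n p - b n\<bar> + \<bar>Bn n \<omega>\<bar> / LS" for \<omega>
        proof -
          have eq: "Z n \<omega> - (lin_noise n p \<omega> + b n) = (det_bias n p - b n) - Bn n \<omega> / LS" unfolding Zeq by simp
          have "\<bar>(det_bias n p - b n) - Bn n \<omega> / LS\<bar> \<le> \<bar>det_bias n p - b n\<bar> + \<bar>Bn n \<omega> / LS\<bar>" by (rule abs_triangle_ineq4)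
          also have "\<bar>Bn n \<omega> / LS\<bar> = \<bar>Bn n \<omega>\<bar> / LS" using LS by (simp add: abs_divide)
          finally show ?thesis unfolding eq .
        qed
      qed
      also have "\<bar>det_bias n p - b n\<bar> = \<bar>(det_bias n p - (h n)\<^sup>2 * lin_bias p) / (h n)\<^sup>2\<bar> * (h n)\<^sup>2"
        using hp unfolding b_def by (simp add: abs_divide)
      also have "\<dots> \<le> \<bar>(det_bias n p - (h n)\<^sup>2 * lin_bias p) / (h n)\<^sup>2\<bar> * rho n"
        using r(3) by (intro mult_left_mono) auto
      finally have "\<bar>expectation (\<lambda>\<omega>. \<bar>Z n \<omega>\<bar>) - expectation (\<lambda>\<omega>. \<bar>lin_noise n p \<omega> + b n\<bar>)\<bar> \<le> err n * rho n"
        unfolding err_def by (simp add: distrib_right)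
      then show ?case using r(1) by (simp add: abs_divide pos_divide_le_eq)
    qed
  qed
  have B: "(\<lambda>n. (expectation (\<lambda>\<omega>. \<bar>lin_noise n p \<omega> + b n\<bar>) - point_risk n p) / rho n) \<longlonglongrightarrow> 0"
  proof -
    have ev: "eventually (\<lambda>n. (expectation (\<lambda>\<omega>. \<bar>lin_noise n p \<omega> + b n\<bar>) - sg / sqrt (real n * h n) * (LINT v|std_normal_distribution. \<bar>v + b n * sqrt (real n * h n) / sg\<bar>)) / rho n
        = (expectation (\<lambda>\<omega>. \<bar>lin_noise n p \<omega> + b n\<bar>) - point_risk n p) / rho n) sequentially"
      using ev_n
    proof eventually_elim
      case (elim n)
      define q where "q = sqrt (real n * h n)"
      have q: "q > 0" unfolding q_def using elim h_pos[of n] by simp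
      define u where "u = \<bar>lin_bias p\<bar> / sg * (q * (h n)\<^sup>2)"
      have u: "\<bar>b n * q / sg\<bar> = u" unfolding b_def u_def using sg q by (simp add: abs_mult)
      have "std_normal_density (b n * q / sg) = std_normal_density \<bar>b n * q / sg\<bar>"
        by (simp only: std_normal_density_def power2_abs)
      then have "std_normal_density (b n * q / sg) = std_normal_density u" unfolding u .
      then have "(LINT v|std_normal_distribution. \<bar>v + b n * q / sg\<bar>) = 2 * std_normal_density u + u * (2 * cdf std_normal_distribution u - 1)"
        unfolding std_normal_mean_abs u by simp
      then have "sg / q * (LINT v|std_normal_distribution. \<bar>v + b n * q / sg\<bar>) = sg / q * (2 * std_normal_density u + u * (2 * cdf std_normal_distribution u - 1))"
        by (rule arg_cong)
      also have "\<dots> = 2 * (sg / q) * std_normal_density u + (sg / q * u) * (2 * cdf std_normal_distribution u - 1)"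
        by (simp only: distrib_left mult_ac)
      also have "sg / q * u = \<bar>lin_bias p\<bar> * (h n)\<^sup>2" unfolding u_def using sg q by simp
      finally have "sg / q * (LINT v|std_normal_distribution. \<bar>v + b n * q / sg\<bar>) = point_risk n p"
        unfolding point_risk_def u_def q_def sg_def .
      then show ?case unfolding q_def by simp
    qed
    have lim: "(\<lambda>n. (expectation (\<lambda>\<omega>. \<bar>lin_noise n p \<omega> + b n\<bar>) - sg / sqrt (real n * h n) * (LINT v|std_normal_distribution. \<bar>v + b n * sqrt (real n * h n) / sg\<bar>)) / rho n) \<longlonglongrightarrow> 0"
      unfolding sg_def by (rule lin_noise_clt[OF p c2])
    show ?thesis by (rule Lim_transform_eventually[OF lim ev])
  qed
  show ?thesis using tendsto_add[OF A B] unfolding Z_def by (simp add: add_divide_distrib[symmetric])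
qed

theorem risk_asymp:
  assumes c2: "card P \<ge> 2"
  shows "(\<lambda>n. (expectation (risk n (h n)) - L * (\<Sum>p\<in>P. point_risk n p / \<bar>m p\<bar>)) / rho n) \<longlonglongrightarrow> 0"
proof -
  define E where "E n p = expectation (\<lambda>\<omega>. \<bar>(fhat n (h n) \<omega> p - f p) - level_lin (fhat n (h n) \<omega>)\<bar>)" for n p
  have "(\<lambda>n. L * (\<Sum>p\<in>P. (E n p - point_risk n p) / rho n / \<bar>m p\<bar>)) \<longlonglongrightarrow> L * (\<Sum>p\<in>P. 0 / \<bar>m p\<bar>)"
    unfolding E_def using slope_nz by (intro tendsto_mult tendsto_const tendsto_sum tendsto_divide point_risk_asymp c2) auto
  then have l1: "(\<lambda>n. L * (\<Sum>p\<in>P. (E n p - point_risk n p) / rho n / \<bar>m p\<bar>)) \<longlonglongrightarrow> 0" by simp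
  have ev: "eventually (\<lambda>n. (expectation (risk n (h n)) - expectation (\<lambda>\<omega>. risk_lin (fhat n (h n) \<omega>))) / rho n
      + L * (\<Sum>p\<in>P. (E n p - point_risk n p) / rho n / \<bar>m p\<bar>)
      = (expectation (risk n (h n)) - L * (\<Sum>p\<in>P. point_risk n p / \<bar>m p\<bar>)) / rho n) sequentially"
    using ev_n
  proof eventually_elim
    case (elim n)
    note n = elim and hp = h_pos[of n]
    have gi: "integrable M (\<lambda>\<omega>. fhat n (h n) \<omega> k)" for k
      by (rule square_dev_imp_integrable[OF fhat_rv fhat_variance(1)[OF hp n]])
    have A: "{x. L \<le> f x} \<in> sets borel" by measurable
    have mi: "integrable M (\<lambda>\<omega>. mass_dev (fhat n (h n) \<omega>))"
    proof (rule square_dev_imp_integrable[OF mass_dev_rv[OF hp n]])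
      show "integrable M (\<lambda>\<omega>. (mass_dev (fhat n (h n) \<omega>) - (LINT x|lborel. (fbar (h n) x - f x) * indicator {x. L \<le> f x} x))\<^sup>2)"
        unfolding mass_dev_split[OF hp n] using fhat_mass_variance(1)[OF hp n A] by simp
    qed
    have li: "integrable M (\<lambda>\<omega>. level_lin (fhat n (h n) \<omega>))"
      unfolding level_lin_def using gi mi by (intro integrable_divide_zero Bochner_Integration.integrable_add Bochner_Integration.integrable_sum Bochner_Integration.integrable_diff) auto
    have "expectation (\<lambda>\<omega>. risk_lin (fhat n (h n) \<omega>)) = L * (\<Sum>p\<in>P. E n p / \<bar>m p\<bar>)"
    proof -
      have i: "integrable M (\<lambda>\<omega>. \<bar>(fhat n (h n) \<omega> p - f p) - level_lin (fhat n (h n) \<omega>)\<bar> / \<bar>m p\<bar>)" for p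
        using gi li by (intro integrable_divide_zero integrable_abs Bochner_Integration.integrable_diff) auto
      show ?thesis unfolding risk_lin_def E_def integral_mult_right_zero
        by (subst Bochner_Integration.integral_sum) (rule i, simp)
    qed
    moreover have "L * (\<Sum>p\<in>P. (E n p - point_risk n p) / rho n / \<bar>m p\<bar>) = (L * (\<Sum>p\<in>P. E n p / \<bar>m p\<bar>) - L * (\<Sum>p\<in>P. point_risk n p / \<bar>m p\<bar>)) / rho n"
    proof -
      have "(\<Sum>p\<in>P. (E n p - point_risk n p) / rho n / \<bar>m p\<bar>) = (\<Sum>p\<in>P. (E n p / \<bar>m p\<bar> - point_risk n p / \<bar>m p\<bar>) / rho n)"
        by (intro sum.cong refl) (simp add: diff_divide_distrib mult.commute)
      also have "\<dots> = ((\<Sum>p\<in>P. E n p / \<bar>m p\<bar>) - (\<Sum>p\<in>P. point_risk n p / \<bar>m p\<bar>)) / rho n"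
        by (simp add: sum_divide_distrib[symmetric] sum_subtractf)
      finally show ?thesis by (simp add: right_diff_distrib)
    qed
    ultimately show ?case by (simp add: add_divide_distrib[symmetric])
  qed
  have "(\<lambda>n. (expectation (risk n (h n)) - expectation (\<lambda>\<omega>. risk_lin (fhat n (h n) \<omega>))) / rho n
      + L * (\<Sum>p\<in>P. (E n p - point_risk n p) / rho n / \<bar>m p\<bar>)) \<longlonglongrightarrow> 0 + 0"
    by (intro tendsto_add risk_lin_approx l1)
  then have "(\<lambda>n. (expectation (risk n (h n)) - expectation (\<lambda>\<omega>. risk_lin (fhat n (h n) \<omega>))) / rho n
      + L * (\<Sum>p\<in>P. (E n p - point_risk n p) / rho n / \<bar>m p\<bar>)) \<longlonglongrightarrow> 0" by simp
  then show ?thesis using ev by (rule Lim_transform_eventually)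
qed

end

section \<open>The superlevel set of the density\<close>

text \<open>On an open subset of \<open>S\<close> derivatives within \<open>S\<close> are ordinary
  ones, so the witnesses of \<open>C2_on\<close> agree there with iterated
  \<open>deriv\<close>.\<close>

lemma C2_on_imp_deriv:
  assumes C2: "C2_on S f" and U: "open U" "U \<subseteq> S"
  shows "\<And>y. y \<in> U \<Longrightarrow> (f has_real_derivative deriv f y) (at y)"
    and "\<And>y. y \<in> U \<Longrightarrow> (deriv f has_real_derivative deriv (deriv f) y) (at y)"
    and "continuous_on U (deriv (deriv f))"
proof -
  obtain f1 f2 where f1: "\<And>y. y \<in> S \<Longrightarrow> (f has_real_derivative f1 y) (at y within S)"
    and f2: "\<And>y. y \<in> S \<Longrightarrow> (f1 has_real_derivative f2 y) (at y within S)" and cont: "continuous_on S f2"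
    using C2 unfolding C2_on_def by blast
  have d1: "(f has_real_derivative f1 y) (at y)" if "y \<in> U" for y
  proof -
    have "y \<in> S" using that U(2) by blast
    from DERIV_subset[OF f1[OF this] U(2)] show ?thesis unfolding at_within_open[OF that U(1)] .
  qed
  have d2: "(f1 has_real_derivative f2 y) (at y)" if "y \<in> U" for y
  proof -
    have "y \<in> S" using that U(2) by blast
    from DERIV_subset[OF f2[OF this] U(2)] show ?thesis unfolding at_within_open[OF that U(1)] .
  qed
  have e1: "deriv f y = f1 y" if "y \<in> U" for y by (rule DERIV_imp_deriv[OF d1[OF that]])
  have d3: "(deriv f has_real_derivative f2 y) (at y)" if "y \<in> U" for y
    by (rule has_field_derivative_transform_within_open[OF d2[OF that] U(1) that]) (simp add: e1)
  have e2: "deriv (deriv f) y = f2 y" if "y \<in> U" for y by (rule DERIV_imp_deriv[OF d3[OF that]])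
  show "(f has_real_derivative deriv f y) (at y)" if "y \<in> U" for y using d1[OF that] e1[OF that] by simp
  show "(deriv f has_real_derivative deriv (deriv f) y) (at y)" if "y \<in> U" for y using d3[OF that] e2[OF that] by simp
  show "continuous_on U (deriv (deriv f))"
    using continuous_on_subset[OF cont U(2)] e2 by (simp cong: continuous_on_cong)
qed

text \<open>After subtracting the quadratic polynomial built from the values at \<open>y\<close>,
  the derivative is of size \<open>e * \<bar>t\<bar>\<close>: the mean value inequality is used once
  for \<open>f1\<close> and then once for \<open>f\<close>.\<close>

lemma taylor_second_order:
  fixes f f1 f2 :: "real \<Rightarrow> real"
  assumes d1: "\<And>z. \<bar>z - y\<bar> \<le> dl \<Longrightarrow> (f has_real_derivative f1 z) (at z)"
    and d2: "\<And>z. \<bar>z - y\<bar> \<le> dl \<Longrightarrow> (f1 has_real_derivative f2 z) (at z)"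
    and close: "\<And>z. \<bar>z - y\<bar> \<le> dl \<Longrightarrow> \<bar>f2 z - f2 y\<bar> \<le> e" and t: "\<bar>t\<bar> \<le> dl"
  shows "\<bar>f (y + t) - f y - t * f1 y - t\<^sup>2 / 2 * f2 y\<bar> \<le> e * t\<^sup>2"
proof -
  define S where "S = {z. \<bar>z - y\<bar> \<le> \<bar>t\<bar>}"
  have "S = {y - \<bar>t\<bar>..y + \<bar>t\<bar>}" unfolding S_def by (auto simp: abs_le_iff)
  then have cS: "convex S" by (simp only: convex_real_interval)
  have sub: "\<bar>z - y\<bar> \<le> dl" if "z \<in> S" for z using that t by (simp add: S_def)
  have e0: "e \<ge> 0" using close[of y] t by simp
  have g1: "norm ((f1 z - z * f2 y) - (f1 y - y * f2 y)) \<le> e * norm (z - y)" if z: "z \<in> S" for z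
  proof (rule field_differentiable_bound[OF cS, where f' = "\<lambda>w. f2 w - f2 y"])
    show "((\<lambda>w. f1 w - w * f2 y) has_field_derivative f2 w - f2 y) (at w within S)" if "w \<in> S" for w
    proof (rule has_field_derivative_at_within)
      have "((\<lambda>w. w * f2 y) has_real_derivative f2 y) (at w)" by (auto intro!: derivative_eq_intros)
      from DERIV_diff[OF d2[OF sub[OF that]] this] show "((\<lambda>w. f1 w - w * f2 y) has_real_derivative f2 w - f2 y) (at w)" .
    qed
    show "norm (f2 w - f2 y) \<le> e" if "w \<in> S" for w using close[OF sub[OF that]] by simp
  qed (use z in \<open>auto simp: S_def\<close>)
  have "norm ((f (y + t) - (y + t) * f1 y - (y + t - y)\<^sup>2 / 2 * f2 y) - (f y - y * f1 y - (y - y)\<^sup>2 / 2 * f2 y)) \<le> (e * \<bar>t\<bar>) * norm (y + t - y)"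
  proof (rule field_differentiable_bound[OF cS, where f' = "\<lambda>w. f1 w - f1 y - (w - y) * f2 y"])
    show "((\<lambda>w. f w - w * f1 y - (w - y)\<^sup>2 / 2 * f2 y) has_field_derivative f1 w - f1 y - (w - y) * f2 y) (at w within S)" if "w \<in> S" for w
    proof (rule has_field_derivative_at_within)
      have a: "((\<lambda>w. w * f1 y) has_real_derivative f1 y) (at w)" by (auto intro!: derivative_eq_intros)
      have b: "((\<lambda>w. (w - y)\<^sup>2 / 2 * f2 y) has_real_derivative (w - y) * f2 y) (at w)" by (auto intro!: derivative_eq_intros)
      show "((\<lambda>w. f w - w * f1 y - (w - y)\<^sup>2 / 2 * f2 y) has_real_derivative f1 w - f1 y - (w - y) * f2 y) (at w)"
        by (rule DERIV_diff[OF DERIV_diff[OF d1[OF sub[OF that]] a] b])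
    qed
    show "norm (f1 w - f1 y - (w - y) * f2 y) \<le> e * \<bar>t\<bar>" if w: "w \<in> S" for w
    proof -
      have "f1 w - f1 y - (w - y) * f2 y = (f1 w - w * f2 y) - (f1 y - y * f2 y)" by (simp add: algebra_simps)
      then have "norm (f1 w - f1 y - (w - y) * f2 y) \<le> e * norm (w - y)" using g1[OF w] by simp
      also have "\<dots> \<le> e * \<bar>t\<bar>" using w e0 by (intro mult_left_mono) (auto simp: S_def)
      finally show ?thesis .
    qed
  qed (auto simp: S_def)
  moreover have "(f (y + t) - (y + t) * f1 y - (y + t - y)\<^sup>2 / 2 * f2 y) - (f y - y * f1 y - (y - y)\<^sup>2 / 2 * f2 y) = f (y + t) - f y - t * f1 y - t\<^sup>2 / 2 * f2 y"
    by (simp add: algebra_simps)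
  moreover have "(e * \<bar>t\<bar>) * norm (y + t - y) = e * t\<^sup>2" by (simp add: power2_eq_square)
  ultimately show ?thesis unfolding real_norm_def by (simp only:)
qed

lemma connected_sign_constant:
  fixes f :: "real \<Rightarrow> real"
  assumes "connected C" "continuous_on C f" "\<And>t. t \<in> C \<Longrightarrow> f t \<noteq> L" "p \<in> C" "t \<in> C"
  shows "L < f p \<Longrightarrow> L < f t" "f p < L \<Longrightarrow> f t < L"
proof -
  have c: "connected (f ` C)" by (rule connected_continuous_image[OF assms(2,1)])
  have n: "L \<notin> f ` C" using assms(3) by force
  show "L < f t" if "L < f p"
    using connectedD_interval[OF c imageI[OF assms(5)] imageI[OF assms(4)], of L] n that by (meson less_imp_le not_le)
  show "f t < L" if "f p < L"
    using connectedD_interval[OF c imageI[OF assms(4)] imageI[OF assms(5)], of L] n that by (meson less_imp_le not_le)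
qed

locale hdr_density =
  fixes \<tau> :: real and f :: "real \<Rightarrow> real" and r :: nat and x :: "nat \<Rightarrow> real"
  assumes tau: "0 < \<tau>" "\<tau> < 1" and pd: "prob_density f" and dc: "density_condition \<tau> f r x"
begin

definition L :: real where "L = hdr_level \<tau> f"
definition P :: "real set" where "P = x ` {1..2 * r}"
definition Jm :: real where "Jm = (\<Sum>j=1..r. deriv f (x (2 * j)) - deriv f (x (2 * j - 1)))"

lemma f_int: "integrable lborel f" "(LINT y|lborel. f y) = 1"
  using pd unfolding prob_density_def by (auto simp: has_bochner_integral_iff)

lemma f_nonneg: "f y \<ge> 0" using pd unfolding prob_density_def by blast

lemma f_uc: "uniformly_continuous_on UNIV f" using dc unfolding density_condition_def by blast

lemma f_cont: "continuous_on A f" using uniformly_continuous_imp_continuous[OF f_uc] continuous_on_subset by blast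

lemma f_bounded: "\<exists>C>0. \<forall>y. f y \<le> C"
  by (rule uniformly_continuous_integrable_bounded[OF f_uc f_int(1) f_nonneg])

lemma x_less_iff: "i \<in> {1..2 * r} \<Longrightarrow> j \<in> {1..2 * r} \<Longrightarrow> x i < x j \<longleftrightarrow> i < j"
proof -
  have sm: "strict_mono_on {1..2 * r} x" using dc unfolding density_condition_def by blast
  assume i: "i \<in> {1..2 * r}" and j: "j \<in> {1..2 * r}"
  show ?thesis
    using strict_mono_onD[OF sm i j] strict_mono_onD[OF sm j i] by (cases i j rule: linorder_cases) (auto simp: less_imp_le not_less)
qed

lemma x_le_iff: "i \<in> {1..2 * r} \<Longrightarrow> j \<in> {1..2 * r} \<Longrightarrow> x i \<le> x j \<longleftrightarrow> i \<le> j"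
  using x_less_iff[of j i] by (simp add: not_less[symmetric])

lemma x_inj: "inj_on x {1..2 * r}"
  using x_le_iff by (intro inj_onI) (metis order_antisym order_refl)

lemma level_set: "f t = L \<longleftrightarrow> t \<in> P"
  using dc unfolding density_condition_def L_def P_def by blast

lemma P_finite: "finite P" unfolding P_def by simp

text \<open>The level set is the finite set \<open>P\<close>, hence null, which makes the mass at
  the level exact.\<close>

lemma level_facts: "L > 0" "mass_above f L = 1 - \<tau>"
proof -
  obtain C where C: "\<And>y. f y \<le> C" using f_bounded by blast
  have "AE y in lborel. y \<notin> P"
    using P_finite by (intro AE_not_in finite_imp_null_set_lborel)
  then have "AE y in lborel. f y \<noteq> hdr_level \<tau> f"
    by eventually_elim (use level_set L_def in metis)
  from mass_above_level_exact[OF f_int(1) f_nonneg C tau(2) f_int(2) tau(1) this]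
  show "L > 0" "mass_above f L = 1 - \<tau>" unfolding L_def by auto
qed

text \<open>Without a crossing \<open>f\<close> would stay below \<open>L\<close> everywhere, as it
  does near infinity, and would have no mass above the level.\<close>

lemma r_pos: "r \<ge> 1"
proof (rule ccontr)
  assume "\<not> r \<ge> 1"
  then have ne: "\<And>t. f t \<noteq> L" using level_set unfolding P_def by auto
  have "(f \<longlongrightarrow> 0) at_infinity"
    by (rule uniformly_continuous_integrable_tendsto_0[OF f_uc f_int(1) f_nonneg])
  then have "eventually (\<lambda>t. f t < L) at_infinity" by (rule order_tendstoD) (rule level_facts)
  then obtain b where "\<And>t. norm t \<ge> b \<Longrightarrow> f t < L" unfolding eventually_at_infinity by blast
  then have "f \<bar>b\<bar> < L" by simp
  then have lt: "f t < L" for t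
    using connected_sign_constant(2)[OF connected_UNIV f_cont ne, of "\<bar>b\<bar>" t] by simp
  have "mass_above f L = 0" unfolding mass_above_def using lt by (simp add: not_le[symmetric])
  then show False using level_facts tau by simp
qed

definition margin :: real where
  "margin = (SOME dl. dl > 0 \<and> C2_on (\<Union>j\<in>{1..r}. {x (2*j - 1) - dl .. x (2*j) + dl}) f)"

lemma margin: "margin > 0" "C2_on (\<Union>j\<in>{1..r}. {x (2*j - 1) - margin .. x (2*j) + margin}) f"
proof -
  have "\<exists>dl. dl > 0 \<and> C2_on (\<Union>j\<in>{1..r}. {x (2*j - 1) - dl .. x (2*j) + dl}) f"
    using dc unfolding density_condition_def by blast
  from someI_ex[OF this] show "margin > 0" "C2_on (\<Union>j\<in>{1..r}. {x (2*j - 1) - margin .. x (2*j) + margin}) f"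
    unfolding margin_def by auto
qed

definition nbhd :: "real \<Rightarrow> real set" where
  "nbhd s = (\<Union>j\<in>{1..r}. {x (2*j - 1) - s .. x (2*j) + s})"

lemma nbhd_compact: "compact (nbhd s)" unfolding nbhd_def by (intro compact_UN) auto

lemma nbhd_enlarge: "y \<in> nbhd s \<Longrightarrow> \<bar>z - y\<bar> \<le> t \<Longrightarrow> z \<in> nbhd (s + t)"
  unfolding nbhd_def by (fastforce simp: abs_le_iff)

lemma smooth:
  assumes "y \<in> nbhd s" "s < margin"
  shows "(f has_real_derivative deriv f y) (at y)" "(deriv f has_real_derivative deriv (deriv f) y) (at y)" "isCont (deriv (deriv f)) y"
proof -
  define U where "U = (\<Union>j\<in>{1..r}. {x (2*j - 1) - margin <..< x (2*j) + margin})"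
  have U: "open U" "U \<subseteq> (\<Union>j\<in>{1..r}. {x (2*j - 1) - margin .. x (2*j) + margin})" unfolding U_def by (auto intro: less_imp_le)
  have y: "y \<in> U" using assms unfolding U_def nbhd_def by fastforce
  note c = C2_on_imp_deriv[OF margin(2) U]
  show "(f has_real_derivative deriv f y) (at y)" "(deriv f has_real_derivative deriv (deriv f) y) (at y)" using c(1,2)[OF y] .
  show "isCont (deriv (deriv f)) y" using c(3) U(1) y continuous_on_eq_continuous_at by blast
qed

lemma x_in_nbhd: "i \<in> {1..2 * r} \<Longrightarrow> x i \<in> nbhd 0"
proof -
  assume i: "i \<in> {1..2 * r}"
  \<comment> \<open>Both \<open>i = 2 * j - 1\<close> and \<open>i = 2 * j\<close> are sent to the
    index \<open>j\<close> of their component.\<close>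
  define j where "j = (i + 1) div 2"
  have "1 \<le> j" "j \<le> r" "2 * j - 1 \<le> i" "i \<le> 2 * j"
    using i unfolding j_def atLeastAtMost_iff by - presburger+
  then have j: "j \<in> {1..r}" "2 * j - 1 \<le> i" "i \<le> 2 * j" "1 \<le> 2 * j - 1" "2 * j \<le> 2 * r" by auto
  then have "x (2 * j - 1) \<le> x i" "x i \<le> x (2 * j)" using i by (auto simp: x_le_iff)
  then show ?thesis unfolding nbhd_def using j(1) by force
qed

lemma P_in_nbhd: "p \<in> P \<Longrightarrow> p \<in> nbhd 0" unfolding P_def using x_in_nbhd by blast

lemma near_P_in_nbhd: "p \<in> P \<Longrightarrow> \<bar>z - p\<bar> \<le> s \<Longrightarrow> z \<in> nbhd s"
  using nbhd_enlarge[OF P_in_nbhd, of p z s] by simp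

lemma slope_sign: "i \<in> {1..2 * r} \<Longrightarrow> odd i \<Longrightarrow> deriv f (x i) > 0" "i \<in> {1..2 * r} \<Longrightarrow> even i \<Longrightarrow> deriv f (x i) < 0"
proof -
  have s: "\<And>j. j \<in> {1..r} \<Longrightarrow> deriv f (x (2*j - 1)) > 0 \<and> deriv f (x (2*j)) < 0"
    using dc unfolding density_condition_def by blast
  show "deriv f (x i) > 0" if ii: "i \<in> {1..2 * r}" and od: "odd i"
  proof -
    obtain k where "i = 2 * k + 1" using od by (auto elim: oddE)
    then have "i = 2 * (k + 1) - 1" "k + 1 \<in> {1..r}" using ii by auto
    then show ?thesis using s[of "k + 1"] by simp
  qed
  show "deriv f (x i) < 0" if ii: "i \<in> {1..2 * r}" and ev: "even i"
  proof -
    obtain k where "i = 2 * k" using ev by (auto elim: evenE)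
    then show ?thesis using s[of k] ii by simp
  qed
qed

lemma slope_nz: "p \<in> P \<Longrightarrow> deriv f p \<noteq> 0"
  unfolding P_def using slope_sign by (metis imageE less_irrefl)

lemma x_deriv: "i \<in> {1..2 * r} \<Longrightarrow> (f has_real_derivative deriv f (x i)) (at (x i))"
  using smooth(1)[OF x_in_nbhd] margin(1) by blast

lemma f_x: "i \<in> {1..2 * r} \<Longrightarrow> f (x i) = L"
  using level_set unfolding P_def by blast

text \<open>Between consecutive crossings \<open>f - L\<close> has constant sign, and the slope at
  the adjacent crossing decides it: after an odd crossing \<open>f\<close> is above the level, after
  an even one below.\<close>

lemma superlevel: "{y. L \<le> f y} = (\<Union>j\<in>{1..r}. {x (2*j - 1) .. x (2*j)})"
proof -
  have main: "L \<le> f y \<longleftrightarrow> (\<exists>j\<in>{1..r}. x (2*j - 1) \<le> y \<and> y \<le> x (2*j))" for y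
  proof (cases "y \<in> P")
    case True
    then have "y \<in> nbhd 0" by (rule P_in_nbhd)
    then have "\<exists>j\<in>{1..r}. x (2*j - 1) \<le> y \<and> y \<le> x (2*j)" unfolding nbhd_def by auto
    moreover have "f y = L" using True level_set by blast
    ultimately show ?thesis by simp
  next
    case yP: False
    have yx: "y \<noteq> x k" if "k \<in> {1..2 * r}" for k using that yP unfolding P_def by blast
    \<comment> \<open>Indices of the crossings to the left of \<open>y\<close>. If there are none,
      the slope at the first crossing, seen from the left, decides.\<close>
    define I where "I = {i\<in>{1..2 * r}. x i < y}"
    show ?thesis
    proof (cases "I = {}")
      case True
      have i1: "1 \<in> {1..2 * r}" using r_pos by auto
      have "\<not> x 1 < y" using True i1 unfolding I_def by blast
      then have y1: "y < x 1" using yx[OF i1] by simp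
      have ne: "f t \<noteq> L" if "t \<in> {..<x 1}" for t
      proof
        assume "f t = L"
        then obtain k where k: "k \<in> {1..2 * r}" "t = x k" using level_set unfolding P_def by blast
        then show False using that x_less_iff[OF k(1) i1] by simp
      qed
      obtain dl where dl: "dl > 0" "\<And>h. h > 0 \<Longrightarrow> h < dl \<Longrightarrow> f (x 1 - h) < f (x 1)"
        using DERIV_pos_inc_left[OF x_deriv[OF i1] slope_sign(1)[OF i1]] by auto
      have "f (x 1 - dl / 2) < L" using dl(2)[of "dl / 2"] dl(1) f_x[OF i1] by simp
      then have "f y < L"
        by (intro connected_sign_constant(2)[where C="{..<x 1}" and p="x 1 - dl / 2" and t=y, OF _ f_cont ne]) (use dl(1) y1 in auto)
      moreover have "\<not> (\<exists>j\<in>{1..r}. x (2*j - 1) \<le> y \<and> y \<le> x (2*j))"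
      proof
        assume "\<exists>j\<in>{1..r}. x (2*j - 1) \<le> y \<and> y \<le> x (2*j)"
        then obtain j where j: "j \<in> {1..r}" "x (2*j - 1) \<le> y" by blast
        have "2 * j - 1 \<in> {1..2 * r}" using j(1) by auto
        then have "x 1 \<le> x (2*j - 1)" using x_le_iff[OF i1] by simp
        then show False using j y1 by simp
      qed
      ultimately show ?thesis by simp
    next
      case False
      have finI: "finite I" unfolding I_def by simp
      define i where "i = Max I"
      have iI: "i \<in> I" unfolding i_def using finI False by (rule Max_in)
      then have i: "i \<in> {1..2 * r}" "x i < y" unfolding I_def by auto
      have imax: "k \<le> i" if "k \<in> {1..2 * r}" "x k < y" for k unfolding i_def using that finI by (intro Max_ge) (auto simp: I_def)
      \<comment> \<open>The component of the complement of \<open>P\<close> containing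
        \<open>y\<close>; after the last crossing it is a ray.\<close>
      define C where "C = (if i < 2 * r then {x i<..<x (i + 1)} else {x i<..})"
      have nxt: "y < x (i + 1)" if "i < 2 * r"
      proof (rule ccontr)
        assume "\<not> y < x (i + 1)"
        moreover have k: "i + 1 \<in> {1..2 * r}" using that by auto
        ultimately have "x (i + 1) < y" using yx[OF k] by simp
        from imax[OF k this] show False by simp
      qed
      have yC: "y \<in> C" unfolding C_def using i nxt by auto
      have cC: "connected C" unfolding C_def by auto
      have neC: "f t \<noteq> L" if t: "t \<in> C" for t
      proof
        assume "f t = L"
        then obtain k where k: "k \<in> {1..2 * r}" "t = x k" using level_set unfolding P_def by blast
        have "x i < x k" using t k unfolding C_def by (auto split: if_splits)
        then have ik: "i < k" using x_less_iff[OF i(1) k(1)] by simp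
        then have lt: "i < 2 * r" using k by auto
        have "x k < x (i + 1)" using t k lt unfolding C_def by simp
        moreover have "i + 1 \<in> {1..2 * r}" using lt by auto
        ultimately have "k < i + 1" using x_less_iff[OF k(1)] by blast
        then show False using ik by simp
      qed
      have near: "x i + s \<in> C" if "0 < s" "s < y - x i" for s
        using that i nxt unfolding C_def by auto
      show ?thesis
      proof (cases "odd i")
        case True
        obtain dl where dl: "dl > 0" "\<And>h. h > 0 \<Longrightarrow> h < dl \<Longrightarrow> f (x i) < f (x i + h)"
          using DERIV_pos_inc_right[OF x_deriv[OF i(1)] slope_sign(1)[OF i(1) True]] by auto
        define s where "s = min dl (y - x i) / 2"
        have s: "0 < s" "s < dl" "s < y - x i" using dl(1) i(2) unfolding s_def by (auto simp: min_def)
        have "L < f (x i + s)" using dl(2)[OF s(1,2)] f_x[OF i(1)] by simp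
        then have "L < f y" using connected_sign_constant(1)[OF cC f_cont neC near[OF s(1,3)] yC] by simp
        moreover have "\<exists>j\<in>{1..r}. x (2*j - 1) \<le> y \<and> y \<le> x (2*j)"
        proof -
          obtain k where k: "i = 2 * k + 1" using True by (auto elim: oddE)
          have lt: "i < 2 * r" using i(1) k unfolding atLeastAtMost_iff by presburger
          then have "k + 1 \<in> {1..r}" using k by auto
          moreover have "x (2 * (k + 1) - 1) \<le> y" "y \<le> x (2 * (k + 1))" using i(2) nxt[OF lt] k by auto
          ultimately show ?thesis by blast
        qed
        ultimately show ?thesis by simp
      next
        case ev: False
        obtain dl where dl: "dl > 0" "\<And>h. h > 0 \<Longrightarrow> h < dl \<Longrightarrow> f (x i + h) < f (x i)"
          using DERIV_neg_dec_right[OF x_deriv[OF i(1)] slope_sign(2)[OF i(1)]] ev by auto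
        define s where "s = min dl (y - x i) / 2"
        have s: "0 < s" "s < dl" "s < y - x i" using dl(1) i(2) unfolding s_def by (auto simp: min_def)
        have "f (x i + s) < L" using dl(2)[OF s(1,2)] f_x[OF i(1)] by simp
        then have "f y < L" using connected_sign_constant(2)[OF cC f_cont neC near[OF s(1,3)] yC] by simp
        moreover have "\<not> (\<exists>j\<in>{1..r}. x (2*j - 1) \<le> y \<and> y \<le> x (2*j))"
        proof
          assume "\<exists>j\<in>{1..r}. x (2*j - 1) \<le> y \<and> y \<le> x (2*j)"
          then obtain j where j: "j \<in> {1..r}" "x (2*j - 1) \<le> y" "y \<le> x (2*j)" by blast
          have k: "2 * j - 1 \<in> {1..2 * r}" "2 * j \<in> {1..2 * r}" using j(1) by auto
          have "x (2 * j - 1) < y" using j(2) yx[OF k(1)] by simp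
          then have "2 * j - 1 \<le> i" by (rule imax[OF k(1)])
          moreover have "2 * j - 1 \<noteq> i"
          proof
            assume "2 * j - 1 = i"
            then show False using ev j(1) by auto
          qed
          ultimately have "2 * j \<le> i" by linarith
          then have "x (2 * j) \<le> x i" using x_le_iff[OF k(2) i(1)] by simp
          then show False using j(3) i(2) by simp
        qed
        ultimately show ?thesis by simp
      qed
    qed
  qed
  show ?thesis unfolding set_eq_iff using main by auto
qed

lemma superlevel_sub: "{y. L \<le> f y} = nbhd 0" unfolding superlevel nbhd_def by simp

lemma superlevel_indicator: "indicator {y. L \<le> f y} t = (\<Sum>j=1..r. indicator {x (2*j - 1) .. x (2*j)} t :: real)"
proof -
  have "disjoint_family_on (\<lambda>j. {x (2*j - 1) .. x (2*j)}) {1..r}"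
    unfolding disjoint_family_on_def
  proof (intro ballI impI)
    fix i j assume ij: "i \<in> {1..r}" "j \<in> {1..r}" "i \<noteq> j"
    have dis: "{x (2*i - 1) .. x (2*i)} \<inter> {x (2*j - 1) .. x (2*j)} = {}" if "i \<in> {1..r}" "j \<in> {1..r}" "i < j" for i j
    proof -
      have "x (2*i) < x (2*j - 1)" using that by (subst x_less_iff) auto
      then show ?thesis by auto
    qed
    show "{x (2*i - 1) .. x (2*i)} \<inter> {x (2*j - 1) .. x (2*j)} = {}"
      using ij dis[of i j] dis[of j i] by (cases "i < j") auto
  qed
  then show ?thesis unfolding superlevel by (subst indicator_UN_disjoint) auto
qed

text \<open>The fundamental theorem of calculus on each component of the superlevel set; this is the
  origin of the differences of first derivatives in \<open>coef_D1\<close>.\<close>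

lemma curvature_integral: "has_bochner_integral lborel (\<lambda>t. deriv (deriv f) t * indicator {y. L \<le> f y} t) Jm"
proof -
  have "has_bochner_integral lborel (\<lambda>t. \<Sum>j=1..r. deriv (deriv f) t * indicator {x (2*j - 1) .. x (2*j)} t) Jm"
    unfolding Jm_def
  proof (intro has_bochner_integral_sum)
    fix j assume j: "j \<in> {1..r}"
    have k: "2 * j - 1 \<in> {1..2 * r}" "2 * j \<in> {1..2 * r}" using j by auto
    have le: "x (2 * j - 1) \<le> x (2 * j)" using x_le_iff[OF k] by simp
    have sub: "t \<in> nbhd 0" if "x (2 * j - 1) \<le> t" "t \<le> x (2 * j)" for t
      using that j unfolding nbhd_def by auto
    show "has_bochner_integral lborel (\<lambda>t. deriv (deriv f) t * indicator {x (2*j - 1) .. x (2*j)} t) (deriv f (x (2 * j)) - deriv f (x (2 * j - 1)))"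
    proof (rule has_bochner_integral_FTC_Icc_real[OF le])
      fix t assume t: "x (2 * j - 1) \<le> t" "t \<le> x (2 * j)"
      show "(deriv f has_real_derivative deriv (deriv f) t) (at t)" "isCont (deriv (deriv f)) t"
        using smooth(2,3)[OF sub[OF t] margin(1)] .
    qed
  qed
  then show ?thesis unfolding superlevel_indicator sum_distrib_left .
qed

lemma taylor_uniform:
  assumes e: "e > 0"
  shows "\<exists>dl>0. \<forall>y\<in>nbhd (margin / 2). \<forall>t. \<bar>t\<bar> \<le> dl \<longrightarrow> \<bar>f (y + t) - f y - t * deriv f y - t\<^sup>2 / 2 * deriv (deriv f) y\<bar> \<le> e * t\<^sup>2"
proof -
  \<comment> \<open>The extra \<open>margin / 4\<close> keeps segments of length at most
    \<open>d'\<close> in a compact set on which \<open>f\<close> is smooth.\<close>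
  let ?S = "nbhd (margin / 2 + margin / 4)"
  have S: "margin / 2 + margin / 4 < margin" using margin(1) by simp
  have "uniformly_continuous_on ?S (deriv (deriv f))"
    using smooth(3)[OF _ S] by (intro compact_uniformly_continuous nbhd_compact continuous_at_imp_continuous_on) auto
  then obtain dl where dl: "dl > 0" "\<And>y z. y \<in> ?S \<Longrightarrow> z \<in> ?S \<Longrightarrow> dist z y < dl \<Longrightarrow> dist (deriv (deriv f) z) (deriv (deriv f) y) < e"
    using e unfolding uniformly_continuous_on_def by metis
  define d' where "d' = min (dl / 2) (margin / 4)"
  have d': "d' > 0" "d' < dl" "d' \<le> margin / 4" unfolding d'_def using dl(1) margin(1) by auto
  have "\<bar>f (y + t) - f y - t * deriv f y - t\<^sup>2 / 2 * deriv (deriv f) y\<bar> \<le> e * t\<^sup>2"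
    if y: "y \<in> nbhd (margin / 2)" and t: "\<bar>t\<bar> \<le> d'" for y t
  proof (rule taylor_second_order[OF _ _ _ t])
    fix z assume z: "\<bar>z - y\<bar> \<le> d'"
    have zS: "z \<in> ?S" by (rule nbhd_enlarge[OF y]) (use z d' in linarith)
    have yS: "y \<in> ?S" by (rule nbhd_enlarge[OF y]) (use margin(1) in simp)
    show "(f has_real_derivative deriv f z) (at z)" "(deriv f has_real_derivative deriv (deriv f) z) (at z)"
      using smooth(1,2)[OF zS S] .
    have "dist z y < dl" using z d' by (simp add: dist_real_def)
    from dl(2)[OF yS zS this] show "\<bar>deriv (deriv f) z - deriv (deriv f) y\<bar> \<le> e" by (simp add: dist_real_def)
  qed
  then show ?thesis using d'(1) by blast
qed

lemma derivs_bounded: "\<exists>C\<ge>0. \<forall>y\<in>nbhd (margin / 2). \<bar>deriv f y\<bar> \<le> C \<and> \<bar>deriv (deriv f) y\<bar> \<le> C"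
proof -
  have S: "margin / 2 < margin" using margin(1) by simp
  have c1: "continuous_on (nbhd (margin / 2)) (deriv f)"
    using smooth(2)[OF _ S] by (intro continuous_at_imp_continuous_on) (auto intro: DERIV_isCont)
  have c2: "continuous_on (nbhd (margin / 2)) (deriv (deriv f))"
    using smooth(3)[OF _ S] by (intro continuous_at_imp_continuous_on) auto
  obtain A where A: "\<And>y. y \<in> nbhd (margin / 2) \<Longrightarrow> \<bar>deriv f y\<bar> \<le> A"
    using compact_imp_bounded[OF compact_continuous_image[OF c1 nbhd_compact]] unfolding bounded_real by auto
  obtain B where B: "\<And>y. y \<in> nbhd (margin / 2) \<Longrightarrow> \<bar>deriv (deriv f) y\<bar> \<le> B"
    using compact_imp_bounded[OF compact_continuous_image[OF c2 nbhd_compact]] unfolding bounded_real by auto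
  show ?thesis
  proof (intro exI[of _ "max 0 (max A B)"] conjI ballI)
    fix y assume "y \<in> nbhd (margin / 2)"
    then show "\<bar>deriv f y\<bar> \<le> max 0 (max A B)" "\<bar>deriv (deriv f) y\<bar> \<le> max 0 (max A B)" using A[of y] B[of y] by auto
  qed simp
qed

lemma separation: "\<exists>d>0. \<forall>p\<in>P. \<forall>q\<in>P. p \<noteq> q \<longrightarrow> d < \<bar>p - q\<bar>"
proof -
  \<comment> \<open>The extra element 1 avoids the minimum of an empty set.\<close>
  define G where "G = insert 1 ((\<lambda>(p, q). \<bar>p - q\<bar>) ` {u \<in> P \<times> P. fst u \<noteq> snd u})"
  have G: "finite G" "G \<noteq> {}" unfolding G_def using P_finite by auto
  have pos: "0 < Min G" using G by (subst Min_gr_iff) (auto simp: G_def)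
  have "Min G / 2 < \<bar>p - q\<bar>" if "p \<in> P" "q \<in> P" "p \<noteq> q" for p q
  proof -
    have "Min G \<le> \<bar>p - q\<bar>" using that by (intro Min_le G) (force simp: G_def)
    then show ?thesis using pos by linarith
  qed
  then show ?thesis using pos by (intro exI[of _ "Min G / 2"]) auto
qed

text \<open>Near infinity \<open>f\<close> is below \<open>L / 2\<close>; on the remaining compact
  set, with the crossings cut out, \<open>\<bar>f - L\<bar>\<close> attains a positive
  minimum.\<close>

lemma away_from_level:
  assumes d: "d > 0"
  shows "\<exists>c1>0. \<forall>y. (\<forall>p\<in>P. d < \<bar>y - p\<bar>) \<longrightarrow> c1 \<le> \<bar>f y - L\<bar>"
proof -
  have "(f \<longlongrightarrow> 0) at_infinity"
    by (rule uniformly_continuous_integrable_tendsto_0[OF f_uc f_int(1) f_nonneg])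
  then have "eventually (\<lambda>t. f t < L / 2) at_infinity" by (rule order_tendstoD) (use level_facts in simp)
  then obtain b where b: "\<And>t. \<bar>t\<bar> \<ge> b \<Longrightarrow> f t < L / 2" unfolding eventually_at_infinity real_norm_def by blast
  define S where "S = cball 0 b \<inter> (\<Inter>p\<in>P. {y. d \<le> \<bar>y - p\<bar>})"
  have "closed {y. d \<le> \<bar>y - p\<bar>}" for p :: real
    by (intro closed_Collect_le continuous_intros)
  then have cS: "compact S" unfolding S_def by (intro compact_Int_closed compact_cball closed_INT) auto
  have ne: "f y \<noteq> L" if "y \<in> S" for y
  proof
    assume "f y = L"
    then have "y \<in> P" using level_set by blast
    then have "d \<le> \<bar>y - y\<bar>" using that unfolding S_def by blast
    then show False using d by simp
  qed
  have "\<exists>c>0. \<forall>y\<in>S. c \<le> \<bar>f y - L\<bar>"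
  proof (cases "S = {}")
    case True
    then show ?thesis by (intro exI[of _ 1]) simp
  next
    case False
    have "continuous_on S (\<lambda>y. \<bar>f y - L\<bar>)" by (intro continuous_intros f_cont)
    from continuous_attains_inf[OF cS False this]
    obtain z where z: "z \<in> S" "\<And>y. y \<in> S \<Longrightarrow> \<bar>f z - L\<bar> \<le> \<bar>f y - L\<bar>" by blast
    then show ?thesis using ne[OF z(1)] by (intro exI[of _ "\<bar>f z - L\<bar>"]) auto
  qed
  then obtain c where c: "c > 0" "\<And>y. y \<in> S \<Longrightarrow> c \<le> \<bar>f y - L\<bar>" by blast
  have "min c (L / 2) \<le> \<bar>f y - L\<bar>" if y: "\<forall>p\<in>P. d < \<bar>y - p\<bar>" for y
  proof (cases "\<bar>y\<bar> \<le> b")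
    case True
    then have "y \<in> S" using y unfolding S_def by (auto intro: less_imp_le)
    then show ?thesis using c(2) by fastforce
  next
    case False
    then have "f y < L / 2" by (intro b) simp
    then show ?thesis by linarith
  qed
  then show ?thesis using c(1) level_facts(1) by (intro exI[of _ "min c (L / 2)"]) auto
qed

text \<open>With \<open>s\<close> the least absolute slope, \<open>d\<close> is taken so small that
  the quadratic remainder stays below \<open>s / 2 * \<bar>y - p\<bar>\<close>. The affine term then
  determines the sign of \<open>f - L\<close> and leaves the lower constant
  \<open>s / 2\<close>.\<close>

lemma crossing_constants:
  "\<exists>Cf C1 c c1 d C2 C3. level_crossings f (deriv f) \<tau> L Cf C1 c c1 d P \<and> d \<le> margin / 2 \<and>
    (\<forall>p\<in>P. \<forall>y. \<bar>y - p\<bar> \<le> d \<longrightarrow> \<bar>f y - L - deriv f p * (y - p)\<bar> \<le> C3 * (y - p)\<^sup>2 \<and> \<bar>deriv (deriv f) y\<bar> \<le> C2)"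
proof -
  obtain Cf where Cf: "\<And>y. f y \<le> Cf" using f_bounded by blast
  obtain C2 where C2: "C2 \<ge> 0" "\<And>y. y \<in> nbhd (margin / 2) \<Longrightarrow> \<bar>deriv f y\<bar> \<le> C2 \<and> \<bar>deriv (deriv f) y\<bar> \<le> C2"
    using derivs_bounded by blast
  obtain dl where dl: "dl > 0" "\<And>y t. y \<in> nbhd (margin / 2) \<Longrightarrow> \<bar>t\<bar> \<le> dl \<Longrightarrow> \<bar>f (y + t) - f y - t * deriv f y - t\<^sup>2 / 2 * deriv (deriv f) y\<bar> \<le> 1 * t\<^sup>2"
    using taylor_uniform[of 1] by auto
  obtain g where g: "g > 0" "\<And>p q. p \<in> P \<Longrightarrow> q \<in> P \<Longrightarrow> p \<noteq> q \<Longrightarrow> g < \<bar>p - q\<bar>" using separation by blast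
  define C3 where "C3 = 1 + C2 / 2"
  have C3: "C3 > 0" using C2 unfolding C3_def by simp
  have Pne: "P \<noteq> {}" unfolding P_def using r_pos by auto
  define s where "s = Min ((\<lambda>p. \<bar>deriv f p\<bar>) ` P)"
  have s0: "s > 0" unfolding s_def using P_finite Pne slope_nz by (subst Min_gr_iff) auto
  have s: "s \<le> \<bar>deriv f p\<bar>" if "p \<in> P" for p unfolding s_def using that P_finite by (intro Min_le) auto
  \<comment> \<open>In turn: separation of the crossings, validity of the expansion, room inside the
    smooth neighbourhood, dominance of the slope.\<close>
  define d where "d = Min {g / 2, dl, margin / 2, s / (2 * C3)}"
  have d: "d > 0" "d \<le> g / 2" "d \<le> dl" "d \<le> margin / 2" "d \<le> s / (2 * C3)"
    unfolding d_def using g(1) dl(1) margin(1) s0 C3 by auto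
  have m0: "\<bar>t\<bar> \<le> margin / 2" if "\<bar>t\<bar> \<le> d" for t using that d(4) by linarith
  have pin: "p \<in> nbhd (margin / 2)" if "p \<in> P" for p
    using near_P_in_nbhd[OF that, of p "margin / 2"] margin(1) by simp
  have quad: "\<bar>f y - L - deriv f p * (y - p)\<bar> \<le> C3 * (y - p)\<^sup>2" if p: "p \<in> P" and y: "\<bar>y - p\<bar> \<le> d" for p y
  proof -
    have fp: "f p = L" using p level_set by blast
    have yd: "\<bar>y - p\<bar> \<le> dl" using y d(3) by linarith
    have "\<bar>f y - L - (y - p) * deriv f p - (y - p)\<^sup>2 / 2 * deriv (deriv f) p\<bar> \<le> (y - p)\<^sup>2"
      using dl(2)[OF pin[OF p] yd] fp by simp
    moreover have "\<bar>(y - p)\<^sup>2 / 2 * deriv (deriv f) p\<bar> \<le> (y - p)\<^sup>2 / 2 * C2"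
      unfolding abs_mult using C2(2)[OF pin[OF p]] by (intro mult_mono) auto
    moreover have "\<bar>a - b\<bar> \<le> u + v" if "\<bar>a - b - w\<bar> \<le> u" "\<bar>w\<bar> \<le> v" for a b u v w :: real using that by linarith
    ultimately have "\<bar>f y - L - (y - p) * deriv f p\<bar> \<le> (y - p)\<^sup>2 + (y - p)\<^sup>2 / 2 * C2" by blast
    then show ?thesis unfolding C3_def by (simp add: algebra_simps)
  qed
  have lin: "\<bar>f y - L - deriv f p * (y - p)\<bar> \<le> s / 2 * \<bar>y - p\<bar>" if p: "p \<in> P" and y: "\<bar>y - p\<bar> \<le> d" for p y
  proof -
    have "C3 * \<bar>y - p\<bar> \<le> C3 * d" using y C3 by (intro mult_left_mono) auto
    also have "C3 * d \<le> s / 2" using d(5) C3 by (simp add: field_simps)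
    finally have "C3 * \<bar>y - p\<bar> \<le> s / 2" .
    then have "C3 * \<bar>y - p\<bar> * \<bar>y - p\<bar> \<le> s / 2 * \<bar>y - p\<bar>" by (rule mult_right_mono) simp
    moreover have "C3 * (y - p)\<^sup>2 = C3 * \<bar>y - p\<bar> * \<bar>y - p\<bar>" by (simp add: power2_eq_square abs_mult_self_eq)
    ultimately show ?thesis using quad[OF that] by linarith
  qed
  obtain c1 where c1: "c1 > 0" "\<And>y. (\<forall>p\<in>P. d < \<bar>y - p\<bar>) \<Longrightarrow> c1 \<le> \<bar>f y - L\<bar>" using away_from_level[OF d(1)] by blast
  have sm: "s * \<bar>y - p\<bar> \<le> \<bar>deriv f p * (y - p)\<bar>" if "p \<in> P" for p y
    unfolding abs_mult using s[OF that] by (intro mult_right_mono) auto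
  have "level_crossings f (deriv f) \<tau> L Cf (C2 + s / 2) (s / 2) c1 d P"
  proof
    show "0 < \<tau>" "\<tau> < 1" by (rule tau)+
    show "integrable lborel f" by (rule f_int)
    show "f y \<ge> 0" "f y \<le> Cf" for y by (rule f_nonneg, rule Cf)
    show "L > 0" "mass_above f L = 1 - \<tau>" by (rule level_facts)+
    show "finite P" "P \<noteq> {}" by (rule P_finite, rule Pne)
    show "d > 0" "s / 2 > 0" "C2 + s / 2 > 0" "c1 > 0" using d c1 s0 C2(1) by auto
    show "p = q" if "p \<in> P" "q \<in> P" "\<bar>y - p\<bar> \<le> d" "\<bar>y - q\<bar> \<le> d" for p q y
    proof (rule ccontr)
      assume "p \<noteq> q"
      from g(2)[OF that(1,2) this] show False using that(3,4) d(2) by linarith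
    qed
    show "s / 2 \<le> \<bar>deriv f p\<bar>" if "p \<in> P" for p using s[OF that] s0 by linarith
    fix p y assume p: "p \<in> P" and y: "\<bar>y - p\<bar> \<le> d"
    define a b where "a = f y - L" and "b = deriv f p * (y - p)"
    define u where "u = s * \<bar>y - p\<bar>"
    have u: "0 \<le> u" "s / 2 * \<bar>y - p\<bar> = u / 2" unfolding u_def using s0 by auto
    have ab: "\<bar>a - b\<bar> \<le> u / 2" "u \<le> \<bar>b\<bar>" using lin[OF p y] sm[OF p, of y] u unfolding a_def b_def u_def by auto
    have "\<bar>b\<bar> \<le> C2 * \<bar>y - p\<bar>" unfolding b_def abs_mult using C2(2)[OF pin[OF p]] by (intro mult_right_mono) auto
    then have "\<bar>a\<bar> \<le> C2 * \<bar>y - p\<bar> + u / 2" using ab by linarith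
    then show "\<bar>f y - L\<bar> \<le> (C2 + s / 2) * \<bar>y - p\<bar>" unfolding a_def u(2)[symmetric] by (simp add: algebra_simps)
    have "u / 2 \<le> \<bar>a\<bar>" using ab u(1) by linarith
    then show "s / 2 * \<bar>y - p\<bar> \<le> \<bar>f y - L\<bar>" unfolding a_def u(2)[symmetric] .
    have "0 \<le> a \<longleftrightarrow> 0 \<le> b" using ab u(1) by linarith
    then show "L \<le> f y \<longleftrightarrow> 0 \<le> deriv f p * (y - p)" unfolding a_def b_def by simp
  next
    show "c1 \<le> \<bar>f y - L\<bar>" if "\<And>p. p \<in> P \<Longrightarrow> d < \<bar>y - p\<bar>" for y using c1(2) that by blast
  qed
  moreover have "\<bar>deriv (deriv f) y\<bar> \<le> C2" if "p \<in> P" "\<bar>y - p\<bar> \<le> d" for p y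
    using C2(2) near_P_in_nbhd[OF that(1) m0[OF that(2)]] by blast
  ultimately show ?thesis using quad d(4) by blast
qed

end

section \<open>Uniformity over the bandwidth range\<close>

text \<open>Bounded variation makes both \<open>K\<close> and \<open>deriv K\<close> bounded, and a
  bound for the derivative is a Lipschitz constant.\<close>

lemma kernel_condition_bounds:
  assumes "kernel_condition K"
  shows "\<exists>CK. \<forall>y. K y \<le> CK" "\<exists>LK. \<forall>y z. \<bar>K y - K z\<bar> \<le> LK * \<bar>y - z\<bar>"
proof -
  have bv: "bounded_variation K" "bounded_variation (deriv K)" and df: "\<And>y. K differentiable at y"
    using assms unfolding kernel_condition_def by blast+
  show "\<exists>CK. \<forall>y. K y \<le> CK" using bounded_variation_imp_bounded[OF bv(1)] by (meson abs_le_D1)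
  obtain B where B: "\<And>y. \<bar>deriv K y\<bar> \<le> B" using bounded_variation_imp_bounded[OF bv(2)] by blast
  have "norm (K y - K z) \<le> B * norm (y - z)" for y z
    by (rule field_differentiable_bound[where S=UNIV and f'="deriv K"])
      (use B df in \<open>auto simp: DERIV_deriv_iff_real_differentiable\<close>)
  then show "\<exists>LK. \<forall>y z. \<bar>K y - K z\<bar> \<le> LK * \<bar>y - z\<bar>" by auto
qed

text \<open>Rewrites the argument of the normal functions as the bias order \<open>h^2\<close> in
  units of \<open>1 / sqrt (n h)\<close>.\<close>

lemma powr_five_halves: "h > 0 \<Longrightarrow> sqrt (real n) * h powr (5/2) = sqrt (real n * h) * h\<^sup>2"
proof -
  assume h: "h > 0"
  have "h powr (5/2) = h powr (2 + 1/2)" by simp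
  also have "\<dots> = h\<^sup>2 * sqrt h" using h by (simp only: powr_add powr_half_sqrt powr_numeral)
  finally show ?thesis by (simp add: real_sqrt_mult)
qed

section \<open>Bias expansions and identification of the coefficients\<close>

locale hdr_estimation = hdr_density \<tau> f r x + prob_space M
  for \<tau> :: real and f r x and M :: "'a measure" +
  fixes K :: "real \<Rightarrow> real" and X :: "nat \<Rightarrow> 'a \<Rightarrow> real"
  assumes kern: "is_kernel K" "kernel_condition K" and indep: "indep_vars (\<lambda>_. borel) X {1..}"
    and distr: "\<And>i. i \<ge> 1 \<Longrightarrow> distributed M lborel (X i) (\<lambda>t. ennreal (f t))"
begin

lemma sum_P: "(\<Sum>p\<in>P. g p) = (\<Sum>j=1..2 * r. g (x j))" for g :: "real \<Rightarrow> real"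
  unfolding P_def using sum.reindex[OF x_inj, of g] by (simp add: comp_def)

lemma card_P: "card P = 2 * r"
  unfolding P_def using card_image[OF x_inj] by simp

abbreviation rel_error :: "nat \<Rightarrow> real \<Rightarrow> real" where
  "rel_error n h \<equiv> \<bar>expectation (\<lambda>\<omega>. density_mass f (sym_diff (hdr \<tau> (kde K (\<lambda>i. X i \<omega>) n h)) (hdr \<tau> f)))
     - hdr_risk_expansion \<tau> f K r x n h\<bar> / (1 / sqrt (real n * h) + h\<^sup>2)"

text \<open>\<open>X 0\<close> is not even assumed to be measurable, whence the index \<open>max 1 i\<close>.\<close>

lemma kde_setting_exists: "\<exists>Cf CK LK. kde_setting M (\<lambda>i. X (max 1 i)) f K Cf CK LK"
proof -
  obtain Cf where Cf: "\<And>y. f y \<le> Cf" using f_bounded by blast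
  obtain CK where CK: "\<And>y. K y \<le> CK" using kernel_condition_bounds(1)[OF kern(2)] by blast
  obtain LK where LK: "\<And>y z. \<bar>K y - K z\<bar> \<le> LK * \<bar>y - z\<bar>" using kernel_condition_bounds(2)[OF kern(2)] by blast
  have K: "\<And>y. K y \<ge> 0" "has_bochner_integral lborel (\<lambda>x. x * K x) 0" "integrable lborel (\<lambda>x. x\<^sup>2 * K x)"
    using kern(2) unfolding kernel_condition_def by blast+
  have rv: "X (max 1 i) \<in> borel_measurable M" for i
    using distr[of "max 1 i"] unfolding distributed_def by simp
  have ind: "indep_vars (\<lambda>_. borel) (\<lambda>i. X (max 1 i)) {1..}"
    by (rule indep_vars_cong[THEN iffD1, OF refl _ refl indep]) (auto simp: max_def)
  have "kde_setting M (\<lambda>i. X (max 1 i)) f K Cf CK LK"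
  proof (unfold_locales)
    show "has_bochner_integral lborel f 1" using f_int by (simp add: has_bochner_integral_iff)
    show "has_bochner_integral lborel K 1" using kern(1) unfolding is_kernel_def .
  qed (use f_nonneg Cf f_uc K CK LK rv ind distr in \<open>auto simp: max_def\<close>)
  then show ?thesis by blast
qed

lemma bias_uniform:
  assumes "kde_setting M Y f K Cf CK LK" "e > 0"
  shows "\<exists>h0>0. \<forall>h. 0 < h \<and> h < h0 \<longrightarrow> (\<forall>y\<in>nbhd (margin / 2).
    \<bar>kde_setting.fbar f K h y - f y - h\<^sup>2 / 2 * kde_setting.mu2 K * deriv (deriv f) y\<bar> \<le> e * h\<^sup>2)"
proof -
  interpret E: kde_setting M Y f K Cf CK LK by (rule assms)
  obtain C where C: "C \<ge> 0" "\<And>y. y \<in> nbhd (margin / 2) \<Longrightarrow> \<bar>deriv f y\<bar> \<le> C" "\<And>y. y \<in> nbhd (margin / 2) \<Longrightarrow> \<bar>deriv (deriv f) y\<bar> \<le> C"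
    using derivs_bounded by blast
  show ?thesis by (rule E.fbar_bias[OF taylor_uniform C(2,3,1) assms(2)])
qed

text \<open>The superlevel set is compact and lies where the bias expansion is uniform, so the
  expansion can be integrated over it; \<open>curvature_integral\<close> evaluates the leading
  term.\<close>

lemma mass_bias:
  assumes "kde_setting M Y f K Cf CK LK" "e > 0"
  shows "\<exists>h0>0. \<forall>h. 0 < h \<and> h < h0 \<longrightarrow>
    \<bar>(LINT y|lborel. (kde_setting.fbar f K h y - f y) * indicator {y. L \<le> f y} y) - h\<^sup>2 / 2 * kde_setting.mu2 K * Jm\<bar> \<le> e * h\<^sup>2"
proof -
  interpret E: kde_setting M Y f K Cf CK LK by (rule assms)
  let ?A = "{y. L \<le> f y}" and ?N = "measure lborel (nbhd 0)"
  have e': "e / (?N + 1) > 0" using assms(2) by (simp add: add_nonneg_pos)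
  obtain h0 where h0: "h0 > 0" "\<And>h y. 0 < h \<Longrightarrow> h < h0 \<Longrightarrow> y \<in> nbhd (margin / 2) \<Longrightarrow>
      \<bar>E.fbar h y - f y - h\<^sup>2 / 2 * E.mu2 * deriv (deriv f) y\<bar> \<le> e / (?N + 1) * h\<^sup>2"
    using bias_uniform[OF assms(1) e'] by blast
  have sub: "y \<in> nbhd (margin / 2)" if "y \<in> nbhd 0" for y
    using nbhd_enlarge[OF that, of y "margin / 2"] margin(1) by simp
  have ci: "integrable lborel (\<lambda>y. deriv (deriv f) y * indicator ?A y)" "(LINT y|lborel. deriv (deriv f) y * indicator ?A y) = Jm"
    using curvature_integral by (simp_all only: has_bochner_integral_iff)
  have Am: "?A \<in> sets borel" unfolding superlevel_sub using nbhd_compact by (simp add: borel_compact)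
  have const: "(LINT y|lborel. k * indicator (nbhd 0) y) = k * ?N" for k :: real
    unfolding integral_mult_right_zero by simp
  have frac: "e / (?N + 1) * t\<^sup>2 * ?N \<le> e * t\<^sup>2" for t :: real
  proof -
    have "a / (b + 1) * u * b \<le> a * u" if "0 \<le> a" "0 \<le> b" "0 \<le> u" for a b u :: real
    proof -
      have "a * u * (b / (b + 1)) \<le> a * u * 1" using that by (intro mult_left_mono) auto
      then show ?thesis by (simp add: mult_ac)
    qed
    then show ?thesis using assms(2) by simp
  qed
  have "\<bar>(LINT y|lborel. (E.fbar h y - f y) * indicator ?A y) - h\<^sup>2 / 2 * E.mu2 * Jm\<bar> \<le> e * h\<^sup>2" if h: "0 < h" "h < h0" for h
  proof -
    have fb: "integrable lborel (E.fbar h)" using E.fbar_int[OF h(1)] by (simp only: has_bochner_integral_iff)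
    have i1: "integrable lborel (\<lambda>y. (E.fbar h y - f y) * indicator ?A y)"
      using Am fb f_int(1) by (intro integrable_mult_indicator_real) auto
    have i2: "integrable lborel (\<lambda>y. h\<^sup>2 / 2 * E.mu2 * (deriv (deriv f) y * indicator ?A y))"
      by (intro integrable_mult_right ci)
    have fin: "emeasure lborel (nbhd 0) < \<infinity>" using nbhd_compact emeasure_compact_finite by blast
    have i3: "integrable lborel (\<lambda>y. e / (?N + 1) * h\<^sup>2 * indicator (nbhd 0) y)"
      using fin nbhd_compact by (intro integrable_mult_right integrable_real_indicator) (auto simp: borel_compact)
    have e1: "(LINT y|lborel. (E.fbar h y - f y) * indicator ?A y) - h\<^sup>2 / 2 * E.mu2 * Jm
       = (LINT y|lborel. (E.fbar h y - f y) * indicator ?A y - h\<^sup>2 / 2 * E.mu2 * (deriv (deriv f) y * indicator ?A y))"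
      using i1 i2 ci(2) by simp
    have e2: "norm (LINT y|lborel. (E.fbar h y - f y) * indicator ?A y - h\<^sup>2 / 2 * E.mu2 * (deriv (deriv f) y * indicator ?A y)) \<le> (LINT y|lborel. e / (?N + 1) * h\<^sup>2 * indicator (nbhd 0) y)"
    proof (rule Bochner_Integration.integral_norm_bound_integral[OF Bochner_Integration.integrable_diff[OF i1 i2] i3])
      fix y
      show "norm ((E.fbar h y - f y) * indicator ?A y - h\<^sup>2 / 2 * E.mu2 * (deriv (deriv f) y * indicator ?A y)) \<le> e / (?N + 1) * h\<^sup>2 * indicator (nbhd 0) y"
      proof (cases "y \<in> nbhd 0")
        case True
        then show ?thesis using h0(2)[OF h sub[OF True]]
          unfolding superlevel_sub by (simp only: indicator_simps mult_1_right real_norm_def simp_thms)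
      next
        case False
        then show ?thesis
          unfolding superlevel_sub by (simp only: indicator_simps mult_zero_right diff_self norm_zero simp_thms)
      qed
    qed
    show ?thesis
      unfolding e1 real_norm_def[symmetric] by (rule order_trans[OF e2]) (simp only: const frac)
  qed
  then show ?thesis using h0(1) by blast
qed

theorem expansion_along_sequence:
  assumes h: "\<And>n. h n > 0" "h \<longlonglongrightarrow> 0" "filterlim (\<lambda>n. real n * h n ^ 3) at_top sequentially"
  shows "(\<lambda>n. rel_error n (h n)) \<longlonglongrightarrow> 0"
proof -
  define Y where "Y i = X (max 1 i)" for i
  obtain Cf0 CK LK where "kde_setting M Y f K Cf0 CK LK" using kde_setting_exists unfolding Y_def by blast
  then interpret E0: kde_setting M Y f K Cf0 CK LK .
  obtain Cf C1 c c1 d C2 C3 where lc: "level_crossings f (deriv f) \<tau> L Cf C1 c c1 d P" and d: "d \<le> margin / 2"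
    and quad: "\<And>p y. p \<in> P \<Longrightarrow> \<bar>y - p\<bar> \<le> d \<Longrightarrow> \<bar>f y - L - deriv f p * (y - p)\<bar> \<le> C3 * (y - p)\<^sup>2"
    and f2b: "\<And>p y. p \<in> P \<Longrightarrow> \<bar>y - p\<bar> \<le> d \<Longrightarrow> \<bar>deriv (deriv f) y\<bar> \<le> C2"
    using crossing_constants by blast
  interpret LC: level_crossings f "deriv f" \<tau> L Cf C1 c c1 d P by (rule lc)
  \<comment> \<open>The sampling locale shares one bound for \<open>f\<close> between its two
    parents, so the setting is established again with \<open>Cf\<close> in place of
    \<open>Cf0\<close>.\<close>
  have kd: "kde_setting M Y f K Cf CK LK"
    by unfold_locales (use E0.f_int1 LC.f_nonneg LC.f_le f_uc E0.K_nonneg E0.K_int1 E0.K_le E0.K_lip E0.K_mean E0.K_second E0.X_rv E0.X_indep E0.X_distr in auto)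
  have nb: "y \<in> nbhd (margin / 2)" if "p \<in> P" "\<bar>y - p\<bar> \<le> d" for p y
    using near_P_in_nbhd[OF that(1), of y "margin / 2"] that(2) d by linarith
  interpret S: hdr_bandwidth M Y f K Cf CK LK "deriv f" \<tau> L C1 c c1 d P "deriv (deriv f)" C2 C3 Jm h
  proof (intro_locales)
    show "kde_setting_axioms M Y f K Cf CK LK" using kd unfolding kde_setting_def by blast
    show "hdr_sampling_axioms f K (deriv f) L d P (deriv (deriv f)) C2 C3 Jm"
    proof
      show "isCont (deriv (deriv f)) p" if "p \<in> P" for p using smooth(3)[OF P_in_nbhd[OF that] margin(1)] .
      show "\<exists>h0>0. \<forall>h. 0 < h \<and> h < h0 \<longrightarrow>
        (\<forall>p\<in>P. \<forall>x. \<bar>x - p\<bar> \<le> d \<longrightarrow> \<bar>kde_setting.fbar f K h x - f x - h\<^sup>2 / 2 * kde_setting.mu2 K * deriv (deriv f) x\<bar> \<le> e * h\<^sup>2)" if "e > 0" for e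
        using bias_uniform[OF kd that] nb by meson
      show "\<exists>h0>0. \<forall>h. 0 < h \<and> h < h0 \<longrightarrow>
        \<bar>(LINT x|lborel. (kde_setting.fbar f K h x - f x) * indicator {x. L \<le> f x} x) - h\<^sup>2 / 2 * kde_setting.mu2 K * Jm\<bar> \<le> e * h\<^sup>2" if "e > 0" for e
        by (rule mass_bias[OF kd that])
    qed (rule quad f2b; assumption)+
    show "hdr_bandwidth_axioms h" by standard (rule h)+
  qed
  \<comment> \<open>\<open>r \<ge> 1\<close> yields at least two crossings, hence positive limiting
    variances.\<close>
  have c2: "card P \<ge> 2" using card_P r_pos by simp
  let ?a = "\<lambda>k. 1 / \<bar>deriv f k\<bar>"
  have SS: "LC.slope_sum = (\<Sum>j=1..2 * r. 1 / \<bar>deriv f (x j)\<bar>)" unfolding LC.slope_sum_def sum_P ..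
  have mu: "S.mu2 = second_moment K" unfolding S.mu2_def second_moment_def ..
  have RK: "S.RK = roughness K" unfolding S.RK_def roughness_def ..
  have alg2: "L * R * ((1 - 2 * (1 / m / s)) + T / s\<^sup>2) = R * L - 2 * (R * L / m * inverse s) + R * L * inverse (s\<^sup>2) * T" for R m s T :: real
    by (simp add: divide_inverse algebra_simps)
  \<comment> \<open>With \<open>a\<close> the inverse absolute slope at a crossing and
    \<open>s\<close> the sum of these, every coefficient contributes \<open>a^2 / s^2\<close>, and
    the one at \<open>x j\<close> an additional \<open>1 - 2 * a / s\<close>. The former add up to
    \<open>coef_D2\<close>, the latter produces \<open>roughness K * L\<close> and
    \<open>coef_D3\<close>.\<close>
  have var: "S.lin_var (x j) = roughness K * L - 2 * coef_D3 \<tau> f K r x j + coef_D2 \<tau> f K r x" if j: "j \<in> {1..2 * r}" for j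
  proof -
    have xP: "x j \<in> P" unfolding P_def using j by blast
    have "(S.lin_coef (x j) k)\<^sup>2 = (if k = x j then 1 - 2 * (?a k / LC.slope_sum) else 0) + (1 / (deriv f k)\<^sup>2) / LC.slope_sum\<^sup>2" for k
      unfolding S.lin_coef_def by (simp add: power2_diff power_divide power_mult_distrib)
    then have "(\<Sum>k\<in>P. (S.lin_coef (x j) k)\<^sup>2) = (1 - 2 * (?a (x j) / LC.slope_sum)) + (\<Sum>k\<in>P. 1 / (deriv f k)\<^sup>2) / LC.slope_sum\<^sup>2"
      using xP P_finite by (simp add: sum.distrib sum_divide_distrib)
    then have "S.lin_var (x j) = L * roughness K * ((1 - 2 * (?a (x j) / LC.slope_sum)) + (\<Sum>k\<in>P. 1 / (deriv f k)\<^sup>2) / LC.slope_sum\<^sup>2)"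
      unfolding S.lin_var_def RK by (simp only:)
    then show ?thesis
      unfolding coef_D2_def coef_D3_def SS[symmetric] sum_P L_def[symmetric] by (simp only: alg2)
  qed
  have alg3: "m / 2 * (q - (A + J / l) / s) = 1 / 2 * m * q - 1 / 2 * m * inverse s * (A + 1 / l * J)" for m q A J l s :: real
    by (simp only: divide_inverse algebra_simps mult_1_left)
  have bias: "S.lin_bias p = 1/2 * second_moment K * deriv (deriv f) p - coef_D1 \<tau> f K r x" for p
    unfolding S.lin_bias_def coef_D1_def SS[symmetric] sum_P L_def[symmetric] mu Jm_def[symmetric]
    by (rule alg3)
  have alg: "2 * L * s / m * u / q + L * b / m * k * c = L * ((2 * (s / q) * u + b * k * c) / m)" for s m u q b k c :: real
    by (simp add: divide_inverse algebra_simps)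
  have expn: "hdr_risk_expansion \<tau> f K r x n (h n) = L * (\<Sum>p\<in>P. S.point_risk n p / \<bar>deriv f p\<bar>)" for n
    unfolding hdr_risk_expansion_def sum_P sum_distrib_left
  proof (rule sum.cong[OF refl])
    fix j assume j: "j \<in> {1..2 * r}"
    show "coef_B1 \<tau> f K r x j * std_normal_density (coef_B2 \<tau> f K r x j * (sqrt (real n) * h n powr (5/2))) / sqrt (real n * h n) +
        coef_B3 \<tau> f K r x j * (h n)\<^sup>2 * (2 * cdf std_normal_distribution (coef_B2 \<tau> f K r x j * (sqrt (real n) * h n powr (5/2))) - 1)
      = L * (S.point_risk n (x j) / \<bar>deriv f (x j)\<bar>)"
      unfolding coef_B1_def coef_B2_def coef_B3_def L_def[symmetric] var[OF j, symmetric] bias[symmetric] S.point_risk_def powr_five_halves[OF h(1)]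
      by (rule alg)
  qed
  have hdr_f: "hdr \<tau> f = {y. L \<le> f y}" unfolding hdr_def L_def ..
  have kdeY: "kde K (\<lambda>i. X i \<omega>) n = kde K (\<lambda>i. Y i \<omega>) n" for \<omega> n
    unfolding kde_def Y_def by (intro ext arg_cong2[where f="(*)"] refl sum.cong) (auto simp: max_def)
  have "(\<lambda>n. \<bar>(expectation (S.risk n (h n)) - L * (\<Sum>p\<in>P. S.point_risk n p / \<bar>deriv f p\<bar>)) / S.rho n\<bar>) \<longlonglongrightarrow> 0"
    using S.risk_asymp[OF c2] by (rule tendsto_rabs_zero)
  moreover have "\<bar>(expectation (S.risk n (h n)) - L * (\<Sum>p\<in>P. S.point_risk n p / \<bar>deriv f p\<bar>)) / S.rho n\<bar> = rel_error n (h n)" for n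
  proof -
    have "0 \<le> S.rho n" unfolding S.rho_def using h(1)[of n] by simp
    then show ?thesis unfolding abs_divide expn S.risk_def hdr_f kdeY by (simp add: S.rho_def)
  qed
  ultimately show ?thesis by simp
qed

end

text \<open>Eventually \<open>hm n \<le> 1\<close> and the logarithm is at least 1, so that
  \<open>n hm^4 / sqrt (ln (1 / hm)) \<le> n hm^4 \<le> n h^3\<close> for every bandwidth
  \<open>h\<close> in the range.\<close>

lemma bandwidth_condition_selection:
  assumes bc: "bandwidth_condition hm hp" and h: "\<And>n. h n \<in> {hm n..hp n}"
  shows "eventually (\<lambda>n. h n > 0) sequentially" "h \<longlonglongrightarrow> 0" "filterlim (\<lambda>n. real n * h n ^ 3) at_top sequentially"
proof -
  have hm: "\<And>n. 0 \<le> hm n" "\<And>n. hm n \<le> hp n" and lim: "filterlim (\<lambda>n. real n * hm n ^ 4 / sqrt (ln (1 / hm n))) at_top sequentially"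
    and hp: "hp \<longlonglongrightarrow> 0" using bc unfolding bandwidth_condition_def by blast+
  have hb: "hm n \<le> h n" "h n \<le> hp n" "0 \<le> h n" for n using h[of n] hm[of n] by auto
  \<comment> \<open>At \<open>hm n = 0\<close> the quotient is 0, so its divergence excludes this
    for large \<open>n\<close>.\<close>
  have ev: "eventually (\<lambda>n. 0 < hm n) sequentially"
    using lim[unfolded filterlim_at_top_dense, rule_format, of 0]
  proof eventually_elim
    case (elim n)
    then have "hm n \<noteq> 0" by auto
    then show ?case using hm(1)[of n] by simp
  qed
  then show "eventually (\<lambda>n. h n > 0) sequentially" by eventually_elim (use hb(1) in \<open>meson less_le_trans\<close>)
  show "h \<longlonglongrightarrow> 0" by (rule tendsto_sandwich[OF _ _ tendsto_const hp]) (use hb in auto)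
  \<comment> \<open>Below \<open>exp (- 1)\<close> the logarithm \<open>ln (1 / hm n)\<close> is at
    least 1.\<close>
  have ev1: "eventually (\<lambda>n. hp n < exp (- 1)) sequentially" by (rule order_tendstoD(2)[OF hp]) simp
  have div1: "y / s \<le> y" if "1 \<le> s" "0 \<le> y" for y s :: real
    using mult_left_mono[OF that] that(1) by (simp add: divide_le_eq)
  show "filterlim (\<lambda>n. real n * h n ^ 3) at_top sequentially"
  proof (rule filterlim_at_top_mono[OF lim])
    show "eventually (\<lambda>n. real n * hm n ^ 4 / sqrt (ln (1 / hm n)) \<le> real n * h n ^ 3) sequentially"
      using ev ev1
    proof eventually_elim
      case (elim n)
      have lt: "hm n < exp (- 1)" using elim hm(2)[of n] by simp
      also have "exp (- 1) \<le> (1::real)" by simp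
      finally have le1: "hm n \<le> 1" by simp
      have "ln (hm n) < - 1" using ln_less_cancel_iff[of "hm n" "exp (- 1)"] lt elim by simp
      then have "1 \<le> ln (1 / hm n)" using elim by (simp add: ln_div)
      then have "1 \<le> sqrt (ln (1 / hm n))" by simp
      then have "real n * hm n ^ 4 / sqrt (ln (1 / hm n)) \<le> real n * hm n ^ 4"
        by (rule div1) (use elim in simp)
      also have "\<dots> \<le> real n * h n ^ 3"
      proof -
        have "hm n ^ 4 \<le> hm n ^ 3" using elim le1 by (intro power_decreasing) auto
        also have "\<dots> \<le> h n ^ 3" using hb(1) elim by (intro power_mono) auto
        finally show ?thesis by (simp add: mult_left_mono)
      qed
      finally show ?case .
    qed
  qed
qed

text \<open>The supremum is taken in \<open>ereal\<close>, where it exists without a bound on the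
  errors. A bound valid for all bandwidths at once is obtained by contradiction along a sequence of
  violating bandwidths.\<close>

theorem theorem1:
  fixes \<tau> :: real and f K :: "real \<Rightarrow> real" and r :: nat and x :: "nat \<Rightarrow> real"
    and hm hp :: "nat \<Rightarrow> real" and M :: "'a measure" and X :: "nat \<Rightarrow> 'a \<Rightarrow> real"
  assumes "0 < \<tau>" and "\<tau> < 1"
    and "prob_density f"
    and "density_condition \<tau> f r x"
    and "bandwidth_condition hm hp"
    and "is_kernel K"
    and "kernel_condition K"
    and "prob_space M"
    and "prob_space.indep_vars M (\<lambda>_. borel) X {1..}"
    and "\<And>i. i \<ge> 1 \<Longrightarrow> distributed M lborel (X i) (\<lambda>t. ennreal (f t))"
  shows "(\<lambda>n. SUP h\<in>{hm n..hp n}.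
            ereal (\<bar>prob_space.expectation M
                      (\<lambda>\<omega>. density_mass f
                         (sym_diff (hdr \<tau> (kde K (\<lambda>i. X i \<omega>) n h)) (hdr \<tau> f)))
                    - hdr_risk_expansion \<tau> f K r x n h\<bar>
                   / (1 / sqrt (real n * h) + h\<^sup>2))) \<longlonglongrightarrow> 0"
proof -
  interpret prob_space M by (rule assms)
  interpret hdr_estimation \<tau> f r x M K X by unfold_locales (rule assms; assumption?)+
  have hm: "0 \<le> hm n" "hm n \<le> hp n" for n using assms(5) unfolding bandwidth_condition_def by blast+
  have nn: "0 \<le> rel_error n (hm n)" for n using hm[of n] by simp
  have uniform: "eventually (\<lambda>n. \<forall>h\<in>{hm n..hp n}. rel_error n h \<le> e) sequentially" if e: "e > 0" for e
  proof -
    \<comment> \<open>A maximiser may not exist; any bandwidth with error above \<open>e\<close>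
      serves, and \<open>hm n\<close> is a filler for the other indices.\<close>
    define g where "g n = (if \<exists>h\<in>{hm n..hp n}. e < rel_error n h then SOME h. h \<in> {hm n..hp n} \<and> e < rel_error n h else hm n)" for n
    have bad: "g n \<in> {hm n..hp n} \<and> e < rel_error n (g n)" if "\<exists>h\<in>{hm n..hp n}. e < rel_error n h" for n
      using someI_ex[OF that[unfolded Bex_def]] that unfolding g_def by simp
    have g: "g n \<in> {hm n..hp n}" for n
      using bad[of n] hm[of n] by (cases "\<exists>h\<in>{hm n..hp n}. e < rel_error n h") (auto simp: g_def)
    note sel = bandwidth_condition_selection[OF assms(5) g]
    \<comment> \<open>Positivity at every index is obtained by altering the finitely many terms
      where \<open>g n\<close> is 0.\<close>
    define h where "h n = (if g n > 0 then g n else 1)" for n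
    have eq: "eventually (\<lambda>n. g n = h n) sequentially" using sel(1) by eventually_elim (simp add: h_def)
    have "(\<lambda>n. rel_error n (h n)) \<longlonglongrightarrow> 0"
    proof (rule expansion_along_sequence)
      show "h n > 0" for n unfolding h_def by simp
      show "h \<longlonglongrightarrow> 0" using sel(2) eq by (rule Lim_transform_eventually)
      have "eventually (\<lambda>n. real n * g n ^ 3 \<le> real n * h n ^ 3) sequentially" using eq by eventually_elim simp
      then show "filterlim (\<lambda>n. real n * h n ^ 3) at_top sequentially" by (rule filterlim_at_top_mono[OF sel(3)])
    qed
    then have "eventually (\<lambda>n. rel_error n (h n) < e) sequentially" using e by (rule order_tendstoD)
    then show ?thesis using eq
    proof eventually_elim
      case (elim n)
      show ?case
      proof (rule ccontr)
        assume "\<not> (\<forall>h\<in>{hm n..hp n}. rel_error n h \<le> e)"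
        then have "\<exists>h\<in>{hm n..hp n}. e < rel_error n h" by (meson not_le)
        from bad[OF this] elim show False by simp
      qed
    qed
  qed
  show ?thesis
  proof (rule order_tendstoI)
    fix a :: ereal assume a: "a < 0"
    have "a < (SUP h\<in>{hm n..hp n}. ereal (rel_error n h))" for n
    proof -
      have "hm n \<in> {hm n..hp n}" using hm[of n] by simp
      then have "ereal (rel_error n (hm n)) \<le> (SUP h\<in>{hm n..hp n}. ereal (rel_error n h))" by (rule SUP_upper)
      moreover have "0 \<le> ereal (rel_error n (hm n))" using nn by simp
      ultimately show ?thesis using a by (meson less_le_trans order_trans)
    qed
    then show "eventually (\<lambda>n. a < (SUP h\<in>{hm n..hp n}. ereal (rel_error n h))) sequentially" by simp
  next
    fix a :: ereal assume a: "0 < a"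
    obtain e where e: "0 < ereal e" "ereal e < a" using ereal_dense2[OF a] by blast
    have "eventually (\<lambda>n. \<forall>h\<in>{hm n..hp n}. rel_error n h \<le> e) sequentially" by (rule uniform) (use e in simp)
    then show "eventually (\<lambda>n. (SUP h\<in>{hm n..hp n}. ereal (rel_error n h)) < a) sequentially"
    proof eventually_elim
      case (elim n)
      then have "(SUP h\<in>{hm n..hp n}. ereal (rel_error n h)) \<le> ereal e" by (intro SUP_least) simp
      then show ?case using e(2) by (rule le_less_trans)
    qed
  qed
qed

end
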